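(* Let $K$ be a number field with ring of integers $\mathcal{O}_K$ and let $n \in \mathbb{N}$. Suppose that $n \geq 2$. Let $\mathcal{V} \subseteq \mathbb{G}^n_{m,\mathcal{O}_K}$ be an integral closed subscheme of dimension $2$ that dominates $\operatorname{Spec} \mathcal{O}_K$. Suppose that the generic fiber $\mathcal{V}_K$ of $\mathcal{V}$ is not contained in any proper algebraic subgroup of $\mathbb{G}^n_{m,K}$. For a maximal ideal $\mathfrak{P}$ of $\mathcal{O}_K$, denote by $N(\mathfrak{P})$ its norm and by $\mathcal{V}_{\mathfrak{P}}$ the fiber of $\mathcal{V}$ over $\mathfrak{P}$. Then there exists $C = C(K,n,\mathcal{V})$ such that the following holds. Suppose that $N \in \mathbb{N}$, $\mathfrak{P}$ is a maximal ideal of $\mathcal{O}_K$, and $x \in \mathcal{V}_{\mathfrak{P}} \cap \ker [N]$. Then one of the following holds: (1) $\log N(\mathfrak{P}) \leq CN^{\frac{2n-1}{n(n-1)}}$, or (2) there exists $y \in \mathcal{V}_K$ such that $y$ is contained in an algebraic subgroup of $\mathbb{G}^n_{m,K}$ of codimension at least $2$ and $x$ is contained in the Zariski closure of $y$ in $\mathcal{V}$. In both cases, we have that $$\log N(\mathfrak{P}) \leq \begin{cases} CN^{\frac{3}{2}} &\text{if } n = 2,\\ CN &\text{if } n \geq 3,\end{cases}$$ unless $y$ can be chosen inside $\ker [N]$ (that is, unless (2) holds with some $y$ that moreover lies in $\ker[N]$).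
   Context: Here $\mathbb{N}=\{1,2,\dots\}$, $\mathbb{G}^n_{m,\mathcal{O}_K} = \operatorname{Spec}\mathcal{O}_K[X_1^{\pm1},\dots,X_n^{\pm1}]$, and dimension means (absolute) Krull dimension. $\ker[N]$ is the kernel of the $N$-th power endomorphism of $\mathbb{G}^n_{m,\mathcal{O}_K}$ (the closed subscheme defined by $X_1^N=\dots=X_n^N=1$) or of its base change. Points $x$, $y$ are scheme-theoretic points. *)

theory Defs
  imports
    "HOL-Analysis.Finite_Cartesian_Product"
    "HOL-Analysis.Abstract_Topology"
    "HOL-Library.Extended_Nat"
    "HOL-Library.Poly_Mapping"
    "HOL-Library.Product_Plus"
    "HOL-Computational_Algebra.Polynomial"
    "HOL-Algebra.QuotRing"
begin

section \<open>Spectra with their Zariski topology\<close>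

text \<open>Closed subschemes of \<open>Spec R\<close> are given by ideals of \<open>R\<close>, points by prime ideals.\<close>

definition spec :: "('a, 'b) ring_scheme \<Rightarrow> 'a set set" where
  "spec R = {P. primeideal P R}"

definition zero_locus :: "('a, 'b) ring_scheme \<Rightarrow> 'a set \<Rightarrow> 'a set set" where
  "zero_locus R S = {P \<in> spec R. S \<subseteq> P}"

definition zariski :: "('a, 'b) ring_scheme \<Rightarrow> 'a set topology" where
  "zariski R = topology (\<lambda>U. \<exists>S \<subseteq> carrier R. U = spec R - zero_locus R S)"

lemma zero_locus_Un:
  assumes "S \<subseteq> carrier R" "T \<subseteq> carrier R"
  shows "zero_locus R S \<union> zero_locus R T = zero_locus R {s \<otimes>\<^bsub>R\<^esub> t |s t. s \<in> S \<and> t \<in> T}"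
proof (intro equalityI subsetI)
  fix P assume "P \<in> zero_locus R S \<union> zero_locus R T"
  then have P: "primeideal P R" and "S \<subseteq> P \<or> T \<subseteq> P"
    by (auto simp: zero_locus_def spec_def)
  interpret primeideal P R by fact
  show "P \<in> zero_locus R {s \<otimes>\<^bsub>R\<^esub> t |s t. s \<in> S \<and> t \<in> T}"
    using \<open>S \<subseteq> P \<or> T \<subseteq> P\<close> assms P
    by (auto simp: zero_locus_def spec_def intro: I_l_closed I_r_closed)
next
  fix P assume *: "P \<in> zero_locus R {s \<otimes>\<^bsub>R\<^esub> t |s t. s \<in> S \<and> t \<in> T}"
  then have P: "primeideal P R" by (auto simp: zero_locus_def spec_def)
  interpret primeideal P R by fact
  have "S \<subseteq> P \<or> T \<subseteq> P"
  proof (rule ccontr)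
    assume "\<not> (S \<subseteq> P \<or> T \<subseteq> P)"
    then obtain s t where st: "s \<in> S" "s \<notin> P" "t \<in> T" "t \<notin> P" by blast
    then have "s \<otimes>\<^bsub>R\<^esub> t \<in> P" using * by (auto simp: zero_locus_def)
    then show False using st assms I_prime[of s t] by blast
  qed
  then show "P \<in> zero_locus R S \<union> zero_locus R T"
    using P by (auto simp: zero_locus_def spec_def)
qed

lemma istopology_zariski:
  "istopology (\<lambda>U. \<exists>S \<subseteq> carrier R. U = spec R - zero_locus R S)"
  unfolding istopology_def
proof (intro conjI allI impI)
  fix U V
  assume "\<exists>S \<subseteq> carrier R. U = spec R - zero_locus R S" "\<exists>S \<subseteq> carrier R. V = spec R - zero_locus R S"
  then obtain S T where ST: "S \<subseteq> carrier R" "U = spec R - zero_locus R S"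
    "T \<subseteq> carrier R" "V = spec R - zero_locus R T" by blast
  show "\<exists>W \<subseteq> carrier R. U \<inter> V = spec R - zero_locus R W"
  proof (cases "spec R = {}")
    case True
    then show ?thesis using ST by auto
  next
    case False
    then obtain P where "primeideal P R" by (auto simp: spec_def)
    then interpret primeideal P R .
    have "{s \<otimes>\<^bsub>R\<^esub> t |s t. s \<in> S \<and> t \<in> T} \<subseteq> carrier R" using ST by auto
    moreover have "U \<inter> V = spec R - zero_locus R {s \<otimes>\<^bsub>R\<^esub> t |s t. s \<in> S \<and> t \<in> T}"
      using zero_locus_Un[OF ST(1,3)] ST by blast
    ultimately show ?thesis by blast
  qed
next
  fix \<K> assume "\<forall>U\<in>\<K>. \<exists>S \<subseteq> carrier R. U = spec R - zero_locus R S"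
  then obtain f where f: "\<And>U. U \<in> \<K> \<Longrightarrow> f U \<subseteq> carrier R \<and> U = spec R - zero_locus R (f U)"
    by metis
  have "\<Union>\<K> = (\<Union>U\<in>\<K>. spec R - zero_locus R (f U))" using f by blast
  also have "\<dots> = spec R - zero_locus R (\<Union>U\<in>\<K>. f U)" by (auto simp: zero_locus_def)
  finally show "\<exists>S \<subseteq> carrier R. \<Union>\<K> = spec R - zero_locus R S"
    using f by (intro exI[of _ "\<Union>U\<in>\<K>. f U"]) blast
qed

lemma openin_zariski:
  "openin (zariski R) U \<longleftrightarrow> (\<exists>S \<subseteq> carrier R. U = spec R - zero_locus R S)"
  by (simp add: zariski_def topology_inverse'[OF istopology_zariski])

text \<open>The map \<open>Spec S \<rightarrow> Spec R\<close> induced by a ring homomorphism \<open>\<phi>\<close> from \<open>R\<close> to \<open>S\<close>.\<close>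

definition spec_map :: "('a, 'b) ring_scheme \<Rightarrow> ('a \<Rightarrow> 'c) \<Rightarrow> 'c set \<Rightarrow> 'a set" where
  "spec_map R \<phi> Q = {a \<in> carrier R. \<phi> a \<in> Q}"

section \<open>Dimension and codimension\<close>

definition irreducible_closedin :: "'a topology \<Rightarrow> 'a set \<Rightarrow> bool" where
  "irreducible_closedin X Z \<longleftrightarrow> closedin X Z \<and> Z \<noteq> {} \<and>
     (\<forall>A B. closedin X A \<and> closedin X B \<and> Z \<subseteq> A \<union> B \<longrightarrow> Z \<subseteq> A \<or> Z \<subseteq> B)"

definition irreducible_chain :: "'a topology \<Rightarrow> nat \<Rightarrow> (nat \<Rightarrow> 'a set) \<Rightarrow> bool" where
  "irreducible_chain X k Z \<longleftrightarrow>
     (\<forall>i\<le>k. irreducible_closedin X (Z i)) \<and> (\<forall>i<k. Z i \<subset> Z (Suc i))"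

text \<open>With values in \<^typ>\<open>enat\<close>, the empty space gets dimension 0 and the empty subset
  gets codimension \<open>\<infinity>\<close>.\<close>

definition krull_dim :: "'a topology \<Rightarrow> enat" where
  "krull_dim X = Sup {enat k |k. \<exists>Z. irreducible_chain X k Z}"

definition codim :: "'a topology \<Rightarrow> 'a set \<Rightarrow> enat" where
  "codim X Y = (INF W \<in> {W. irreducible_closedin X W \<and> W \<subseteq> Y}.
     Sup {enat k |k. \<exists>Z. irreducible_chain X k Z \<and> Z 0 = W})"

section \<open>Number fields\<close>

definition number_field :: "'k::field_char_0 itself \<Rightarrow> bool" where
  "number_field _ \<longleftrightarrow>
     (\<exists>B. finite_dimensional_vector_space (\<lambda>q (x::'k). of_rat q * x) B)"

definition ring_on :: "'a::comm_ring_1 set \<Rightarrow> 'a ring" where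
  "ring_on S = \<lparr>carrier = S, monoid.mult = (*), one = 1, ring.zero = 0, add = (+)\<rparr>"

definition ring_of_integers :: "'k::field_char_0 ring" (\<open>\<O>\<close>) where
  "\<O> = ring_on {x. algebraic_int x}"

text \<open>The absolute norm of an ideal.\<close>

definition ideal_norm :: "'k::field_char_0 set \<Rightarrow> nat" where
  "ideal_norm P = card (carrier (\<O> Quot P))"

section \<open>Tori\<close>

text \<open>Laurent polynomials in variables indexed by \<open>'n\<close> are finitely supported functions on
  \<open>\<int>\<^sup>n\<close>, of type \<open>(int^'n) \<Rightarrow>\<^sub>0 'k\<close>, with convolution as product.  More generally
  \<open>'m \<Rightarrow>\<^sub>0 'k\<close> is the group algebra of \<open>'m\<close>; for \<open>'m = (int^'n) \<times> (int^'n)\<close> it is the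
  coordinate ring of the product of two tori.  \<open>laurent S\<close> is the subring with coefficients
  in \<open>S\<close>, so the coordinate rings of the torus over the ring of integers and over the field are
  \<open>laurent (carrier \<O>)\<close> and \<open>laurent UNIV\<close>.\<close>

definition laurent :: "'k::comm_ring_1 set \<Rightarrow> ('m::comm_monoid_add \<Rightarrow>\<^sub>0 'k) ring" where
  "laurent S = ring_on {f. \<forall>m. Poly_Mapping.lookup f m \<in> S}"

definition var :: "'n::finite \<Rightarrow> (int^'n) \<Rightarrow>\<^sub>0 'k::comm_ring_1" where
  "var i = Poly_Mapping.single (axis i 1) 1"

text \<open>The \<open>'k\<close>-linear map sending the monomial \<open>X\<^sup>m\<close> to \<open>X\<^bsup>\<phi> m\<^esup>\<close>.\<close>

definition monomial_map :: "('m \<Rightarrow> 'l) \<Rightarrow> ('m \<Rightarrow>\<^sub>0 'k::comm_ring_1) \<Rightarrow> ('l \<Rightarrow>\<^sub>0 'k)" where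
  "monomial_map \<phi> f =
     (\<Sum>m\<in>Poly_Mapping.keys f. Poly_Mapping.single (\<phi> m) (Poly_Mapping.lookup f m))"

text \<open>\<open>algebraic_subgroup J\<close>: the closed subscheme \<open>H\<close> of the torus over the field \<open>'k\<close> with
  ideal \<open>J\<close> is a subgroup scheme.  The three last conditions say, in terms of coordinate
  rings, that \<open>H\<close> contains the unit section, that multiplication maps \<open>H \<times> H\<close> into \<open>H\<close>, and that
  inversion maps \<open>H\<close> into \<open>H\<close>.  The two sets of generators are the pullbacks of \<open>J\<close> along the
  projections, and multiplication pulls \<open>X\<^sup>m\<close> back to \<open>X\<^sup>m \<otimes> X\<^sup>m\<close>, which has exponent \<open>(m, m)\<close>.\<close>

definition algebraic_subgroup :: "((int^'n::finite) \<Rightarrow>\<^sub>0 'k::field) set \<Rightarrow> bool" where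
  "algebraic_subgroup J \<longleftrightarrow>
     ideal J (laurent UNIV) \<and>
     (\<forall>f\<in>J. (\<Sum>m\<in>Poly_Mapping.keys f. Poly_Mapping.lookup f m) = 0) \<and>
     monomial_map (\<lambda>m. (m, m)) ` J \<subseteq>
       Idl\<^bsub>laurent UNIV\<^esub> (monomial_map (\<lambda>m. (m, 0)) ` J \<union> monomial_map (\<lambda>m. (0, m)) ` J) \<and>
     monomial_map uminus ` J \<subseteq> J"

text \<open>The points of the kernel of the \<open>N\<close>-th power map, on the torus over \<open>S\<close>.\<close>

definition torsion_kernel :: "'k::comm_ring_1 set \<Rightarrow> nat \<Rightarrow> ((int^'n::finite) \<Rightarrow>\<^sub>0 'k) set set" where
  "torsion_kernel S N = zero_locus (laurent S) (range (\<lambda>i. var i ^ N - 1))"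

section \<open>Closed subschemes of the torus over the ring of integers\<close>

definition structure_map :: "((int^'n::finite) \<Rightarrow>\<^sub>0 'k::field_char_0) set \<Rightarrow> 'k set" where
  "structure_map = spec_map \<O> (Poly_Mapping.single 0)"

definition dominates_base :: "((int^'n::finite) \<Rightarrow>\<^sub>0 'k::field_char_0) set \<Rightarrow> bool" where
  "dominates_base I \<longleftrightarrow>
     zariski \<O> closure_of (structure_map ` zero_locus (laurent (carrier \<O>)) I) = spec \<O>"

definition fibre :: "((int^'n::finite) \<Rightarrow>\<^sub>0 'k::field_char_0) set \<Rightarrow> 'k set
    \<Rightarrow> ((int^'n) \<Rightarrow>\<^sub>0 'k) set set" where
  "fibre I P = {x \<in> zero_locus (laurent (carrier \<O>)) I. structure_map x = P}"

text \<open>The ideal of the generic fibre, as a closed subscheme of the torus over the field.\<close>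

definition generic_fibre :: "((int^'n::finite) \<Rightarrow>\<^sub>0 'k::field_char_0) set
    \<Rightarrow> ((int^'n) \<Rightarrow>\<^sub>0 'k) set" where
  "generic_fibre I = Idl\<^bsub>laurent UNIV\<^esub> I"

text \<open>The point \<open>y\<close> of the generic fibre lies in an algebraic subgroup of codimension at least 2
  and its image in the closed subscheme \<open>V\<close> with ideal \<open>I\<close> specializes to \<open>x\<close> in \<open>V\<close>.\<close>

definition unlikely_lift :: "((int^'n::finite) \<Rightarrow>\<^sub>0 'k::field_char_0) set
    \<Rightarrow> ((int^'n) \<Rightarrow>\<^sub>0 'k) set \<Rightarrow> ((int^'n) \<Rightarrow>\<^sub>0 'k) set \<Rightarrow> bool" where
  "unlikely_lift I x y \<longleftrightarrow>
     y \<in> zero_locus (laurent UNIV) (generic_fibre I) \<and>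
     (\<exists>J. algebraic_subgroup J \<and>
          codim (zariski (laurent UNIV)) (zero_locus (laurent UNIV) J) \<ge> 2 \<and>
          y \<in> zero_locus (laurent UNIV) J) \<and>
     x \<in> subtopology (zariski (laurent (carrier \<O>))) (zero_locus (laurent (carrier \<O>)) I)
           closure_of {spec_map (laurent (carrier \<O>)) (\<lambda>f. f) y}"

end

theory Submission imports Defs "Jordan_Normal_Form.Char_Poly" begin

text \<open>Let \<open>\<Lambda>\<close> be the lattice of the exponents \<open>m\<close> with \<open>X\<^sup>m = 1\<close> at \<open>x\<close>. The \<open>N\<close>-th roots of unity in a field number at
  most \<open>N\<close>, so by the box principle \<open>\<Lambda>\<close> contains a vector \<open>a\<close> of length \<open>O(N\<^bsup>1/n\<^esup>)\<close> and a vector \<open>b\<close>, independent of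
  \<open>a\<close>, of length \<open>O(N\<^bsup>1/(n-1)\<^esup>)\<close>. Let \<open>p\<close> be the prime number below \<open>x\<close>; its logarithm is comparable to that of the norm. If
  \<open>log p\<close> exceeds a multiple of \<open>|a|\<close>, a going-down argument places \<open>x\<close> on a horizontal curve of \<open>V\<close> on which
  \<open>X\<^sup>a = 1\<close>. On the generic fibre, \<open>X\<^sup>a - 1\<close> and \<open>X\<^sup>b - 1\<close> satisfy a polynomial relation whose coefficients, by Siegel's
  lemma, are at most \<open>exp (C |a| |b|)\<close> in size; if \<open>p\<close> is larger than that, the relation forces \<open>X\<^sup>b = 1\<close> on the whole curve,
  and its generic point is \<open>y\<close>. A packing argument shows that \<open>\<Lambda>\<close> is generated by vectors \<open>c\<close> with
  \<open>|a| |c| \<le> 9 N\<close>; for \<open>log p\<close> beyond a multiple of \<open>N\<close> all of \<open>\<Lambda>\<close>, and in particular \<open>N \<int>\<^sup>n\<close>, is therefore trivial on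
  the curve, so that \<open>y\<close> lies in the kernel of \<open>[N]\<close>.\<close>

section \<open>Prime ideals of subrings\<close>

text \<open>Going down needs a normal base. It is Z[w] with w = X^a - 1, which embeds in the
  factorial ring of integer polynomials, so that the relations of one element over it form a
  principal ideal. The coordinate ring must be integral over this base near \<open>x\<close>, and
  here a large p enters: a relation between w and a generator with coefficients below p survives the
  reduction modulo w and p, and after an integer shift the generator becomes a quotient of integral
  elements with denominator outside \<open>x\<close>. Relations are taken over Z and not over the
  integers of K, so that the pigeonhole handles plain integers; constants of K enter only through
  their monic equations. If every monomial is algebraic over Z on the generic fibre, no curve is
  sought: one small relation for w already contradicts the size of p. The exponent of N in (1) is
  1/n + 1/(n-1), one summand from each of the two short vectors. Quotients and localizations are
  never formed. Subrings, ideals and primes are sets inside one ring type, V is a prime of its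
  Laurent ring, equations hold modulo that prime, and localizing at \<open>x\<close> means
  multiplying by an element outside \<open>x\<close>.\<close>

definition subring_set :: "'a::comm_ring_1 set \<Rightarrow> bool" where
  "subring_set S \<longleftrightarrow> 1 \<in> S \<and> (\<forall>x\<in>S. \<forall>y\<in>S. x - y \<in> S \<and> x * y \<in> S)"

definition ideal_set :: "'a::comm_ring_1 set \<Rightarrow> 'a set \<Rightarrow> bool" where
  "ideal_set S J \<longleftrightarrow> J \<subseteq> S \<and> 0 \<in> J \<and> (\<forall>x\<in>J. \<forall>y\<in>J. x + y \<in> J) \<and> (\<forall>s\<in>S. \<forall>x\<in>J. s * x \<in> J)"

definition prime_set :: "'a::comm_ring_1 set \<Rightarrow> 'a set \<Rightarrow> bool" where
  "prime_set S q \<longleftrightarrow> ideal_set S q \<and> 1 \<notin> q \<and> (\<forall>x\<in>S. \<forall>y\<in>S. x * y \<in> q \<longrightarrow> x \<in> q \<or> y \<in> q)"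

lemma subring_setI:
  assumes "1 \<in> S" "\<And>x y. x \<in> S \<Longrightarrow> y \<in> S \<Longrightarrow> x - y \<in> S" "\<And>x y. x \<in> S \<Longrightarrow> y \<in> S \<Longrightarrow> x * y \<in> S"
  shows "subring_set S"
  using assms by (auto simp: subring_set_def)

lemma subring_set_UNIV [simp]: "subring_set UNIV"
  by (simp add: subring_set_def)

lemma
  assumes "subring_set S"
  shows subring_set_1: "1 \<in> S" and subring_set_0: "0 \<in> S"
    and subring_set_diff: "x \<in> S \<Longrightarrow> y \<in> S \<Longrightarrow> x - y \<in> S"
    and subring_set_mult: "x \<in> S \<Longrightarrow> y \<in> S \<Longrightarrow> x * y \<in> S"
    and subring_set_uminus: "x \<in> S \<Longrightarrow> - x \<in> S"
    and subring_set_add: "x \<in> S \<Longrightarrow> y \<in> S \<Longrightarrow> x + y \<in> S"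
proof -
  show "1 \<in> S" "x \<in> S \<Longrightarrow> y \<in> S \<Longrightarrow> x - y \<in> S" "x \<in> S \<Longrightarrow> y \<in> S \<Longrightarrow> x * y \<in> S" for x y
    using assms by (auto simp: subring_set_def)
  show 0: "0 \<in> S" using assms unfolding subring_set_def by (metis diff_self)
  show u: "x \<in> S \<Longrightarrow> - x \<in> S" for x using assms 0 unfolding subring_set_def by (metis diff_0)
  show "x \<in> S \<Longrightarrow> y \<in> S \<Longrightarrow> x + y \<in> S" for x y
    using assms u unfolding subring_set_def by (metis diff_minus_eq_add)
qed

lemma subring_set_power: "subring_set S \<Longrightarrow> x \<in> S \<Longrightarrow> x ^ n \<in> S"
  by (induction n) (auto intro: subring_set_1 subring_set_mult)

lemma subring_set_sum: "subring_set S \<Longrightarrow> (\<And>i. i \<in> A \<Longrightarrow> f i \<in> S) \<Longrightarrow> sum f A \<in> S"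
  by (induction A rule: infinite_finite_induct) (auto intro: subring_set_0 subring_set_add)

lemma subring_set_of_nat: "subring_set S \<Longrightarrow> of_nat n \<in> S"
  by (induction n) (auto intro: subring_set_0 subring_set_1 subring_set_add)

lemma subring_set_of_int: "subring_set S \<Longrightarrow> of_int n \<in> S"
  by (cases n rule: int_cases2) (auto intro: subring_set_of_nat subring_set_uminus)

lemma
  assumes "ideal_set S J"
  shows ideal_set_subset: "J \<subseteq> S" and ideal_set_0: "0 \<in> J"
    and ideal_set_add: "x \<in> J \<Longrightarrow> y \<in> J \<Longrightarrow> x + y \<in> J"
    and ideal_set_lmult: "s \<in> S \<Longrightarrow> x \<in> J \<Longrightarrow> s * x \<in> J"
    and ideal_set_rmult: "s \<in> S \<Longrightarrow> x \<in> J \<Longrightarrow> x * s \<in> J"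
  using assms by (auto simp: ideal_set_def mult.commute)

lemma ideal_set_uminus: "subring_set S \<Longrightarrow> ideal_set S J \<Longrightarrow> x \<in> J \<Longrightarrow> - x \<in> J"
  using ideal_set_lmult[of S J "-1" x] by (simp add: subring_set_1 subring_set_uminus)

lemma ideal_set_diff: "subring_set S \<Longrightarrow> ideal_set S J \<Longrightarrow> x \<in> J \<Longrightarrow> y \<in> J \<Longrightarrow> x - y \<in> J"
  using ideal_set_add[of S J x "-y"] ideal_set_uminus[of S J y] by simp

lemma ideal_set_sum: "ideal_set S J \<Longrightarrow> (\<And>i. i \<in> A \<Longrightarrow> f i \<in> J) \<Longrightarrow> sum f A \<in> J"
  by (induction A rule: infinite_finite_induct) (auto intro: ideal_set_0 ideal_set_add)

lemma
  assumes "prime_set S q"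
  shows prime_set_ideal: "ideal_set S q" and prime_set_1: "1 \<notin> q"
    and prime_setD: "x \<in> S \<Longrightarrow> y \<in> S \<Longrightarrow> x * y \<in> q \<Longrightarrow> x \<in> q \<or> y \<in> q"
    and prime_set_subset: "q \<subseteq> S" and prime_set_0: "0 \<in> q"
  using assms by (auto simp: prime_set_def ideal_set_def)

lemma prime_set_not_mult:
  "prime_set S q \<Longrightarrow> x \<in> S \<Longrightarrow> y \<in> S \<Longrightarrow> x \<notin> q \<Longrightarrow> y \<notin> q \<Longrightarrow> x * y \<notin> q"
  by (auto dest: prime_setD)

lemma prime_set_not_power: "subring_set S \<Longrightarrow> prime_set S q \<Longrightarrow> x \<in> S \<Longrightarrow> x \<notin> q \<Longrightarrow> x ^ n \<notin> q"
  by (induction n) (auto simp: prime_set_1 prime_set_not_mult subring_set_power)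

lemma mult_mem_prime_set_cancel: "prime_set S q \<Longrightarrow> x \<in> S \<Longrightarrow> y \<in> S \<Longrightarrow> x \<notin> q \<Longrightarrow> x * y \<in> q \<longleftrightarrow> y \<in> q"
  using prime_setD[of S q x y] ideal_set_lmult[OF prime_set_ideal, of S q x y] by auto

lemma prime_set_Int:
  assumes "prime_set T q" "subring_set S" "S \<subseteq> T"
  shows "prime_set S (q \<inter> S)"
  using assms unfolding prime_set_def ideal_set_def
  by (auto simp: subring_set_0 subring_set_add subring_set_mult subset_iff)

text \<open>An ideal maximal among those avoiding a multiplicative set is prime.\<close>

lemma prime_set_avoiding:
  assumes S: "subring_set S" and J: "ideal_set S J"
    and M: "1 \<in> M" "M \<subseteq> S" "\<And>x y. x \<in> M \<Longrightarrow> y \<in> M \<Longrightarrow> x * y \<in> M" and JM: "J \<inter> M = {}"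
  obtains q where "prime_set S q" "J \<subseteq> q" "q \<inter> M = {}"
proof -
  define F where "F = {A. ideal_set S A \<and> J \<subseteq> A \<and> A \<inter> M = {}}"
  have "\<exists>q\<in>F. \<forall>A\<in>F. q \<subseteq> A \<longrightarrow> A = q"
  proof (rule subset_Zorn_nonempty)
    show "F \<noteq> {}" using J JM by (auto simp: F_def)
    fix C assume "C \<noteq> {}" and "subset.chain F C"
    then have C: "C \<noteq> {}" "C \<subseteq> F" "\<And>A B. A \<in> C \<Longrightarrow> B \<in> C \<Longrightarrow> A \<subseteq> B \<or> B \<subseteq> A"
      by (auto simp: subset_chain_def)
    have add: "x + y \<in> \<Union>C" if "x \<in> \<Union>C" "y \<in> \<Union>C" for x y
    proof -
      from that obtain A B where "A \<in> C" "B \<in> C" "x \<in> A" "y \<in> B" by blast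
      then have "\<exists>D\<in>C. x \<in> D \<and> y \<in> D" using C(3)[of A B] by (meson subsetD)
      then obtain D where "D \<in> C" "x \<in> D" "y \<in> D" by blast
      moreover have "ideal_set S D" using C(2) \<open>D \<in> C\<close> by (auto simp: F_def)
      ultimately show ?thesis using ideal_set_add[of S D x y] by blast
    qed
    have Ci: "ideal_set S A" if "A \<in> C" for A using C(2) that by (auto simp: F_def)
    have "\<Union>C \<subseteq> S" using ideal_set_subset[OF Ci] by blast
    moreover have "0 \<in> \<Union>C" using C(1) ideal_set_0[OF Ci] by blast
    moreover have "s * x \<in> \<Union>C" if "s \<in> S" "x \<in> \<Union>C" for s x
      using that ideal_set_lmult[OF Ci] by blast
    ultimately have "ideal_set S (\<Union>C)"
      using add unfolding ideal_set_def by (intro conjI ballI) assumption+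
    then show "\<Union>C \<in> F" using C by (auto simp: F_def)
  qed
  then obtain q where q: "q \<in> F" and max: "\<And>A. A \<in> F \<Longrightarrow> q \<subseteq> A \<Longrightarrow> A = q" by blast
  have qi: "ideal_set S q" using q by (simp add: F_def)
  \<comment> \<open>By maximality the ideal generated by q and x must meet M; applied to two
    elements outside q, this puts a product of two elements of M into q as soon as x y lies
    there.\<close>
  have ext: "\<exists>s\<in>S. \<exists>a\<in>q. a + s * x \<in> M" if x: "x \<in> S" "x \<notin> q" for x
  proof (rule ccontr)
    assume contr: "\<not> ?thesis"
    define A where "A = {a + s * x |a s. a \<in> q \<and> s \<in> S}"
    have "ideal_set S A"
      unfolding ideal_set_def
    proof (intro conjI ballI)
      show "A \<subseteq> S" using S x ideal_set_subset[OF qi] by (auto simp: A_def intro!: subring_set_add[OF S] subring_set_mult[OF S])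
      show "0 \<in> A" using ideal_set_0[OF qi] subring_set_0[OF S] unfolding A_def
        by (intro CollectI exI[of _ 0]) simp
      fix u v assume "u \<in> A" "v \<in> A"
      then obtain a s b t where "u = a + s * x" "v = b + t * x" "a \<in> q" "b \<in> q" "s \<in> S" "t \<in> S"
        by (auto simp: A_def)
      then have "u + v = (a + b) + (s + t) * x" by (simp add: algebra_simps)
      moreover have "a + b \<in> q" "s + t \<in> S"
        using \<open>a \<in> q\<close> \<open>b \<in> q\<close> \<open>s \<in> S\<close> \<open>t \<in> S\<close> by (auto intro: ideal_set_add[OF qi] subring_set_add[OF S])
      ultimately show "u + v \<in> A" unfolding A_def by blast
    next
      fix r u assume "r \<in> S" "u \<in> A"
      then obtain a s where u: "u = a + s * x" "a \<in> q" "s \<in> S" by (auto simp: A_def)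
      have "r * a \<in> q" "r * s \<in> S"
        using u \<open>r \<in> S\<close> by (auto intro: ideal_set_lmult[OF qi] subring_set_mult[OF S])
      moreover have "r * u = r * a + (r * s) * x" by (simp add: u(1) algebra_simps)
      ultimately show "r * u \<in> A" unfolding A_def by blast
    qed
    moreover have "a \<in> A" if "a \<in> q" for a
      using subring_set_0[OF S] that unfolding A_def by (intro CollectI exI[of _ a] exI[of _ 0]) simp
    moreover have "A \<inter> M = {}" using contr by (auto simp: A_def)
    ultimately have "A = q" using q by (intro max) (auto simp: F_def)
    moreover have "0 + 1 * x \<in> A" using ideal_set_0[OF qi] subring_set_1[OF S] unfolding A_def by blast
    ultimately show False using x by simp
  qed
  have "prime_set S q"
    unfolding prime_set_def
  proof (intro conjI ballI impI)
    show "ideal_set S q" by (rule qi)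
    show "1 \<notin> q" using q M by (auto simp: F_def)
    fix x y assume xy: "x \<in> S" "y \<in> S" "x * y \<in> q"
    show "x \<in> q \<or> y \<in> q"
    proof (rule ccontr)
      assume "\<not> ?thesis"
      then have "x \<notin> q" "y \<notin> q" by auto
      with ext[of x] ext[of y] xy obtain s a t b
        where *: "s \<in> S" "a \<in> q" "a + s * x \<in> M" "t \<in> S" "b \<in> q" "b + t * y \<in> M"
        by blast
      have "(a + s * x) * (b + t * y) = (b + t * y) * a + (s * x) * b + (s * t) * (x * y)"
        by (simp add: algebra_simps)
      moreover have "b + t * y \<in> S" "s * x \<in> S" "s * t \<in> S"
        using * xy M S by (auto intro: subring_set_mult)
      ultimately have "(a + s * x) * (b + t * y) \<in> q"
        using * xy by (auto intro!: ideal_set_add[OF qi] ideal_set_lmult[OF qi])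
      moreover have "(a + s * x) * (b + t * y) \<in> M" using * M by blast
      ultimately show False using q by (auto simp: F_def)
    qed
  qed
  then show thesis using q by (intro that[of q]) (auto simp: F_def)
qed

section \<open>Polynomials with coefficients in a subring or an ideal\<close>

definition polys :: "'a::comm_ring_1 set \<Rightarrow> 'a poly set" where
  "polys R = {f. \<forall>i. coeff f i \<in> R}"

definition adjoin :: "'a::comm_ring_1 set \<Rightarrow> 'a \<Rightarrow> 'a set" where
  "adjoin R \<alpha> = (\<lambda>f. poly f \<alpha>) ` polys R"

lemma polys_coeff: "f \<in> polys R \<Longrightarrow> coeff f i \<in> R"
  by (simp add: polys_def)

lemma ideal_set_subring: "subring_set R \<Longrightarrow> ideal_set R R"
  by (auto simp: ideal_set_def subring_set_0 subring_set_add subring_set_mult)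

lemma polys_ideal:
  assumes R: "subring_set R" and J: "ideal_set R J"
  shows "ideal_set (polys R) (polys J)"
  unfolding ideal_set_def polys_def
  using ideal_set_subset[OF J] ideal_set_0[OF J]
  by (auto simp: coeff_mult intro!: ideal_set_sum[OF J] ideal_set_add[OF J] ideal_set_lmult[OF J])

lemma polys_subring:
  assumes R: "subring_set R" shows "subring_set (polys R)"
proof (rule subring_setI)
  show "1 \<in> polys R" using R by (auto simp: polys_def coeff_1 subring_set_1 subring_set_0)
  show "x - y \<in> polys R" if "x \<in> polys R" "y \<in> polys R" for x y
    using that R by (auto simp: polys_def intro: subring_set_diff)
  show "x * y \<in> polys R" if "x \<in> polys R" "y \<in> polys R" for x y
    using that ideal_set_lmult[OF polys_ideal[OF R ideal_set_subring[OF R]]] by blast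
qed

lemma polys_monom: "subring_set R \<Longrightarrow> c \<in> R \<Longrightarrow> monom c n \<in> polys R"
  by (auto simp: polys_def subring_set_0)

lemma polys_const: "subring_set R \<Longrightarrow> c \<in> R \<Longrightarrow> [:c:] \<in> polys R"
  using polys_monom[of R c 0] by (simp add: monom_0)

lemma polys_smult: "subring_set R \<Longrightarrow> c \<in> R \<Longrightarrow> f \<in> polys R \<Longrightarrow> Polynomial.smult c f \<in> polys R"
  by (auto simp: polys_def intro: subring_set_mult)

lemma poly_mem_ideal:
  assumes "ideal_set S J" "subring_set S" "f \<in> polys J" "a \<in> S"
  shows "poly f a \<in> J"
  unfolding poly_altdef
  using assms by (auto intro!: ideal_set_sum ideal_set_rmult subring_set_power simp: polys_coeff)

lemma poly_mem_subring:
  "subring_set S \<Longrightarrow> f \<in> polys S \<Longrightarrow> a \<in> S \<Longrightarrow> poly f a \<in> S"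
  using poly_mem_ideal[OF ideal_set_subring] .

lemma polys_mono: "R \<subseteq> S \<Longrightarrow> f \<in> polys R \<Longrightarrow> f \<in> polys S"
  by (auto simp: polys_def)

lemma adjoin_subring:
  assumes R: "subring_set R" shows "subring_set (adjoin R a)"
proof (rule subring_setI)
  note P = polys_subring[OF R]
  show "1 \<in> adjoin R a" unfolding adjoin_def using subring_set_1[OF P] by (force intro: image_eqI[of _ _ 1])
  fix x y assume "x \<in> adjoin R a" "y \<in> adjoin R a"
  then obtain f g where fg: "f \<in> polys R" "g \<in> polys R" "x = poly f a" "y = poly g a" by (auto simp: adjoin_def)
  show "x - y \<in> adjoin R a" unfolding adjoin_def
    using fg subring_set_diff[OF P] by (intro image_eqI[of _ _ "f - g"]) auto
  show "x * y \<in> adjoin R a" unfolding adjoin_def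
    using fg subring_set_mult[OF P] by (intro image_eqI[of _ _ "f * g"]) auto
qed

lemma adjoin_base: "subring_set R \<Longrightarrow> R \<subseteq> adjoin R a"
  unfolding adjoin_def by (auto intro!: image_eqI[of _ _ "[:_:]"] polys_const)

lemma adjoin_gen: "subring_set R \<Longrightarrow> a \<in> adjoin R a"
  unfolding adjoin_def by (auto intro!: image_eqI[of _ _ "monom 1 1"] polys_monom simp: poly_monom subring_set_1)

lemma adjoin_subset: "subring_set S \<Longrightarrow> R \<subseteq> S \<Longrightarrow> a \<in> S \<Longrightarrow> adjoin R a \<subseteq> S"
  unfolding adjoin_def using poly_mem_subring polys_mono by blast

text \<open>Stands in for passing to (R/q)[T]: cutting f off after its last coefficient outside q
  gives a representative whose leading coefficient is nonzero modulo q, so that its degree is the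
  degree of the reduction.\<close>

lemma poly_truncate:
  assumes R: "subring_set R" and q: "ideal_set R q" and f: "f \<in> polys R" "f \<notin> polys q"
  obtains g where "g \<in> polys R" "lead_coeff g \<notin> q" "degree g \<le> degree f" "f - g \<in> polys q"
proof -
  define A where "A = {i. coeff f i \<notin> q}"
  have A: "finite A" "A \<noteq> {}"
  proof -
    have "A \<subseteq> {..degree f}" using ideal_set_0[OF q] by (auto simp: A_def) (metis le_degree)
    then show "finite A" by (rule finite_subset) auto
    show "A \<noteq> {}" using f by (auto simp: A_def polys_def)
  qed
  define m where "m = Max A"
  have m: "coeff f m \<notin> q" "\<And>i. i > m \<Longrightarrow> coeff f i \<in> q"
    using Max_in[OF A] Max_ge[OF A(1)] by (auto simp: m_def A_def) (metis leD)
  define g where "g = poly_cutoff (Suc m) f"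
  have cg: "coeff g i = (if i \<le> m then coeff f i else 0)" for i
    by (simp add: g_def coeff_poly_cutoff less_Suc_eq_le)
  have nz: "coeff f m \<noteq> 0" using m(1) ideal_set_0[OF q] by metis
  have dg: "degree g = m"
    using nz by (intro antisym degree_le le_degree) (auto simp: cg)
  show thesis
  proof
    show "g \<in> polys R" using f(1) subring_set_0[OF R] by (auto simp: polys_def cg)
    show "lead_coeff g \<notin> q" using m(1) by (simp add: dg cg)
    show "degree g \<le> degree f" using nz by (simp add: dg le_degree)
    show "f - g \<in> polys q" using m(2) ideal_set_0[OF q] by (auto simp: polys_def cg)
  qed
qed

text \<open>Degrees add over the domain R/q. The coefficient to look at is the one in degree
  \<open>degree g + degree f\<close>, with g the truncation of w modulo q.\<close>

lemma coeff_mult_notin_prime: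
  assumes R: "subring_set R" and q: "prime_set R q"
    and w: "w \<in> polys R" "w \<notin> polys q" and f: "f \<in> polys R" "lead_coeff f \<notin> q"
  shows "\<exists>j\<ge>degree f. coeff (w * f) j \<notin> q"
proof -
  note qi = prime_set_ideal[OF q]
  obtain g where g: "g \<in> polys R" "lead_coeff g \<notin> q" "w - g \<in> polys q"
    using poly_truncate[OF R qi w] by blast
  define j where "j = degree g + degree f"
  have "coeff (g * f) j = lead_coeff g * lead_coeff f" by (simp add: j_def coeff_mult_degree_sum)
  then have 1: "coeff (g * f) j \<notin> q"
    using prime_set_not_mult[OF q] g f polys_coeff by metis
  have "(w - g) * f \<in> polys q"
    using ideal_set_rmult[OF polys_ideal[OF R qi]] g f by blast
  then have 2: "coeff (w * f) j - coeff (g * f) j \<in> q"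
    by (metis coeff_diff left_diff_distrib polys_coeff)
  have "coeff (w * f) j \<notin> q"
  proof
    assume "coeff (w * f) j \<in> q"
    from ideal_set_diff[OF R qi this 2] 1 show False by simp
  qed
  then show ?thesis by (auto simp: j_def intro!: exI[of _ j])
qed

text \<open>Leading coefficients of R need not be units, so g is multiplied by the leading
  coefficient of f before each cancellation of its top term.\<close>

lemma pseudo_division:
  assumes R: "subring_set R" and f: "f \<in> polys R" and g: "g \<in> polys R"
  shows "\<exists>k w r. w \<in> polys R \<and> r \<in> polys R \<and> Polynomial.smult (lead_coeff f ^ k) g = w * f + r \<and> (r = 0 \<or> degree r < degree f)"
  using g
proof (induction "degree g" arbitrary: g rule: less_induct)
  case less
  note P = polys_subring[OF R]
  show ?case
  proof (cases "g = 0 \<or> degree g < degree f")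
    case True
    then show ?thesis using less.prems subring_set_0[OF P]
      by (intro exI[of _ 0] exI[of _ 0] exI[of _ g]) auto
  next
    case False
    define d where "d = degree g - degree f"
    define h where "h = Polynomial.smult (lead_coeff f) g - monom (lead_coeff g) d * f"
    have mon: "monom (lead_coeff g) d \<in> polys R" using polys_monom[OF R] polys_coeff[OF less.prems] by blast
    have hR: "h \<in> polys R" unfolding h_def
      using f less.prems mon by (intro subring_set_diff[OF P] subring_set_mult[OF P] polys_smult[OF R]) (auto simp: polys_coeff)
    have dg: "degree g = d + degree f" using False by (simp add: d_def)
    have c0: "coeff h (degree g) = 0"
      by (simp add: h_def dg coeff_monom_mult)
    have dh: "degree h \<le> degree g"
      unfolding h_def
      by (rule degree_diff_le[OF degree_smult_le]) 
         (metis dg add_le_mono degree_monom_le degree_mult_le le_trans order_refl)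
    have "h = 0 \<or> degree h < degree g"
      using c0 dh by (metis le_neq_implies_less leading_coeff_0_iff)
    then have "\<exists>k w r. w \<in> polys R \<and> r \<in> polys R \<and> Polynomial.smult (lead_coeff f ^ k) h = w * f + r \<and> (r = 0 \<or> degree r < degree f)"
    proof
      assume "h = 0" then show ?thesis using subring_set_0[OF P]
        by (intro exI[of _ 0] exI[of _ 0]) auto
    qed (use less.hyps hR in blast)
    then obtain k w r where kwr: "w \<in> polys R" "r \<in> polys R" "Polynomial.smult (lead_coeff f ^ k) h = w * f + r" "r = 0 \<or> degree r < degree f"
      by blast
    have "Polynomial.smult (lead_coeff f ^ Suc k) g = Polynomial.smult (lead_coeff f ^ k) h + Polynomial.smult (lead_coeff f ^ k) (monom (lead_coeff g) d * f)"
      by (simp add: h_def smult_diff_right mult.commute)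
    also have "\<dots> = (w + Polynomial.smult (lead_coeff f ^ k) (monom (lead_coeff g) d)) * f + r"
      using kwr by (simp add: algebra_simps)
    finally have e: "Polynomial.smult (lead_coeff f ^ Suc k) g = (w + Polynomial.smult (lead_coeff f ^ k) (monom (lead_coeff g) d)) * f + r" .
    have "w + Polynomial.smult (lead_coeff f ^ k) (monom (lead_coeff g) d) \<in> polys R"
      using kwr mon f by (intro subring_set_add[OF P] polys_smult[OF R] subring_set_power[OF R]) (auto simp: polys_coeff)
    then show ?thesis using e kwr by blast
  qed
qed

section \<open>Lifting primes along finitely generated extensions\<close>

text \<open>f replaces the minimal polynomial of a over the fraction field of R modulo q: a relation
  of least degree, truncated so that its leading coefficient is nonzero modulo q.\<close>

lemma minimal_relation:
  assumes R: "subring_set R" and q: "prime_set UNIV q"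
    and alg: "\<exists>f\<in>polys R. f \<notin> polys q \<and> poly f a \<in> q"
  obtains f where "f \<in> polys R" "lead_coeff f \<notin> q" "poly f a \<in> q" "degree f > 0"
    "\<And>g. g \<in> polys R \<Longrightarrow> poly g a \<in> q \<Longrightarrow> g \<notin> polys q \<Longrightarrow> degree f \<le> degree g"
proof -
  note qi = prime_set_ideal[OF q]
  define P where "P f \<longleftrightarrow> f \<in> polys R \<and> lead_coeff f \<notin> q \<and> poly f a \<in> q" for f
  have trunc: "\<exists>g. P g \<and> degree g \<le> degree f" if f: "f \<in> polys R" "f \<notin> polys q" "poly f a \<in> q" for f
  proof -
    have qR: "ideal_set R (q \<inter> R)" using prime_set_ideal[OF prime_set_Int[OF q R]] by simp
    have "f \<notin> polys (q \<inter> R)" using f by (auto simp: polys_def)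
    then obtain g where g: "g \<in> polys R" "lead_coeff g \<notin> q \<inter> R" "degree g \<le> degree f" "f - g \<in> polys (q \<inter> R)"
      using poly_truncate[OF R qR f(1)] by blast
    have "poly (f - g) a \<in> q"
      using poly_mem_ideal[OF qi, of "f - g" a] g by (auto simp: polys_def)
    then have "poly g a \<in> q" using ideal_set_diff[OF _ qi f(3)] by fastforce
    moreover have "lead_coeff g \<notin> q" using g polys_coeff by blast
    ultimately show ?thesis using g unfolding P_def by blast
  qed
  then have "\<exists>f. P f" using alg by blast
  then obtain f where f: "P f" "\<And>g. P g \<Longrightarrow> degree f \<le> degree g"
    using ex_has_least_nat[of P _ degree] by blast
  have "degree f > 0"
  proof (rule ccontr)
    assume "\<not> ?thesis"
    then obtain c where "f = [:c:]" using degree_eq_zeroE by auto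
    then show False using f(1) by (simp add: P_def)
  qed
  moreover have "degree f \<le> degree g" if "g \<in> polys R" "poly g a \<in> q" "g \<notin> polys q" for g
    using trunc[of g] f(2) that le_trans by blast
  ultimately show thesis using f(1) by (intro that[of f]) (auto simp: P_def)
qed

text \<open>The pseudo-remainder is again a relation of a modulo q, of degree below the minimal one,
  so all of its coefficients lie in q.\<close>

lemma reduce_by_minimal_relation:
  assumes R: "subring_set R" and q: "prime_set UNIV q"
    and f: "f \<in> polys R" "lead_coeff f \<notin> q" "poly f a \<in> q"
    "\<And>g. g \<in> polys R \<Longrightarrow> poly g a \<in> q \<Longrightarrow> g \<notin> polys q \<Longrightarrow> degree f \<le> degree g"
    and g: "g \<in> polys R" "poly g a \<in> q"
  obtains k w r where "w \<in> polys R" "r \<in> polys R" "r \<in> polys q"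
    "Polynomial.smult (lead_coeff f ^ k) g = w * f + r"
proof -
  note qi = prime_set_ideal[OF q]
  obtain k w r where kwr: "w \<in> polys R" "r \<in> polys R" "Polynomial.smult (lead_coeff f ^ k) g = w * f + r"
    "r = 0 \<or> degree r < degree f"
    using pseudo_division[OF R f(1) g(1)] by blast
  have "r = Polynomial.smult (lead_coeff f ^ k) g - w * f" using kwr by simp
  then have "poly r a = lead_coeff f ^ k * poly g a - poly w a * poly f a" by simp
  then have "poly r a \<in> q"
    using g f by (auto intro!: ideal_set_diff[OF _ qi] ideal_set_lmult[OF qi])
  then have "r \<in> polys q"
    using kwr f(4)[of r] ideal_set_0[OF qi] by (cases "r = 0") (auto simp: polys_def)
  then show thesis using kwr by (intro that[of w r k])
qed

text \<open>Modulo q this is the fact that a nonzero element of an algebraic extension divides a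
  nonzero element of the base. Inverses and norms are avoided: among the nonzero multiples of d one
  takes a polynomial expression in a of least degree and shows that it is constant.\<close>

lemma algebraic_divides_base:
  assumes R: "subring_set R" and q: "prime_set UNIV q"
    and alg: "\<exists>f\<in>polys R. f \<notin> polys q \<and> poly f a \<in> q"
    and d: "d \<in> adjoin R a" "d \<notin> q"
  obtains e r where "e \<in> adjoin R a" "r \<in> R" "r \<notin> q" "d * e - r \<in> q"
proof -
  note qi = prime_set_ideal[OF q] and S = adjoin_subring[OF R, of a]
  have qR: "prime_set R (q \<inter> R)" using prime_set_Int[OF q R] by simp
  obtain f where f: "f \<in> polys R" "lead_coeff f \<notin> q" "poly f a \<in> q" "degree f > 0"
    "\<And>g. g \<in> polys R \<Longrightarrow> poly g a \<in> q \<Longrightarrow> g \<notin> polys q \<Longrightarrow> degree f \<le> degree g"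
    using minimal_relation[OF R q alg] by metis
  define Q where "Q W \<longleftrightarrow> W \<in> polys R \<and> poly W a \<notin> q \<and> (\<exists>e\<in>adjoin R a. poly W a - d * e \<in> q)" for W
  have trunc: "\<exists>V. Q V \<and> lead_coeff V \<notin> q \<and> degree V \<le> degree W" if W: "Q W" for W
  proof -
    have "W \<notin> polys (q \<inter> R)" using W poly_mem_ideal[OF qi, of W a] by (auto simp: Q_def polys_def)
    then obtain V where V: "V \<in> polys R" "lead_coeff V \<notin> q \<inter> R" "degree V \<le> degree W" "W - V \<in> polys (q \<inter> R)"
      using poly_truncate[OF R prime_set_ideal[OF qR]] W by (auto simp: Q_def)
    have WV: "poly W a - poly V a \<in> q"
      using poly_mem_ideal[OF qi, of "W - V" a] V by (auto simp: polys_def)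
    have "poly V a \<notin> q" using W ideal_set_add[OF qi WV, of "poly V a"] by (auto simp: Q_def)
    moreover obtain e where "e \<in> adjoin R a" "poly W a - d * e \<in> q" using W by (auto simp: Q_def)
    with ideal_set_diff[OF _ qi this(2) WV] have "poly V a - d * e \<in> q" by (simp add: algebra_simps)
    ultimately have "Q V" using V(1) \<open>e \<in> adjoin R a\<close> unfolding Q_def by blast
    then show ?thesis using V polys_coeff by blast
  qed
  obtain D where D: "D \<in> polys R" "d = poly D a" using d by (auto simp: adjoin_def)
  have "Q D" using D d subring_set_1[OF S] ideal_set_0[OF qi] unfolding Q_def by force
  then have "\<exists>W. Q W \<and> lead_coeff W \<notin> q" using trunc by blast
  then obtain W where W: "Q W \<and> lead_coeff W \<notin> q" "\<And>V. Q V \<and> lead_coeff V \<notin> q \<Longrightarrow> degree W \<le> degree V"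
    using ex_has_least_nat[of "\<lambda>W. Q W \<and> lead_coeff W \<notin> q" _ degree] by blast
  have min: "degree W \<le> degree V" if "Q V" for V
    using trunc[OF that] W(2) le_trans by blast
  have WR: "W \<in> polys R" using W by (auto simp: Q_def)
  obtain e where e: "e \<in> adjoin R a" "poly W a - d * e \<in> q" using W by (auto simp: Q_def)
  have mult: "\<exists>e'\<in>adjoin R a. c * poly W a - d * e' \<in> q" if "c \<in> adjoin R a" for c
    using ideal_set_lmult[OF qi _ e(2), of c] subring_set_mult[OF S that e(1)]
    by (intro bexI[of _ "c * e"]) (auto simp: algebra_simps)
  have deg: "degree W < degree f"
  proof (rule ccontr)
    assume "\<not> ?thesis"
    obtain k w r where kwr: "w \<in> polys R" "r \<in> polys R" "Polynomial.smult (lead_coeff f ^ k) W = w * f + r" "r = 0 \<or> degree r < degree f"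
      using pseudo_division[OF R f(1) WR] by blast
    have "r = Polynomial.smult (lead_coeff f ^ k) W - w * f" using kwr by simp
    then have ra: "poly r a = lead_coeff f ^ k * poly W a - poly w a * poly f a" by simp
    have wf: "poly w a * poly f a \<in> q" using f by (auto intro: ideal_set_lmult[OF qi])
    have lk: "lead_coeff f ^ k \<in> R" "lead_coeff f ^ k \<notin> q"
      using f polys_coeff[OF f(1)] prime_set_not_power[OF subring_set_UNIV q] subring_set_power[OF R] by auto
    have "lead_coeff f ^ k * poly W a \<notin> q" using lk W prime_set_not_mult[OF q] by (auto simp: Q_def)
    then have nq: "poly r a \<notin> q" using ideal_set_add[OF qi _ wf, of "poly r a"] ra by auto
    obtain e' where "e' \<in> adjoin R a" "lead_coeff f ^ k * poly W a - d * e' \<in> q"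
      using mult adjoin_base[OF R] lk by blast
    with ideal_set_diff[OF _ qi this(2) wf] have "e' \<in> adjoin R a" "poly r a - d * e' \<in> q" by (auto simp: ra algebra_simps)
    then have "Q r" using kwr nq unfolding Q_def by blast
    moreover have "r \<noteq> 0" using nq ideal_set_0[OF qi] by auto
    ultimately show False using min[of r] kwr \<open>\<not> degree W < degree f\<close> by auto
  qed
  have "degree W = 0"
  \<comment> \<open>Otherwise divide f by W. The remainder at a is a multiple of d of smaller
    degree, hence zero modulo q; then the quotient w is itself a relation of a. So its degree modulo
    q is at least that of f, and w W is too long to agree with a multiple of f up to r.\<close>
  proof (rule ccontr)
    assume "degree W \<noteq> 0"
    obtain k w r where kwr: "w \<in> polys R" "r \<in> polys R" "Polynomial.smult (lead_coeff W ^ k) f = w * W + r" "r = 0 \<or> degree r < degree W"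
      using pseudo_division[OF R WR f(1)] by blast
    have r: "r = Polynomial.smult (lead_coeff W ^ k) f - w * W" using kwr by simp
    then have ra: "poly r a = lead_coeff W ^ k * poly f a - poly w a * poly W a" by simp
    have lf: "lead_coeff W ^ k * poly f a \<in> q" using f by (auto intro: ideal_set_lmult[OF qi])
    have wa: "poly w a \<in> adjoin R a" using kwr by (auto simp: adjoin_def)
    obtain e' where e': "e' \<in> adjoin R a" "poly w a * poly W a - d * e' \<in> q" using mult[OF wa] by blast
    have rq: "poly r a \<in> q"
    proof (rule ccontr)
      assume nq: "poly r a \<notin> q"
      have "poly r a - d * (- e') \<in> q"
        using ideal_set_diff[OF _ qi lf e'(2)] by (simp add: ra algebra_simps)
      then have "Q r" using nq kwr subring_set_uminus[OF S e'(1)] unfolding Q_def by blast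
      moreover have "r \<noteq> 0" using nq ideal_set_0[OF qi] by auto
      ultimately show False using min[of r] kwr by auto
    qed
    then have "poly w a * poly W a \<in> q"
      using ideal_set_diff[OF _ qi lf rq] by (simp add: ra)
    then have "poly w a \<in> q" using W prime_setD[OF q] by (auto simp: Q_def)
    have "w \<notin> polys q"
    proof
      assume "w \<in> polys q"
      then have "coeff (w * W) (degree f) \<in> q"
        using ideal_set_rmult[OF polys_ideal[OF subring_set_UNIV qi]] by (auto simp: polys_def)
      moreover have "coeff r (degree f) = 0" using kwr(4) deg by (auto intro: coeff_eq_0)
      ultimately have "lead_coeff W ^ k * lead_coeff f \<in> q"
        using arg_cong[OF kwr(3), of "\<lambda>p. coeff p (degree f)"] by simp
      then show False using f W prime_setD[OF q] prime_set_not_power[OF subring_set_UNIV q] by blast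
    qed
    then have wq: "w \<notin> polys (q \<inter> R)" by (auto simp: polys_def)
    then obtain v where v: "v \<in> polys R" "lead_coeff v \<notin> q \<inter> R" "degree v \<le> degree w" "w - v \<in> polys (q \<inter> R)"
      using poly_truncate[OF R prime_set_ideal[OF qR] kwr(1)] by blast
    have lv: "lead_coeff v \<notin> q" using v polys_coeff by blast
    have "poly w a - poly v a \<in> q" using poly_mem_ideal[OF qi, of "w - v" a] v by (auto simp: polys_def)
    then have "poly v a \<in> q" using ideal_set_diff[OF _ qi \<open>poly w a \<in> q\<close>] by fastforce
    moreover have "v \<notin> polys q" using lv by (auto simp: polys_def)
    ultimately have dv: "degree f \<le> degree v" using f(5) v(1) by blast
    define j where "j = degree v + degree W"
    have "j > degree f" using dv \<open>degree W \<noteq> 0\<close> by (simp add: j_def)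
    then have "coeff (w * W) j = 0"
      using arg_cong[OF kwr(3), of "\<lambda>p. coeff p j"] kwr(4) deg by (auto simp: coeff_eq_0)
    moreover have "coeff ((w - v) * W) j \<in> q"
      using ideal_set_rmult[OF polys_ideal[OF subring_set_UNIV qi], of W "w - v"] v by (auto simp: polys_def)
    ultimately have "coeff (v * W) j \<in> q"
      using ideal_set_uminus[OF _ qi] by (fastforce simp: algebra_simps)
    then have "lead_coeff v * lead_coeff W \<in> q" by (simp add: j_def coeff_mult_degree_sum)
    then show False using lv W prime_setD[OF q] by blast
  qed
  then obtain r where r: "W = [:r:]" using degree_eq_zeroE by auto
  have "r \<in> R" "r \<notin> q" using WR W polys_coeff[of W R 0] by (auto simp: r)
  moreover have "d * e - r \<in> q" using ideal_set_uminus[OF _ qi e(2)] by (simp add: r)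
  ultimately show thesis using e(1) by (intro that)
qed

text \<open>\<open>primes_lift q R S\<close>: modulo \<open>q\<close>, generic primes of \<open>R\<close> lift to primes of \<open>S\<close>,
  and the lift can be chosen to avoid any given element.\<close>

definition primes_lift :: "'a::comm_ring_1 set \<Rightarrow> 'a set \<Rightarrow> 'a set \<Rightarrow> bool" where
  "primes_lift q R S \<longleftrightarrow> (\<forall>d\<in>S. d \<notin> q \<longrightarrow> (\<exists>h\<in>R. h \<notin> q \<and>
     (\<forall>P. prime_set R P \<and> q \<inter> R \<subseteq> P \<and> h \<notin> P \<longrightarrow>
        (\<exists>Q. prime_set S Q \<and> q \<inter> S \<subseteq> Q \<and> Q \<inter> R = P \<and> d \<notin> Q))))"

text \<open>A prime of R[a] above P that avoids d exists unless some s d^k, with s outside P, lies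
  in the ideal generated by P and q. The element h is chosen to make this impossible; its choice
  depends on whether a is algebraic or transcendental modulo q.\<close>

lemma primes_lift_adjoin:
  assumes R: "subring_set R" and q: "prime_set UNIV q"
  shows "primes_lift q R (adjoin R a)"
  unfolding primes_lift_def
proof (intro ballI impI)
  fix d assume d: "d \<in> adjoin R a" "d \<notin> q"
  note qi = prime_set_ideal[OF q] and S = adjoin_subring[OF R, of a]
  have qR: "prime_set R (q \<inter> R)" using prime_set_Int[OF q R] by simp
  define S where "S = adjoin R a"
  have SS: "subring_set S" "R \<subseteq> S" using adjoin_subring[OF R] adjoin_base[OF R] by (auto simp: S_def)
  \<comment> \<open>Reduction to the one equation that must be excluded: the prime is maximal among
    the ideals that contain P and q and avoid all products s d^k.\<close>
  have lift: "\<exists>Q. prime_set S Q \<and> q \<inter> S \<subseteq> Q \<and> Q \<inter> R = P \<and> d \<notin> Q"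
    if P: "prime_set R P" "q \<inter> R \<subseteq> P"
      and main: "\<And>s k F z. s \<in> R \<Longrightarrow> s \<notin> P \<Longrightarrow> F \<in> polys P \<Longrightarrow> z \<in> q \<Longrightarrow> s * d ^ k = poly F a + z \<Longrightarrow> False" for P
  proof -
    define J where "J = {poly F a + z |F z. F \<in> polys P \<and> z \<in> q \<inter> S}"
    define M where "M = {s * d ^ k |s k. s \<in> R \<and> s \<notin> P}"
    have PR: "P \<subseteq> R" using prime_set_subset[OF P(1)] .
    have Pp: "ideal_set (polys R) (polys P)" using polys_ideal[OF R prime_set_ideal[OF P(1)]] .
    have qS: "ideal_set S (q \<inter> S)" using prime_set_ideal[OF prime_set_Int[OF q SS(1)]] by simp
    have J: "ideal_set S J"
      unfolding ideal_set_def
    proof (intro conjI ballI)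
      show "J \<subseteq> S" using PR by (auto simp: J_def S_def[symmetric] intro!: subring_set_add[OF SS(1)])
          (auto simp: S_def adjoin_def polys_def)
      have "poly 0 a + 0 \<in> J" unfolding J_def using ideal_set_0[OF Pp] ideal_set_0[OF qS] by blast
      then show "0 \<in> J" by simp
      fix x y assume "x \<in> J" "y \<in> J"
      then obtain F z G w where *: "x = poly F a + z" "y = poly G a + w" "F \<in> polys P" "G \<in> polys P" "z \<in> q \<inter> S" "w \<in> q \<inter> S"
        by (auto simp: J_def)
      then have "x + y = poly (F + G) a + (z + w)" by simp
      moreover have "F + G \<in> polys P" "z + w \<in> q \<inter> S" using * ideal_set_add[OF Pp] ideal_set_add[OF qS] by blast+
      ultimately show "x + y \<in> J" unfolding J_def by blast
    next
      fix s x assume "s \<in> S" "x \<in> J"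
      then obtain F z G where *: "x = poly F a + z" "s = poly G a" "F \<in> polys P" "G \<in> polys R" "z \<in> q \<inter> S"
        by (auto simp: J_def S_def adjoin_def)
      then have "s * x = poly (G * F) a + s * z" by (simp add: algebra_simps)
      moreover have "G * F \<in> polys P" "s * z \<in> q \<inter> S" using * ideal_set_lmult[OF Pp] ideal_set_lmult[OF qS \<open>s \<in> S\<close>] by blast+
      ultimately show "s * x \<in> J" unfolding J_def by blast
    qed
    have dS: "d \<in> S" using d by (simp add: S_def)
    have M1: "1 \<in> M" unfolding M_def using subring_set_1[OF R] prime_set_1[OF P(1)]
      by (intro CollectI exI[of _ 1] exI[of _ 0]) simp
    have M2: "M \<subseteq> S" using SS dS by (auto simp: M_def intro!: subring_set_mult[OF SS(1)] subring_set_power[OF SS(1)])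
    have M3: "x * y \<in> M" if xy: "x \<in> M" "y \<in> M" for x y
    proof -
      from xy obtain s k t l where st: "x = s * d ^ k" "y = t * d ^ l" "s \<in> R" "s \<notin> P" "t \<in> R" "t \<notin> P" by (auto simp: M_def)
      have "x * y = (s * t) * d ^ (k + l)" by (simp add: st power_add algebra_simps)
      moreover have "s * t \<in> R" "s * t \<notin> P" using st subring_set_mult[OF R] prime_set_not_mult[OF P(1)] by auto
      ultimately show ?thesis unfolding M_def by blast
    qed
    have JM: "J \<inter> M = {}"
    proof (rule ccontr)
      assume "J \<inter> M \<noteq> {}"
      then obtain x where "x \<in> J" "x \<in> M" by blast
      then show False using main by (auto simp: J_def M_def)
    qed
    obtain Q where Q: "prime_set S Q" "J \<subseteq> Q" "Q \<inter> M = {}"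
      using prime_set_avoiding[OF SS(1) J M1 M2 M3 JM] by blast
    have "q \<inter> S \<subseteq> J"
    proof
      fix x assume "x \<in> q \<inter> S"
      then have "poly 0 a + x \<in> J" unfolding J_def using ideal_set_0[OF Pp] by blast
      then show "x \<in> J" by simp
    qed
    moreover have "x \<in> J" if "x \<in> P" for x
    proof -
      have "[:x:] \<in> polys P" using that prime_set_0[OF P(1)] by (auto simp: polys_def coeff_pCons split: nat.splits)
      then have "poly [:x:] a + 0 \<in> J" unfolding J_def using ideal_set_0[OF qS] by blast
      then show ?thesis by simp
    qed
    moreover have "x \<in> P" if "x \<in> Q" "x \<in> R" for x
    proof (rule ccontr)
      assume "x \<notin> P"
      then have "x * d ^ 0 \<in> M" using that unfolding M_def by blast
      then show False using that Q(3) by auto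
    qed
    moreover have "1 * d ^ 1 \<in> M" unfolding M_def using subring_set_1[OF R] prime_set_1[OF P(1)] by blast
    then have "d \<notin> Q" using Q(3) by auto
    ultimately show ?thesis using Q PR by (intro exI[of _ Q]) blast
  qed
  show "\<exists>h\<in>R. h \<notin> q \<and> (\<forall>P. prime_set R P \<and> q \<inter> R \<subseteq> P \<and> h \<notin> P \<longrightarrow>
        (\<exists>Q. prime_set (adjoin R a) Q \<and> q \<inter> adjoin R a \<subseteq> Q \<and> Q \<inter> R = P \<and> d \<notin> Q))"
  proof (cases "\<exists>f\<in>polys R. f \<notin> polys q \<and> poly f a \<in> q")
    case alg: True
    obtain f where f: "f \<in> polys R" "lead_coeff f \<notin> q" "poly f a \<in> q" "degree f > 0"
      "\<And>g. g \<in> polys R \<Longrightarrow> poly g a \<in> q \<Longrightarrow> g \<notin> polys q \<Longrightarrow> degree f \<le> degree g"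
      using minimal_relation[OF R q alg] by metis
    obtain e r where er: "e \<in> adjoin R a" "r \<in> R" "r \<notin> q" "d * e - r \<in> q"
      using algebraic_divides_base[OF R q alg d] by metis
    have lR: "lead_coeff f \<in> R" using f polys_coeff by blast
    \<comment> \<open>Two elements have to stay nonzero modulo P: the leading coefficient of f, so
      that f keeps its degree, and the element r of R that d divides.\<close>
    show ?thesis
    proof (intro bexI[of _ "lead_coeff f * r"] conjI allI impI)
      show "lead_coeff f * r \<in> R" using lR er subring_set_mult[OF R] by blast
      show "lead_coeff f * r \<notin> q" using prime_set_not_mult[OF q] f er by blast
      fix P assume "prime_set R P \<and> q \<inter> R \<subseteq> P \<and> lead_coeff f * r \<notin> P"
      then have P: "prime_set R P" "q \<inter> R \<subseteq> P" and lr: "lead_coeff f * r \<notin> P" by auto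
      note Pi = prime_set_ideal[OF P(1)]
      have l: "lead_coeff f \<notin> P" and r: "r \<notin> P"
        using lr lR er ideal_set_lmult[OF Pi] ideal_set_rmult[OF Pi] by blast+
      show "\<exists>Q. prime_set (adjoin R a) Q \<and> q \<inter> adjoin R a \<subseteq> Q \<and> Q \<inter> R = P \<and> d \<notin> Q"
        unfolding S_def[symmetric]
      proof (rule lift[OF P])
        fix s k F z assume s: "s \<in> R" "s \<notin> P" and F: "F \<in> polys P" and z: "z \<in> q" and eq: "s * d ^ k = poly F a + z"
        obtain E where E: "E \<in> polys R" "e = poly E a" using er by (auto simp: adjoin_def)
        have PR: "F \<in> polys R" using F prime_set_subset[OF P(1)] by (auto simp: polys_def)
        have Pp: "ideal_set (polys R) (polys P)" using polys_ideal[OF R Pi] .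
        \<comment> \<open>Multiplying the forbidden equation by e^k turns d^k into r^k. So g is a
          relation of a modulo q, while modulo P it is the constant s r^k.\<close>
        define g where "g = [:s * r ^ k:] - E ^ k * F"
        have sr: "s * r ^ k \<in> R" "s * r ^ k \<notin> P"
          using s er r subring_set_mult[OF R] subring_set_power[OF R] prime_set_not_mult[OF P(1)] prime_set_not_power[OF R P(1)] by auto
        have EF: "E ^ k * F \<in> polys P" using ideal_set_lmult[OF Pp] subring_set_power[OF polys_subring[OF R]] E F by blast
        have gR: "g \<in> polys R" unfolding g_def
          using sr EF prime_set_subset[OF P(1)] polys_const[OF R] subring_set_diff[OF polys_subring[OF R]] by (meson polys_mono)
        have "(d * e) ^ k - r ^ k \<in> q"
          using ideal_set_rmult[OF qi _ er(4)] by (metis power_diff_sumr2 UNIV_I mult.commute)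
        then have "s * ((d * e) ^ k - r ^ k) \<in> q" using ideal_set_lmult[OF qi] by blast
        moreover have "e ^ k * z \<in> q" using z ideal_set_lmult[OF qi] by blast
        ultimately have "e ^ k * z - s * ((d * e) ^ k - r ^ k) \<in> q" using ideal_set_diff[OF _ qi] by simp
        moreover have "e ^ k * (s * d ^ k) = e ^ k * poly F a + e ^ k * z" by (simp add: eq algebra_simps)
        then have "poly g a = e ^ k * z - s * ((d * e) ^ k - r ^ k)"
          by (simp add: g_def E algebra_simps power_mult_distrib)
        ultimately have gq: "poly g a \<in> q" by simp
        obtain m w t where w: "w \<in> polys R" "t \<in> polys R" "t \<in> polys q" "Polynomial.smult (lead_coeff f ^ m) g = w * f + t"
          using reduce_by_minimal_relation[OF R q f(1,2,3) _ gR gq] f(5) by metis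
        have tP: "t \<in> polys P" using w P(2) by (auto simp: polys_def)
        have lm: "lead_coeff f ^ m \<in> R" "lead_coeff f ^ m \<notin> P"
          using lR l subring_set_power[OF R] prime_set_not_power[OF R P(1)] by auto
        have hi: "coeff (w * f) j \<in> P" if "j > 0" for j
        proof -
          have "coeff (w * f) j = lead_coeff f ^ m * coeff g j - coeff t j"
            using arg_cong[OF w(4), of "\<lambda>p. coeff p j"] by (simp add: algebra_simps)
          moreover have "coeff g j = - coeff (E ^ k * F) j" using that by (simp add: g_def coeff_pCons split: nat.splits)
          ultimately have "coeff (w * f) j = - (lead_coeff f ^ m * coeff (E ^ k * F) j + coeff t j)" by simp
          also have "\<dots> \<in> P" using EF tP lm
            by (intro ideal_set_uminus[OF R Pi] ideal_set_add[OF Pi] ideal_set_lmult[OF Pi]) (auto simp: polys_coeff)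
          finally show ?thesis .
        qed
        \<comment> \<open>Modulo P a nonzero constant equals w f. Since f has positive degree modulo
          P, w must vanish modulo P, and then so does the constant.\<close>
        show False
        proof (cases "w \<in> polys P")
          case False
          then obtain j where "j \<ge> degree f" "coeff (w * f) j \<notin> P"
            using coeff_mult_notin_prime[OF R P(1) w(1) False f(1) l] by blast
          then show False using hi f(4) by auto
        next
          case True
          then have wP: "coeff (w * f) 0 \<in> P" using ideal_set_rmult[OF Pp f(1)] polys_coeff by blast
          have "lead_coeff f ^ m * coeff g 0 = coeff (w * f) 0 + coeff t 0"
            using arg_cong[OF w(4), of "\<lambda>p. coeff p 0"] by simp
          moreover have "coeff g 0 = s * r ^ k - coeff (E ^ k * F) 0" by (simp add: g_def)
          ultimately have "lead_coeff f ^ m * (s * r ^ k) = coeff (w * f) 0 + coeff t 0 + lead_coeff f ^ m * coeff (E ^ k * F) 0"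
            by (simp add: algebra_simps)
          also have "\<dots> \<in> P" using wP tP EF lm by (auto intro!: ideal_set_add[OF Pi] ideal_set_lmult[OF Pi] simp: polys_coeff)
          finally show False using prime_set_not_mult[OF P(1)] lm sr by blast
        qed
      qed
    qed
  next
    case False
    obtain D where D: "D \<in> polys R" "d = poly D a" using d by (auto simp: adjoin_def)
    then have "D \<notin> polys q" using d(2) poly_mem_ideal[OF qi, of D a] by auto
    then obtain i where i: "coeff D i \<notin> q" by (auto simp: polys_def)
    \<comment> \<open>With a transcendental modulo q, equations at a are equations between
      polynomials modulo q. It suffices that D stays nonzero modulo P, which one coefficient
      guarantees.\<close>
    show ?thesis
    proof (intro bexI[of _ "coeff D i"] conjI allI impI)
      show "coeff D i \<in> R" "coeff D i \<notin> q" using i D polys_coeff by auto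
      fix P assume "prime_set R P \<and> q \<inter> R \<subseteq> P \<and> coeff D i \<notin> P"
      then have P: "prime_set R P" "q \<inter> R \<subseteq> P" and Di: "coeff D i \<notin> P" by auto
      note Pi = prime_set_ideal[OF P(1)]
      have DP: "D \<notin> polys P" using Di by (auto simp: polys_def)
      \<comment> \<open>P[T] is prime in R[T], by comparing leading terms modulo P.\<close>
      have prod: "G \<in> polys P \<or> H \<in> polys P" if GH: "G \<in> polys R" "H \<in> polys R" "G * H \<in> polys P" for G H
      proof (rule ccontr)
        assume c: "\<not> ?thesis"
        then obtain H' where H': "H' \<in> polys R" "lead_coeff H' \<notin> P" "H - H' \<in> polys P"
          using poly_truncate[OF R Pi GH(2)] by blast
        have "G * (H - H') \<in> polys P" using ideal_set_lmult[OF polys_ideal[OF R Pi] GH(1) H'(3)] .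
        then have "G * H - G * (H - H') \<in> polys P"
          using ideal_set_diff[OF polys_subring[OF R] polys_ideal[OF R Pi]] GH by blast
        then have "G * H' \<in> polys P" by (simp add: algebra_simps)
        then show False using coeff_mult_notin_prime[OF R P(1) GH(1) _ H'(1,2)] c by (auto simp: polys_def)
      qed
      have Dk: "D ^ k \<notin> polys P" for k
      proof (induction k)
        case 0 then show ?case using prime_set_1[OF P(1)] by (auto simp: polys_def coeff_1 intro!: exI[of _ 0])
      next
        case (Suc k) then show ?case using prod[of D "D ^ k"] DP D subring_set_power[OF polys_subring[OF R]] by auto
      qed
      show "\<exists>Q. prime_set (adjoin R a) Q \<and> q \<inter> adjoin R a \<subseteq> Q \<and> Q \<inter> R = P \<and> d \<notin> Q"
        unfolding S_def[symmetric]
      proof (rule lift[OF P])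
        fix s k F z assume s: "s \<in> R" "s \<notin> P" and F: "F \<in> polys P" and z: "z \<in> q" and eq: "s * d ^ k = poly F a + z"
        define g where "g = [:s:] * D ^ k - F"
        have PR: "F \<in> polys R" using F prime_set_subset[OF P(1)] by (auto simp: polys_def)
        have sD: "[:s:] * D ^ k \<in> polys R"
          using s polys_const[OF R] D subring_set_power[OF polys_subring[OF R]] subring_set_mult[OF polys_subring[OF R]] by blast
        then have gR: "g \<in> polys R" unfolding g_def using PR subring_set_diff[OF polys_subring[OF R]] by blast
        have "poly g a = z" by (simp add: g_def D(2)[symmetric] eq)
        then have "g \<in> polys q" using False gR z by blast
        then have "g \<in> polys P" using gR P(2) by (auto simp: polys_def)
        then have "g + F \<in> polys P" using F ideal_set_add[OF polys_ideal[OF R Pi]] by blast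
        then have "[:s:] * D ^ k \<in> polys P" by (simp add: g_def)
        then have "[:s:] \<in> polys P" using prod Dk s polys_const[OF R] D subring_set_power[OF polys_subring[OF R]] by blast
        then show False using s polys_coeff[of "[:s:]" P 0] by auto
      qed
    qed
  qed
qed

lemma primes_lift_refl: "primes_lift q R R"
  unfolding primes_lift_def
proof (intro ballI impI)
  fix d assume d: "d \<in> R" "d \<notin> q"
  have "P \<inter> R = P" if "prime_set R P" for P using prime_set_subset[OF that] by blast
  then show "\<exists>h\<in>R. h \<notin> q \<and> (\<forall>P. prime_set R P \<and> q \<inter> R \<subseteq> P \<and> h \<notin> P \<longrightarrow>
        (\<exists>Q. prime_set R Q \<and> q \<inter> R \<subseteq> Q \<and> Q \<inter> R = P \<and> d \<notin> Q))"
    using d by (intro bexI[of _ d]) auto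
qed

lemma primes_liftE:
  assumes "primes_lift q R S" "d \<in> S" "d \<notin> q"
  obtains h where "h \<in> R" "h \<notin> q" "\<And>P. prime_set R P \<Longrightarrow> q \<inter> R \<subseteq> P \<Longrightarrow> h \<notin> P \<Longrightarrow>
        \<exists>Q. prime_set S Q \<and> q \<inter> S \<subseteq> Q \<and> Q \<inter> R = P \<and> d \<notin> Q"
proof -
  have "\<exists>h\<in>R. h \<notin> q \<and> (\<forall>P. prime_set R P \<and> q \<inter> R \<subseteq> P \<and> h \<notin> P \<longrightarrow>
        (\<exists>Q. prime_set S Q \<and> q \<inter> S \<subseteq> Q \<and> Q \<inter> R = P \<and> d \<notin> Q))"
    using assms(1)[unfolded primes_lift_def, rule_format, OF assms(2,3)] .
  then show thesis by (elim bexE conjE) (rule that, assumption+, simp)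
qed

text \<open>Transitivity is the reason for letting the lift avoid a prescribed element: the h of the
  upper extension is the element to be avoided in the lower one.\<close>

lemma primes_lift_trans:
  assumes "primes_lift q R S" "primes_lift q S T" "R \<subseteq> S"
  shows "primes_lift q R T"
  unfolding primes_lift_def
proof (intro ballI impI)
  fix d assume "d \<in> T" "d \<notin> q"
  then obtain h where h: "h \<in> S" "h \<notin> q" "\<And>P. prime_set S P \<Longrightarrow> q \<inter> S \<subseteq> P \<Longrightarrow> h \<notin> P \<Longrightarrow>
        \<exists>Q. prime_set T Q \<and> q \<inter> T \<subseteq> Q \<and> Q \<inter> S = P \<and> d \<notin> Q"
    by (rule primes_liftE[OF assms(2)]) (rule that)
  from h(1,2) obtain g where g: "g \<in> R" "g \<notin> q" "\<And>P. prime_set R P \<Longrightarrow> q \<inter> R \<subseteq> P \<Longrightarrow> g \<notin> P \<Longrightarrow>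
        \<exists>Q. prime_set S Q \<and> q \<inter> S \<subseteq> Q \<and> Q \<inter> R = P \<and> h \<notin> Q"
    by (rule primes_liftE[OF assms(1)]) (rule that)
  show "\<exists>h\<in>R. h \<notin> q \<and> (\<forall>P. prime_set R P \<and> q \<inter> R \<subseteq> P \<and> h \<notin> P \<longrightarrow>
        (\<exists>Q. prime_set T Q \<and> q \<inter> T \<subseteq> Q \<and> Q \<inter> R = P \<and> d \<notin> Q))"
  proof (intro bexI[of _ g] conjI allI impI)
    fix P assume P: "prime_set R P \<and> q \<inter> R \<subseteq> P \<and> g \<notin> P"
    then obtain Q where Q: "prime_set S Q" "q \<inter> S \<subseteq> Q" "Q \<inter> R = P" "h \<notin> Q" using g(3) by blast
    then obtain Q' where "prime_set T Q'" "q \<inter> T \<subseteq> Q'" "Q' \<inter> S = Q" "d \<notin> Q'" using h(3) by blast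
    moreover then have "Q' \<inter> R = P" using Q(3) assms(3) by blast
    ultimately show "\<exists>Q. prime_set T Q \<and> q \<inter> T \<subseteq> Q \<and> Q \<inter> R = P \<and> d \<notin> Q" by blast
  qed (use g(1,2) in auto)
qed

lemma foldl_adjoin_subring: "subring_set R \<Longrightarrow> subring_set (foldl adjoin R xs)"
  by (induction xs arbitrary: R) (simp_all add: adjoin_subring)

lemma foldl_adjoin_base: "subring_set R \<Longrightarrow> R \<subseteq> foldl adjoin R xs"
proof (induction xs arbitrary: R)
  case (Cons a xs)
  then show ?case using adjoin_base[of R a] adjoin_subring[of R a] by (simp add: subset_trans)
qed simp

lemma foldl_adjoin_gens: "subring_set R \<Longrightarrow> set xs \<subseteq> foldl adjoin R xs"
proof (induction xs arbitrary: R)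
  case (Cons a xs)
  then show ?case using adjoin_gen[of R a] adjoin_subring[of R a] foldl_adjoin_base[of "adjoin R a" xs] by auto
qed simp

lemma foldl_adjoin_subset:
  "subring_set S \<Longrightarrow> R \<subseteq> S \<Longrightarrow> set xs \<subseteq> S \<Longrightarrow> foldl adjoin R xs \<subseteq> S"
  by (induction xs arbitrary: R) (simp_all add: adjoin_subset)

lemma primes_lift_foldl_adjoin:
  "subring_set R \<Longrightarrow> prime_set UNIV q \<Longrightarrow> primes_lift q R (foldl adjoin R xs)"
proof (induction xs arbitrary: R)
  case (Cons a xs)
  have "primes_lift q (adjoin R a) (foldl adjoin (adjoin R a) xs)"
    using Cons.IH[OF adjoin_subring[OF Cons.prems(1)] Cons.prems(2)] .
  with primes_lift_adjoin[OF Cons.prems] have "primes_lift q R (foldl adjoin (adjoin R a) xs)"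
    by (rule primes_lift_trans) (rule adjoin_base[OF Cons.prems(1)])
  then show ?case by simp
qed (simp add: primes_lift_refl)

section \<open>Relations with integral coefficients\<close>

definition ev :: "'a::comm_ring_1 \<Rightarrow> int poly \<Rightarrow> 'a" where
  "ev t f = poly (map_poly of_int f) t"

text \<open>The coefficients of H are polynomials in the first argument t, and the second argument s
  replaces the outer variable: a relation H(t, s), read as a polynomial in s over Z[t].\<close>

definition ev2 :: "'a::comm_ring_1 \<Rightarrow> 'a \<Rightarrow> int poly poly \<Rightarrow> 'a" where
  "ev2 t s H = poly (map_poly (ev t) H) s"

lemma comm_ring_hom_poly_map_poly:
  assumes "comm_ring_hom f" shows "comm_ring_hom (\<lambda>p. poly (map_poly f p) t)"
proof -
  interpret map_poly_comm_ring_hom f by (rule map_poly_comm_ring_hom.intro[OF assms])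
  show ?thesis by unfold_locales (simp_all add: hom_distribs)
qed

lemma comm_ring_hom_of_int: "comm_ring_hom (of_int :: int \<Rightarrow> 'a::comm_ring_1)"
  by unfold_locales auto

lemma comm_ring_hom_ev: "comm_ring_hom (ev t)"
  using comm_ring_hom_poly_map_poly[OF comm_ring_hom_of_int] unfolding ev_def[abs_def] .

lemma comm_ring_hom_ev2: "comm_ring_hom (ev2 t s)"
  using comm_ring_hom_poly_map_poly[OF comm_ring_hom_ev] unfolding ev2_def[abs_def] .

interpretation ev: comm_ring_hom "ev t" for t by (rule comm_ring_hom_ev)
interpretation ev2: comm_ring_hom "ev2 t s" for t s by (rule comm_ring_hom_ev2)

lemma ev_const [simp]: "ev t [:c:] = of_int c"
  by (cases "c = 0") (simp_all add: ev_def map_poly_pCons)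

lemma ev_pCons: "ev t (pCons c f) = of_int c + t * ev t f"
  by (cases "c = 0 \<and> f = 0") (auto simp: ev_def map_poly_pCons)

lemma ev_X [simp]: "ev t [:0, 1:] = t"
  by (simp add: ev_pCons)

lemma ev2_pCons: "ev2 t s (pCons c f) = ev t c + s * ev2 t s f"
  by (cases "c = 0 \<and> f = 0") (auto simp: ev2_def map_poly_pCons)

lemma ev2_const [simp]: "ev2 t s [:c:] = ev t c"
  by (simp add: ev2_pCons)

lemma ev2_monom [simp]: "ev2 t s (monom c n) = ev t c * s ^ n"
  by (simp add: ev2_def map_poly_monom poly_monom)

lemma ev_altdef:
  assumes "degree f \<le> n" shows "ev t f = (\<Sum>i\<le>n. of_int (coeff f i) * t ^ i)"
proof -
  have "ev t f = (\<Sum>i\<le>degree f. ev t (monom (coeff f i) i))"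
    by (subst poly_as_sum_of_monoms[symmetric, of f]) (rule ev.hom_sum)
  also have "\<dots> = (\<Sum>i\<le>n. ev t (monom (coeff f i) i))"
    using assms by (intro sum.mono_neutral_left) (auto simp: coeff_eq_0)
  finally show ?thesis by (simp add: ev_def map_poly_monom poly_monom)
qed

lemma ev2_altdef:
  assumes "degree f \<le> n" shows "ev2 t s f = (\<Sum>i\<le>n. ev t (coeff f i) * s ^ i)"
proof -
  have "ev2 t s f = (\<Sum>i\<le>degree f. ev2 t s (monom (coeff f i) i))"
    by (subst poly_as_sum_of_monoms[symmetric, of f]) (rule ev2.hom_sum)
  also have "\<dots> = (\<Sum>i\<le>n. ev2 t s (monom (coeff f i) i))"
    using assms by (intro sum.mono_neutral_left) (auto simp: coeff_eq_0)
  finally show ?thesis by simp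
qed

lemma ev_mem: "subring_set S \<Longrightarrow> t \<in> S \<Longrightarrow> ev t f \<in> S"
  by (subst ev_altdef[OF order_refl])
     (intro subring_set_sum subring_set_mult subring_set_of_int subring_set_power)

lemma ev2_mem: "subring_set S \<Longrightarrow> t \<in> S \<Longrightarrow> s \<in> S \<Longrightarrow> ev2 t s f \<in> S"
  by (subst ev2_altdef[OF order_refl])
     (intro subring_set_sum subring_set_mult ev_mem subring_set_power)

lemma ev_diff_mem:
  assumes "subring_set S" "t \<in> S"
  obtains b where "b \<in> S" "ev t f = of_int (poly f 0) + t * b"
proof (cases f)
  case (pCons c g)
  then show thesis using ev_mem[OF assms, of g] by (intro that[of "ev t g"]) (auto simp: ev_pCons)
qed

definition transcendental_mod :: "'a::comm_ring_1 set \<Rightarrow> 'a \<Rightarrow> bool" where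
  "transcendental_mod I t \<longleftrightarrow> (\<forall>f. ev t f \<in> I \<longrightarrow> f = 0)"

lemma prime_set_vimage:
  assumes f: "comm_ring_hom f" and I: "prime_set UNIV I"
  shows "prime_set UNIV {x. f x \<in> I}"
proof -
  interpret comm_ring_hom f by (rule f)
  show ?thesis using I unfolding prime_set_def ideal_set_def
    by (auto simp: hom_distribs)
qed

text \<open>The ideal of relations lives in the factorial ring \<open>\<int>[t][T]\<close>: a prime factor of a relation of least degree
  generates it.\<close>

lemma relations_principal:
  fixes H :: "int poly poly"
  assumes I: "prime_set UNIV I" and t: "transcendental_mod I t" and H: "H \<noteq> 0" "ev2 t s H \<in> I"
  obtains G where "G \<noteq> 0" "\<And>F. ev2 t s F \<in> I \<longleftrightarrow> G dvd F"
proof -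
  define P where "P = {F. ev2 t s F \<in> I}"
  have P: "prime_set UNIV P" unfolding P_def by (rule prime_set_vimage[OF comm_ring_hom_ev2 I])
  note Pi = prime_set_ideal[OF P]
  \<comment> \<open>Transcendence of t is used here: no nonzero relation is free of the outer
    variable, so every relation G other than 0 has positive degree.\<close>
  have const: "F = 0" if "F \<in> P" "degree F = 0" for F
    using that t by (auto simp: P_def transcendental_mod_def elim!: degree_eq_zeroE)
  obtain M where M: "M \<in> P" "M \<noteq> 0" "\<And>F. F \<in> P \<Longrightarrow> F \<noteq> 0 \<Longrightarrow> degree M \<le> degree F"
    using ex_has_least_nat[of "\<lambda>F. F \<in> P \<and> F \<noteq> 0" H degree] H by (auto simp: P_def)
  have "\<exists>G. prime_elem G \<and> G dvd F \<and> G \<in> P" if "F \<in> P" "F \<noteq> 0" for F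
    using that
  proof (induction F rule: prime_divisors_induct)
    case (unit F)
    then obtain G where "1 = F * G" by (auto elim: dvdE)
    then have "1 \<in> P" using ideal_set_rmult[OF Pi UNIV_I unit(2), of G] by simp
    then show ?case using prime_set_1[OF P] by simp
  next
    case (factor p F)
    then have "p \<in> P \<or> F \<in> P" using prime_setD[OF P] by auto
    then show ?case
    proof
      assume "p \<in> P" then show ?thesis using factor.hyps by (intro exI[of _ p]) auto
    next
      assume "F \<in> P" then show ?thesis using factor by (auto intro: dvd_mult)
    qed
  qed auto
  then obtain G where G: "prime_elem G" "G dvd M" "G \<in> P" using M by blast
  have G0: "G \<noteq> 0" using G by auto
  have dG: "degree G \<le> degree F" if "F \<in> P" "F \<noteq> 0" for F
    using dvd_imp_degree_le[OF G(2) M(2)] M(3)[OF that] by simp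
  have dG0: "degree G > 0" using const G(3) G0 by blast
  have "G dvd F" if F: "F \<in> P" for F
  proof -
    obtain k w r where kwr: "Polynomial.smult (lead_coeff G ^ k) F = w * G + r" "r = 0 \<or> degree r < degree G"
      using pseudo_division[of UNIV G F] by (auto simp: polys_def)
    have "r = [:lead_coeff G ^ k:] * F - w * G" using kwr by simp
    then have "r \<in> P" using ideal_set_lmult[OF Pi UNIV_I F] ideal_set_lmult[OF Pi UNIV_I G(3)]
      by (simp only: ideal_set_diff[OF subring_set_UNIV Pi])
    then have "r = 0" using kwr(2) dG[of r] by linarith
    \<comment> \<open>G is prime of positive degree, so it cannot divide the constant produced by
      the pseudo-division and must divide F.\<close>
    then have "G dvd [:lead_coeff G ^ k:] * F" using kwr by (auto simp: dvd_def mult.commute)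
    then have "G dvd [:lead_coeff G ^ k:] \<or> G dvd F" using G(1) prime_elem_dvd_multD by blast
    moreover have "\<not> G dvd [:lead_coeff G ^ k:]"
    proof
      assume "G dvd [:lead_coeff G ^ k:]"
      then have "degree G \<le> degree [:lead_coeff G ^ k:]" using G0 by (intro dvd_imp_degree_le) auto
      then show False using dG0 by simp
    qed
    ultimately show ?thesis by blast
  qed
  moreover have "F \<in> P" if "G dvd F" for F
    using that G(3) ideal_set_rmult[OF Pi _ G(3)] by (auto elim!: dvdE)
  ultimately have "ev2 t s F \<in> I \<longleftrightarrow> G dvd F" for F unfolding P_def by blast
  then show thesis by (rule that[OF G0])
qed

section \<open>Finite modules and integral elements modulo a prime\<close>

definition span_mod :: "'a::comm_ring_1 \<Rightarrow> 'a set \<Rightarrow> 'a set \<Rightarrow> 'a set" where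
  "span_mod t I W = {x. \<exists>c. x - (\<Sum>v\<in>W. ev t (c v) * v) \<in> I}"

lemma span_mod_ideal:
  assumes I: "ideal_set UNIV I" shows "I \<subseteq> span_mod t I W"
  unfolding span_mod_def by (auto intro!: exI[of _ "\<lambda>_. 0"])

lemma span_mod_add:
  assumes I: "ideal_set UNIV I" and "x \<in> span_mod t I W" "y \<in> span_mod t I W"
  shows "x + y \<in> span_mod t I W"
proof -
  obtain c d where "x - (\<Sum>v\<in>W. ev t (c v) * v) \<in> I" "y - (\<Sum>v\<in>W. ev t (d v) * v) \<in> I"
    using assms by (auto simp: span_mod_def)
  from ideal_set_add[OF I this]
  have "x + y - (\<Sum>v\<in>W. ev t (c v + d v) * v) \<in> I"
    by (simp add: hom_distribs sum.distrib algebra_simps)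
  then show ?thesis unfolding span_mod_def by (intro CollectI exI[of _ "\<lambda>v. c v + d v"])
qed

lemma span_mod_scale:
  assumes I: "ideal_set UNIV I" and "x \<in> span_mod t I W"
  shows "ev t f * x \<in> span_mod t I W"
proof -
  obtain c where "x - (\<Sum>v\<in>W. ev t (c v) * v) \<in> I" using assms by (auto simp: span_mod_def)
  from ideal_set_lmult[OF I UNIV_I this, of "ev t f"]
  have "ev t f * x - (\<Sum>v\<in>W. ev t (f * c v) * v) \<in> I"
    by (simp add: hom_distribs sum_distrib_left right_diff_distrib mult.assoc)
  then show ?thesis unfolding span_mod_def by (intro CollectI exI[of _ "\<lambda>v. f * c v"])
qed

lemma span_mod_uminus:
  "ideal_set UNIV I \<Longrightarrow> x \<in> span_mod t I W \<Longrightarrow> - x \<in> span_mod t I W"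
  using span_mod_scale[of I x t W "-1"] by (simp add: hom_distribs)

lemma span_mod_diff:
  "ideal_set UNIV I \<Longrightarrow> x \<in> span_mod t I W \<Longrightarrow> y \<in> span_mod t I W \<Longrightarrow> x - y \<in> span_mod t I W"
  using span_mod_add[of I x t W "-y"] span_mod_uminus[of I y t W] by simp

lemma span_mod_sum:
  assumes I: "ideal_set UNIV I" and "\<And>i. i \<in> A \<Longrightarrow> f i \<in> span_mod t I W"
  shows "sum f A \<in> span_mod t I W"
  using assms(2)
proof (induction A rule: infinite_finite_induct)
  case (insert a A) then show ?case by (simp add: span_mod_add[OF I])
qed (use span_mod_ideal[OF I] ideal_set_0[OF I] in auto)

lemma span_mod_gen:
  assumes I: "ideal_set UNIV I" and W: "finite W" "v \<in> W"
  shows "v \<in> span_mod t I W"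
proof -
  have "(\<Sum>u\<in>W. ev t (if u = v then 1 else 0) * u) = (\<Sum>u\<in>W. if u = v then u else 0)"
    by (intro sum.cong) auto
  then have "v - (\<Sum>u\<in>W. ev t (if u = v then 1 else 0) * u) \<in> I"
    using W ideal_set_0[OF I] by simp
  then show ?thesis unfolding span_mod_def by (intro CollectI exI)
qed

lemma span_mod_mult:
  assumes I: "ideal_set UNIV I" and g: "\<And>v. v \<in> W \<Longrightarrow> g * v \<in> span_mod t I W'" and x: "x \<in> span_mod t I W"
  shows "g * x \<in> span_mod t I W'"
proof -
  obtain c where c: "x - (\<Sum>v\<in>W. ev t (c v) * v) \<in> I" using x by (auto simp: span_mod_def)
  have "g * (x - (\<Sum>v\<in>W. ev t (c v) * v)) \<in> span_mod t I W'"
    using ideal_set_lmult[OF I UNIV_I c] span_mod_ideal[OF I] by blast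
  moreover have "(\<Sum>v\<in>W. ev t (c v) * (g * v)) \<in> span_mod t I W'"
    using g by (intro span_mod_sum[OF I] span_mod_scale[OF I]) auto
  ultimately have *: "g * (x - (\<Sum>v\<in>W. ev t (c v) * v)) + (\<Sum>v\<in>W. ev t (c v) * (g * v)) \<in> span_mod t I W'"
    by (rule span_mod_add[OF I])
  have "(\<Sum>v\<in>W. ev t (c v) * (g * v)) = g * (\<Sum>v\<in>W. ev t (c v) * v)"
    by (simp only: sum_distrib_left mult.left_commute)
  then have "g * (x - (\<Sum>v\<in>W. ev t (c v) * v)) + (\<Sum>v\<in>W. ev t (c v) * (g * v)) = g * x"
    by (simp only: right_diff_distrib diff_add_cancel)
  with * show ?thesis by simp
qed

text \<open>By Cayley--Hamilton.\<close>

lemma monic_relation: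
  fixes a :: "'a::comm_ring_1"
  assumes I: "ideal_set UNIV I" and W: "finite W" and a: "\<And>v. v \<in> W \<Longrightarrow> a * v \<in> span_mod t I W"
  obtains H where "lead_coeff H = 1" "\<And>v. v \<in> W \<Longrightarrow> ev2 t a H * v \<in> I"
proof -
  obtain ws where ws: "set ws = W" "distinct ws" using finite_distinct_list[OF W] by blast
  define n where "n = length ws"
  have "\<forall>v\<in>W. \<exists>c. a * v - (\<Sum>u\<in>W. ev t (c u) * u) \<in> I" using a by (auto simp: span_mod_def)
  then obtain c where c: "\<And>v. v \<in> W \<Longrightarrow> a * v - (\<Sum>u\<in>W. ev t (c v u) * u) \<in> I" by metis
  define Q where "Q = mat n n (\<lambda>(i, j). c (ws ! i) (ws ! j))"
  have Q: "Q \<in> carrier_mat n n" by (simp add: Q_def)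
  \<comment> \<open>A is the matrix a - Q. It kills the vector of generators modulo I, and
    multiplying by its adjugate shows that its determinant, the characteristic polynomial at a, does
    so too.\<close>
  define A where "A = map_mat (ev2 t a) (char_poly_matrix Q)"
  have A: "A \<in> carrier_mat n n" using Q by (simp add: A_def)
  have Aij: "A $$ (i, j) = (if i = j then a else 0) - ev t (c (ws ! i) (ws ! j))" if "i < n" "j < n" for i j
    using that Q by (auto simp: A_def char_poly_matrix_def Q_def hom_distribs ev2_pCons)
  have det: "det A = ev2 t a (char_poly Q)"
    unfolding A_def char_poly_def by (rule ev2.hom_det)
  have sum_ws: "(\<Sum>j<n. f (ws ! j)) = (\<Sum>u\<in>W. f u)" for f :: "'a \<Rightarrow> 'a"
    using sum.reindex_bij_betw[OF bij_betw_nth[OF ws(2) refl refl], of f] ws(1)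
    by (simp add: n_def)
  have Av: "(\<Sum>j<n. A $$ (k, j) * ws ! j) \<in> I" if k: "k < n" for k
  proof -
    have "(\<Sum>j<n. A $$ (k, j) * ws ! j) = (\<Sum>j<n. (if k = j then a * ws ! j else 0) - ev t (c (ws ! k) (ws ! j)) * ws ! j)"
      using k by (intro sum.cong) (auto simp: Aij left_diff_distrib)
    also have "\<dots> = a * ws ! k - (\<Sum>j<n. ev t (c (ws ! k) (ws ! j)) * ws ! j)"
      using k by (simp add: sum_subtractf)
    also have "(\<Sum>j<n. ev t (c (ws ! k) (ws ! j)) * ws ! j) = (\<Sum>u\<in>W. ev t (c (ws ! k) u) * u)"
      by (rule sum_ws)
    also have "a * ws ! k - \<dots> \<in> I" using c[of "ws ! k"] k ws(1) by (auto simp: n_def)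
    finally show ?thesis .
  qed
  have "det A * ws ! i \<in> I" if i: "i < n" for i
  proof -
    have B: "adj_mat A \<in> carrier_mat n n" using adj_mat(1)[OF A] .
    have e: "(\<Sum>k<n. adj_mat A $$ (i, k) * A $$ (k, j)) = (if i = j then det A else 0)" if j: "j < n" for j
    proof -
      have "(adj_mat A * A) $$ (i, j) = (\<Sum>k<n. adj_mat A $$ (i, k) * A $$ (k, j))"
        using i j A B by (auto simp: scalar_prod_def lessThan_atLeast0)
      then show ?thesis using adj_mat(3)[OF A] i j by (cases "i = j") simp_all
    qed
    have "det A * ws ! i = (\<Sum>j<n. (if i = j then det A else 0) * ws ! j)"
      using i by (simp add: if_distrib[of "\<lambda>x. x * _"] cong: if_cong)
    also have "\<dots> = (\<Sum>j<n. (\<Sum>k<n. adj_mat A $$ (i, k) * A $$ (k, j)) * ws ! j)"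
      using e by (intro sum.cong) auto
    also have "\<dots> = (\<Sum>k<n. adj_mat A $$ (i, k) * (\<Sum>j<n. A $$ (k, j) * ws ! j))"
      by (simp add: sum_distrib_left sum_distrib_right mult.assoc) (rule sum.swap)
    also have "\<dots> \<in> I" using ideal_set_lmult[OF I UNIV_I Av] by (intro ideal_set_sum[OF I]) auto
    finally show ?thesis .
  qed
  then have "ev2 t a (char_poly Q) * v \<in> I" if "v \<in> W" for v
    using that ws(1) det by (auto simp: in_set_conv_nth n_def)
  moreover have "lead_coeff (char_poly Q) = 1" using degree_monic_char_poly[OF Q] by auto
  ultimately show thesis by (intro that[of "char_poly Q"])
qed

text \<open>The module spanned by W over Z[t] is stable under each g in G only after multiplication
  by the common denominator h. The element 1 lies in W so that products of generators can be
  expanded on W, starting from 1.\<close>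

definition stable_module :: "'a::comm_ring_1 \<Rightarrow> 'a set \<Rightarrow> 'a set \<Rightarrow> int poly \<Rightarrow> 'a set \<Rightarrow> bool" where
  "stable_module t I W h G \<longleftrightarrow> finite W \<and> 1 \<in> W \<and> ev t h \<notin> I \<and>
     (\<forall>g\<in>G. \<forall>v\<in>W. ev t h * (g * v) \<in> span_mod t I W)"

lemma stable_module_empty: "prime_set UNIV I \<Longrightarrow> stable_module t I {1} 1 {}"
  by (simp add: stable_module_def prime_set_1)

text \<open>W is enlarged by the powers of g below the degree of F. Only the product g * g^(D-1)
  leaves the new span, and the relation F brings it back at the cost of the leading coefficient,
  which joins the denominator.\<close>

lemma stable_module_insert:
  assumes I: "prime_set UNIV I" and st: "stable_module t I W h G"
    and F: "ev2 t g F \<in> I" "ev t (lead_coeff F) \<notin> I"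
  obtains W' where "stable_module t I W' (h * lead_coeff F) (insert g G)"
proof -
  note Ii = prime_set_ideal[OF I]
  define D where "D = degree F"
  have D0: "D > 0"
  proof (rule ccontr)
    assume "\<not> D > 0"
    then obtain c where "F = [:c:]" by (auto simp: D_def elim: degree_eq_zeroE)
    then show False using F by simp
  qed
  define W' where "W' = (\<lambda>(v, j). v * g ^ j) ` (W \<times> {..<D})"
  have W: "finite W" "1 \<in> W" "ev t h \<notin> I" "\<And>g v. g \<in> G \<Longrightarrow> v \<in> W \<Longrightarrow> ev t h * (g * v) \<in> span_mod t I W"
    using st by (auto simp: stable_module_def)
  have fin: "finite W'" using W(1) by (simp add: W'_def)
  have gen: "v * g ^ j \<in> span_mod t I W'" if "v \<in> W" "j < D" for v j
    using that by (intro span_mod_gen[OF Ii fin]) (auto simp: W'_def)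
  have lead: "ev t (lead_coeff F) * (g * (v * g ^ j)) \<in> span_mod t I W'" if v: "v \<in> W" and j: "j < D" for v j
  proof (cases "Suc j < D")
    case True
    then have "v * g ^ Suc j \<in> span_mod t I W'" using gen v by blast
    then have "g * (v * g ^ j) \<in> span_mod t I W'" by (simp add: mult_ac)
    then show ?thesis by (rule span_mod_scale[OF Ii])
  next
    case False
    then have jD: "D = Suc j" using j by simp
    have "ev2 t g F = (\<Sum>i\<le>D. ev t (coeff F i) * g ^ i)" by (rule ev2_altdef) (simp add: D_def)
    also have "\<dots> = ev t (lead_coeff F) * g ^ D + (\<Sum>i<D. ev t (coeff F i) * g ^ i)"
      by (simp add: D_def lessThan_Suc_atMost[symmetric] add.commute)
    finally have "ev t (lead_coeff F) * g ^ D = ev2 t g F - (\<Sum>i<D. ev t (coeff F i) * g ^ i)" by simp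
    then have *: "v * (ev t (lead_coeff F) * g ^ D) = v * (ev2 t g F - (\<Sum>i<D. ev t (coeff F i) * g ^ i))" by simp
    have "ev t (lead_coeff F) * (g * (v * g ^ j)) = v * (ev t (lead_coeff F) * g ^ D)"
      by (simp add: jD mult_ac)
    also note *
    also have "v * (ev2 t g F - (\<Sum>i<D. ev t (coeff F i) * g ^ i)) = v * ev2 t g F - (\<Sum>i<D. ev t (coeff F i) * (v * g ^ i))"
      by (simp only: right_diff_distrib sum_distrib_left mult.left_commute)
    finally have "ev t (lead_coeff F) * (g * (v * g ^ j)) = v * ev2 t g F - (\<Sum>i<D. ev t (coeff F i) * (v * g ^ i))" .
    moreover have "v * ev2 t g F \<in> span_mod t I W'"
      using ideal_set_lmult[OF Ii UNIV_I F(1)] span_mod_ideal[OF Ii] by blast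
    moreover have "(\<Sum>i<D. ev t (coeff F i) * (v * g ^ i)) \<in> span_mod t I W'"
      using gen v by (intro span_mod_sum[OF Ii] span_mod_scale[OF Ii]) auto
    ultimately show ?thesis by (simp only: span_mod_diff[OF Ii])
  qed
  have "ev t (h * lead_coeff F) * (g' * v) \<in> span_mod t I W'" if "g' \<in> insert g G" "v \<in> W'" for g' v
  proof -
    from that(2) obtain u j where u: "v = u * g ^ j" "u \<in> W" "j < D" by (auto simp: W'_def)
    show ?thesis
    proof (cases "g' = g")
      case True
      then show ?thesis using span_mod_scale[OF Ii lead[OF u(2,3)], of h] by (simp add: u ev.hom_mult mult.assoc)
    next
      case False
      then have "ev t h * (g' * u) \<in> span_mod t I W" using that(1) u(2) by (intro W(4)) auto
      then have "g ^ j * (ev t h * (g' * u)) \<in> span_mod t I W'"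
        by (rule span_mod_mult[OF Ii, rotated]) (use gen[OF _ u(3)] in \<open>simp add: mult.commute\<close>)
      from span_mod_scale[OF Ii this, of "lead_coeff F"] show ?thesis by (simp add: u ev.hom_mult mult_ac)
    qed
  qed
  moreover have "1 \<in> W'" unfolding W'_def using W(2) D0 by (intro image_eqI[of _ _ "(1, 0)"]) auto
  moreover have "ev t (h * lead_coeff F) \<notin> I" using prime_set_not_mult[OF I _ _ W(3) F(2)] by (simp add: ev.hom_mult)
  ultimately have "stable_module t I W' (h * lead_coeff F) (insert g G)"
    using fin unfolding stable_module_def by (intro conjI ballI)
  then show thesis by (rule that)
qed

section \<open>Elements integral over Z[t] modulo a prime\<close>

definition integral_mod :: "'a::comm_ring_1 \<Rightarrow> 'a set \<Rightarrow> 'a set" where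
  "integral_mod t I = {a. \<exists>H. lead_coeff H = 1 \<and> ev2 t a H \<in> I}"

text \<open>For monic relations the denominator of \<open>stable_module_insert\<close> is 1, so a
  and b act on a common finite module; a - b and a * b act on it as well, and
  \<open>monic_relation\<close> applies to them.\<close>

lemma integral_mod_subring:
  assumes I: "prime_set UNIV I" shows "subring_set (integral_mod t I)"
proof -
  note Ii = prime_set_ideal[OF I]
  have key: "a - b \<in> integral_mod t I \<and> a * b \<in> integral_mod t I"
    if ab: "a \<in> integral_mod t I" "b \<in> integral_mod t I" for a b
  proof -
    obtain F H where FH: "lead_coeff F = 1" "ev2 t a F \<in> I" "lead_coeff H = 1" "ev2 t b H \<in> I"
      using ab by (auto simp: integral_mod_def)
    obtain W where W: "stable_module t I W (1 * lead_coeff F) (insert a {})"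
      using stable_module_insert[OF I stable_module_empty[OF I] FH(2)] FH prime_set_1[OF I] by auto
    obtain W' where W': "stable_module t I W' (1 * lead_coeff F * lead_coeff H) {b, a}"
      using stable_module_insert[OF I W FH(4)] FH prime_set_1[OF I] by auto
    then have st: "finite W'" "1 \<in> W'" "\<And>v. v \<in> W' \<Longrightarrow> a * v \<in> span_mod t I W'" "\<And>v. v \<in> W' \<Longrightarrow> b * v \<in> span_mod t I W'"
      by (auto simp: stable_module_def FH)
    have int: "c \<in> integral_mod t I" if c: "\<And>v. v \<in> W' \<Longrightarrow> c * v \<in> span_mod t I W'" for c
    proof -
      obtain K where "lead_coeff K = 1" "\<And>v. v \<in> W' \<Longrightarrow> ev2 t c K * v \<in> I"
        using monic_relation[OF Ii st(1) c] by metis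
      then have "lead_coeff K = 1" "ev2 t c K \<in> I" using st(2) by force+
      then show ?thesis by (auto simp: integral_mod_def)
    qed
    have "a - b \<in> integral_mod t I"
      using st by (intro int) (auto simp: left_diff_distrib intro: span_mod_diff[OF Ii])
    moreover have "a * (b * v) \<in> span_mod t I W'" if "v \<in> W'" for v
      using span_mod_mult[OF Ii st(3) st(4)[OF that]] by blast
    then have "a * b \<in> integral_mod t I" by (intro int) (simp add: mult.assoc)
    ultimately show ?thesis by blast
  qed
  have "1 \<in> integral_mod t I"
    unfolding integral_mod_def using ideal_set_0[OF Ii]
    by (intro CollectI exI[of _ "[:-1, 1:]"]) (simp add: ev2_pCons hom_distribs)
  then show ?thesis using key by (intro subring_setI) auto
qed

lemma ev_integral_mod:
  assumes "ideal_set UNIV I" shows "ev t f \<in> integral_mod t I"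
proof -
  have "ev2 t (ev t f) [:- f, 1:] = 0" by (simp add: ev2_pCons ev.hom_uminus)
  then have "ev2 t (ev t f) [:- f, 1:] \<in> I" using ideal_set_0[OF assms] by simp
  moreover have "lead_coeff [:- f, 1:] = 1" by simp
  ultimately show ?thesis unfolding integral_mod_def by blast
qed

lemma integral_mod_cong:
  assumes I: "prime_set UNIV I" and "a - b \<in> I" "b \<in> integral_mod t I"
  shows "a \<in> integral_mod t I"
proof -
  have "ev2 t (a - b) [:0, 1:] \<in> I" using assms(2) by (simp add: ev2_pCons)
  moreover have "lead_coeff [:0, 1 :: int poly:] = 1" by simp
  ultimately have "a - b \<in> integral_mod t I" unfolding integral_mod_def by blast
  from subring_set_add[OF integral_mod_subring[OF I] this assms(3)] show ?thesis by simp
qed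

text \<open>In A * B = c T^n the orders of vanishing at 0 add up to n, as do the degrees, and no
  order exceeds the degree. So order and degree of A agree.\<close>

lemma factor_of_monom:
  fixes A B :: "'a::idom poly"
  assumes "A * B = monom c n" "c \<noteq> 0" "i \<noteq> degree A"
  shows "coeff A i = 0"
proof -
  have nz: "A \<noteq> 0" "B \<noteq> 0" using assms by auto
  have "monom c n = [:c:] * [:- 0, 1:] ^ n" by (simp add: monom_altdef)
  then have "Polynomial.order 0 (A * B) = n" using assms(1,2) order_power_n_n[of 0 n] by (simp add: order_smult)
  then have "Polynomial.order 0 A + Polynomial.order 0 B = n" using nz by (simp add: order_mult)
  moreover have "degree A + degree B = n" using assms nz by (metis degree_mult_eq degree_monom_eq)
  moreover have "Polynomial.order 0 A \<le> degree A" "Polynomial.order 0 B \<le> degree B" using nz by (auto intro: order_degree)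
  ultimately have "Polynomial.order 0 A = degree A" by linarith
  then have "[:0, 1:] ^ degree A dvd A" using order_1[of 0 A] by simp
  then obtain C where C: "A = [:0, 1:] ^ degree A * C" by (auto elim: dvdE)
  then have "C \<noteq> 0" using nz by auto
  moreover have "degree A = degree A + degree C"
    using \<open>C \<noteq> 0\<close> by (subst C) (simp add: degree_mult_eq degree_power_eq)
  ultimately obtain e where "C = [:e:]" by (metis add_cancel_right_right degree_eq_zeroE)
  then have "A = monom e (degree A)" using C by (simp add: monom_altdef mult.commute)
  then show ?thesis using assms(3) by (metis coeff_monom)
qed

lemma power_diff_mem_ideal:
  fixes a b :: "'a::comm_ring_1"
  assumes I: "ideal_set UNIV I" and ab: "a - b \<in> I"
  shows "a ^ n - b ^ n \<in> I"
  using ideal_set_rmult[OF I UNIV_I ab] by (simp only: power_diff_sumr2)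

text \<open>The minimal polynomial of \<open>s\<close> over \<open>\<int>[w]\<close> divides both a monic
  polynomial and one that is congruent to \<open>m\<^sup>D T\<^sup>D\<close> modulo \<open>w\<close>, so it is congruent to \<open>T\<^sup>d\<close> up to a unit.\<close>

lemma going_down:
  assumes S: "subring_set S" and I: "prime_set UNIV I" and x: "prime_set S x" "I \<inter> S \<subseteq> x"
    and w: "w \<in> x" "transcendental_mod I w"
    and s: "s \<in> S" "s \<in> integral_mod w I" and g: "g \<in> integral_mod w I"
    and m: "m \<noteq> 0" "of_int m * s - w * g \<in> I"
  shows "s \<in> x"
proof -
  note Ii = prime_set_ideal[OF I] and xi = prime_set_ideal[OF x(1)]
  obtain K where K: "lead_coeff K = 1" "ev2 w s K \<in> I" using s by (auto simp: integral_mod_def)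
  obtain H where H: "lead_coeff H = 1" "ev2 w g H \<in> I" using g by (auto simp: integral_mod_def)
  define D where "D = degree H"
  define U where "U = [:0, 1::int:]"
  \<comment> \<open>This is w^D H(m T / w). Since m s is w g modulo I, its value at s is w^D H(g),
    hence zero modulo I; at w = 0 only the top term m^D T^D is left.\<close>
  define E where "E = (\<Sum>i\<le>D. monom (coeff H i * [:m:] ^ i * U ^ (D - i)) i)"
  have mw: "(of_int m * s) ^ i - (w * g) ^ i \<in> I" for i
    by (rule power_diff_mem_ideal[OF Ii m(2)])
  have "ev2 w s E = (\<Sum>i\<le>D. ev w (coeff H i) * w ^ (D - i) * (of_int m * s) ^ i)"
    by (simp add: E_def U_def ev2.hom_sum ev.hom_mult ev.hom_power power_mult_distrib mult_ac)
  also have "\<dots> = (\<Sum>i\<le>D. ev w (coeff H i) * w ^ (D - i) * (w * g) ^ i)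
      + (\<Sum>i\<le>D. ev w (coeff H i) * w ^ (D - i) * ((of_int m * s) ^ i - (w * g) ^ i))"
    by (simp add: sum_subtractf right_diff_distrib)
  also have "(\<Sum>i\<le>D. ev w (coeff H i) * w ^ (D - i) * (w * g) ^ i) = w ^ D * ev2 w g H"
  proof -
    have "ev w (coeff H i) * w ^ (D - i) * (w * g) ^ i = w ^ D * (ev w (coeff H i) * g ^ i)" if "i \<le> D" for i
    proof -
      have "w ^ D = w ^ (D - i) * w ^ i" using that by (simp flip: power_add)
      then show ?thesis by (simp add: power_mult_distrib mult_ac)
    qed
    then show ?thesis by (simp add: ev2_altdef[of H D] D_def sum_distrib_left)
  qed
  also have "\<dots> + (\<Sum>i\<le>D. ev w (coeff H i) * w ^ (D - i) * ((of_int m * s) ^ i - (w * g) ^ i)) \<in> I"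
    using ideal_set_lmult[OF Ii UNIV_I mw] ideal_set_lmult[OF Ii UNIV_I H(2)]
    by (intro ideal_set_add[OF Ii] ideal_set_sum[OF Ii]) simp_all
  finally have EI: "ev2 w s E \<in> I" .
  have "K \<noteq> 0" using K by auto
  obtain G where G: "G \<noteq> 0" "\<And>F. ev2 w s F \<in> I \<longleftrightarrow> G dvd F"
    using relations_principal[OF I w(2) \<open>K \<noteq> 0\<close> K(2)] by metis
  have "G dvd K" "G dvd E" using G K EI by auto
  then obtain K' E' where K': "K = G * K'" and E': "E = G * E'" by (auto elim!: dvdE)
  have "lead_coeff G * lead_coeff K' = 1" using K(1) by (simp add: K' lead_coeff_mult)
  \<comment> \<open>G divides the monic K, so its leading coefficient is a unit. This keeps the
    degree of G when w is set to 0.\<close>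
  then have lG: "1 = lead_coeff G * lead_coeff K'" by simp
  define \<phi> where "\<phi> = (\<lambda>F :: int poly poly. map_poly (\<lambda>c. poly c 0) F)"
  have hom0: "comm_ring_hom (\<lambda>c :: int poly. poly c 0)" by unfold_locales auto
  interpret h0: map_poly_comm_ring_hom "\<lambda>c :: int poly. poly c 0" by (rule map_poly_comm_ring_hom.intro[OF hom0])
  have c\<phi>: "coeff (\<phi> F) i = poly (coeff F i) 0" for F i by (simp add: \<phi>_def coeff_map_poly)
  have "coeff (\<phi> E) i = coeff (monom (m ^ D) D) i" for i
    using H(1) by (auto simp: c\<phi> E_def coeff_sum U_def poly_sum if_distrib[of "\<lambda>p. poly p 0"] poly_power power_0_left D_def cong: if_cong)
  then have "\<phi> E = monom (m ^ D) D" by (intro poly_eqI)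
  then have GE: "\<phi> G * \<phi> E' = monom (m ^ D) D" by (simp add: E' \<phi>_def h0.hom_mult)
  have "poly (lead_coeff G) 0 \<noteq> 0" using arg_cong[OF lG, of "\<lambda>p. poly p 0"] by auto
  then have dG: "degree (\<phi> G) = degree G"
    by (intro antisym degree_le le_degree) (auto simp: c\<phi> coeff_eq_0)
  have low: "poly (coeff G i) 0 = 0" if "i \<noteq> degree G" for i
    using factor_of_monom[OF GE _ , of i] m(1) that by (simp add: dG c\<phi>)
  have wS: "w \<in> S" using w(1) ideal_set_subset[OF xi] by blast
  \<comment> \<open>Every lower coefficient of G is a multiple of w, hence lies in x. In G(s) = 0
    only a unit times a power of s remains, and x is prime.\<close>
  have lowx: "ev w (coeff G i) * s ^ i \<in> x" if i: "i < degree G" for i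
  proof -
    obtain b where "b \<in> S" "ev w (coeff G i) = of_int (poly (coeff G i) 0) + w * b"
      using ev_diff_mem[OF S wS] by blast
    then have "ev w (coeff G i) * s ^ i = w * (b * s ^ i)" using low[of i] i by (simp add: mult_ac)
    moreover have "b * s ^ i \<in> S" using \<open>b \<in> S\<close> s(1) by (intro subring_set_mult[OF S] subring_set_power[OF S])
    ultimately show ?thesis using ideal_set_rmult[OF xi _ w(1)] by simp
  qed
  have "ev2 w s G \<in> I \<inter> S" using G(2)[of G] ev2_mem[OF S wS s(1)] by simp
  then have "ev2 w s G \<in> x" using x(2) by blast
  moreover have "ev2 w s G = ev w (lead_coeff G) * s ^ degree G + (\<Sum>i<degree G. ev w (coeff G i) * s ^ i)"
    by (simp add: ev2_altdef[OF order_refl] lessThan_Suc_atMost[symmetric] add.commute)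
  moreover have "(\<Sum>i<degree G. ev w (coeff G i) * s ^ i) \<in> x"
    using lowx by (intro ideal_set_sum[OF xi]) auto
  ultimately have "ev w (lead_coeff G) * s ^ degree G \<in> x"
    using ideal_set_diff[OF S xi, of "ev2 w s G" "\<Sum>i<degree G. ev w (coeff G i) * s ^ i"] by simp
  then have "ev w (lead_coeff K') * (ev w (lead_coeff G) * s ^ degree G) \<in> x"
    by (rule ideal_set_lmult[OF xi ev_mem[OF S wS]])
  moreover have "ev w (lead_coeff K') * (ev w (lead_coeff G) * s ^ degree G) = s ^ degree G"
  proof -
    have "ev w (lead_coeff K') * (ev w (lead_coeff G) * s ^ degree G) = ev w (lead_coeff G * lead_coeff K') * s ^ degree G"
      by (simp add: ev.hom_mult mult_ac)
    then show ?thesis by (simp add: lG[symmetric] ev.hom_one)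
  qed
  ultimately have "s ^ degree G \<in> x" by simp
  then show "s \<in> x" using prime_set_not_power[OF S x(1) s(1)] by blast
qed

text \<open>The elements of S whose image in the localization at x comes from the ring of integral
  elements: s is the fraction (e s) / e with an integral denominator outside x.\<close>

definition locally_integral :: "'a::comm_ring_1 set \<Rightarrow> 'a set \<Rightarrow> 'a \<Rightarrow> 'a set \<Rightarrow> 'a set" where
  "locally_integral S x w I = {s\<in>S. \<exists>e\<in>S. e \<notin> x \<and> e \<in> integral_mod w I \<and> e * s \<in> integral_mod w I}"

lemma locally_integral_subring:
  assumes S: "subring_set S" and I: "prime_set UNIV I" and x: "prime_set S x"
  shows "subring_set (locally_integral S x w I)"
proof (rule subring_setI)
  note T = integral_mod_subring[OF I, of w]
  show "1 \<in> locally_integral S x w I"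
    using subring_set_1[OF S] subring_set_1[OF T] prime_set_1[OF x] by (auto simp: locally_integral_def intro!: bexI[of _ 1])
  fix a b assume ab: "a \<in> locally_integral S x w I" "b \<in> locally_integral S x w I"
  then obtain c d where c: "c \<in> S" "c \<notin> x" "c \<in> integral_mod w I" "c * a \<in> integral_mod w I"
    and d: "d \<in> S" "d \<notin> x" "d \<in> integral_mod w I" "d * b \<in> integral_mod w I"
    and abS: "a \<in> S" "b \<in> S"
    by (auto simp: locally_integral_def)
  have cd: "c * d \<in> S" "c * d \<notin> x" "c * d \<in> integral_mod w I"
    using c d subring_set_mult[OF S] subring_set_mult[OF T] prime_set_not_mult[OF x] by auto
  have "(c * d) * (a - b) = d * (c * a) - c * (d * b)" by (simp add: algebra_simps)
  also have "\<dots> \<in> integral_mod w I"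
    by (rule subring_set_diff[OF T subring_set_mult[OF T d(3) c(4)] subring_set_mult[OF T c(3) d(4)]])
  finally show "a - b \<in> locally_integral S x w I"
    using cd subring_set_diff[OF S abS] unfolding locally_integral_def by blast
  have "(c * d) * (a * b) = (c * a) * (d * b)" by (simp add: algebra_simps)
  also have "\<dots> \<in> integral_mod w I" by (rule subring_set_mult[OF T c(4) d(4)])
  finally show "a * b \<in> locally_integral S x w I"
    using cd subring_set_mult[OF S abS] unfolding locally_integral_def by blast
qed

text \<open>The wanted prime contains J, the ideal generated by w modulo I, and avoids all m s with
  m a nonzero integer and s outside x; avoiding them means to lie inside x and to contain no nonzero
  integer. That J avoids them is the statement of \<open>going_down\<close>, once common
  denominators are multiplied in.\<close>

lemma horizontal_prime:
  assumes S: "subring_set S" and I: "prime_set UNIV I" and x: "prime_set S x" "I \<inter> S \<subseteq> x"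
    and w: "w \<in> x" "transcendental_mod I w" and li: "S \<subseteq> locally_integral S x w I"
  obtains q where "prime_set S q" "I \<inter> S \<subseteq> q" "w \<in> q" "q \<subseteq> x" "\<And>m. m \<noteq> 0 \<Longrightarrow> of_int m \<notin> q"
proof -
  note Ii = prime_set_ideal[OF I] and T = integral_mod_subring[OF I, of w]
  have wS: "w \<in> S" using w(1) prime_set_subset[OF x(1)] by blast
  have gd: "s \<in> x" if sg: "s \<in> S" "g \<in> S" "m \<noteq> 0" "of_int m * s - w * g \<in> I" for s g m
  proof -
    obtain c d where c: "c \<in> S" "c \<notin> x" "c \<in> integral_mod w I" "c * s \<in> integral_mod w I"
      and d: "d \<in> S" "d \<notin> x" "d \<in> integral_mod w I" "d * g \<in> integral_mod w I"
      using subsetD[OF li sg(1)] subsetD[OF li sg(2)] unfolding locally_integral_def by blast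
    have cs: "(c * d) * s \<in> integral_mod w I"
      using subring_set_mult[OF T d(3) c(4)] by (simp add: mult_ac)
    have dg: "(c * d) * g \<in> integral_mod w I"
      using subring_set_mult[OF T c(3) d(4)] by (simp add: mult_ac)
    have cdS: "c * d * s \<in> S" using c d sg subring_set_mult[OF S] by auto
    have "(c * d) * (of_int m * s - w * g) \<in> I" using sg ideal_set_lmult[OF Ii] by blast
    then have "of_int m * ((c * d) * s) - w * ((c * d) * g) \<in> I" by (simp add: algebra_simps)
    then have "(c * d) * s \<in> x" using going_down[OF S I x w cdS cs dg sg(3)] by blast
    then show ?thesis using prime_setD[OF x(1)] c d sg subring_set_mult[OF S] by blast
  qed
  define J where "J = {a \<in> S. \<exists>b\<in>S. a - w * b \<in> I}"
  define M where "M = {of_int m * s |m s. m \<noteq> 0 \<and> s \<in> S \<and> s \<notin> x}"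
  have J: "ideal_set S J"
    unfolding ideal_set_def
  proof (intro conjI ballI)
    show "J \<subseteq> S" by (auto simp: J_def)
    show "0 \<in> J" using subring_set_0[OF S] ideal_set_0[OF Ii] by (auto simp: J_def intro!: bexI[of _ 0])
    fix a b assume "a \<in> J" "b \<in> J"
    then obtain c d where *: "a \<in> S" "b \<in> S" "c \<in> S" "d \<in> S" "a - w * c \<in> I" "b - w * d \<in> I" by (auto simp: J_def)
    have "(a + b) - w * (c + d) \<in> I" using ideal_set_add[OF Ii *(5,6)] by (simp add: algebra_simps)
    then show "a + b \<in> J" using * subring_set_add[OF S] unfolding J_def by blast
  next
    fix s a assume sa: "s \<in> S" "a \<in> J"
    then obtain c where *: "a \<in> S" "c \<in> S" "a - w * c \<in> I" by (auto simp: J_def)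
    have "s * a - w * (s * c) \<in> I" using ideal_set_lmult[OF Ii UNIV_I *(3), of s] by (simp add: algebra_simps)
    then show "s * a \<in> J" using * sa subring_set_mult[OF S] unfolding J_def by blast
  qed
  have M1: "of_int m * s \<in> M" if "m \<noteq> 0" "s \<in> S" "s \<notin> x" for m s using that unfolding M_def by blast
  have 1: "1 \<in> M" using M1[of 1 1] subring_set_1[OF S] prime_set_1[OF x(1)] by simp
  have 2: "M \<subseteq> S" using subring_set_mult[OF S] subring_set_of_int[OF S] unfolding M_def by blast
  have 3: "a * b \<in> M" if ab: "a \<in> M" "b \<in> M" for a b
  proof -
    obtain m s k r where *: "a = of_int m * s" "b = of_int k * r" "m \<noteq> 0" "k \<noteq> 0" "s \<in> S" "r \<in> S" "s \<notin> x" "r \<notin> x"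
      using ab by (auto simp: M_def)
    have "of_int (m * k) * (s * r) \<in> M"
      using * subring_set_mult[OF S] prime_set_not_mult[OF x(1)] by (intro M1) auto
    then show ?thesis by (simp add: * algebra_simps)
  qed
  have 4: "J \<inter> M = {}"
  proof (rule ccontr)
    assume "J \<inter> M \<noteq> {}"
    then obtain a where "a \<in> J" "a \<in> M" by blast
    then show False using gd unfolding J_def M_def by blast
  qed
  obtain q where q: "prime_set S q" "J \<subseteq> q" "q \<inter> M = {}"
    using prime_set_avoiding[OF S J 1 2 3 4] by blast
  show thesis
  proof
    show "prime_set S q" by (rule q)
    have "a \<in> J" if "a \<in> I \<inter> S" for a
      using that subring_set_0[OF S] unfolding J_def by (intro CollectI conjI bexI[of _ 0]) auto
    then show "I \<inter> S \<subseteq> q" using q(2) by blast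
    have "w \<in> J" using wS subring_set_1[OF S] ideal_set_0[OF Ii] unfolding J_def by (intro CollectI conjI bexI[of _ 1]) auto
    then show "w \<in> q" using q(2) by blast
    show "q \<subseteq> x"
    proof
      fix a assume a: "a \<in> q"
      show "a \<in> x"
      proof (rule ccontr)
        assume "a \<notin> x"
        then have "of_int 1 * a \<in> M" using a prime_set_subset[OF q(1)] by (intro M1) auto
        then show False using a q(3) by auto
      qed
    qed
    fix m :: int assume "m \<noteq> 0"
    then have "of_int m * 1 \<in> M" using subring_set_1[OF S] prime_set_1[OF x(1)] by (intro M1)
    then show "of_int m \<notin> q" using q(3) by auto
  qed
qed

text \<open>A relation of \<open>a\<close> over \<open>\<int>[w]\<close> whose constant term is a unit at \<open>x\<close> makes \<open>1 / a\<close> integral at \<open>x\<close>;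
  \<open>b\<close> is that inverse up to the constant term.\<close>

lemma inverse_integral:
  assumes S: "subring_set S" and I: "prime_set UNIV I" and x: "prime_set S x" "I \<inter> S \<subseteq> x"
    and w: "w \<in> S" and a: "a \<in> S" and F: "ev2 w a F \<in> I" "ev w (coeff F 0) \<notin> x"
  obtains b where "b \<in> S" "b \<notin> x" "b \<in> integral_mod w I" "b * a - ev w (coeff F 0) \<in> I"
proof (cases F)
  case (pCons c F')
  note Ii = prime_set_ideal[OF I] and xi = prime_set_ideal[OF x(1)]
  define b where "b = - ev2 w a F'"
  have c: "coeff F 0 = c" by (simp add: pCons)
  have bS: "b \<in> S" unfolding b_def using ev2_mem[OF S w a] subring_set_uminus[OF S] by blast
  have "ev2 w a F = ev w c - b * a" by (simp add: pCons ev2_pCons b_def mult.commute)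
  then have ba: "b * a - ev w c \<in> I" using ideal_set_uminus[OF _ Ii F(1)] by simp
  have cS: "ev w c \<in> S" using ev_mem[OF S w] .
  have bx: "b \<notin> x"
  proof
    assume "b \<in> x"
    then have "b * a \<in> x" using ideal_set_rmult[OF xi a] by blast
    moreover have "b * a - ev w c \<in> x" using ba x(2) subring_set_diff[OF S subring_set_mult[OF S bS a] cS] by blast
    ultimately have "b * a - (b * a - ev w c) \<in> x" by (rule ideal_set_diff[OF S xi])
    then show False using F(2) c by simp
  qed
  define D where "D = degree F'"
  \<comment> \<open>The reversed polynomial of F, made monic: b acts as -c/a would up to sign
    conventions of F, namely b a = c modulo I, and c H(b) = b^(D+1) F(a) modulo I.\<close>
  define H where "H = monom 1 (Suc D) + (\<Sum>i\<le>D. monom (coeff F' i * c ^ i) (D - i))"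
  have "degree (\<Sum>i\<le>D. monom (coeff F' i * c ^ i) (D - i)) < Suc D"
    by (intro le_imp_less_Suc degree_sum_le) (auto intro: order_trans[OF degree_monom_le])
  then have dH: "degree H = Suc D" "lead_coeff H = 1"
    unfolding H_def by (simp_all add: degree_add_eq_left degree_monom_eq coeff_eq_0)
  have pw: "(b * a) ^ i - ev w c ^ i \<in> I" for i
    by (rule power_diff_mem_ideal[OF Ii ba])
  define X where "X = (\<Sum>i\<le>D. ev w (coeff F' i) * b ^ (D - i) * ev w c ^ Suc i)"
  define Y where "Y = (\<Sum>i\<le>D. ev w (coeff F' i) * b ^ (D - i) * (b * a) ^ Suc i)"
  define Z where "Z = (\<Sum>i\<le>D. ev w (coeff F' i) * b ^ (D - i) * ((b * a) ^ Suc i - ev w c ^ Suc i))"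
  have X: "ev w c * ev2 w b H = ev w c * b ^ Suc D + X"
    by (simp add: H_def X_def ev2.hom_add ev2.hom_sum ev.hom_mult ev.hom_power ev.hom_one distrib_left sum_distrib_left mult_ac)
  have XYZ: "X = Y - Z" by (simp add: X_def Y_def Z_def sum_subtractf right_diff_distrib del: power_Suc)
  have "ev w (coeff F' i) * b ^ (D - i) * (b * a) ^ Suc i = b ^ Suc D * (a * (ev w (coeff F' i) * a ^ i))" if "i \<le> D" for i
  proof -
    have "b ^ D = b ^ (D - i) * b ^ i" using that by (simp flip: power_add)
    then show ?thesis by (simp add: power_mult_distrib mult_ac)
  qed
  then have Y: "Y = b ^ Suc D * (a * ev2 w a F')"
    by (simp add: Y_def ev2_altdef[of F' D] D_def sum_distrib_left)
  have Z: "Z \<in> I" unfolding Z_def using ideal_set_lmult[OF Ii UNIV_I pw] by (intro ideal_set_sum[OF Ii])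
  have "ev w c * ev2 w b H = b ^ Suc D * ev2 w a F - Z"
    unfolding X XYZ Y by (simp add: pCons ev2_pCons algebra_simps)
  then have "ev w c * ev2 w b H \<in> I"
    using ideal_set_diff[OF _ Ii ideal_set_lmult[OF Ii UNIV_I F(1)] Z] by simp
  moreover have "ev w c \<notin> I" using F(2) cS x(2) c by auto
  ultimately have "ev2 w b H \<in> I" using prime_setD[OF I] by blast
  then have "b \<in> integral_mod w I" using dH unfolding integral_mod_def by blast
  then show thesis using bS bx ba c by (intro that) auto
qed

section \<open>Bivariate relations\<close>

text \<open>Exchange of the two variables: the coefficients are moved into the outer variable and
  the inner one is substituted for the old outer variable. Written as an evaluation, it is a ring
  homomorphism by construction.\<close>

definition swap_vars :: "int poly poly \<Rightarrow> int poly poly" where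
  "swap_vars H = poly (map_poly (map_poly (\<lambda>c. [:c:])) H) [:[:0, 1:]:]"

lemma comm_ring_hom_const_poly: "comm_ring_hom (\<lambda>c::'a::comm_ring_1. [:c:])"
  by unfold_locales (auto simp: one_pCons)

lemma comm_ring_hom_map_poly:
  assumes "comm_ring_hom f" shows "comm_ring_hom (map_poly f)"
proof -
  interpret map_poly_comm_ring_hom f by (rule map_poly_comm_ring_hom.intro[OF assms])
  show ?thesis by (rule comm_ring_hom_axioms)
qed

interpretation swap_vars: comm_ring_hom swap_vars
  unfolding swap_vars_def[abs_def]
  by (intro comm_ring_hom_poly_map_poly comm_ring_hom_map_poly comm_ring_hom_const_poly)

lemma swap_vars_pCons:
  "swap_vars (pCons q H) = map_poly (\<lambda>c. [:c:]) q + Polynomial.smult [:0, 1:] (swap_vars H)"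
  by (cases "q = 0 \<and> H = 0") (auto simp: swap_vars_def map_poly_pCons)

lemma coeff_swap_vars: "coeff (coeff (swap_vars H) i) j = coeff (coeff H j) i"
proof (induction H arbitrary: j)
  case 0 then show ?case by (simp add: swap_vars.hom_zero)
next
  case (pCons q H)
  then show ?case
    by (cases j) (simp_all add: swap_vars_pCons coeff_map_poly)
qed

lemma swap_vars_swap_vars [simp]: "swap_vars (swap_vars H) = H"
  by (intro poly_eqI) (simp add: coeff_swap_vars)

lemma ev2_map_const: "ev2 t w (map_poly (\<lambda>c. [:c:]) q) = ev w q"
  by (induction q) (simp_all add: map_poly_pCons ev2_pCons ev_pCons)

lemma ev2_swap_vars: "ev2 t w (swap_vars H) = ev2 w t H"
proof (induction H)
  case 0 then show ?case by (simp add: swap_vars.hom_zero)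
next
  case (pCons q H)
  have "Polynomial.smult [:0, 1:] (swap_vars H) = [:[:0, 1:]:] * swap_vars H" by simp
  then have "ev2 t w (Polynomial.smult [:0, 1:] (swap_vars H)) = t * ev2 t w (swap_vars H)"
    by (simp only: ev2.hom_mult ev2_const ev_X)
  then show ?case using pCons by (simp add: swap_vars_pCons ev2_pCons ev2.hom_add ev2_map_const)
qed

text \<open>The generator G of the relations between t and w divides the nonzero relation E, which
  involves w alone; so G involves w alone. It divides P, hence each coefficient of a power of t in P
  vanishes at w modulo I.\<close>

lemma algebraic_relation_trivial:
  assumes I: "prime_set UNIV I" and t: "transcendental_mod I t" and w: "\<not> transcendental_mod I w"
    and P: "ev2 w t P \<in> I"
  shows "ev w (coeff P j) \<in> I"
proof -
  obtain E where E: "E \<noteq> 0" "ev w E \<in> I" using w by (auto simp: transcendental_mod_def)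
  define E' where "E' = swap_vars [:E:]"
  have E'0: "E' \<noteq> 0"
  proof
    assume "E' = 0"
    then have "swap_vars E' = 0" by (simp add: swap_vars.hom_zero)
    then show False using E by (simp add: E'_def)
  qed
  have E'I: "ev2 t w E' \<in> I" using E by (simp add: E'_def ev2_swap_vars)
  obtain G where G: "G \<noteq> 0" "\<And>F. ev2 t w F \<in> I \<longleftrightarrow> G dvd F"
    by (rule relations_principal[OF I t E'0 E'I]) (rule that)
  have "G dvd E'" using G(2) E'I by blast
  then obtain K where K: "E' = G * K" by (rule dvdE)
  have GK: "swap_vars G * swap_vars K = [:E:]"
    using arg_cong[OF K, of swap_vars] by (simp add: E'_def swap_vars.hom_mult)
  then have "swap_vars G \<noteq> 0" "swap_vars K \<noteq> 0" using E by auto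
  then have "degree (swap_vars G) = 0"
    using arg_cong[OF GK, of degree] by (simp add: degree_mult_eq)
  then obtain g where g: "swap_vars G = [:g:]" by (rule degree_eq_zeroE)
  have "ev2 w t (swap_vars G) \<in> I" using G(2)[of G] by (simp add: ev2_swap_vars)
  then have gI: "ev w g \<in> I" by (simp add: g)
  have "G dvd swap_vars P" using G(2)[of "swap_vars P"] P by (simp add: ev2_swap_vars)
  then obtain L where L: "swap_vars P = G * L" by (rule dvdE)
  have "P = [:g:] * swap_vars L"
    using arg_cong[OF L, of swap_vars] by (simp add: swap_vars.hom_mult g)
  then have "coeff P j = g * coeff (swap_vars L) j" by simp
  then show ?thesis using ideal_set_rmult[OF prime_set_ideal[OF I] UNIV_I gI] by (simp add: ev.hom_mult)
qed

text \<open>The bound for the number of roots over the domain S/x, splitting off one root at a time.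
  It serves twice: for nonroots modulo p, and for T^N - 1, which has at most N roots modulo
  x.\<close>

lemma polys_prime_of_many_roots:
  fixes f :: "'a::comm_ring_1 poly"
  assumes S: "subring_set S" and x: "prime_set S x" and f: "f \<in> polys S"
    and A: "finite A" "A \<subseteq> S" "card A > degree f" "\<And>r. r \<in> A \<Longrightarrow> poly f r \<in> x"
    and inc: "\<And>r s. r \<in> A \<Longrightarrow> s \<in> A \<Longrightarrow> r \<noteq> s \<Longrightarrow> r - s \<notin> x"
  shows "f \<in> polys x"
  using f A inc
proof (induction "degree f" arbitrary: f A)
  case 0
  then obtain c where c: "f = [:c:]" by (metis degree_eq_zeroE)
  have "A \<noteq> {}" using 0 by auto
  then have "c \<in> x" using 0 c by auto
  then show ?case using prime_set_0[OF x] by (auto simp: c polys_def coeff_pCons split: nat.splits)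
next
  case (Suc n)
  note xi = prime_set_ideal[OF x]
  obtain r where r: "r \<in> A" using Suc.prems(4) by fastforce
  define g where "g = synthetic_div f r"
  have fg: "f = [:- r, 1:] * g + [:poly f r:]"
    unfolding g_def using synthetic_div_correct'[of r f] by simp
  have rS: "r \<in> S" and fr: "poly f r \<in> x" using r Suc.prems by auto
  have gS: "g \<in> polys S"
  proof -
    have "coeff g i \<in> S" for i
    proof (induction "degree f - i" arbitrary: i rule: less_induct)
      case less
      show ?case
      proof (cases "i \<ge> degree f")
        case True
        then have "coeff g i = 0" using Suc.hyps(2) by (intro coeff_eq_0) (auto simp: g_def degree_synthetic_div)
        then show ?thesis using subring_set_0[OF S] by simp
      next
        case False
        have "coeff f (Suc i) = coeff g i - r * coeff g (Suc i)"
          by (subst fg) simp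
        then have "coeff g i = coeff f (Suc i) + r * coeff g (Suc i)" by simp
        moreover have "coeff g (Suc i) \<in> S" using less[of "Suc i"] False by auto
        ultimately show ?thesis using rS polys_coeff[OF Suc.prems(1)]
          by (auto intro: subring_set_add[OF S] subring_set_mult[OF S])
      qed
    qed
    then show ?thesis by (simp add: polys_def)
  qed
  have gx: "g \<in> polys x"
  proof (rule Suc.hyps(1)[of g "A - {r}"])
    show "n = degree g" using Suc.hyps(2) by (simp add: g_def degree_synthetic_div)
    then show "degree g < card (A - {r})" using Suc.prems(2,4) Suc.hyps(2) r by simp
    fix s assume s: "s \<in> A - {r}"
    then have sS: "s \<in> S" using Suc.prems(3) by auto
    have "poly f s = (s - r) * poly g s + poly f r" by (subst fg) (simp add: algebra_simps)
    then have "(s - r) * poly g s = poly f s - poly f r" by simp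
    also have "\<dots> \<in> x" using s fr Suc.prems(5)[of s] by (intro ideal_set_diff[OF S xi]) auto
    finally have "(s - r) * poly g s \<in> x" .
    moreover have "s - r \<notin> x" using Suc.prems(6)[of s r] s r by auto
    ultimately show "poly g s \<in> x"
      using prime_setD[OF x subring_set_diff[OF S sS rS] poly_mem_subring[OF S gS sS]] by blast
  qed (use gS Suc.prems in auto)
  have "coeff f i \<in> x" for i
  proof -
    have "coeff f i = coeff ([:- r, 1:] * g) i + coeff [:poly f r:] i" by (subst fg) simp
    also have "\<dots> \<in> x"
      using gx fr prime_set_0[OF x] rS subring_set_uminus[OF S rS]
      by (cases i) (auto simp: polys_coeff intro!: ideal_set_add[OF xi] ideal_set_diff[OF S xi] ideal_set_uminus[OF S xi] ideal_set_lmult[OF xi])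
    finally show ?thesis .
  qed
  then show ?case by (simp add: polys_def)
qed

lemma prime_set_multiples:
  assumes "prime (p::nat)" shows "prime_set (UNIV :: int set) {n. int p dvd n}"
  using assms prime_dvd_mult_iff[of "int p"] not_prime_unit
  by (auto simp: prime_set_def ideal_set_def)

lemma exists_nonroot_mod_prime:
  fixes f :: "int poly"
  assumes p: "prime p" and "degree f < p" "\<not> int p dvd coeff f j"
  obtains c :: int where "\<not> int p dvd poly f c"
proof (rule ccontr)
  assume "\<not> thesis"
  then have all: "int p dvd poly f c" for c using that by blast
  have "f \<in> polys {n. int p dvd n}"
  proof (rule polys_prime_of_many_roots[OF subring_set_UNIV prime_set_multiples[OF p], of f "{0..<int p}"])
    fix r s assume rs: "r \<in> {0..<int p}" "s \<in> {0..<int p}" "r \<noteq> s"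
    show "r - s \<notin> {n. int p dvd n}"
    proof
      assume "r - s \<in> {n. int p dvd n}"
      then have "int p \<le> \<bar>r - s\<bar>" using rs(3) dvd_imp_le_int[of "r - s" "int p"] by simp
      then show False using rs by auto
    qed
  qed (use all assms(2) in \<open>auto simp: polys_def\<close>)
  then show False using assms(3) by (auto simp: polys_def)
qed

text \<open>Siegel's lemma with at least twice as many unknowns as equations: two points of a box
  have the same image, and their difference is the solution.\<close>

lemma siegel_pigeonhole:
  fixes A :: "'s \<Rightarrow> 'e \<Rightarrow> int"
  assumes S: "finite S" "S \<noteq> {}" and E: "finite E" "2 * card E \<le> card S" and M: "M \<ge> 1"
    and A: "\<And>s e. s \<in> S \<Longrightarrow> e \<in> E \<Longrightarrow> \<bar>A s e\<bar> \<le> M"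
  obtains c where "\<exists>s\<in>S. c s \<noteq> 0" "\<And>s. s \<in> S \<Longrightarrow> \<bar>c s\<bar> \<le> 2 * int (card S) * M"
    "\<And>e. e \<in> E \<Longrightarrow> (\<Sum>s\<in>S. c s * A s e) = 0"
proof -
  define k where "k = int (card S)"
  have k: "k \<ge> 1" using S by (simp add: k_def Suc_le_eq card_gt_0_iff)
  \<comment> \<open>With this H each equation takes at most H * H + 1 values on the box, fewer than
    (H + 1)^2. As there are two unknowns per equation, the box has more points than values.\<close>
  define H where "H = 2 * k * M"
  have H: "H \<ge> 1" using k M mult_mono[of 1 k 1 M] by (simp add: H_def)
  define Y where "Y = S \<rightarrow>\<^sub>E {0..H}"
  define Z where "Z = E \<rightarrow>\<^sub>E {- (k * M * H)..k * M * H}"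
  define f where "f y = (\<lambda>e\<in>E. \<Sum>s\<in>S. y s * A s e)" for y :: "'s \<Rightarrow> int"
  have fin: "finite Y" "finite Z" unfolding Y_def Z_def using S E by (auto intro: finite_PiE)
  have cY: "card Y = nat (H + 1) ^ card S" using S by (simp add: Y_def card_PiE)
  have "nat (k * M * H + 1 - - (k * M * H)) = nat (H * H + 1)" by (simp add: H_def algebra_simps)
  then have cZ: "card Z = nat (H * H + 1) ^ card E" using E by (simp add: Z_def card_PiE)
  have fYZ: "f y \<in> Z" if y: "y \<in> Y" for y
    unfolding Z_def
  proof (rule PiE_I)
    fix e assume e: "e \<in> E"
    have "\<bar>\<Sum>s\<in>S. y s * A s e\<bar> \<le> (\<Sum>s\<in>S. \<bar>y s * A s e\<bar>)" by (rule sum_abs)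
    also have "\<dots> \<le> (\<Sum>s\<in>S. H * M)"
    proof (rule sum_mono)
      fix s assume s: "s \<in> S"
      then have "\<bar>y s\<bar> \<le> H" using y by (auto simp: Y_def dest: PiE_mem)
      then show "\<bar>y s * A s e\<bar> \<le> H * M" using A[OF s e] by (simp add: abs_mult mult_mono)
    qed
    also have "\<dots> = k * M * H" by (simp add: k_def)
    finally show "f y e \<in> {- (k * M * H)..k * M * H}" using e by (auto simp: f_def abs_le_iff)
  qed (simp add: f_def)
  have "card Z < card Y"
  proof (cases "card E = 0")
    case True
    have "1 < nat (H + 1)" "card S > 0" using H S by (auto simp: card_gt_0_iff)
    then have "1 < nat (H + 1) ^ card S" by (rule one_less_power)
    then show ?thesis using True by (simp add: cY cZ)
  next
    case False
    have "H * H + 1 < (H + 1) * (H + 1)" "0 < (H + 1) * (H + 1)" using H by (simp_all add: algebra_simps add_pos_nonneg)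
    then have "nat (H * H + 1) < nat ((H + 1) * (H + 1))" by (simp only: zless_nat_conj)
    then have "nat (H * H + 1) < nat (H + 1) ^ 2" using H by (simp add: power2_eq_square nat_mult_distrib)
    then have "card Z < (nat (H + 1) ^ 2) ^ card E"
      unfolding cZ using False by (intro power_strict_mono) auto
    also have "\<dots> = nat (H + 1) ^ (2 * card E)" by (simp add: power_mult)
    also have "\<dots> \<le> nat (H + 1) ^ card S" using E H by (intro power_increasing) auto
    finally show ?thesis by (simp add: cY)
  qed
  then have "\<not> inj_on f Y" using card_inj_on_le[of f Y Z] fYZ fin by fastforce
  then obtain y y' where y: "y \<in> Y" "y' \<in> Y" "f y = f y'" "y \<noteq> y'" by (auto simp: inj_on_def)
  define c where "c s = y s - y' s" for s
  show thesis
  proof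
    show "\<exists>s\<in>S. c s \<noteq> 0"
    proof (rule ccontr)
      assume "\<not> ?thesis"
      then have "y = y'" using y(1,2) unfolding Y_def by (intro PiE_ext) (auto simp: c_def)
      then show False using y by simp
    qed
    fix s assume "s \<in> S"
    then have "y s \<in> {0..H}" "y' s \<in> {0..H}" using y(1,2) by (auto simp: Y_def dest: PiE_mem)
    then show "\<bar>c s\<bar> \<le> 2 * int (card S) * M" by (auto simp: c_def H_def k_def)
  next
    fix e assume "e \<in> E"
    then show "(\<Sum>s\<in>S. c s * A s e) = 0"
      using fun_cong[OF y(3), of e] by (simp add: f_def c_def left_diff_distrib sum_subtractf)
  qed
qed

section \<open>Small relations between monomials\<close>

text \<open>The sum of the absolute values of the coefficients is submultiplicative, so that bounds
  for words multiply without factors depending on the degree.\<close>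

definition poly_norm :: "int poly \<Rightarrow> int" where
  "poly_norm f = (\<Sum>i\<le>degree f. \<bar>coeff f i\<bar>)"

lemma poly_norm_altdef: "degree f \<le> n \<Longrightarrow> poly_norm f = (\<Sum>i\<le>n. \<bar>coeff f i\<bar>)"
  unfolding poly_norm_def by (intro sum.mono_neutral_left) (auto simp: coeff_eq_0)

lemma poly_norm_nonneg [simp]: "poly_norm f \<ge> 0"
  by (simp add: poly_norm_def sum_nonneg)

lemma poly_norm_0 [simp]: "poly_norm 0 = 0"
  by (simp add: poly_norm_def)

lemma poly_norm_1 [simp]: "poly_norm 1 = 1"
  by (simp add: poly_norm_def)

lemma coeff_le_poly_norm: "\<bar>coeff f i\<bar> \<le> poly_norm f"
proof (cases "i \<le> degree f")
  case True
  then show ?thesis unfolding poly_norm_def by (intro member_le_sum) auto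
qed (simp add: coeff_eq_0)

lemma poly_norm_add: "poly_norm (f + g) \<le> poly_norm f + poly_norm g"
proof -
  define n where "n = max (degree f) (degree g)"
  have "degree (f + g) \<le> n" unfolding n_def by (rule degree_add_le_max)
  then show ?thesis
    using poly_norm_altdef[of f n] poly_norm_altdef[of g n] poly_norm_altdef[of "f + g" n]
    by (simp add: n_def sum.distrib[symmetric] sum_mono abs_triangle_ineq)
qed

lemma poly_norm_uminus [simp]: "poly_norm (- f) = poly_norm f"
  by (simp add: poly_norm_def)

lemma poly_norm_diff: "poly_norm (f - g) \<le> poly_norm f + poly_norm g"
  using poly_norm_add[of f "- g"] by simp

lemma poly_norm_sum: "poly_norm (sum f A) \<le> (\<Sum>a\<in>A. poly_norm (f a))"
proof (induction A rule: infinite_finite_induct)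
  case (insert a A)
  then show ?case using poly_norm_add[of "f a" "sum f A"] by simp
qed auto

lemma poly_norm_mult: "poly_norm (f * g) \<le> poly_norm f * poly_norm g"
proof (induction f)
  case (pCons c f)
  have pn: "poly_norm (pCons d h) = \<bar>d\<bar> + poly_norm h" for d h
  proof -
    have "poly_norm (pCons d h) = (\<Sum>i\<le>Suc (degree h). \<bar>coeff (pCons d h) i\<bar>)"
      by (rule poly_norm_altdef) (rule degree_pCons_le)
    also have "\<dots> = \<bar>coeff (pCons d h) 0\<bar> + (\<Sum>i\<le>degree h. \<bar>coeff (pCons d h) (Suc i)\<bar>)"
      by (rule sum.atMost_Suc_shift)
    finally show ?thesis by (simp only: coeff_pCons_0 coeff_pCons_Suc poly_norm_def)
  qed
  have sm: "poly_norm (Polynomial.smult c g) = \<bar>c\<bar> * poly_norm g"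
    using poly_norm_altdef[of "Polynomial.smult c g" "degree g"]
    by (simp add: poly_norm_def abs_mult sum_distrib_left)
  have "poly_norm (pCons c f * g) \<le> poly_norm (Polynomial.smult c g) + poly_norm (pCons 0 (f * g))"
    using poly_norm_add[of "Polynomial.smult c g" "pCons 0 (f * g)"] by simp
  also have "\<dots> \<le> (\<bar>c\<bar> + poly_norm f) * poly_norm g"
    using pCons by (simp add: pn sm distrib_right)
  finally show ?case by (simp add: pn)
qed auto

inductive word :: "'a::comm_ring_1 set \<Rightarrow> nat \<Rightarrow> 'a \<Rightarrow> bool" for G where
  word_0: "word G 0 1"
| word_Suc: "g \<in> G \<Longrightarrow> word G n u \<Longrightarrow> word G (Suc n) (g * u)"

lemma word_gen: "g \<in> G \<Longrightarrow> word G 1 g"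
  using word_Suc[OF _ word_0, of g G] by simp

text \<open>Bounded coordinates: \<open>coords n f M\<close> says that \<open>h ^ n * f\<close> has coordinates on \<open>W\<close> of degree at most
  \<open>B * n\<close> and total size at most \<open>M\<close>.\<close>

locale coordinates =
  fixes t :: "'a::comm_ring_1" and I W G :: "'a set" and h :: "int poly"
    and c :: "'a \<Rightarrow> 'a \<Rightarrow> 'a \<Rightarrow> int poly" and B :: nat and K :: int
  assumes I: "prime_set UNIV I" and W: "finite W" "1 \<in> W" and h: "ev t h \<notin> I"
    and c: "\<And>g v. g \<in> G \<Longrightarrow> v \<in> W \<Longrightarrow> ev t h * (g * v) - (\<Sum>u\<in>W. ev t (c g v u) * u) \<in> I"
    and deg: "degree h \<le> B" "\<And>g v u. g \<in> G \<Longrightarrow> v \<in> W \<Longrightarrow> u \<in> W \<Longrightarrow> degree (c g v u) \<le> B"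
    and K: "K \<ge> 1" "poly_norm h \<le> K" "\<And>g v. g \<in> G \<Longrightarrow> v \<in> W \<Longrightarrow> (\<Sum>u\<in>W. poly_norm (c g v u)) \<le> K"
begin

lemma Ii: "ideal_set UNIV I"
  using prime_set_ideal[OF I] .

definition coords :: "nat \<Rightarrow> 'a \<Rightarrow> int \<Rightarrow> bool" where
  "coords n f M \<longleftrightarrow> (\<exists>d. ev t h ^ n * f - (\<Sum>v\<in>W. ev t (d v) * v) \<in> I \<and>
     (\<forall>v\<in>W. degree (d v) \<le> B * n) \<and> (\<Sum>v\<in>W. poly_norm (d v)) \<le> M)"

lemma coords_1: "coords 0 1 1"
proof -
  have "(\<Sum>v\<in>W. ev t (if v = 1 then 1 else 0) * v) = (\<Sum>v\<in>W. if v = 1 then v else 0)"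
    by (intro sum.cong) (auto simp: ev.hom_one ev.hom_zero)
  moreover have "(\<Sum>v\<in>W. poly_norm (if v = 1 then 1 else 0)) = (\<Sum>v\<in>W. if v = 1 then 1 else 0)"
    by (intro sum.cong) auto
  ultimately show ?thesis
    unfolding coords_def using W ideal_set_0[OF Ii]
    by (intro exI[of _ "\<lambda>v. if v = 1 then 1 else 0"]) auto
qed

lemma coords_mono: "coords n f M \<Longrightarrow> M \<le> M' \<Longrightarrow> coords n f M'"
  unfolding coords_def by (meson order_trans)

lemma coords_nonneg: "coords n f M \<Longrightarrow> M \<ge> 0"
  unfolding coords_def by (meson order_trans poly_norm_nonneg sum_nonneg)

lemma coords_gen:
  assumes g: "g \<in> G" and f: "coords n f M"
  shows "coords (Suc n) (g * f) (K * M)"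
proof -
  obtain d where d: "ev t h ^ n * f - (\<Sum>v\<in>W. ev t (d v) * v) \<in> I"
    "\<And>v. v \<in> W \<Longrightarrow> degree (d v) \<le> B * n" "(\<Sum>v\<in>W. poly_norm (d v)) \<le> M"
    using f by (auto simp: coords_def)
  define e where "e u = (\<Sum>v\<in>W. d v * c g v u)" for u
  have 1: "(ev t h * g) * (ev t h ^ n * f - (\<Sum>v\<in>W. ev t (d v) * v)) \<in> I"
    by (rule ideal_set_lmult[OF Ii UNIV_I d(1)])
  have 2: "(\<Sum>v\<in>W. ev t (d v) * (ev t h * (g * v) - (\<Sum>u\<in>W. ev t (c g v u) * u))) \<in> I"
    by (intro ideal_set_sum[OF Ii] ideal_set_lmult[OF Ii] c g UNIV_I)
  have "(\<Sum>u\<in>W. ev t (e u) * u) = (\<Sum>u\<in>W. \<Sum>v\<in>W. ev t (d v) * (ev t (c g v u) * u))"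
    by (simp add: e_def ev.hom_sum ev.hom_mult sum_distrib_right mult.assoc)
  also have "\<dots> = (\<Sum>v\<in>W. \<Sum>u\<in>W. ev t (d v) * (ev t (c g v u) * u))" by (rule sum.swap)
  finally have e: "(\<Sum>u\<in>W. ev t (e u) * u) = (\<Sum>v\<in>W. ev t (d v) * (\<Sum>u\<in>W. ev t (c g v u) * u))"
    by (simp add: sum_distrib_left)
  define S where "S v = (\<Sum>u\<in>W. ev t (c g v u) * u)" for v
  have "(\<Sum>v\<in>W. ev t (d v) * (ev t h * (g * v) - S v))
      = ev t h * g * (\<Sum>v\<in>W. ev t (d v) * v) - (\<Sum>v\<in>W. ev t (d v) * S v)"
    by (simp add: right_diff_distrib sum_subtractf sum_distrib_left mult_ac)
  with 2 e have "ev t h * g * (\<Sum>v\<in>W. ev t (d v) * v) - (\<Sum>u\<in>W. ev t (e u) * u) \<in> I"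
    by (simp only: S_def)
  from ideal_set_add[OF Ii 1 this]
  have "ev t h ^ Suc n * (g * f) - (\<Sum>u\<in>W. ev t (e u) * u) \<in> I"
    by (simp add: right_diff_distrib mult_ac)
  moreover have "degree (e u) \<le> B * Suc n" if u: "u \<in> W" for u
    unfolding e_def
  proof (intro degree_sum_le W)
    fix v assume v: "v \<in> W"
    have "degree (d v * c g v u) \<le> degree (d v) + degree (c g v u)" by (rule degree_mult_le)
    also have "\<dots> \<le> B * n + B" using d(2)[OF v] deg(2)[OF g v u] by simp
    finally show "degree (d v * c g v u) \<le> B * Suc n" by simp
  qed
  moreover have "(\<Sum>u\<in>W. poly_norm (e u)) \<le> K * M"
  proof -
    have "(\<Sum>u\<in>W. poly_norm (e u)) \<le> (\<Sum>u\<in>W. \<Sum>v\<in>W. poly_norm (d v) * poly_norm (c g v u))"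
      unfolding e_def by (intro sum_mono order_trans[OF poly_norm_sum] poly_norm_mult)
    also have "\<dots> = (\<Sum>v\<in>W. poly_norm (d v) * (\<Sum>u\<in>W. poly_norm (c g v u)))"
      by (subst sum.swap) (simp add: sum_distrib_left)
    also have "\<dots> \<le> (\<Sum>v\<in>W. poly_norm (d v) * K)"
      using K(3)[OF g] by (intro sum_mono mult_left_mono) auto
    also have "\<dots> = K * (\<Sum>v\<in>W. poly_norm (d v))" by (simp add: sum_distrib_left mult.commute)
    also have "\<dots> \<le> K * M" using d(3) K(1) by (intro mult_left_mono) auto
    finally show ?thesis .
  qed
  ultimately show ?thesis unfolding coords_def by blast
qed

lemma coords_pad1:
  assumes "coords n f M" shows "coords (Suc n) f (K * M)"
proof -
  obtain d where d: "ev t h ^ n * f - (\<Sum>v\<in>W. ev t (d v) * v) \<in> I"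
    "\<And>v. v \<in> W \<Longrightarrow> degree (d v) \<le> B * n" "(\<Sum>v\<in>W. poly_norm (d v)) \<le> M"
    using assms by (auto simp: coords_def)
  have "ev t h * (ev t h ^ n * f - (\<Sum>v\<in>W. ev t (d v) * v)) \<in> I"
    by (rule ideal_set_lmult[OF Ii UNIV_I d(1)])
  then have "ev t h ^ Suc n * f - (\<Sum>v\<in>W. ev t (h * d v) * v) \<in> I"
    by (simp add: right_diff_distrib sum_distrib_left ev.hom_mult mult.assoc)
  moreover have "degree (h * d v) \<le> B * Suc n" if v: "v \<in> W" for v
    using degree_mult_le[of h "d v"] deg(1) d(2)[OF v] by simp
  moreover have "(\<Sum>v\<in>W. poly_norm (h * d v)) \<le> K * M"
  proof -
    have "(\<Sum>v\<in>W. poly_norm (h * d v)) \<le> (\<Sum>v\<in>W. K * poly_norm (d v))"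
      using K(2) by (intro sum_mono order_trans[OF poly_norm_mult] mult_right_mono) auto
    also have "\<dots> \<le> K * M" using d(3) K(1) by (simp add: sum_distrib_left[symmetric] mult_left_mono)
    finally show ?thesis .
  qed
  ultimately show ?thesis unfolding coords_def by (intro exI[of _ "\<lambda>v. h * d v"]) blast
qed

lemma coords_pad: "coords n f M \<Longrightarrow> coords (n + k) f (K ^ k * M)"
proof (induction k)
  case (Suc k)
  show ?case using coords_pad1[OF Suc.IH[OF Suc.prems]] by (simp add: mult.assoc)
qed simp

lemma coords_word: "word G a u \<Longrightarrow> coords n f M \<Longrightarrow> coords (n + a) (u * f) (K ^ a * M)"
proof (induction rule: word.induct)
  case (word_Suc g k u)
  show ?case using coords_gen[OF word_Suc.hyps(1) word_Suc.IH[OF word_Suc.prems]]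
    by (simp add: mult.assoc)
qed simp

lemma coords_diff:
  assumes "coords n f M" "coords n f' M'" shows "coords n (f - f') (M + M')"
proof -
  obtain d where d: "ev t h ^ n * f - (\<Sum>v\<in>W. ev t (d v) * v) \<in> I"
    "\<And>v. v \<in> W \<Longrightarrow> degree (d v) \<le> B * n" "(\<Sum>v\<in>W. poly_norm (d v)) \<le> M"
    using assms(1) by (auto simp: coords_def)
  obtain e where e: "ev t h ^ n * f' - (\<Sum>v\<in>W. ev t (e v) * v) \<in> I"
    "\<And>v. v \<in> W \<Longrightarrow> degree (e v) \<le> B * n" "(\<Sum>v\<in>W. poly_norm (e v)) \<le> M'"
    using assms(2) by (auto simp: coords_def)
  have "ev t h ^ n * (f - f') - (\<Sum>v\<in>W. ev t (d v - e v) * v) \<in> I"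
    using ideal_set_diff[OF _ Ii d(1) e(1)]
    by (simp add: ev.hom_minus left_diff_distrib right_diff_distrib sum_subtractf algebra_simps)
  moreover have "degree (d v - e v) \<le> B * n" if "v \<in> W" for v
    using that d(2) e(2) by (intro degree_diff_le)
  moreover have "(\<Sum>v\<in>W. poly_norm (d v - e v)) \<le> (\<Sum>v\<in>W. poly_norm (d v) + poly_norm (e v))"
    by (intro sum_mono poly_norm_diff)
  then have "(\<Sum>v\<in>W. poly_norm (d v - e v)) \<le> M + M'"
    using d(3) e(3) by (simp add: sum.distrib)
  ultimately show ?thesis unfolding coords_def by (intro exI[of _ "\<lambda>v. d v - e v"]) blast
qed

text \<open>The difference costs a factor 2, which is absorbed into 2^a because a is positive; the
  bound stays a pure power of 2 K, with the length as exponent.\<close>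

lemma coords_word_minus_1:
  assumes u: "word G a u" and a: "a \<ge> 1" and f: "coords n f M"
  shows "coords (n + a) ((u - 1) * f) ((2 * K) ^ a * M)"
proof -
  have cd: "coords (n + a) (u * f - f) (K ^ a * M + K ^ a * M)"
    by (rule coords_diff[OF coords_word[OF u f] coords_pad[OF f]])
  have "(2::int) ^ 1 \<le> 2 ^ a" using a by (intro power_increasing) auto
  then have "2 * (K ^ a * M) \<le> 2 ^ a * (K ^ a * M)"
    using K(1) coords_nonneg[OF f] by (intro mult_right_mono) auto
  moreover have "(2 * K) ^ a * M = 2 ^ a * (K ^ a * M)" by (simp add: power_mult_distrib)
  ultimately have "K ^ a * M + K ^ a * M \<le> (2 * K) ^ a * M" by linarith
  then have "coords (n + a) (u * f - f) ((2 * K) ^ a * M)" using cd by (rule coords_mono[rotated])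
  then show ?thesis by (simp add: left_diff_distrib)
qed

lemma coords_word_minus_1_power:
  assumes u: "word G a u" and a: "a \<ge> 1" and f: "coords n f M"
  shows "coords (n + a * i) ((u - 1) ^ i * f) ((2 * K) ^ (a * i) * M)"
proof (induction i)
  case (Suc i)
  show ?case using coords_word_minus_1[OF u a Suc.IH] by (simp add: power_add mult_ac add_ac)
qed (simp add: f)

text \<open>The p * q products of powers are the unknowns; the equations say that each coefficient
  of each coordinate on W vanishes, after all products have been brought to the common denominator
  h^n. Powers of u - 1 and v - 1 are used in place of powers of u and v because the size of the
  coefficients matters for a relation in these differences.\<close>

lemma siegel_relation:
  assumes u: "word G a u" "a \<ge> 1" and v: "word G b v" "b \<ge> 1"
    and pq: "p \<ge> 1" "q \<ge> 1" "p * q \<ge> 2 * (card W * (B * (a * p + b * q) + 1))"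
  obtains d :: "nat \<Rightarrow> nat \<Rightarrow> int" where "\<exists>i<p. \<exists>j<q. d i j \<noteq> 0"
    "\<And>i j. i < p \<Longrightarrow> j < q \<Longrightarrow> \<bar>d i j\<bar> \<le> 2 * int (p * q) * (2 * K) ^ (a * p + b * q)"
    "(\<Sum>i<p. \<Sum>j<q. of_int (d i j) * ((u - 1) ^ i * (v - 1) ^ j)) \<in> I"
proof -
  define n where "n = a * p + b * q"
  define M where "M = (2 * K) ^ n"
  have K2: "2 * K \<ge> 1" using K(1) by simp
  have M: "M \<ge> 1" unfolding M_def using one_le_power[OF K2] .
  have "coords n ((u - 1) ^ i * (v - 1) ^ j) M" if ij: "i < p" "j < q" for i j
  proof -
    define L where "L = 2 * K"
    have "coords (a * i + b * j) ((v - 1) ^ j * ((u - 1) ^ i * 1)) (L ^ (b * j) * (L ^ (a * i) * 1))"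
      using coords_word_minus_1_power[OF v coords_word_minus_1_power[OF u coords_1]] unfolding L_def by simp
    then have 1: "coords (a * i + b * j) ((u - 1) ^ i * (v - 1) ^ j) (L ^ (a * i + b * j))"
      by (simp add: power_add mult.commute)
    have le: "a * i \<le> a * p" "b * j \<le> b * q" using ij by auto
    define k where "k = n - (a * i + b * j)"
    have nk: "n = (a * i + b * j) + k" unfolding k_def n_def using le by linarith
    have "coords n ((u - 1) ^ i * (v - 1) ^ j) (K ^ k * L ^ (a * i + b * j))"
      using coords_pad[OF 1, of k] by (simp only: nk[symmetric])
    moreover have "K ^ k * L ^ (a * i + b * j) \<le> L ^ k * L ^ (a * i + b * j)"
      using K(1) by (intro mult_right_mono power_mono) (auto simp: L_def)
    moreover have "L ^ k * L ^ (a * i + b * j) = M"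
      unfolding M_def L_def[symmetric] by (subst nk) (simp only: power_add[of L] mult.commute)
    ultimately show ?thesis using coords_mono by metis
  qed
  then have cij: "coords n ((u - 1) ^ i * (v - 1) ^ j) M" if "i < p" "j < q" for i j using that .
  define Q where "Q i j d \<longleftrightarrow> ev t h ^ n * ((u - 1) ^ i * (v - 1) ^ j) - (\<Sum>v\<in>W. ev t (d v) * v) \<in> I \<and>
     (\<forall>v\<in>W. degree (d v) \<le> B * n) \<and> (\<Sum>v\<in>W. poly_norm (d v)) \<le> M" for i j d
  define D where "D i j = (SOME d. Q i j d)" for i j
  have D: "ev t h ^ n * ((u - 1) ^ i * (v - 1) ^ j) - (\<Sum>v\<in>W. ev t (D i j v) * v) \<in> I \<and>
     (\<forall>v\<in>W. degree (D i j v) \<le> B * n) \<and> (\<Sum>v\<in>W. poly_norm (D i j v)) \<le> M"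
    if ij: "i < p" "j < q" for i j
  proof -
    have "\<exists>d. Q i j d" using cij[OF ij] unfolding coords_def Q_def .
    then have "Q i j (D i j)" unfolding D_def by (rule someI_ex)
    then show ?thesis unfolding Q_def .
  qed
  define S where "S = {..<p} \<times> {..<q}"
  define E where "E = W \<times> {..B * n}"
  define A where "A = (\<lambda>(i, j) (w, k). coeff (D i j w) k)"
  have "(0, 0) \<in> S" using pq by (auto simp: S_def)
  then have S: "finite S" "S \<noteq> {}" "card S = p * q" by (auto simp: S_def)
  have E: "finite E" "2 * card E \<le> card S" using pq W S by (auto simp: E_def n_def)
  have A: "\<bar>A s e\<bar> \<le> M" if sE: "s \<in> S" "e \<in> E" for s e
  proof -
    from sE obtain i j w k where se: "s = (i, j)" "e = (w, k)" "i < p" "j < q" "w \<in> W" by (auto simp: S_def E_def)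
    have "\<bar>A s e\<bar> \<le> poly_norm (D i j w)" by (simp add: A_def se coeff_le_poly_norm)
    also have "\<dots> \<le> (\<Sum>w\<in>W. poly_norm (D i j w))" using se W by (intro member_le_sum) auto
    finally show ?thesis using D[OF se(3,4)] by linarith
  qed
  obtain d where d: "\<exists>s\<in>S. d s \<noteq> 0" "\<And>s. s \<in> S \<Longrightarrow> \<bar>d s\<bar> \<le> 2 * int (card S) * M"
    "\<And>e. e \<in> E \<Longrightarrow> (\<Sum>s\<in>S. d s * A s e) = 0"
    by (rule siegel_pigeonhole[OF S(1,2) E M, of A]) (rule A, assumption+, rule that)
  define X where "X i j = ev t h ^ n * ((u - 1) ^ i * (v - 1) ^ j)" for i j
  have zero: "(\<Sum>i<p. \<Sum>j<q. [:d (i, j):] * D i j w) = 0" if w: "w \<in> W" for w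
  proof (rule poly_eqI)
    fix k
    have "coeff (\<Sum>i<p. \<Sum>j<q. [:d (i, j):] * D i j w) k = (\<Sum>s\<in>S. d s * A s (w, k))"
      by (simp add: coeff_sum S_def A_def sum.cartesian_product split_beta)
    also have "\<dots> = 0"
    proof (cases "k \<le> B * n")
      case True then show ?thesis using d(3)[of "(w, k)"] w by (simp add: E_def)
    next
      case False
      have "A s (w, k) = 0" if s: "s \<in> S" for s
      proof -
        obtain i j where ij: "s = (i, j)" "i < p" "j < q" using s by (auto simp: S_def)
        have "degree (D i j w) < k" using D[OF ij(2,3)] w False by force
        then show ?thesis by (simp add: A_def ij coeff_eq_0)
      qed
      then show ?thesis by simp
    qed
    finally show "coeff (\<Sum>i<p. \<Sum>j<q. [:d (i, j):] * D i j w) k = coeff 0 k" by simp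
  qed
  have "(\<Sum>i<p. \<Sum>j<q. of_int (d (i, j)) * (X i j - (\<Sum>w\<in>W. ev t (D i j w) * w))) \<in> I"
    using D by (intro ideal_set_sum[OF Ii] ideal_set_lmult[OF Ii UNIV_I]) (auto simp: X_def)
  moreover have "(\<Sum>i<p. \<Sum>j<q. of_int (d (i, j)) * (\<Sum>w\<in>W. ev t (D i j w) * w)) = 0"
  proof -
    have "(\<Sum>i<p. \<Sum>j<q. of_int (d (i, j)) * (\<Sum>w\<in>W. ev t (D i j w) * w))
      = (\<Sum>i<p. \<Sum>j<q. \<Sum>w\<in>W. ev t ([:d (i, j):] * D i j w) * w)"
      by (simp only: sum_distrib_left ev.hom_mult ev_const mult.assoc)
    also have "\<dots> = (\<Sum>w\<in>W. \<Sum>i<p. \<Sum>j<q. ev t ([:d (i, j):] * D i j w) * w)"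
      by (simp only: sum.swap[of _ W])
    also have "\<dots> = (\<Sum>w\<in>W. ev t (\<Sum>i<p. \<Sum>j<q. [:d (i, j):] * D i j w) * w)"
      by (simp only: ev.hom_sum sum_distrib_right)
    also have "\<dots> = 0" by (intro sum.neutral ballI) (simp only: zero ev.hom_zero mult_zero_left)
    finally show ?thesis .
  qed
  ultimately have "(\<Sum>i<p. \<Sum>j<q. of_int (d (i, j)) * X i j) \<in> I"
    by (simp add: right_diff_distrib sum_subtractf)
  also have "(\<Sum>i<p. \<Sum>j<q. of_int (d (i, j)) * X i j)
    = ev t h ^ n * (\<Sum>i<p. \<Sum>j<q. of_int (d (i, j)) * ((u - 1) ^ i * (v - 1) ^ j))"
    by (simp add: X_def sum_distrib_left mult_ac)
  finally have "(\<Sum>i<p. \<Sum>j<q. of_int (d (i, j)) * ((u - 1) ^ i * (v - 1) ^ j)) \<in> I"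
    using prime_setD[OF I UNIV_I UNIV_I] prime_set_not_power[OF subring_set_UNIV I UNIV_I h] by blast
  moreover have "\<exists>i<p. \<exists>j<q. d (i, j) \<noteq> 0" using d(1) by (auto simp: S_def)
  moreover have "\<bar>d (i, j)\<bar> \<le> 2 * int (p * q) * (2 * K) ^ (a * p + b * q)" if "i < p" "j < q" for i j
    using d(2)[of "(i, j)"] that S(3) by (simp add: S_def M_def n_def)
  ultimately show thesis by (intro that[of "\<lambda>i j. d (i, j)"])
qed

end

section \<open>Relations whose size is exponential in the word lengths\<close>

lemma stable_module_coordinates:
  assumes I: "prime_set UNIV I" and G: "finite G" and st: "stable_module t I W h G"
  obtains c B K where "coordinates t I W G h c B K"
proof -
  have W: "finite W" "1 \<in> W" "ev t h \<notin> I" "\<And>g v. g \<in> G \<Longrightarrow> v \<in> W \<Longrightarrow> ev t h * (g * v) \<in> span_mod t I W"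
    using st unfolding stable_module_def by auto
  have "\<forall>g v. \<exists>c. g \<in> G \<longrightarrow> v \<in> W \<longrightarrow> ev t h * (g * v) - (\<Sum>u\<in>W. ev t (c u) * u) \<in> I"
    using W(4) unfolding span_mod_def by blast
  then obtain c where c: "\<And>g v. g \<in> G \<Longrightarrow> v \<in> W \<Longrightarrow> ev t h * (g * v) - (\<Sum>u\<in>W. ev t (c g v u) * u) \<in> I"
    by metis
  define B where "B = degree h + (\<Sum>g\<in>G. \<Sum>v\<in>W. \<Sum>u\<in>W. degree (c g v u))"
  define K where "K = 1 + poly_norm h + (\<Sum>g\<in>G. \<Sum>v\<in>W. \<Sum>u\<in>W. poly_norm (c g v u))"
  have "coordinates t I W G h c B K"
  proof
    fix g v assume gv: "g \<in> G" "v \<in> W"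
    have "(\<Sum>u\<in>W. poly_norm (c g v u)) \<le> (\<Sum>v\<in>W. \<Sum>u\<in>W. poly_norm (c g v u))"
      using gv(2) W(1) by (intro member_le_sum) (auto simp: sum_nonneg)
    also have "\<dots> \<le> (\<Sum>g\<in>G. \<Sum>v\<in>W. \<Sum>u\<in>W. poly_norm (c g v u))"
      using gv(1) G by (intro member_le_sum) (auto simp: sum_nonneg)
    finally show "(\<Sum>u\<in>W. poly_norm (c g v u)) \<le> K"
      unfolding K_def using poly_norm_nonneg[of h] by linarith
    fix u assume u: "u \<in> W"
    have "degree (c g v u) \<le> (\<Sum>u\<in>W. degree (c g v u))" using u W(1) by (intro member_le_sum) auto
    also have "\<dots> \<le> (\<Sum>v\<in>W. \<Sum>u\<in>W. degree (c g v u))" using gv(2) W(1) by (intro member_le_sum) auto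
    also have "\<dots> \<le> (\<Sum>g\<in>G. \<Sum>v\<in>W. \<Sum>u\<in>W. degree (c g v u))" using gv(1) G by (intro member_le_sum) auto
    finally show "degree (c g v u) \<le> B" by (simp add: B_def)
  next
    show "K \<ge> 1" "poly_norm h \<le> K" by (simp_all add: K_def sum_nonneg)
  qed (use I W(1,2,3) c in \<open>simp_all add: B_def\<close>)
  then show thesis by (rule that)
qed

text \<open>At t = 0 the coordinates only matter through their constant terms, so they may be taken
  of degree 0. This covers the case in which all generators are algebraic over Z.\<close>

lemma coordinates_const:
  assumes "coordinates 0 I W G h c B K"
  shows "coordinates 0 I W G [:poly h 0:] (\<lambda>g v u. [:poly (c g v u) 0:]) 0 K"
proof -
  interpret coordinates 0 I W G h c B K by (rule assms)
  have ev0: "ev (0::'a) [:poly f 0:] = ev 0 f" for f by (cases f) (simp add: ev_pCons)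
  have nrm: "poly_norm [:poly f 0:] \<le> poly_norm f" for f
    using coeff_le_poly_norm[of f 0] by (simp add: poly_norm_def poly_0_coeff_0)
  show ?thesis
  proof
    fix g v assume gv: "g \<in> G" "v \<in> W"
    show "ev 0 [:poly h 0:] * (g * v) - (\<Sum>u\<in>W. ev 0 [:poly (c g v u) 0:] * u) \<in> I"
      using c[OF gv] by (simp only: ev0)
    have "(\<Sum>u\<in>W. poly_norm [:poly (c g v u) 0:]) \<le> (\<Sum>u\<in>W. poly_norm (c g v u))"
      by (intro sum_mono nrm)
    then show "(\<Sum>u\<in>W. poly_norm [:poly (c g v u) 0:]) \<le> K" using K(3)[OF gv] by linarith
  next
    show "poly_norm [:poly h 0:] \<le> K" using K(2) nrm[of h] by linarith
    show "ev 0 [:poly h 0:] \<notin> I" using h by (simp only: ev0) simp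
  qed (use I W K(1) in auto)
qed

lemma ev_monom [simp]: "ev t (monom c n) = of_int c * t ^ n"
  by (simp add: ev_def map_poly_monom poly_monom)

lemma degree_map_const: "degree (map_poly (\<lambda>c. [:c:]) f) = degree (f :: 'a::comm_ring_1 poly)"
  by (rule degree_map_poly) simp

text \<open>The left side is the bound of \<open>siegel_relation\<close> for p q = c^2 n and a p + b
  q = 2 c n; everything is absorbed into one exponential in n.\<close>

lemma size_bound:
  fixes c K :: real
  assumes "c \<ge> 1" "K \<ge> 1" "n \<ge> 1"
  shows "2 * c ^ 2 * n * K powr (2 * c * n) \<le> exp ((2 * c ^ 2 + 1 + 2 * c * ln K) * n)"
proof -
  have "2 * c ^ 2 \<le> exp (2 * c ^ 2)" using exp_ge_add_one_self[of "2 * c ^ 2"] by linarith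
  also have "\<dots> \<le> exp (2 * c ^ 2 * n)" using assms(3) by (simp add: mult_le_cancel_left1)
  finally have 1: "2 * c ^ 2 \<le> exp (2 * c ^ 2 * n)" .
  have 2: "n \<le> exp n" using exp_ge_add_one_self[of n] by linarith
  have "2 * c ^ 2 * n * K powr (2 * c * n) \<le> exp (2 * c ^ 2 * n) * exp n * exp (2 * c * n * ln K)"
    using assms 1 2 by (intro mult_mono) (auto simp: powr_def)
  also have "\<dots> = exp ((2 * c ^ 2 + 1 + 2 * c * ln K) * n)"
    by (simp add: exp_add[symmetric] algebra_simps)
  finally show ?thesis .
qed

lemma (in coordinates) bounded_relation:
  obtains C :: real where "C \<ge> 1"
    "\<And>a b u v. word G a u \<Longrightarrow> word G b v \<Longrightarrow> a \<ge> 1 \<Longrightarrow> b \<ge> 1 \<Longrightarrow>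
      \<exists>P. P \<noteq> 0 \<and> ev2 (u - 1) (v - 1) P \<in> I \<and> real (degree P) \<le> exp (C * (real a * real b)) \<and>
        (\<forall>i j. real_of_int \<bar>coeff (coeff P j) i\<bar> \<le> exp (C * (real a * real b)))"
proof -
  \<comment> \<open>With n = a b there are c^2 n unknowns and card W (2 B c n + 1) equations; this c
    makes the former at least twice the latter.\<close>
  define c where "c = 2 * card W * (2 * B + 1)"
  have "card W \<ge> 1" using W by (metis One_nat_def Suc_leI card_gt_0_iff empty_iff)
  then have c1: "c \<ge> 1" by (simp add: c_def)
  define K' where "K' = real_of_int (2 * K)"
  have K': "K' \<ge> 1" using K(1) by (simp add: K'_def)
  define C where "C = 2 * real c ^ 2 + 1 + 2 * real c * ln K'"
  have "ln K' \<ge> 0" using K' by simp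
  then have C0: "C \<ge> 2 * real c ^ 2 + 1" by (simp add: C_def)
  have "real c * 1 \<le> real c * real c" using c1 by (intro mult_left_mono) auto
  then have cC: "real c \<le> C" "C \<ge> 1" using C0 by (simp_all add: power2_eq_square)
  show thesis
  proof (rule that[OF cC(2)])
    fix a b u v assume u: "word G a u" and v: "word G b v" and ab: "a \<ge> 1" "b \<ge> 1"
    define n where "n = a * b"
    have n: "n \<ge> 1" using ab by (simp add: n_def)
    \<comment> \<open>Balancing a p = b q makes the exponent of the bound proportional to a
      b.\<close>
    define p q where "p = c * b" and "q = c * a"
    have pq1: "p \<ge> 1" "q \<ge> 1" using c1 ab by (auto simp: p_def q_def)
    have pq: "p * q = c ^ 2 * n" "a * p + b * q = 2 * c * n"
      by (simp_all add: p_def q_def n_def power2_eq_square algebra_simps)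
    have "2 * (card W * (B * (a * p + b * q) + 1)) = 2 * card W * (2 * B * (c * n) + 1)"
      unfolding pq by (simp add: algebra_simps)
    also have "\<dots> \<le> 2 * card W * (2 * B * (c * n) + c * n)"
      using c1 n by (intro mult_left_mono add_left_mono) auto
    also have "\<dots> = p * q" unfolding pq by (simp add: c_def power2_eq_square algebra_simps)
    finally obtain d :: "nat \<Rightarrow> nat \<Rightarrow> int" where d: "\<exists>i<p. \<exists>j<q. d i j \<noteq> 0"
      "\<And>i j. i < p \<Longrightarrow> j < q \<Longrightarrow> \<bar>d i j\<bar> \<le> 2 * int (p * q) * (2 * K) ^ (a * p + b * q)"
      "(\<Sum>i<p. \<Sum>j<q. of_int (d i j) * ((u - 1) ^ i * (v - 1) ^ j)) \<in> I"
      by (rule siegel_relation[OF u ab(1) v ab(2) pq1]) (rule that)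
    define P where "P = (\<Sum>j<q. monom (\<Sum>i<p. monom (d i j) i) j)"
    have cP: "coeff (coeff P j) i = (if i < p \<and> j < q then d i j else 0)" for i j
      by (simp add: P_def coeff_sum if_distrib[of "\<lambda>x. coeff x _"] cong: if_cong)
    have "P \<noteq> 0" using d(1) cP by (metis coeff_0)
    moreover have "ev2 (u - 1) (v - 1) P = (\<Sum>j<q. \<Sum>i<p. of_int (d i j) * (u - 1) ^ i * (v - 1) ^ j)"
      by (simp add: P_def ev2.hom_sum ev.hom_sum sum_distrib_right)
    then have "ev2 (u - 1) (v - 1) P \<in> I"
      using d(3) by (subst (asm) sum.swap) (simp add: mult.assoc)
    moreover have "real (degree P) \<le> exp (C * (real a * real b))"
    proof -
      have "degree P \<le> q"
        unfolding P_def by (intro degree_sum_le) (auto intro: order_trans[OF degree_monom_le])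
      then have "real (degree P) \<le> real c * real a" by (simp add: q_def flip: of_nat_mult)
      also have "\<dots> \<le> C * (real a * real b)"
        using cC ab by (intro mult_mono) auto
      also have "\<dots> \<le> exp (C * (real a * real b))" using exp_ge_add_one_self[of "C * (real a * real b)"] by linarith
      finally show ?thesis .
    qed
    moreover have "real_of_int \<bar>coeff (coeff P j) i\<bar> \<le> exp (C * (real a * real b))" for i j
    proof (cases "i < p \<and> j < q")
      case True
      then have "\<bar>coeff (coeff P j) i\<bar> \<le> 2 * int (c ^ 2 * n) * (2 * K) ^ (2 * c * n)"
        using d(2)[of i j] by (simp add: cP pq)
      then have "real_of_int \<bar>coeff (coeff P j) i\<bar> \<le> real_of_int (2 * int (c ^ 2 * n) * (2 * K) ^ (2 * c * n))"
        by (simp only: of_int_le_iff)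
      also have "\<dots> = 2 * real c ^ 2 * real n * K' ^ (2 * c * n)" by (simp add: K'_def)
      also have "K' ^ (2 * c * n) = K' powr (2 * real c * real n)"
        using K' powr_realpow[of K' "2 * c * n"] by simp
      also have "2 * real c ^ 2 * real n * \<dots> \<le> exp (C * real n)"
        unfolding C_def using c1 K' n by (intro size_bound) auto
      finally show ?thesis by (simp add: n_def)
    next
      case False
      then show ?thesis by (auto simp: cP)
    qed
    ultimately show "\<exists>P. P \<noteq> 0 \<and> ev2 (u - 1) (v - 1) P \<in> I \<and> real (degree P) \<le> exp (C * (real a * real b)) \<and>
        (\<forall>i j. real_of_int \<bar>coeff (coeff P j) i\<bar> \<le> exp (C * (real a * real b)))" by blast
  qed
qed

text \<open>With B = 0 the number of equations is card W whatever the length of u. So a fixed number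
  of powers of u - 1 suffices (the second word is idle, q = 1), and the size of the relation is
  exponential in a alone.\<close>

lemma (in coordinates) bounded_relation_const:
  assumes "B = 0"
  obtains C :: real where "C \<ge> 1"
    "\<And>a u. word G a u \<Longrightarrow> a \<ge> 1 \<Longrightarrow>
      \<exists>P. P \<noteq> 0 \<and> ev (u - 1) P \<in> I \<and> (\<forall>i. real_of_int \<bar>coeff P i\<bar> \<le> exp (C * real a))"
proof -
  define p where "p = 2 * card W"
  have "card W \<ge> 1" using W by (metis One_nat_def Suc_leI card_gt_0_iff empty_iff)
  then have p1: "p \<ge> 1" by (simp add: p_def)
  define K' where "K' = real_of_int (2 * K)"
  have K': "K' \<ge> 1" using K(1) by (simp add: K'_def)
  define C where "C = 2 * real p ^ 2 + 1 + 2 * real p * ln K'"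
  have "ln K' \<ge> 0" using K' by simp
  then have C1: "C \<ge> 1" by (simp add: C_def)
  show thesis
  proof (rule that[OF C1])
    fix a u assume u: "word G a u" and a: "a \<ge> 1"
    have "p * 1 \<ge> 2 * (card W * (B * (a * p + a * 1) + 1))" by (simp add: assms p_def)
    then obtain d :: "nat \<Rightarrow> nat \<Rightarrow> int" where d: "\<exists>i<p. \<exists>j<1. d i j \<noteq> 0"
      "\<And>i j. i < p \<Longrightarrow> j < 1 \<Longrightarrow> \<bar>d i j\<bar> \<le> 2 * int (p * 1) * (2 * K) ^ (a * p + a * 1)"
      "(\<Sum>i<p. \<Sum>j<1. of_int (d i j) * ((u - 1) ^ i * (u - 1) ^ j)) \<in> I"
      by (rule siegel_relation[OF u a u a p1 order_refl]) (rule that)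
    define P where "P = (\<Sum>i<p. monom (d i 0) i)"
    have cP: "coeff P i = (if i < p then d i 0 else 0)" for i
      by (simp add: P_def coeff_sum)
    have "P \<noteq> 0" using d(1) cP by (metis coeff_0 less_one)
    moreover have "ev (u - 1) P \<in> I"
      using d(3) by (simp add: P_def ev.hom_sum)
    moreover have "real_of_int \<bar>coeff P i\<bar> \<le> exp (C * real a)" for i
    proof (cases "i < p")
      case True
      then have "\<bar>coeff P i\<bar> \<le> 2 * int p * (2 * K) ^ (a * p + a)"
        using d(2)[of i 0] by (simp add: cP)
      then have "real_of_int \<bar>coeff P i\<bar> \<le> real_of_int (2 * int p * (2 * K) ^ (a * p + a))"
        by (simp only: of_int_le_iff)
      also have "\<dots> = 2 * real p * K' ^ (a * p + a)" by (simp add: K'_def)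
      also have "\<dots> \<le> 2 * real p ^ 2 * real a * K' powr (2 * real p * real a)"
      proof -
        have "real p * 1 * 1 \<le> real p * real p * real a" using p1 a by (intro mult_mono) auto
        then have 1: "2 * real p \<le> 2 * real p ^ 2 * real a" by (simp add: power2_eq_square)
        have "a * p + a \<le> 2 * p * a" using p1 a by (cases p) auto
        then have "K' ^ (a * p + a) \<le> K' ^ (2 * p * a)" using K' by (intro power_increasing) auto
        also have "\<dots> = K' powr (2 * real p * real a)"
          using K' powr_realpow[of K' "2 * p * a"] by simp
        finally have 2: "K' ^ (a * p + a) \<le> K' powr (2 * real p * real a)" .
        show ?thesis by (rule mult_mono[OF 1 2]) (use K' in auto)
      qed
      also have "\<dots> \<le> exp (C * real a)"
        unfolding C_def using p1 K' a by (intro size_bound) auto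
      finally show ?thesis .
    next
      case False
      then show ?thesis by (auto simp: cP)
    qed
    ultimately show "\<exists>P. P \<noteq> 0 \<and> ev (u - 1) P \<in> I \<and> (\<forall>i. real_of_int \<bar>coeff P i\<bar> \<le> exp (C * real a))" by blast
  qed
qed

text \<open>The relation will be read at w = 0, where it would be empty if a power of w divided it.
  As w is nonzero modulo the prime I, the largest such power can be removed, which only shifts
  coefficients.\<close>

lemma relation_normalize:
  assumes I: "prime_set UNIV I" and w: "w \<notin> I" and P: "P \<noteq> 0" "ev2 w s P \<in> I"
  obtains Q where "ev2 w s Q \<in> I" "degree Q \<le> degree P"
    "\<And>i j. \<exists>i'. coeff (coeff Q j) i = coeff (coeff P j) i'" "\<exists>j. coeff (coeff Q j) 0 \<noteq> 0"
proof -
  define k where "k = (LEAST i. \<exists>j. coeff (coeff P j) i \<noteq> 0)"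
  have "\<exists>i j. coeff (coeff P j) i \<noteq> 0" using P(1) by (metis leading_coeff_0_iff)
  then have k: "\<exists>j. coeff (coeff P j) k \<noteq> 0" unfolding k_def by (rule LeastI_ex)
  have less: "coeff (coeff P j) i = 0" if "i < k" for i j using not_less_Least[OF that[unfolded k_def]] by blast
  define Q where "Q = map_poly (poly_shift k) P"
  have cQ: "coeff Q j = poly_shift k (coeff P j)" for j by (simp add: Q_def coeff_map_poly)
  have "P = Polynomial.smult (monom 1 k) Q"
    by (intro poly_eqI) (simp add: cQ coeff_monom_mult coeff_poly_shift less)
  then have PQ: "P = [:monom 1 k:] * Q" by simp
  have "ev2 w s P = w ^ k * ev2 w s Q"
    by (subst PQ) (simp only: ev2.hom_mult ev2_const ev_def, simp add: map_poly_monom poly_monom)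
  then have "ev2 w s Q \<in> I"
    using P(2) prime_setD[OF I UNIV_I UNIV_I] prime_set_not_power[OF subring_set_UNIV I UNIV_I w] by metis
  moreover have "degree Q \<le> degree P" by (intro degree_le) (simp add: cQ coeff_eq_0)
  moreover have "\<exists>i'. coeff (coeff Q j) i = coeff (coeff P j) i'" for i j by (auto simp: cQ coeff_poly_shift)
  moreover have "\<exists>j. coeff (coeff Q j) 0 \<noteq> 0" using k by (simp add: cQ coeff_poly_shift)
  ultimately show thesis by (rule that)
qed

lemma ev2_shift: "ev2 w s (pcompose P [:[:c:], 1:]) = ev2 w (s + of_int c) P"
proof (induction P)
  case (pCons q P)
  have e: "ev2 w s [:[:c:], 1:] = s + of_int c" by (simp add: ev2_pCons ev.hom_one)
  have "ev2 w s (pcompose (pCons q P) [:[:c:], 1:]) = ev w q + ev2 w s [:[:c:], 1:] * ev2 w s (pcompose P [:[:c:], 1:])"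
    by (simp only: pcompose_pCons ev2.hom_add ev2.hom_mult ev2_const)
  also have "\<dots> = ev2 w (s + of_int c) (pCons q P)"
    by (simp only: e pCons.IH ev2_pCons[of w "s + of_int c"])
  finally show ?case .
qed (simp add: ev2.hom_zero)

lemma coeff_0_shift: "poly (coeff (pcompose P [:[:c:], 1:]) 0) 0 = poly (map_poly (\<lambda>q. coeff q 0) P) c"
proof (induction P)
  case (pCons q P)
  then show ?case by (cases "q = 0 \<and> P = 0") (auto simp: pcompose_pCons map_poly_pCons poly_0_coeff_0)
qed auto

section \<open>Horizontal primes through torsion points\<close>

text \<open>I is the ideal of the generic fibre, a prime of the big ring, and S the integral
  coordinate ring. \<open>S_gen\<close> says that S is generated by G and by elements integral over
  Z; \<open>dep\<close> says that the fibre has transcendence degree at most 1.\<close>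

locale torsion_curve =
  fixes I S G :: "'a::comm_ring_1 set"
  assumes I: "prime_set UNIV I" and char0: "\<And>m::int. m \<noteq> 0 \<Longrightarrow> of_int m \<notin> I"
    and S: "subring_set S" and G: "finite G" "G \<subseteq> S"
    and S_gen: "\<And>T. subring_set T \<Longrightarrow> G \<subseteq> T \<Longrightarrow>
       (\<And>a f. a \<in> S \<Longrightarrow> lead_coeff f = 1 \<Longrightarrow> ev a f = 0 \<Longrightarrow> a \<in> T) \<Longrightarrow> S \<subseteq> T"
    and dep: "\<And>y z. \<exists>P. P \<noteq> 0 \<and> ev2 y z P \<in> I"
begin

lemma stable_module_exists:
  assumes "\<And>g. g \<in> G \<Longrightarrow> \<exists>F. ev2 t g F \<in> I \<and> ev t (lead_coeff F) \<notin> I"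
  obtains W h where "stable_module t I W h G"
proof -
  have "\<exists>W h. stable_module t I W h A" if "A \<subseteq> G" for A
    using finite_subset[OF that G(1)] that
  proof (induction A rule: finite_induct)
    case empty
    then show ?case using stable_module_empty[OF I] by blast
  next
    case (insert g A)
    then obtain W h where "stable_module t I W h A" by auto
    moreover obtain F where "ev2 t g F \<in> I" "ev t (lead_coeff F) \<notin> I" using assms insert.prems by blast
    ultimately show ?case using stable_module_insert[OF I, of t W h A g F] by metis
  qed
  then show thesis using that by blast
qed

lemma dvd_of_int_mem:
  assumes x: "prime_set S x" and p: "prime p" "of_nat p \<in> x" and m: "of_int m \<in> x"
  shows "int p dvd m"
proof (rule ccontr)
  assume "\<not> int p dvd m"
  then have "coprime (int p) m" using p(1) by (simp add: prime_imp_coprime)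
  then obtain a b where "a * int p + b * m = 1" using bezout_int[of "int p" m] by (auto simp: coprime_iff_gcd_eq_1)
  then have "of_int (a * int p + b * m) = (1 :: 'a)" by simp
  then have "of_int a * of_nat p + of_int b * of_int m = (1 :: 'a)" by simp
  moreover have "of_int a * of_nat p + of_int b * of_int m \<in> x"
    using ideal_set_lmult[OF prime_set_ideal[OF x] subring_set_of_int[OF S] p(2)]
      ideal_set_lmult[OF prime_set_ideal[OF x] subring_set_of_int[OF S] m]
    by (rule ideal_set_add[OF prime_set_ideal[OF x]])
  ultimately show False using prime_set_1[OF x] by simp
qed

lemma small_not_mem:
  assumes x: "prime_set S x" and p: "prime p" "of_nat p \<in> x" and m: "m \<noteq> 0" "\<bar>m\<bar> < int p"
  shows "of_int m \<notin> x"
  using dvd_of_int_mem[OF x p, of m] m dvd_imp_le_int[of m "int p"] by auto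

lemma ev_mem_prime:
  assumes x: "prime_set S x" and w: "w \<in> x" and f: "ev w f \<in> x"
  shows "of_int (coeff f 0) \<in> x"
proof -
  have wS: "w \<in> S" using w prime_set_subset[OF x] by blast
  obtain b where b: "b \<in> S" "ev w f = of_int (poly f 0) + w * b" by (rule ev_diff_mem[OF S wS])
  have "w * b \<in> x" using ideal_set_rmult[OF prime_set_ideal[OF x] b(1) w] .
  then have "ev w f - w * b \<in> x" using f by (intro ideal_set_diff[OF S prime_set_ideal[OF x]])
  then show ?thesis by (simp add: b(2) poly_0_coeff_0)
qed

definition siegel_bound :: "real \<Rightarrow> bool" where
  "siegel_bound C \<longleftrightarrow> (\<forall>a b u v. word G a u \<longrightarrow> word G b v \<longrightarrow> a \<ge> 1 \<longrightarrow> b \<ge> 1 \<longrightarrow>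
      (\<exists>P. P \<noteq> 0 \<and> ev2 (u - 1) (v - 1) P \<in> I \<and> real (degree P) \<le> exp (C * (real a * real b)) \<and>
        (\<forall>i j. real_of_int \<bar>coeff (coeff P j) i\<bar> \<le> exp (C * (real a * real b)))))"

text \<open>Once p exceeds the Siegel bound, a nonzero coefficient cannot be divisible by p and the
  degree is below p. So the relation stays nonzero modulo w and p, and not all residues modulo p can
  be roots.\<close>

lemma normalized_relation:
  assumes rel: "siegel_bound C" and "word G a u" "word G b v" "a \<ge> 1" "b \<ge> 1" "u - 1 \<notin> I" and p: "exp (C * (real a * real b)) < real p"
  obtains P j where "ev2 (u - 1) (v - 1) P \<in> I" "degree P < p"
     "coeff (coeff P j) 0 \<noteq> 0" "\<And>i j. \<bar>coeff (coeff P j) i\<bar> < int p"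
proof -
  obtain P where P: "P \<noteq> 0" "ev2 (u - 1) (v - 1) P \<in> I" "real (degree P) \<le> exp (C * (real a * real b))"
     "\<And>i j. real_of_int \<bar>coeff (coeff P j) i\<bar> \<le> exp (C * (real a * real b))"
    using rel[unfolded siegel_bound_def, rule_format, OF assms(2-5)] by blast
  obtain Q where Q: "ev2 (u - 1) (v - 1) Q \<in> I" "degree Q \<le> degree P"
    "\<And>i j. \<exists>i'. coeff (coeff Q j) i = coeff (coeff P j) i'" "\<exists>j. coeff (coeff Q j) 0 \<noteq> 0"
    by (rule relation_normalize[OF I assms(6) P(1,2)]) (rule that)
  obtain j where j: "coeff (coeff Q j) 0 \<noteq> 0" using Q(4) by blast
  have "\<bar>coeff (coeff Q j) i\<bar> < int p" for i j
  proof -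
    obtain i' where i': "coeff (coeff Q j) i = coeff (coeff P j) i'" using Q(3) by blast
    have "real_of_int \<bar>coeff (coeff P j) i'\<bar> < real_of_int (int p)" using P(4)[of j i'] p by simp
    then show ?thesis unfolding i' by (simp only: of_int_less_iff)
  qed
  moreover have "degree Q < p" using Q(2) P(3) p by linarith
  ultimately show thesis using that[OF Q(1) _ j] by blast
qed

text \<open>At w = 0 the small relation between w and g - 1 becomes a polynomial f that is nonzero
  modulo p. For an integer c that is no root of f modulo p, the relation of g - 1 - c has a constant
  term outside x, so \<open>inverse_integral\<close> writes g - 1 - c as a fraction of integral
  elements with denominator b outside x.\<close>

lemma generators_locally_integral:
  assumes rel: "siegel_bound C" and x: "prime_set S x" "I \<inter> S \<subseteq> x" and p: "prime p" "of_nat p \<in> x"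
    and u: "word G a u" "a \<ge> 1" "u - 1 \<in> x" "u - 1 \<notin> I" and small: "exp (C * real a) < real p"
    and g: "g \<in> G"
  shows "g \<in> locally_integral S x (u - 1) I"
proof -
  define w where "w = u - 1"
  have wS: "w \<in> S" and gS: "g \<in> S" using u(3) prime_set_subset[OF x(1)] g G by (auto simp: w_def)
  have "exp (C * (real a * real 1)) < real p" using small by simp
  then obtain P j where P': "ev2 (u - 1) (g - 1) P \<in> I" "degree P < p" "coeff (coeff P j) 0 \<noteq> 0"
    "\<And>i j. \<bar>coeff (coeff P j) i\<bar> < int p"
    by (rule normalized_relation[OF rel u(1) word_gen[OF g] u(2) order_refl u(4)]) (rule that)
  note P = P'(1)[folded w_def] P'(2-)
  define f where "f = map_poly (\<lambda>q. coeff q 0) P"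
  have cf: "coeff f i = coeff (coeff P i) 0" for i by (simp add: f_def coeff_map_poly)
  have "degree f \<le> degree P" by (intro degree_le) (simp add: cf coeff_eq_0)
  then have "degree f < p" using P(2) by simp
  moreover have "\<not> int p dvd coeff f j"
    using P(3,4) dvd_imp_le_int[of "coeff f j" "int p"] by (auto simp: cf not_less dest: leD)
  ultimately obtain c where c: "\<not> int p dvd poly f c" by (rule exists_nonroot_mod_prime[OF p(1)]) (rule that)
  define a where "a = g - 1 - of_int c"
  have aS: "a \<in> S" unfolding a_def
    using gS by (intro subring_set_diff[OF S] subring_set_1[OF S] subring_set_of_int[OF S])
  define F where "F = pcompose P [:[:c:], 1:]"
  have FI: "ev2 w a F \<in> I" using P(1) by (simp add: F_def ev2_shift a_def)
  have "ev w (coeff F 0) \<notin> x"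
  proof
    assume "ev w (coeff F 0) \<in> x"
    then have "of_int (coeff (coeff F 0) 0) \<in> x" using ev_mem_prime[OF x(1) u(3)] by (simp add: w_def)
    moreover have "coeff (coeff F 0) 0 = poly f c" using coeff_0_shift[of P c] by (simp add: F_def f_def poly_0_coeff_0)
    ultimately show False using c dvd_of_int_mem[OF x(1) p] by simp
  qed
  then obtain b where b: "b \<in> S" "b \<notin> x" "b \<in> integral_mod w I" "b * a - ev w (coeff F 0) \<in> I"
    by (rule inverse_integral[OF S I x wS aS FI]) (rule that)
  have "b * a \<in> integral_mod w I"
    by (rule integral_mod_cong[OF I b(4) ev_integral_mod[OF prime_set_ideal[OF I]]])
  then have "a \<in> locally_integral S x w I" using b aS unfolding locally_integral_def by blast
  moreover have T: "subring_set (locally_integral S x w I)" by (rule locally_integral_subring[OF S I x(1)])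
  ultimately have "a + 1 + of_int c \<in> locally_integral S x w I"
    by (intro subring_set_add[OF T] subring_set_1[OF T] subring_set_of_int[OF T])
  then show ?thesis by (simp add: a_def w_def)
qed

lemma horizontal_prime_through:
  assumes rel: "siegel_bound C" and x: "prime_set S x" "I \<inter> S \<subseteq> x" and p: "prime p" "of_nat p \<in> x"
    and u: "word G a u" "a \<ge> 1" "u - 1 \<in> x" "u - 1 \<notin> I" and small: "exp (C * real a) < real p"
    and tr: "transcendental_mod I (u - 1)"
  obtains q where "prime_set S q" "I \<inter> S \<subseteq> q" "u - 1 \<in> q" "q \<subseteq> x" "\<And>m. m \<noteq> 0 \<Longrightarrow> of_int m \<notin> q"
proof (rule horizontal_prime[OF S I x u(3) tr])
  show "S \<subseteq> locally_integral S x (u - 1) I"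
  proof (rule S_gen)
    show "subring_set (locally_integral S x (u - 1) I)" by (rule locally_integral_subring[OF S I x(1)])
    show "G \<subseteq> locally_integral S x (u - 1) I"
      using generators_locally_integral[OF rel x p u small] by blast
    fix b f assume b: "b \<in> S" "lead_coeff f = (1::int)" "ev b f = 0"
    define H where "H = map_poly (\<lambda>c. [:c:]) f"
    have "ev2 (u - 1) b H = 0" using b(3) by (simp add: H_def ev2_map_const)
    moreover have "degree H = degree f" by (simp add: H_def degree_map_const)
    then have "lead_coeff H = 1" using b(2) by (simp add: H_def coeff_map_poly one_pCons)
    ultimately have "b \<in> integral_mod (u - 1) I"
      using ideal_set_0[OF prime_set_ideal[OF I]] unfolding integral_mod_def by auto
    then show "b \<in> locally_integral S x (u - 1) I"
      using b(1) subring_set_1[OF S] prime_set_1[OF x(1)] subring_set_1[OF integral_mod_subring[OF I]]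
      unfolding locally_integral_def by (intro CollectI conjI bexI[of _ 1]) auto
  qed
qed (rule that)

text \<open>Since w lies in q, the relation between w and z = v - 1 reads z^k (D + z r) = 0 modulo
  q, with D a nonzero integer below p in absolute value. As z lies in x and D does not, the second
  factor is outside x and so outside q; hence z lies in q.\<close>

lemma horizontal_prime_contains:
  assumes rel: "siegel_bound C" and x: "prime_set S x" "I \<inter> S \<subseteq> x" and p: "prime p" "of_nat p \<in> x"
    and u: "word G a u" "a \<ge> 1" "u - 1 \<in> x" "u - 1 \<notin> I"
    and q: "prime_set S q" "I \<inter> S \<subseteq> q" "u - 1 \<in> q" "q \<subseteq> x"
    and v: "word G b v" "b \<ge> 1" "v - 1 \<in> x" and small: "exp (C * (real a * real b)) < real p"
  shows "v - 1 \<in> q"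
proof -
  define w z where "w = u - 1" and "z = v - 1"
  have wS: "w \<in> S" and zS: "z \<in> S" using u(3) v(3) prime_set_subset[OF x(1)] by (auto simp: w_def z_def)
  obtain P j where P': "ev2 (u - 1) (v - 1) P \<in> I" "coeff (coeff P j) 0 \<noteq> 0" "\<And>i j. \<bar>coeff (coeff P j) i\<bar> < int p"
    by (rule normalized_relation[OF rel u(1) v(1) u(2) v(2) u(4) small]) (rule that)
  note P = P'(1)[folded w_def z_def] P'(2-)
  note qi = prime_set_ideal[OF q(1)]
  define k where "k = (LEAST j. coeff (coeff P j) 0 \<noteq> 0)"
  have k: "coeff (coeff P k) 0 \<noteq> 0" unfolding k_def by (rule LeastI[of _ j]) (rule P(2))
  have less: "coeff (coeff P j) 0 = 0" if "j < k" for j using not_less_Least[OF that[unfolded k_def]] by blast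
  define D where "D = coeff (coeff P k) 0"
  have evq: "ev w f - of_int (coeff f 0) \<in> q" for f
  proof -
    obtain b where b: "b \<in> S" "ev w f = of_int (poly f 0) + w * b" by (rule ev_diff_mem[OF S wS])
    then show ?thesis using ideal_set_rmult[OF qi b(1) q(3)] by (simp add: w_def poly_0_coeff_0)
  qed
  define n where "n = degree P + k"
  have "(\<Sum>j\<le>n. (ev w (coeff P j) - of_int (coeff (coeff P j) 0)) * z ^ j) \<in> q"
    using evq zS by (intro ideal_set_sum[OF qi] ideal_set_rmult[OF qi] subring_set_power[OF S])
  moreover have "(\<Sum>j\<le>n. ev w (coeff P j) * z ^ j) \<in> q"
  proof -
    have "ev2 w z P \<in> I \<inter> S" using P(1) ev2_mem[OF S wS zS] by blast
    then show ?thesis using q(2) ev2_altdef[of P n w z] by (auto simp: n_def)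
  qed
  ultimately have 1: "(\<Sum>j\<le>n. of_int (coeff (coeff P j) 0) * z ^ j) \<in> q"
    using ideal_set_diff[OF S qi] by (fastforce simp: left_diff_distrib sum_subtractf)
  define r where "r = (\<Sum>j\<in>{k<..n}. of_int (coeff (coeff P j) 0) * z ^ (j - Suc k))"
  have rS: "r \<in> S" unfolding r_def
    using zS by (intro subring_set_sum[OF S] subring_set_mult[OF S] subring_set_of_int[OF S] subring_set_power[OF S])
  have "(\<Sum>j\<le>n. of_int (coeff (coeff P j) 0) * z ^ j) = (\<Sum>j\<in>{k..n}. of_int (coeff (coeff P j) 0) * z ^ j)"
    using less by (intro sum.mono_neutral_right) auto
  also have "\<dots> = of_int D * z ^ k + (\<Sum>j\<in>{k<..n}. of_int (coeff (coeff P j) 0) * z ^ j)"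
    by (simp add: D_def sum.head n_def)
  also have "(\<Sum>j\<in>{k<..n}. of_int (coeff (coeff P j) 0) * z ^ j) = z ^ k * (z * r)"
    unfolding r_def sum_distrib_left
  proof (intro sum.cong refl)
    fix j assume "j \<in> {k<..n}"
    then have "z ^ j = z ^ k * (z * z ^ (j - Suc k))" by (simp flip: power_Suc power_add)
    then show "of_int (coeff (coeff P j) 0) * z ^ j = z ^ k * (z * (of_int (coeff (coeff P j) 0) * z ^ (j - Suc k)))"
      by (simp add: mult_ac)
  qed
  also have "of_int D * z ^ k + z ^ k * (z * r) = (of_int D + z * r) * z ^ k" by (simp add: algebra_simps)
  finally have "(of_int D + z * r) * z ^ k \<in> q" using 1 by simp
  moreover have "of_int D + z * r \<notin> q"
  proof
    assume "of_int D + z * r \<in> q"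
    then have "of_int D + z * r \<in> x" using q(4) by blast
    moreover have "z * r \<in> x" using v(3) rS ideal_set_rmult[OF prime_set_ideal[OF x(1)]] by (simp add: z_def)
    ultimately have "of_int D + z * r - z * r \<in> x" by (rule ideal_set_diff[OF S prime_set_ideal[OF x(1)]])
    then have "of_int D \<in> x" by simp
    then show False using small_not_mem[OF x(1) p, of D] k P(3)[of k 0] by (simp add: D_def)
  qed
  moreover have "of_int D + z * r \<in> S"
    using zS rS by (intro subring_set_add[OF S] subring_set_mult[OF S] subring_set_of_int[OF S])
  ultimately have "z ^ k \<in> q" using prime_setD[OF q(1) _ subring_set_power[OF S zS]] by blast
  then show ?thesis using prime_set_not_power[OF S q(1) zS] unfolding z_def by blast
qed

text \<open>The case distinction decides the base of the finite module: Z[t] for a word t that is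
  transcendental modulo I, or Z, encoded by t = 0, if there is none.\<close>

theorem torsion_prime:
  obtains C :: real where "C \<ge> 1"
    "\<And>x p a u. prime_set S x \<Longrightarrow> I \<inter> S \<subseteq> x \<Longrightarrow> prime p \<Longrightarrow> of_nat p \<in> x \<Longrightarrow>
       word G a u \<Longrightarrow> a \<ge> 1 \<Longrightarrow> u - 1 \<in> x \<Longrightarrow> u - 1 \<notin> I \<Longrightarrow> exp (C * real a) < real p \<Longrightarrow>
       \<exists>q. prime_set S q \<and> I \<inter> S \<subseteq> q \<and> u - 1 \<in> q \<and> q \<subseteq> x \<and> (\<forall>m. m \<noteq> 0 \<longrightarrow> of_int m \<notin> q) \<and>
         (\<forall>b v. word G b v \<and> b \<ge> 1 \<and> v - 1 \<in> x \<and> exp (C * (real a * real b)) < real p \<longrightarrow> v - 1 \<in> q)"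
proof (cases "\<exists>m t. word G m t \<and> transcendental_mod I t")
  case True
  then obtain m t where t: "word G m t" "transcendental_mod I t" by blast
  have "m \<noteq> 0"
  proof
    assume "m = 0"
    then have "t = 1" using t(1) by (auto elim: word.cases)
    moreover have "ev (1::'a) [:-1, 1:] = 0" by (simp add: ev_pCons)
    ultimately show False using t(2) ideal_set_0[OF prime_set_ideal[OF I]]
      unfolding transcendental_mod_def by (metis one_pCons pCons_eq_0_iff zero_neq_one)
  qed
  then have m: "m \<ge> 1" by simp
  have "\<exists>F. ev2 t g F \<in> I \<and> ev t (lead_coeff F) \<notin> I" for g
  proof -
    obtain P where P: "P \<noteq> 0" "ev2 t g P \<in> I" using dep by blast
    then have "ev t (lead_coeff P) \<notin> I" using t(2) unfolding transcendental_mod_def by (metis leading_coeff_0_iff)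
    then show ?thesis using P(2) by blast
  qed
  then obtain W h where "stable_module t I W h G" using stable_module_exists by blast
  then obtain c B K where co: "coordinates t I W G h c B K"
    by (rule stable_module_coordinates[OF I G(1)])
  obtain C :: real where C: "C \<ge> 1" and rel: "siegel_bound C"
    by (rule coordinates.bounded_relation[OF co]) (rule that, assumption, unfold siegel_bound_def, intro allI impI, blast)
  \<comment> \<open>The length m of t enters the constant because u has to be compared with t as
    well.\<close>
  have Cm: "C \<le> C * real m" using C m by (simp add: mult_le_cancel_left1)
  show thesis
  proof (rule that[of "C * real m"])
    show "C * real m \<ge> 1" using C Cm by linarith
    fix x p a u
    assume x: "prime_set S x" "I \<inter> S \<subseteq> x" and p: "prime p" "of_nat p \<in> x"
      and u: "word G a u" "a \<ge> 1" "u - 1 \<in> x" "u - 1 \<notin> I" and small: "exp (C * real m * real a) < real p"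
    have "C * real a \<le> C * real m * real a" using Cm by (intro mult_right_mono) auto
    then have small1: "exp (C * real a) < real p" using small by (meson exp_le_cancel_iff le_less_trans)
    \<comment> \<open>If u - 1 were algebraic, then in a small relation with t - 1 every coefficient
      would vanish at u - 1 modulo I. Read modulo x, where u - 1 vanishes, this puts a nonzero
      integer of absolute value below p into x.\<close>
    have tr: "transcendental_mod I (u - 1)"
    proof (rule ccontr)
      assume alg: "\<not> transcendental_mod I (u - 1)"
      have "exp (C * (real a * real m)) < real p" using small by (simp add: mult_ac)
      then obtain P j where P: "ev2 (u - 1) (t - 1) P \<in> I" "coeff (coeff P j) 0 \<noteq> 0" "\<And>i j. \<bar>coeff (coeff P j) i\<bar> < int p"
        by (rule normalized_relation[OF rel u(1) t(1) u(2) m u(4)]) (rule that)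
      have t1: "transcendental_mod I (t - 1)"
        unfolding transcendental_mod_def
      proof (intro allI impI)
        fix f assume "ev (t - 1) f \<in> I"
        moreover have "ev t (pcompose f [:-1, 1:]) = ev (t - 1) f" for f :: "int poly"
        proof (induction f)
          case (pCons c f)
          have e: "ev t [:-1, 1:] = t - 1" by (simp add: ev_pCons)
          have "ev t (pcompose (pCons c f) [:-1, 1:]) = of_int c + ev t [:-1, 1:] * ev t (pcompose f [:-1, 1:])"
            by (simp only: pcompose_pCons ev.hom_add ev.hom_mult ev_const)
          also have "\<dots> = ev (t - 1) (pCons c f)"
            by (simp only: e pCons.IH ev_pCons[of "t - 1"])
          finally show ?case .
        qed (simp add: ev.hom_zero)
        ultimately have "pcompose f [:-1, 1:] = 0" using t(2) unfolding transcendental_mod_def by metis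
        then show "f = 0" by (simp add: pcompose_eq_0_iff)
      qed
      have "ev (u - 1) (coeff P j) \<in> I" by (rule algebraic_relation_trivial[OF I t1 alg P(1)])
      moreover have "ev (u - 1) (coeff P j) \<in> S" using u(3) prime_set_subset[OF x(1)] by (intro ev_mem[OF S]) auto
      ultimately have "ev (u - 1) (coeff P j) \<in> x" using x(2) by blast
      then have "of_int (coeff (coeff P j) 0) \<in> x" by (rule ev_mem_prime[OF x(1) u(3)])
      then show False using small_not_mem[OF x(1) p P(2,3)] by blast
    qed
    obtain q where q: "prime_set S q" "I \<inter> S \<subseteq> q" "u - 1 \<in> q" "q \<subseteq> x" "\<And>m. m \<noteq> 0 \<Longrightarrow> of_int m \<notin> q"
      by (rule horizontal_prime_through[OF rel x p u small1 tr]) (rule that)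
    have "v - 1 \<in> q" if v: "word G b v" "b \<ge> 1" "v - 1 \<in> x" "exp (C * real m * (real a * real b)) < real p" for b v
    proof -
      have "C * (real a * real b) \<le> C * real m * (real a * real b)" using Cm by (intro mult_right_mono) auto
      then have "exp (C * (real a * real b)) < real p" using v(4) by (meson exp_le_cancel_iff le_less_trans)
      then show ?thesis by (rule horizontal_prime_contains[OF rel x p u q(1-4) v(1-3)])
    qed
    then show "\<exists>q. prime_set S q \<and> I \<inter> S \<subseteq> q \<and> u - 1 \<in> q \<and> q \<subseteq> x \<and> (\<forall>m. m \<noteq> 0 \<longrightarrow> of_int m \<notin> q) \<and>
         (\<forall>b v. word G b v \<and> b \<ge> 1 \<and> v - 1 \<in> x \<and> exp (C * real m * (real a * real b)) < real p \<longrightarrow> v - 1 \<in> q)"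
      using q by (intro exI[of _ q]) auto
  qed
next
  case False
  \<comment> \<open>All generators are algebraic over Z. The relation then involves u - 1 alone, and
    its nonzero constant term lies in x although it is smaller than p: this case contradicts the
    size of p.\<close>
  have "\<exists>F. ev2 0 g F \<in> I \<and> ev 0 (lead_coeff F) \<notin> I" if g: "g \<in> G" for g
  proof -
    have "\<not> transcendental_mod I g" using False word_gen[OF g] by blast
    then obtain f where f: "ev g f \<in> I" "f \<noteq> 0" by (auto simp: transcendental_mod_def)
    define H where "H = map_poly (\<lambda>c. [:c:]) f"
    have "degree H = degree f" by (simp add: H_def degree_map_const)
    then have "ev 0 (lead_coeff H) = of_int (lead_coeff f)" by (simp add: H_def coeff_map_poly)
    moreover have "of_int (lead_coeff f) \<notin> I" using char0[of "lead_coeff f"] f(2) by simp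
    ultimately have "ev 0 (lead_coeff H) \<notin> I" by metis
    moreover have "ev2 0 g H \<in> I" using f(1) by (simp add: H_def ev2_map_const)
    ultimately show ?thesis by blast
  qed
  then obtain W h where "stable_module 0 I W h G" using stable_module_exists by blast
  then obtain c B K where "coordinates 0 I W G h c B K"
    by (rule stable_module_coordinates[OF I G(1)])
  then have co: "coordinates 0 I W G [:poly h 0:] (\<lambda>g v u. [:poly (c g v u) 0:]) 0 K" by (rule coordinates_const)
  obtain C :: real where C: "C \<ge> 1" and rel: "\<And>a u. word G a u \<Longrightarrow> a \<ge> 1 \<Longrightarrow>
      \<exists>P. P \<noteq> 0 \<and> ev (u - 1) P \<in> I \<and> (\<forall>i. real_of_int \<bar>coeff P i\<bar> \<le> exp (C * real a))"
    by (rule coordinates.bounded_relation_const[OF co refl]) (rule that)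
  show thesis
  proof (rule that[OF C])
    fix x p a u
    assume x: "prime_set S x" "I \<inter> S \<subseteq> x" and p: "prime p" "of_nat p \<in> x"
      and u: "word G a u" "a \<ge> 1" "u - 1 \<in> x" "u - 1 \<notin> I" and small: "exp (C * real a) < real p"
    obtain P where P: "P \<noteq> 0" "ev (u - 1) P \<in> I" "\<And>i. real_of_int \<bar>coeff P i\<bar> \<le> exp (C * real a)"
      using rel[OF u(1,2)] by blast
    have "[:P:] \<noteq> 0" "ev2 (u - 1) 0 [:P:] \<in> I" using P by simp_all
    then obtain Q where Q: "ev2 (u - 1) 0 Q \<in> I" "degree Q \<le> degree [:P:]"
      "\<And>i j. \<exists>i'. coeff (coeff Q j) i = coeff (coeff [:P:] j) i'" "\<exists>j. coeff (coeff Q j) 0 \<noteq> 0"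
      by (rule relation_normalize[OF I u(4)]) (rule that)
    obtain R where R: "Q = [:R:]" using Q(2) by (auto elim: degree_eq_zeroE)
    obtain j where "coeff (coeff Q j) 0 \<noteq> 0" using Q(4) by blast
    then have "coeff R 0 \<noteq> 0" by (cases j) (simp_all add: R)
    moreover obtain i where i: "coeff R 0 = coeff P i" using Q(3)[of 0 0] by (auto simp: R)
    have "real_of_int \<bar>coeff P i\<bar> < real_of_int (int p)" using P(3)[of i] small by simp
    then have "\<bar>coeff R 0\<bar> < int p" unfolding i by (simp only: of_int_less_iff)
    moreover have "ev (u - 1) R \<in> I \<inter> S"
      using Q(1) u(3) prime_set_subset[OF x(1)] by (auto simp: R intro: ev_mem[OF S])
    then have "of_int (coeff R 0) \<in> x" using x(2) by (intro ev_mem_prime[OF x(1) u(3)]) blast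
    ultimately have False using small_not_mem[OF x(1) p] by blast
    then show "\<exists>q. prime_set S q \<and> I \<inter> S \<subseteq> q \<and> u - 1 \<in> q \<and> q \<subseteq> x \<and> (\<forall>m. m \<noteq> 0 \<longrightarrow> of_int m \<notin> q) \<and>
         (\<forall>b v. word G b v \<and> b \<ge> 1 \<and> v - 1 \<in> x \<and> exp (C * (real a * real b)) < real p \<longrightarrow> v - 1 \<in> q)" ..
  qed
qed

end

section \<open>Translation to \<open>HOL-Algebra\<close>\<close>

lemma ring_on_simps [simp]:
  "carrier (ring_on S) = S" "x \<otimes>\<^bsub>ring_on S\<^esub> y = x * y" "x \<oplus>\<^bsub>ring_on S\<^esub> y = x + y"
  "\<one>\<^bsub>ring_on S\<^esub> = 1" "\<zero>\<^bsub>ring_on S\<^esub> = 0"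
  by (simp_all add: ring_on_def)

lemma cring_ring_on:
  fixes S :: "'a::comm_ring_1 set"
  assumes S: "subring_set S" shows "cring (ring_on S)"
proof (rule cringI)
  show "abelian_group (ring_on S)"
  proof (rule abelian_groupI)
    fix x assume "x \<in> carrier (ring_on S)"
    then show "\<exists>y\<in>carrier (ring_on S). y \<oplus>\<^bsub>ring_on S\<^esub> x = \<zero>\<^bsub>ring_on S\<^esub>"
      using subring_set_uminus[OF S, of x] by (intro bexI[of _ "- x"]) auto
  qed (auto simp: subring_set_0[OF S] subring_set_add[OF S] algebra_simps)
  show "comm_monoid (ring_on S)"
    by unfold_locales (auto simp: subring_set_1[OF S] subring_set_mult[OF S] algebra_simps)
qed (auto simp: algebra_simps)

lemma subring_set_ring_on:
  fixes S :: "'a::comm_ring_1 set"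
  assumes "ring (ring_on S)" shows "subring_set S"
proof -
  interpret ring "ring_on S" by (rule assms)
  have um: "- x \<in> S" if x: "x \<in> S" for x
  proof -
    obtain y where "y \<in> S" "y + x = 0" using add.l_inv_ex[of x] x by auto
    then show ?thesis by (metis add_eq_0_iff2)
  qed
  show ?thesis
  proof (rule subring_setI)
    show "1 \<in> S" using one_closed by simp
    show "x * y \<in> S" if "x \<in> S" "y \<in> S" for x y using m_closed[of x y] that by simp
    show "x - y \<in> S" if "x \<in> S" "y \<in> S" for x y using a_closed[of x "- y"] um that by simp
  qed
qed

lemma ideal_ring_on:
  fixes S :: "'a::comm_ring_1 set"
  assumes S: "subring_set S" shows "ideal J (ring_on S) \<longleftrightarrow> ideal_set S J"
proof
  assume "ideal J (ring_on S)"
  then interpret ideal J "ring_on S" .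
  show "ideal_set S J"
    using a_subset additive_subgroup.zero_closed[OF is_additive_subgroup]
      additive_subgroup.a_closed[OF is_additive_subgroup] I_l_closed
    by (auto simp: ideal_set_def)
next
  assume J: "ideal_set S J"
  interpret cring "ring_on S" by (rule cring_ring_on[OF S])
  have inv: "\<ominus>\<^bsub>ring_on S\<^esub> x = - x" if "x \<in> S" for x
    using that subring_set_uminus[OF S] by (intro add.inv_equality) auto
  show "ideal J (ring_on S)"
  proof (rule idealI)
    show "subgroup J (add_monoid (ring_on S))"
    proof (rule add.subgroupI)
      show "J \<noteq> {}" using ideal_set_0[OF J] by auto
    qed (use ideal_set_subset[OF J] ideal_set_add[OF J] ideal_set_uminus[OF S J] inv in
        \<open>auto simp: subset_iff a_inv_def[symmetric]\<close>)
  qed (use J ring_axioms in \<open>auto intro: ideal_set_lmult ideal_set_rmult\<close>)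
qed

lemma primeideal_ring_on:
  fixes S :: "'a::comm_ring_1 set"
  assumes S: "subring_set S" shows "primeideal q (ring_on S) \<longleftrightarrow> prime_set S q"
proof
  assume "primeideal q (ring_on S)"
  then interpret primeideal q "ring_on S" .
  have "ideal_set S q" using ideal_ring_on[OF S] is_ideal by simp
  moreover from this have "1 \<notin> q" using I_notcarr ideal_set_rmult[of S q _ 1] ideal_set_subset[of S q] by fastforce
  ultimately show "prime_set S q" using I_prime by (auto simp: prime_set_def)
next
  assume q: "prime_set S q"
  show "primeideal q (ring_on S)"
  proof (rule primeidealI)
    show "ideal q (ring_on S)" using ideal_ring_on[OF S] prime_set_ideal[OF q] by simp
    show "cring (ring_on S)" by (rule cring_ring_on[OF S])
    show "carrier (ring_on S) \<noteq> q" using prime_set_1[OF q] subring_set_1[OF S] by auto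
  qed (use prime_setD[OF q] in auto)
qed

lemma genideal_ring_on_UNIV: "Idl\<^bsub>ring_on UNIV\<^esub> G = \<Inter>{J. ideal_set UNIV J \<and> G \<subseteq> J}"
  by (simp add: genideal_def ideal_ring_on)

lemma ideal_set_genideal: "ideal_set UNIV (Idl\<^bsub>ring_on UNIV\<^esub> G)"
  unfolding genideal_ring_on_UNIV by (auto simp: ideal_set_def)

lemma genideal_superset: "G \<subseteq> Idl\<^bsub>ring_on UNIV\<^esub> G"
  unfolding genideal_ring_on_UNIV by blast

lemma genideal_least: "ideal_set UNIV J \<Longrightarrow> G \<subseteq> J \<Longrightarrow> Idl\<^bsub>ring_on UNIV\<^esub> G \<subseteq> J"
  unfolding genideal_ring_on_UNIV by blast

lemma ideal_set_vimage:
  assumes f: "comm_ring_hom f" and J: "ideal_set UNIV J"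
  shows "ideal_set UNIV {x. f x \<in> J}"
proof -
  interpret comm_ring_hom f by (rule f)
  show ?thesis using J by (auto simp: ideal_set_def hom_distribs)
qed

lemma hom_genideal:
  assumes f: "comm_ring_hom f" and J: "ideal_set UNIV J" and G: "f ` G \<subseteq> J"
  shows "f ` (Idl\<^bsub>ring_on UNIV\<^esub> G) \<subseteq> J"
  using genideal_least[OF ideal_set_vimage[OF f J], of G] G by auto

lemma spec_ring_on: "subring_set S \<Longrightarrow> spec (ring_on S) = {q. prime_set S q}"
  by (simp add: spec_def primeideal_ring_on)

lemma zero_locus_ring_on: "subring_set S \<Longrightarrow> zero_locus (ring_on S) T = {q. prime_set S q \<and> T \<subseteq> q}"
  by (auto simp: zero_locus_def spec_ring_on)

lemma topspace_zariski:
  assumes S: "subring_set S" shows "topspace (zariski (ring_on S)) = spec (ring_on S)"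
proof -
  have "spec (ring_on S) - zero_locus (ring_on S) {1} = spec (ring_on S)"
    by (auto simp: zero_locus_ring_on[OF S] prime_set_1)
  then have "openin (zariski (ring_on S)) (spec (ring_on S))"
    unfolding openin_zariski using subring_set_1[OF S] by (intro exI[of _ "{1}"]) auto
  then show ?thesis by (auto simp: topspace_def openin_zariski)
qed

lemma closedin_zariski:
  assumes S: "subring_set S"
  shows "closedin (zariski (ring_on S)) Z \<longleftrightarrow> (\<exists>T\<subseteq>S. Z = zero_locus (ring_on S) T)"
proof
  assume "closedin (zariski (ring_on S)) Z"
  then obtain T where Z: "Z \<subseteq> spec (ring_on S)" and T: "T \<subseteq> S" "spec (ring_on S) - Z = spec (ring_on S) - zero_locus (ring_on S) T"
    unfolding closedin_def topspace_zariski[OF S] openin_zariski by auto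
  have "zero_locus (ring_on S) T \<subseteq> spec (ring_on S)" by (auto simp: zero_locus_def)
  then have "Z = zero_locus (ring_on S) T" using Z T(2) by blast
  then show "\<exists>T\<subseteq>S. Z = zero_locus (ring_on S) T" using T(1) by blast
next
  assume "\<exists>T\<subseteq>S. Z = zero_locus (ring_on S) T"
  then show "closedin (zariski (ring_on S)) Z"
    unfolding closedin_def topspace_zariski[OF S] openin_zariski by (auto simp: zero_locus_def)
qed

text \<open>q is the generic point of its zero locus: a closed set that contains q contains the
  whole locus.\<close>

lemma irreducible_closedin_prime:
  assumes S: "subring_set S" and q: "prime_set S q" "J \<subseteq> q"
  shows "irreducible_closedin (subtopology (zariski (ring_on S)) (zero_locus (ring_on S) J)) (zero_locus (ring_on S) q)"
  unfolding irreducible_closedin_def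
proof (intro conjI allI impI)
  let ?X = "zariski (ring_on S)" and ?V = "zero_locus (ring_on S)"
  have "?V q = ?V q \<inter> ?V J" using q(2) by (auto simp: zero_locus_ring_on[OF S])
  moreover have "closedin ?X (?V q)" unfolding closedin_zariski[OF S] using prime_set_subset[OF q(1)] by blast
  ultimately show "closedin (subtopology ?X (?V J)) (?V q)" unfolding closedin_subtopology by blast
  have qV: "q \<in> ?V q" using q by (simp add: zero_locus_ring_on[OF S])
  then show "?V q \<noteq> {}" by blast
  fix A B
  assume *: "closedin (subtopology ?X (?V J)) A \<and> closedin (subtopology ?X (?V J)) B \<and> ?V q \<subseteq> A \<union> B"
  have main: "?V q \<subseteq> A" if A: "closedin (subtopology ?X (?V J)) A" "q \<in> A" for A
  proof -
    obtain T where "A = ?V T \<inter> ?V J" using A(1) unfolding closedin_subtopology closedin_zariski[OF S] by blast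
    then show ?thesis using A(2) by (auto simp: zero_locus_ring_on[OF S])
  qed
  show "?V q \<subseteq> A \<or> ?V q \<subseteq> B" using main[of A] main[of B] * qV by blast
qed

text \<open>The generic point is found as the intersection of all points of W; it is prime because W
  is covered by the loci of x and of y as soon as x y lies in that intersection.\<close>

lemma irreducible_closedin_imp_prime:
  assumes S: "subring_set S" and W: "irreducible_closedin (zariski (ring_on S)) W"
  obtains q where "prime_set S q" "W = zero_locus (ring_on S) q"
proof -
  let ?V = "zero_locus (ring_on S)"
  obtain T where T: "T \<subseteq> S" "W = ?V T" using W unfolding irreducible_closedin_def closedin_zariski[OF S] by blast
  have ne: "W \<noteq> {}" using W by (simp add: irreducible_closedin_def)
  define q where "q = \<Inter>W"
  have pr: "prime_set S P" if "P \<in> W" for P using that T by (simp add: zero_locus_ring_on[OF S])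
  obtain P0 where P0: "P0 \<in> W" using ne by blast
  have i: "ideal_set S P" if "P \<in> W" for P using pr[OF that] by (rule prime_set_ideal)
  have "prime_set S q"
    unfolding prime_set_def ideal_set_def
  proof (intro conjI ballI impI)
    show "q \<subseteq> S" using prime_set_subset[OF pr[OF P0]] P0 unfolding q_def by blast
    show "0 \<in> q" using ideal_set_0[OF i] unfolding q_def by blast
    show "x + y \<in> q" if "x \<in> q" "y \<in> q" for x y using ideal_set_add[OF i] that unfolding q_def by blast
    show "s * x \<in> q" if "s \<in> S" "x \<in> q" for s x using ideal_set_lmult[OF i] that unfolding q_def by blast
    show "1 \<notin> q" using prime_set_1[OF pr[OF P0]] P0 unfolding q_def by blast
    fix x y assume xy: "x \<in> S" "y \<in> S" "x * y \<in> q"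
    have "W \<subseteq> ?V {x} \<union> ?V {y}"
    proof
      fix P assume P: "P \<in> W"
      then have "x * y \<in> P" using xy unfolding q_def by blast
      then have "x \<in> P \<or> y \<in> P" by (rule prime_setD[OF pr[OF P] xy(1,2)])
      then show "P \<in> ?V {x} \<union> ?V {y}" using pr[OF P] by (auto simp: zero_locus_ring_on[OF S])
    qed
    moreover have "closedin (zariski (ring_on S)) (?V {x})" "closedin (zariski (ring_on S)) (?V {y})"
      unfolding closedin_zariski[OF S] using xy by blast+
    ultimately have "W \<subseteq> ?V {x} \<or> W \<subseteq> ?V {y}" using W unfolding irreducible_closedin_def by blast
    then show "x \<in> q \<or> y \<in> q" unfolding q_def by (auto simp: zero_locus_ring_on[OF S])
  qed
  moreover have "W = ?V q"
  proof
    show "W \<subseteq> ?V q" using pr by (auto simp: zero_locus_ring_on[OF S] q_def)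
    have "T \<subseteq> q" unfolding q_def T(2) by (auto simp: zero_locus_ring_on[OF S])
    then show "?V q \<subseteq> W" unfolding T(2) by (auto simp: zero_locus_ring_on[OF S])
  qed
  ultimately show thesis by (rule that)
qed

lemma zero_locus_strict:
  assumes "subring_set S" "prime_set S q" "prime_set S q'" "q' \<subset> q"
  shows "zero_locus (ring_on S) q \<subset> zero_locus (ring_on S) q'"
  using assms by (auto simp: zero_locus_ring_on)

text \<open>Chains of closed sets increase, so the primes are indexed downwards, from the largest,
  \<open>q 0\<close>, to the one next to J.\<close>

lemma krull_dim_prime_chain:
  assumes S: "subring_set S" and q: "\<And>i. i \<le> k \<Longrightarrow> prime_set S (q i)" "\<And>i. i < k \<Longrightarrow> q (Suc i) \<subset> q i" and J: "J \<subseteq> q k"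
  shows "krull_dim (subtopology (zariski (ring_on S)) (zero_locus (ring_on S) J)) \<ge> enat k"
proof -
  have Jq: "J \<subseteq> q i" if "i \<le> k" for i
    using that
  proof (induction "k - i" arbitrary: i)
    case 0
    then show ?case using J by simp
  next
    case (Suc m)
    then have "J \<subseteq> q (Suc i)" by simp
    also have "q (Suc i) \<subset> q i" using Suc by (intro q(2)) simp
    finally show ?case by blast
  qed
  have "irreducible_chain (subtopology (zariski (ring_on S)) (zero_locus (ring_on S) J)) k (\<lambda>i. zero_locus (ring_on S) (q i))"
    unfolding irreducible_chain_def
  proof (intro conjI allI impI)
    fix i assume "i < k"
    then show "zero_locus (ring_on S) (q i) \<subset> zero_locus (ring_on S) (q (Suc i))"
      using q by (intro zero_locus_strict[OF S]) auto
  qed (intro irreducible_closedin_prime[OF S] q Jq)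
  then show ?thesis unfolding krull_dim_def by (intro Sup_upper) blast
qed

text \<open>Codimension is an infimum over all irreducible closed subsets, so a descending chain of
  k steps is required below every prime that contains J.\<close>

lemma codim_prime_chain:
  assumes S: "subring_set S"
    and q: "\<And>Q. prime_set S Q \<Longrightarrow> J \<subseteq> Q \<Longrightarrow> \<exists>q. q 0 = Q \<and> (\<forall>i\<le>k. prime_set S (q i)) \<and> (\<forall>i<k. q (Suc i) \<subset> q i)"
  shows "codim (zariski (ring_on S)) (zero_locus (ring_on S) J) \<ge> enat k"
  unfolding codim_def
proof (rule INF_greatest)
  fix W assume "W \<in> {W. irreducible_closedin (zariski (ring_on S)) W \<and> W \<subseteq> zero_locus (ring_on S) J}"
  then have W: "irreducible_closedin (zariski (ring_on S)) W" "W \<subseteq> zero_locus (ring_on S) J" by auto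
  obtain Q where Q: "prime_set S Q" "W = zero_locus (ring_on S) Q" by (rule irreducible_closedin_imp_prime[OF S W(1)])
  have "Q \<in> W" using Q by (simp add: zero_locus_ring_on[OF S])
  then have "J \<subseteq> Q" using W(2) by (auto simp: zero_locus_ring_on[OF S])
  then obtain q where q: "q 0 = Q" "\<And>i. i \<le> k \<Longrightarrow> prime_set S (q i)" "\<And>i. i < k \<Longrightarrow> q (Suc i) \<subset> q i" using q[OF Q(1)] by blast
  have top: "subtopology (zariski (ring_on S)) (zero_locus (ring_on S) {}) = zariski (ring_on S)"
    using subtopology_topspace[of "zariski (ring_on S)"] by (simp add: topspace_zariski[OF S] zero_locus_def)
  have "irreducible_chain (zariski (ring_on S)) k (\<lambda>i. zero_locus (ring_on S) (q i))"
    unfolding irreducible_chain_def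
  proof (intro conjI allI impI)
    fix i assume "i \<le> k"
    then show "irreducible_closedin (zariski (ring_on S)) (zero_locus (ring_on S) (q i))"
      using irreducible_closedin_prime[OF S q(2), of i "{}"] by (simp add: top)
  next
    fix i assume "i < k"
    then show "zero_locus (ring_on S) (q i) \<subset> zero_locus (ring_on S) (q (Suc i))"
      using q by (intro zero_locus_strict[OF S]) auto
  qed
  then show "enat k \<le> Sup {enat k |k. \<exists>Z. irreducible_chain (zariski (ring_on S)) k Z \<and> Z 0 = W}"
    by (intro Sup_upper CollectI exI[of _ k] conjI refl exI[of _ "\<lambda>i. zero_locus (ring_on S) (q i)"]) (simp_all add: q(1) Q(2))
qed

lemma closure_of_point:
  assumes S: "subring_set S" and q: "prime_set S q" "J \<subseteq> q" and x: "prime_set S x" "q \<subseteq> x"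
  shows "x \<in> subtopology (zariski (ring_on S)) (zero_locus (ring_on S) J) closure_of {q}"
  unfolding in_closure_of
proof (intro conjI allI impI)
  have "x \<in> zero_locus (ring_on S) J" "q \<in> zero_locus (ring_on S) J" using q x by (auto simp: zero_locus_ring_on[OF S])
  then show "x \<in> topspace (subtopology (zariski (ring_on S)) (zero_locus (ring_on S) J))"
    by (auto simp: topspace_subtopology topspace_zariski[OF S] zero_locus_def)
  fix T assume "x \<in> T \<and> openin (subtopology (zariski (ring_on S)) (zero_locus (ring_on S) J)) T"
  then obtain U where U: "x \<in> U" "T = U \<inter> zero_locus (ring_on S) J" "openin (zariski (ring_on S)) U"
    unfolding openin_subtopology by blast
  obtain Y where Y: "U = spec (ring_on S) - zero_locus (ring_on S) Y" using U(3) unfolding openin_zariski by blast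
  have "q \<in> U" using U(1) q x unfolding Y by (auto simp: zero_locus_ring_on[OF S] spec_ring_on[OF S])
  then show "\<exists>y. y \<in> {q} \<and> y \<in> T" using \<open>q \<in> zero_locus (ring_on S) J\<close> U(2) by blast
qed

section \<open>Group algebras\<close>

abbreviation mon :: "'m \<Rightarrow> 'm \<Rightarrow>\<^sub>0 'k::comm_ring_1" where
  "mon m \<equiv> Poly_Mapping.single m 1"

lemma poly_mapping_expand: "f = (\<Sum>m\<in>Poly_Mapping.keys f. Poly_Mapping.single m (Poly_Mapping.lookup f m))"
proof (rule poly_mapping_eqI)
  fix k
  have "Poly_Mapping.lookup (\<Sum>m\<in>Poly_Mapping.keys f. Poly_Mapping.single m (Poly_Mapping.lookup f m)) k
    = (\<Sum>m\<in>Poly_Mapping.keys f. if m = k then Poly_Mapping.lookup f k else 0)"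
    unfolding lookup_sum by (intro sum.cong) (auto simp: lookup_single when_def)
  also have "\<dots> = Poly_Mapping.lookup f k" by (auto simp: in_keys_iff)
  finally show "Poly_Mapping.lookup f k = Poly_Mapping.lookup (\<Sum>m\<in>Poly_Mapping.keys f. Poly_Mapping.single m (Poly_Mapping.lookup f m)) k" by simp
qed

lemma poly_mapping_single_induct:
  fixes f :: "'m \<Rightarrow>\<^sub>0 'k::comm_ring_1"
  assumes "P 0" "\<And>m a. P (Poly_Mapping.single m a)" "\<And>f g. P f \<Longrightarrow> P g \<Longrightarrow> P (f + g)"
  shows "P f"
proof -
  have "P (\<Sum>m\<in>A. Poly_Mapping.single m (Poly_Mapping.lookup f m))" for A
    using assms by (induction A rule: infinite_finite_induct) auto
  then show ?thesis using poly_mapping_expand[of f] by metis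
qed

text \<open>h receives the exponent together with the coefficient, so that one construction yields
  the monomial maps, the sum of the coefficients and the grading homomorphism used for
  homogenization.\<close>

definition extend :: "('m \<Rightarrow> 'k \<Rightarrow> 'b) \<Rightarrow> ('m \<Rightarrow>\<^sub>0 'k::comm_ring_1) \<Rightarrow> 'b::comm_ring_1" where
  "extend h f = (\<Sum>m\<in>Poly_Mapping.keys f. h m (Poly_Mapping.lookup f m))"

locale monomial_extension =
  fixes h :: "'m::comm_monoid_add \<Rightarrow> 'k::comm_ring_1 \<Rightarrow> 'b::comm_ring_1"
  assumes h_add: "h m (a + b) = h m a + h m b"
    and h_mult: "h (m + l) (a * b) = h m a * h l b"
    and h_one: "h 0 1 = 1"
begin

lemma h_zero [simp]: "h m 0 = 0"
  using h_add[of m 0 0] by simp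

lemma extend_superset:
  assumes "finite A" "Poly_Mapping.keys f \<subseteq> A"
  shows "extend h f = (\<Sum>m\<in>A. h m (Poly_Mapping.lookup f m))"
  unfolding extend_def using assms by (intro sum.mono_neutral_left) (auto simp: in_keys_iff)

lemma extend_single [simp]: "extend h (Poly_Mapping.single m a) = h m a"
  by (subst extend_superset[of "{m}"]) auto

lemma extend_zero [simp]: "extend h 0 = 0"
  by (simp add: extend_def)

lemma extend_add: "extend h (f + g) = extend h f + extend h g"
proof -
  define A where "A = Poly_Mapping.keys f \<union> Poly_Mapping.keys g"
  have A: "finite A" "Poly_Mapping.keys f \<subseteq> A" "Poly_Mapping.keys g \<subseteq> A" "Poly_Mapping.keys (f + g) \<subseteq> A"
    using keys_add[of f g] by (auto simp: A_def)
  show ?thesis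
    by (simp add: extend_superset[OF A(1)] A lookup_add h_add sum.distrib)
qed

lemma extend_mult: "extend h (f * g) = extend h f * extend h g"
proof (induction f rule: poly_mapping_single_induct)
  case (2 m a)
  show ?case
    by (induction g rule: poly_mapping_single_induct)
       (auto simp: mult_single h_mult extend_add distrib_left)
qed (auto simp: extend_add distrib_right)

lemma comm_ring_hom_extend: "comm_ring_hom (extend h)"
proof
  show "extend h 1 = 1" using extend_single[of 0 1] by (simp add: h_one)
qed (auto simp: extend_add extend_mult)

end

lemma monomial_extension_monomial_map:
  assumes "\<And>m l. \<phi> (m + l) = \<phi> m + \<phi> l" "\<phi> 0 = 0"
  shows "monomial_extension (\<lambda>m (a::'k::comm_ring_1). Poly_Mapping.single (\<phi> m) a)"
  by unfold_locales (auto simp: single_add mult_single assms)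

lemma monomial_map_extend: "monomial_map \<phi> = extend (\<lambda>m a. Poly_Mapping.single (\<phi> m) a)"
  by (simp add: fun_eq_iff monomial_map_def extend_def)

lemma monomial_map_mon:
  assumes "\<And>m l. \<phi> (m + l) = \<phi> m + \<phi> l" "\<phi> 0 = 0"
  shows "comm_ring_hom (monomial_map \<phi> :: ('m::comm_monoid_add \<Rightarrow>\<^sub>0 'k::comm_ring_1) \<Rightarrow> ('l::comm_monoid_add \<Rightarrow>\<^sub>0 'k))"
    and "monomial_map \<phi> (mon m :: 'm \<Rightarrow>\<^sub>0 'k) = mon (\<phi> m)"
proof -
  interpret monomial_extension "\<lambda>m (a::'k). Poly_Mapping.single (\<phi> m) a"
    by (rule monomial_extension_monomial_map[OF assms])
  show "comm_ring_hom (monomial_map \<phi> :: ('m::comm_monoid_add \<Rightarrow>\<^sub>0 'k::comm_ring_1) \<Rightarrow> ('l::comm_monoid_add \<Rightarrow>\<^sub>0 'k))"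
    unfolding monomial_map_extend by (rule comm_ring_hom_extend)
  show "monomial_map \<phi> (mon m :: 'm \<Rightarrow>\<^sub>0 'k) = mon (\<phi> m)" unfolding monomial_map_extend by simp
qed

text \<open>Evaluation at the unit section, where all monomials become 1.\<close>

definition coeff_sum :: "('m::comm_monoid_add \<Rightarrow>\<^sub>0 'k::comm_ring_1) \<Rightarrow> 'k" where
  "coeff_sum = extend (\<lambda>m a. a)"

lemma monomial_extension_coeff_sum: "monomial_extension (\<lambda>(m::'m::comm_monoid_add) (a::'k::comm_ring_1). a)"
  by unfold_locales (rule refl)+

lemma coeff_sum_altdef: "coeff_sum f = (\<Sum>m\<in>Poly_Mapping.keys f. Poly_Mapping.lookup f m)"
  unfolding coeff_sum_def extend_def ..

lemma coeff_sum_single: "coeff_sum (Poly_Mapping.single m a) = a"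
  unfolding coeff_sum_def by (rule monomial_extension.extend_single[OF monomial_extension_coeff_sum])

lemma comm_ring_hom_coeff_sum: "comm_ring_hom coeff_sum"
  unfolding coeff_sum_def by (rule monomial_extension.comm_ring_hom_extend[OF monomial_extension_coeff_sum])

interpretation coeff_sum: comm_ring_hom coeff_sum
  by (rule comm_ring_hom_coeff_sum)

lemma mon_notin_prime: "prime_set S q \<Longrightarrow> mon (- m) \<in> S \<Longrightarrow> mon (m::'m::ab_group_add) \<notin> q"
  using ideal_set_rmult[OF prime_set_ideal, of S q "mon (- m)" "mon m"] prime_set_1[of S q] by (auto simp: mult_single)

section \<open>Homogenization of primes\<close>

lemma lookup_single_mult:
  fixes F :: "'m::ab_group_add \<Rightarrow>\<^sub>0 'a::comm_ring_1"
  shows "Poly_Mapping.lookup (Poly_Mapping.single k a * F) c = a * Poly_Mapping.lookup F (c - k)"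
  by (induction F rule: poly_mapping_single_induct)
     (auto simp: mult_single lookup_single lookup_add distrib_left when_def algebra_simps)

text \<open>The extension of a prime to Laurent polynomials in one variable is prime: the top terms
  that are nonzero modulo Q multiply to a nonzero term.\<close>

lemma prime_set_coefficients:
  fixes Q :: "'a::comm_ring_1 set"
  assumes Q: "prime_set UNIV Q"
  shows "prime_set UNIV {F :: int \<Rightarrow>\<^sub>0 'a. \<forall>c. Poly_Mapping.lookup F c \<in> Q}"
proof -
  note Qi = prime_set_ideal[OF Q]
  define P where "P = {F :: int \<Rightarrow>\<^sub>0 'a. \<forall>c. Poly_Mapping.lookup F c \<in> Q}"
  have Pi: "ideal_set UNIV P"
    unfolding ideal_set_def
  proof (intro conjI ballI)
    fix s x :: "int \<Rightarrow>\<^sub>0 'a" assume x: "x \<in> P"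
    show "s * x \<in> P"
    proof (induction s rule: poly_mapping_single_induct)
      case 1 then show ?case using ideal_set_0[OF Qi] by (simp add: P_def)
    next
      case (2 m a)
      then show ?case using x ideal_set_lmult[OF Qi] by (simp add: P_def lookup_single_mult)
    next
      case (3 f g)
      then show ?case using ideal_set_add[OF Qi] by (simp add: P_def lookup_add distrib_right)
    qed
  qed (use ideal_set_0[OF Qi] ideal_set_add[OF Qi] in \<open>auto simp: P_def lookup_add\<close>)
  have top: "\<exists>c a H. a \<notin> Q \<and> F - (Poly_Mapping.single c a + H) \<in> P \<and> (\<forall>k\<in>Poly_Mapping.keys H. k < c)"
    if F: "F \<notin> P" for F
  proof -
    define A where "A = {c. Poly_Mapping.lookup F c \<notin> Q}"
    have "A \<subseteq> Poly_Mapping.keys F" using ideal_set_0[OF Qi] by (auto simp: A_def in_keys_iff)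
    then have A: "finite A" "A \<noteq> {}" using F finite_subset[OF _ finite_keys] by (auto simp: A_def P_def)
    define c where "c = Max A"
    have c: "Poly_Mapping.lookup F c \<notin> Q" using Max_in[OF A] by (simp add: c_def A_def)
    have hi: "Poly_Mapping.lookup F k \<in> Q" if "k > c" for k
      using Max_ge[OF A(1), of k] that by (force simp: c_def A_def)
    define H where "H = (\<Sum>k\<in>{k\<in>Poly_Mapping.keys F. k < c}. Poly_Mapping.single k (Poly_Mapping.lookup F k))"
    have lH: "Poly_Mapping.lookup H k = (if k < c then Poly_Mapping.lookup F k else 0)" for k
    proof -
      have "Poly_Mapping.lookup H k = (\<Sum>m\<in>{k\<in>Poly_Mapping.keys F. k < c}. if m = k then Poly_Mapping.lookup F k else 0)"
        unfolding H_def lookup_sum by (intro sum.cong) (auto simp: lookup_single when_def)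
      then show ?thesis by (auto simp: in_keys_iff)
    qed
    have "F - (Poly_Mapping.single c (Poly_Mapping.lookup F c) + H) \<in> P"
      using hi ideal_set_0[OF Qi] by (auto simp: P_def lookup_minus lookup_add lookup_single lH when_def)
    moreover have "\<forall>k\<in>Poly_Mapping.keys H. k < c" by (auto simp: in_keys_iff lH split: if_splits)
    ultimately show ?thesis using c by blast
  qed
  have "prime_set UNIV P"
    unfolding prime_set_def
  proof (intro conjI ballI impI)
    show "1 \<notin> P" using prime_set_1[OF Q] by (auto simp: P_def lookup_one intro!: exI[of _ 0])
    fix F G :: "int \<Rightarrow>\<^sub>0 'a" assume FG: "F * G \<in> P"
    show "F \<in> P \<or> G \<in> P"
    proof (rule ccontr)
      assume "\<not> ?thesis"
      then obtain c a H d b K where F: "a \<notin> Q" "F - (Poly_Mapping.single c a + H) \<in> P" "\<forall>k\<in>Poly_Mapping.keys H. k < c"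
        and G: "b \<notin> Q" "G - (Poly_Mapping.single d b + K) \<in> P" "\<forall>k\<in>Poly_Mapping.keys K. k < d"
        using top by metis
      define F' G' where "F' = Poly_Mapping.single c a + H" and "G' = Poly_Mapping.single d b + K"
      have "F' * G' = F * G - (F - F') * G - F' * (G - G')" by (simp add: algebra_simps)
      also have "\<dots> \<in> P"
        by (rule ideal_set_diff[OF subring_set_UNIV Pi ideal_set_diff[OF subring_set_UNIV Pi FG
              ideal_set_rmult[OF Pi UNIV_I F(2)[folded F'_def]]] ideal_set_lmult[OF Pi UNIV_I G(2)[folded G'_def]]])
      finally have "Poly_Mapping.lookup (F' * G') (c + d) \<in> Q" by (simp add: P_def)
      moreover have "Poly_Mapping.lookup (F' * G') (c + d) = a * b"
      proof -
        have K: "Poly_Mapping.lookup K d = 0" using G(3) by (auto simp: in_keys_iff)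
        have "c + d \<notin> Poly_Mapping.keys (H * G')"
        proof
          assume "c + d \<in> Poly_Mapping.keys (H * G')"
          then obtain k l where kl: "c + d = k + l" "k \<in> Poly_Mapping.keys H" "l \<in> Poly_Mapping.keys G'"
            using keys_mult[of H G'] by auto
          have "l \<le> d" using kl(3) keys_add[of "Poly_Mapping.single d b" K] G(3) by (fastforce simp: G'_def split: if_splits)
          moreover have "k < c" using kl(2) F(3) by blast
          ultimately show False using kl(1) by simp
        qed
        then have "Poly_Mapping.lookup (H * G') (c + d) = 0" by (simp add: in_keys_iff)
        then show ?thesis
          by (simp add: F'_def distrib_right lookup_add lookup_single_mult) (simp add: G'_def lookup_add K)
      qed
      ultimately show False using prime_setD[OF Q, of a b] F(1) G(1) by simp
    qed
  qed (rule Pi)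
  then show ?thesis by (simp add: P_def)
qed

text \<open>\<open>Q'\<close> is the largest ideal contained in \<open>Q\<close> that is graded by \<open>\<phi>\<close>.\<close>

lemma homogenized_prime:
  fixes \<phi> :: "'m::ab_group_add \<Rightarrow> int" and Q :: "('m \<Rightarrow>\<^sub>0 'k::comm_ring_1) set"
  assumes \<phi>: "\<And>m l. \<phi> (m + l) = \<phi> m + \<phi> l" and Q: "prime_set UNIV Q"
  obtains Q' where "prime_set UNIV Q'" "Q' \<subseteq> Q"
    "\<And>m. \<phi> m = 0 \<Longrightarrow> mon m - 1 \<in> Q \<Longrightarrow> mon m - 1 \<in> Q'"
    "\<And>m. \<phi> m \<noteq> 0 \<Longrightarrow> mon m - 1 \<notin> Q'"
proof -
  note Qi = prime_set_ideal[OF Q]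
  have \<phi>0: "\<phi> 0 = 0" using \<phi>[of 0 0] by simp
  \<comment> \<open>With an auxiliary variable t, X^m is sent to t^(phi m) X^m. The graded pieces of
    f are the coefficients of its image, and Q' asks that all of them lie in Q.\<close>
  define h where "h m a = Poly_Mapping.single (\<phi> m) (Poly_Mapping.single m a)" for m and a :: 'k
  interpret monomial_extension h
    by unfold_locales (auto simp: h_def single_add mult_single \<phi> \<phi>0)
  define Q' where "Q' = {f. extend h f \<in> {F. \<forall>c. Poly_Mapping.lookup F c \<in> Q}}"
  have Q': "prime_set UNIV Q'"
    unfolding Q'_def by (rule prime_set_vimage[OF comm_ring_hom_extend prime_set_coefficients[OF Q]])
  show thesis
  proof (rule that[OF Q'])
    show "Q' \<subseteq> Q"
    proof
      fix f assume f: "f \<in> Q'"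
      \<comment> \<open>Setting t = 1 recovers f as the sum of its graded pieces.\<close>
      have ch: "coeff_sum (h m a) = Poly_Mapping.single m a" for m a by (simp only: h_def coeff_sum_single)
      have "coeff_sum (extend h g) = g" for g
        by (induction g rule: poly_mapping_single_induct)
           (simp_all only: extend_zero coeff_sum.hom_zero extend_single ch extend_add coeff_sum.hom_add)
      then have "f = coeff_sum (extend h f)" by (rule sym)
      also have "\<dots> \<in> Q" using f unfolding Q'_def coeff_sum_altdef by (intro ideal_set_sum[OF Qi]) simp
      finally show "f \<in> Q" .
    qed
    have em: "extend h (mon m - 1) = Poly_Mapping.single (\<phi> m) (mon m) - 1" for m
    proof -
      interpret c: comm_ring_hom "extend h" by (rule comm_ring_hom_extend)
      show ?thesis by (simp add: c.hom_minus h_def)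
    qed
    fix m
    show "mon m - 1 \<in> Q'" if "\<phi> m = 0" "mon m - 1 \<in> Q"
      using that ideal_set_0[OF Qi] by (auto simp: Q'_def em lookup_minus lookup_single lookup_one when_def)
    show "mon m - 1 \<notin> Q'" if "\<phi> m \<noteq> 0"
    proof
      assume "mon m - 1 \<in> Q'"
      then have "mon m \<in> Q" using that by (auto simp: Q'_def em lookup_minus lookup_single lookup_one when_def dest: spec[of _ "\<phi> m"])
      then show False using mon_notin_prime[OF Q] by blast
    qed
  qed
qed

section \<open>Subgroups cut out by monomials\<close>

definition subgroup_ideal :: "(int^'n::finite) set \<Rightarrow> ((int^'n) \<Rightarrow>\<^sub>0 'k::field) set" where
  "subgroup_ideal M = Idl\<^bsub>laurent UNIV\<^esub> ((\<lambda>m. mon m - 1) ` M)"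

lemma laurent_UNIV: "laurent UNIV = ring_on UNIV"
  by (simp add: laurent_def)

text \<open>Counit, comultiplication and inversion are ring homomorphisms, so the three conditions
  need checking only on the generators X^m - 1.\<close>

lemma algebraic_subgroup_subgroup_ideal:
  "algebraic_subgroup (subgroup_ideal M :: ((int^'n::finite) \<Rightarrow>\<^sub>0 'k::field) set)"
proof -
  let ?G = "(\<lambda>m. mon m - 1) ` M :: ((int^'n) \<Rightarrow>\<^sub>0 'k) set"
  let ?J = "subgroup_ideal M :: ((int^'n) \<Rightarrow>\<^sub>0 'k) set"
  have J: "?J = Idl\<^bsub>ring_on UNIV\<^esub> ?G" by (simp add: subgroup_ideal_def laurent_UNIV)
  have Ji: "ideal_set UNIV ?J" unfolding J by (rule ideal_set_genideal)
  have GJ: "mon m - 1 \<in> ?J" if "m \<in> M" for m using genideal_superset[of ?G] that unfolding J by blast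
  have 1: "(\<Sum>m\<in>Poly_Mapping.keys f. Poly_Mapping.lookup f m) = 0" if f: "f \<in> ?J" for f :: "(int^'n) \<Rightarrow>\<^sub>0 'k"
  proof -
    have "ideal_set (UNIV :: 'k set) {0}" by (auto simp: ideal_set_def)
    moreover have "coeff_sum (mon m - 1 :: (int^'n) \<Rightarrow>\<^sub>0 'k) = 0" for m
      unfolding coeff_sum.hom_minus coeff_sum_single coeff_sum.hom_one by (rule diff_self)
    then have "coeff_sum ` ?G \<subseteq> {0}" by blast
    ultimately have "coeff_sum ` ?J \<subseteq> {0}" unfolding J by (rule hom_genideal[OF comm_ring_hom_coeff_sum])
    then have "coeff_sum f = 0" using f by blast
    then show ?thesis by (simp only: coeff_sum_altdef)
  qed
  let ?D = "monomial_map (\<lambda>m. (m, m)) :: ((int^'n) \<Rightarrow>\<^sub>0 'k) \<Rightarrow> _"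
  let ?L = "monomial_map (\<lambda>m. (m, 0)) :: ((int^'n) \<Rightarrow>\<^sub>0 'k) \<Rightarrow> ((int^'n) \<times> (int^'n)) \<Rightarrow>\<^sub>0 'k"
  let ?R = "monomial_map (\<lambda>m. (0, m)) :: ((int^'n) \<Rightarrow>\<^sub>0 'k) \<Rightarrow> ((int^'n) \<times> (int^'n)) \<Rightarrow>\<^sub>0 'k"
  let ?K = "Idl\<^bsub>ring_on UNIV\<^esub> (?L ` ?J \<union> ?R ` ?J)"
  have D: "comm_ring_hom ?D" "\<And>m. ?D (mon m) = mon (m, m)"
    and L: "comm_ring_hom ?L" "\<And>m. ?L (mon m) = mon (m, 0)"
    and R: "comm_ring_hom ?R" "\<And>m. ?R (mon m) = mon (0, m)"
    by (rule monomial_map_mon; simp add: zero_prod_def)+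
  interpret D: comm_ring_hom ?D by (rule D)
  interpret L: comm_ring_hom ?L by (rule L)
  interpret R: comm_ring_hom ?R by (rule R)
  have Ki: "ideal_set UNIV ?K" by (rule ideal_set_genideal)
  have "?D ` ?G \<subseteq> ?K"
  proof (intro image_subsetI, elim imageE)
    fix f :: "(int^'n) \<Rightarrow>\<^sub>0 'k" and m assume x: "f = mon m - 1" "m \<in> M"
    have l: "mon (m, 0) - 1 \<in> ?K"
    proof -
      have "?L (mon m - 1) \<in> ?K" using genideal_superset[of "?L ` ?J \<union> ?R ` ?J"] GJ[OF x(2)] by blast
      then show ?thesis by (simp only: L.hom_minus L(2) L.hom_one)
    qed
    have r: "mon (0, m) - 1 \<in> ?K"
    proof -
      have "?R (mon m - 1) \<in> ?K" using genideal_superset[of "?L ` ?J \<union> ?R ` ?J"] GJ[OF x(2)] by blast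
      then show ?thesis by (simp only: R.hom_minus R(2) R.hom_one)
    qed
    have "?D f = mon (0, m) * (mon (m, 0) - 1) + (mon (0, m) - 1)"
      by (simp only: x D.hom_minus D D.hom_one) (simp add: mult_single right_diff_distrib)
    also have "\<dots> \<in> ?K" using l r ideal_set_add[OF Ki] ideal_set_lmult[OF Ki] by blast
    finally show "?D f \<in> ?K" .
  qed
  then have 2: "?D ` ?J \<subseteq> ?K" using hom_genideal[OF D(1) Ki, of ?G] J by simp
  let ?U = "monomial_map uminus :: ((int^'n) \<Rightarrow>\<^sub>0 'k) \<Rightarrow> _"
  have U: "comm_ring_hom ?U" "\<And>m. ?U (mon m) = mon (- m)" by (rule monomial_map_mon; simp)+
  interpret U: comm_ring_hom ?U by (rule U)
  have "?U ` ?G \<subseteq> ?J"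
  proof (intro image_subsetI, elim imageE)
    fix f :: "(int^'n) \<Rightarrow>\<^sub>0 'k" and m assume x: "f = mon m - 1" "m \<in> M"
    have "?U f = - (mon (- m) * (mon m - 1))"
      by (simp only: x U.hom_minus U U.hom_one) (simp add: mult_single right_diff_distrib)
    also have "\<dots> \<in> ?J" using GJ[OF x(2)] by (intro ideal_set_uminus[OF _ Ji] ideal_set_lmult[OF Ji]) auto
    finally show "?U f \<in> ?J" .
  qed
  then have 3: "?U ` ?J \<subseteq> ?J" using hom_genideal[OF U(1) Ji, of ?G] J by simp
  show ?thesis
    unfolding algebraic_subgroup_def laurent_UNIV
    using 1 2 3 Ji by (simp add: ideal_ring_on)
qed

text \<open>Below any prime through the subgroup two homogenizations give two strict steps: the
  first loses X^b - 1 and keeps X^a - 1, the second loses X^a - 1.\<close>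

lemma codim_subgroup_ideal:
  fixes a b :: "int^'n::finite"
  assumes ab: "a $ i * b $ j \<noteq> a $ j * b $ i"
  shows "codim (zariski (laurent UNIV)) (zero_locus (laurent UNIV) (subgroup_ideal {a, b} :: ((int^'n) \<Rightarrow>\<^sub>0 'k::field) set)) \<ge> 2"
proof -
  have "codim (zariski (ring_on UNIV)) (zero_locus (ring_on UNIV) (subgroup_ideal {a, b} :: ((int^'n) \<Rightarrow>\<^sub>0 'k::field) set)) \<ge> enat 2"
  proof (rule codim_prime_chain[OF subring_set_UNIV])
    fix Q :: "((int^'n) \<Rightarrow>\<^sub>0 'k) set" assume Q: "prime_set UNIV Q" "subgroup_ideal {a, b} \<subseteq> Q"
    have aQ: "mon a - 1 \<in> Q" "mon b - 1 \<in> Q"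
      using Q(2) genideal_superset[of "(\<lambda>m. mon m - 1) ` {a, b} :: ((int^'n) \<Rightarrow>\<^sub>0 'k) set"]
      by (auto simp: subgroup_ideal_def laurent_UNIV)
    \<comment> \<open>This linear form vanishes on a, and by the nonvanishing minor not on
      b.\<close>
    define \<phi> where "\<phi> m = a $ i * m $ j - a $ j * m $ i" for m :: "int^'n"
    obtain k where k: "a $ k \<noteq> 0" using ab by (metis mult_zero_left)
    have "\<phi> (m + l) = \<phi> m + \<phi> l" for m l by (simp add: \<phi>_def algebra_simps)
    then obtain Q1 where Q1: "prime_set UNIV Q1" "Q1 \<subseteq> Q" "\<And>m. \<phi> m = 0 \<Longrightarrow> mon m - 1 \<in> Q \<Longrightarrow> mon m - 1 \<in> Q1"
      "\<And>m. \<phi> m \<noteq> 0 \<Longrightarrow> mon m - 1 \<notin> Q1"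
      by (rule homogenized_prime[OF _ Q(1)]) (rule that)
    have aQ1: "mon a - 1 \<in> Q1" "mon b - 1 \<notin> Q1" using Q1(3)[of a] Q1(4)[of b] aQ ab by (auto simp: \<phi>_def mult.commute)
    have "(m + l) $ k = m $ k + l $ k" for m l :: "int^'n" by simp
    then obtain Q2 where Q2: "prime_set UNIV Q2" "Q2 \<subseteq> Q1" "\<And>m. m $ k \<noteq> 0 \<Longrightarrow> mon m - 1 \<notin> Q2"
      by (rule homogenized_prime[OF _ Q1(1)]) (rule that)
    have aQ2: "mon a - 1 \<notin> Q2" using Q2(3)[of a] k by simp
    show "\<exists>q. q 0 = Q \<and> (\<forall>i\<le>2. prime_set UNIV (q i)) \<and> (\<forall>i<2. q (Suc i) \<subset> q i)"
    proof (intro exI[of _ "\<lambda>i. if i = 0 then Q else if i = 1 then Q1 else Q2"] conjI allI impI)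
      fix i :: nat assume "i < 2"
      then have "i = 0 \<or> i = 1" by auto
      then show "(if Suc i = 0 then Q else if Suc i = 1 then Q1 else Q2) \<subset> (if i = 0 then Q else if i = 1 then Q1 else Q2)"
        using Q1(2) Q2(2) aQ(2) aQ1 aQ2 by auto
    qed (auto simp: Q Q1 Q2)
  qed
  then show ?thesis by (simp add: laurent_UNIV numeral_eq_enat)
qed

section \<open>Algebraic dependence from the dimension\<close>

text \<open>The whole ring is finitely generated over the subring of elements that have a nonzero
  integer multiple in the image of e. A homomorphism out of the parameter ring 'b therefore gives a
  prime of that subring, its kernel, and \<open>primes_lift\<close> extends this prime as long as
  one element h is not killed.\<close>

lemma lift_evaluation:
  fixes e :: "'b::idom \<Rightarrow> 'a::comm_ring_1" and I :: "'a set" and xs :: "'a list"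
  assumes e: "comm_ring_hom e" and I: "prime_set UNIV I" and indep: "\<And>b. e b \<in> I \<Longrightarrow> b = 0"
    and Q: "\<And>n::int. n \<noteq> 0 \<Longrightarrow> \<exists>r::'a. of_int n * r = 1"
    and gen: "\<And>T :: 'a set. subring_set T \<Longrightarrow> (\<And>n r. n \<noteq> 0 \<Longrightarrow> of_int n * r = 1 \<Longrightarrow> r \<in> T) \<Longrightarrow> set xs \<subseteq> T \<Longrightarrow> T = UNIV"
  obtains h where "h \<noteq> 0" "\<And>\<phi> :: 'b \<Rightarrow> 'c::{idom,ring_char_0}. comm_ring_hom \<phi> \<Longrightarrow> \<phi> h \<noteq> 0 \<Longrightarrow>
    \<exists>q. prime_set UNIV q \<and> I \<subseteq> q \<and> (\<forall>b. e b \<in> q \<longleftrightarrow> \<phi> b = 0)"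
proof -
  interpret e: comm_ring_hom e by (rule e)
  note Ii = prime_set_ideal[OF I]
  have nI: "of_int n \<notin> I" if n0: "n \<noteq> 0" for n
  proof
    assume nI: "of_int n \<in> I"
    obtain r :: 'a where "of_int n * r = 1" using Q[OF n0] by blast
    then show False using ideal_set_rmult[OF Ii UNIV_I nI, of r] prime_set_1[OF I] by simp
  qed
  define R where "R = {x. \<exists>n::int. n \<noteq> 0 \<and> (\<exists>b. of_int n * x = e b)}"
  have RI: "x \<in> R" if "n \<noteq> 0" "of_int n * x = e b" for x n b using that unfolding R_def by blast
  have R: "subring_set R"
  proof (rule subring_setI)
    show "1 \<in> R" by (rule RI[of 1 _ 1]) (simp_all add: e.hom_one)
    fix x y assume "x \<in> R" "y \<in> R"
    then obtain n b m c where *: "n \<noteq> 0" "of_int n * x = e b" "m \<noteq> 0" "of_int m * y = e c" unfolding R_def by blast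
    have "of_int (n * m) * (x - y) = of_int m * (of_int n * x) - of_int n * (of_int m * y)" by (simp add: algebra_simps)
    also have "\<dots> = e (of_int m * b - of_int n * c)" unfolding * by (simp add: e.hom_minus e.hom_mult e.hom_of_int)
    finally show "x - y \<in> R" using * by (intro RI[of "n * m"]) auto
    have "of_int (n * m) * (x * y) = (of_int n * x) * (of_int m * y)" by (simp add: algebra_simps)
    also have "\<dots> = e (b * c)" unfolding * by (simp add: e.hom_mult)
    finally show "x * y \<in> R" using * by (intro RI[of "n * m"]) auto
  qed
  have "foldl adjoin R xs = UNIV"
  proof (rule gen)
    show "subring_set (foldl adjoin R xs)" by (rule foldl_adjoin_subring[OF R])
    show "set xs \<subseteq> foldl adjoin R xs" by (rule foldl_adjoin_gens[OF R])
    fix n :: int and r :: 'a assume "n \<noteq> 0" "of_int n * r = 1"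
    then have "r \<in> R" by (intro RI[of n _ 1]) (simp_all add: e.hom_one)
    then show "r \<in> foldl adjoin R xs" using foldl_adjoin_base[OF R] by blast
  qed
  then have "primes_lift I R UNIV" using primes_lift_foldl_adjoin[OF R I, of xs] by simp
  then obtain k where k: "k \<in> R" "k \<notin> I" "\<And>P. prime_set R P \<Longrightarrow> I \<inter> R \<subseteq> P \<Longrightarrow> k \<notin> P \<Longrightarrow>
        \<exists>Q. prime_set UNIV Q \<and> I \<inter> UNIV \<subseteq> Q \<and> Q \<inter> R = P \<and> 1 \<notin> Q"
    by (rule primes_liftE[OF _ UNIV_I prime_set_1[OF I]]) (rule that)
  obtain n h where h: "n \<noteq> 0" "of_int n * k = e h" using k(1) unfolding R_def by blast
  show thesis
  proof (rule that)
    show "h \<noteq> 0"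
    proof
      assume "h = 0"
      then have "of_int n * k \<in> I" using h(2) ideal_set_0[OF Ii] by (simp add: e.hom_zero)
      then show False using prime_setD[OF I] nI[OF h(1)] k(2) by blast
    qed
    fix \<phi> :: "'b \<Rightarrow> 'c" assume "comm_ring_hom \<phi>" and h0: "\<phi> h \<noteq> 0"
    then interpret \<phi>: comm_ring_hom \<phi> by simp
    \<comment> \<open>The kernel of the extension of \<phi> to R; it is well defined because e is
      injective modulo I and integers are nonzero in the target.\<close>
    define P where "P = {x. \<exists>n::int. n \<noteq> 0 \<and> (\<exists>b. of_int n * x = e b \<and> \<phi> b = 0)}"
    have PI: "x \<in> P" if "n \<noteq> 0" "of_int n * x = e b" "\<phi> b = 0" for x n b using that unfolding P_def by blast
    have mem: "x \<in> P \<longleftrightarrow> \<phi> b = 0" if nx: "n \<noteq> 0" "of_int n * x = e b" for n x b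
    proof
      assume "x \<in> P"
      then obtain m c where mc: "m \<noteq> 0" "of_int m * x = e c" "\<phi> c = 0" unfolding P_def by blast
      have "e (of_int m * b - of_int n * c) = of_int m * (of_int n * x) - of_int n * (of_int m * x)"
        unfolding nx mc by (simp add: e.hom_minus e.hom_mult e.hom_of_int)
      also have "\<dots> = 0" by (simp add: algebra_simps)
      finally have z: "e (of_int m * b - of_int n * c) = 0" .
      have "of_int m * b - of_int n * c = 0" by (rule indep, unfold z, rule ideal_set_0[OF Ii])
      then have "\<phi> (of_int m * b) = \<phi> (of_int n * c)" by simp
      then have "of_int m * \<phi> b = 0" using mc(3) by (simp add: \<phi>.hom_mult \<phi>.hom_of_int)
      then show "\<phi> b = 0" using mc(1) by simp
    qed (use PI nx in blast)
    have PR: "P \<subseteq> R" unfolding P_def R_def by blast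
    have "prime_set R P"
      unfolding prime_set_def ideal_set_def
    proof (intro conjI ballI impI)
      show "P \<subseteq> R" by (rule PR)
      show "0 \<in> P" by (rule PI[of 1 _ 0]) (simp_all add: e.hom_zero \<phi>.hom_zero)
      show "1 \<notin> P" using mem[of 1 1 1] by (simp add: e.hom_one \<phi>.hom_one)
    next
      fix x y assume "x \<in> P" "y \<in> P"
      then obtain n b m c where *: "n \<noteq> 0" "of_int n * x = e b" "\<phi> b = 0" "m \<noteq> 0" "of_int m * y = e c" "\<phi> c = 0"
        unfolding P_def by blast
      have "of_int (n * m) * (x + y) = of_int m * (of_int n * x) + of_int n * (of_int m * y)" by (simp add: algebra_simps)
      also have "\<dots> = e (of_int m * b + of_int n * c)" unfolding * by (simp add: e.hom_add e.hom_mult e.hom_of_int)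
      finally show "x + y \<in> P" using * by (intro PI[of "n * m" _ "of_int m * b + of_int n * c"]) (auto simp: \<phi>.hom_add \<phi>.hom_mult)
    next
      fix s x assume "s \<in> R" "x \<in> P"
      then obtain n b m c where *: "n \<noteq> 0" "of_int n * s = e b" "m \<noteq> 0" "of_int m * x = e c" "\<phi> c = 0"
        unfolding P_def R_def by blast
      have "of_int (n * m) * (s * x) = (of_int n * s) * (of_int m * x)" by (simp add: algebra_simps)
      also have "\<dots> = e (b * c)" unfolding * by (simp add: e.hom_mult)
      finally show "s * x \<in> P" using * by (intro PI[of "n * m" _ "b * c"]) (auto simp: \<phi>.hom_mult)
    next
      fix x y assume xy: "x \<in> R" "y \<in> R" "x * y \<in> P"
      then obtain n b m c where *: "n \<noteq> 0" "of_int n * x = e b" "m \<noteq> 0" "of_int m * y = e c"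
        unfolding R_def by blast
      have "of_int (n * m) * (x * y) = (of_int n * x) * (of_int m * y)" by (simp add: algebra_simps)
      also have "\<dots> = e (b * c)" unfolding * by (simp add: e.hom_mult)
      finally have "\<phi> (b * c) = 0" using mem[of "n * m" "x * y" "b * c"] * xy(3) by simp
      then have "\<phi> b = 0 \<or> \<phi> c = 0" by (simp add: \<phi>.hom_mult)
      then show "x \<in> P \<or> y \<in> P" using mem[OF *(1,2)] mem[OF *(3,4)] by blast
    qed
    moreover have "I \<inter> R \<subseteq> P"
    proof
      fix x assume x: "x \<in> I \<inter> R"
      then obtain n b where nb: "n \<noteq> 0" "of_int n * x = e b" unfolding R_def by blast
      have "e b \<in> I" unfolding nb(2)[symmetric] using x ideal_set_lmult[OF Ii] by blast
      then have "b = 0" by (rule indep)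
      then show "x \<in> P" using nb by (intro PI[of n _ b]) (simp_all add: \<phi>.hom_zero)
    qed
    moreover have "k \<notin> P" using mem[OF h] h0 by blast
    ultimately obtain q where q: "prime_set UNIV q" "I \<inter> UNIV \<subseteq> q" "q \<inter> R = P" using k(3) by blast
    have "e b \<in> q \<longleftrightarrow> \<phi> b = 0" for b
    proof -
      have "e b \<in> R" by (rule RI[of 1 _ b]) simp_all
      then have "e b \<in> q \<longleftrightarrow> e b \<in> P" using q(3) by blast
      also have "\<dots> \<longleftrightarrow> \<phi> b = 0" by (rule mem[of 1]) simp_all
      finally show ?thesis .
    qed
    then show "\<exists>q. prime_set UNIV q \<and> I \<subseteq> q \<and> (\<forall>b. e b \<in> q \<longleftrightarrow> \<phi> b = 0)" using q by (intro exI[of _ q]) simp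
  qed
qed

lemma int_poly_nonroot:
  fixes f :: "int poly" assumes "f \<noteq> 0" obtains c where "poly f c \<noteq> 0"
proof -
  have "finite {c. poly f c = 0}" using assms by (rule poly_roots_finite)
  then have "{c. poly f c = 0} \<noteq> UNIV" using infinite_UNIV_int by metis
  then show thesis using that by auto
qed

text \<open>Specialize y to a suitable integer c, which leaves z transcendental, and then z to an
  integer d. Each specialization gives a strictly larger prime, witnessed by y - c and z -
  d.\<close>

lemma independent_prime_chain:
  fixes I :: "'a::comm_ring_1 set" and xs :: "'a list"
  assumes I: "prime_set UNIV I" and Q: "\<And>n::int. n \<noteq> 0 \<Longrightarrow> \<exists>r::'a. of_int n * r = 1"
    and gen: "\<And>T :: 'a set. subring_set T \<Longrightarrow> (\<And>n r. n \<noteq> 0 \<Longrightarrow> of_int n * r = 1 \<Longrightarrow> r \<in> T) \<Longrightarrow> set xs \<subseteq> T \<Longrightarrow> T = UNIV"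
    and indep: "\<And>P. ev2 y z P \<in> I \<Longrightarrow> P = 0"
  obtains q1 q2 where "prime_set UNIV q1" "prime_set UNIV q2" "I \<subset> q1" "q1 \<subset> q2"
proof -
  obtain h where h: "h \<noteq> 0" "\<And>\<phi> :: int poly poly \<Rightarrow> int poly. comm_ring_hom \<phi> \<Longrightarrow> \<phi> h \<noteq> 0 \<Longrightarrow>
    \<exists>q. prime_set UNIV q \<and> I \<subseteq> q \<and> (\<forall>b. ev2 y z b \<in> q \<longleftrightarrow> \<phi> b = 0)"
    by (rule lift_evaluation[OF comm_ring_hom_ev2 I indep Q gen]) (assumption+, rule that)
  obtain i where "coeff h i \<noteq> 0" using h(1) by (metis leading_coeff_0_iff)
  then obtain c where c: "poly (coeff h i) c \<noteq> 0" by (rule int_poly_nonroot)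
  define \<phi> where "\<phi> = map_poly (\<lambda>q. poly q c)"
  have cp: "comm_ring_hom (\<lambda>q :: int poly. poly q c)" for c by unfold_locales auto
  have \<phi>: "comm_ring_hom \<phi>" unfolding \<phi>_def by (rule comm_ring_hom_map_poly[OF cp])
  have "coeff (\<phi> h) i \<noteq> 0" using c by (simp add: \<phi>_def coeff_map_poly)
  then have "\<phi> h \<noteq> 0" by auto
  then obtain q1 where q1: "prime_set UNIV q1" "I \<subseteq> q1" "\<And>b. ev2 y z b \<in> q1 \<longleftrightarrow> \<phi> b = 0"
    using h(2)[OF \<phi>] by blast
  have ev_q1: "f = 0" if "ev z f \<in> q1" for f
  proof -
    have "\<phi> (map_poly (\<lambda>c. [:c:]) f) = 0" using q1(3)[of "map_poly (\<lambda>c. [:c:]) f"] that by (simp add: ev2_map_const)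
    then show ?thesis by (simp add: \<phi>_def map_poly_map_poly o_def)
  qed
  have "ev2 y z [:[:-c, 1:]:] \<in> q1" using q1(3)[of "[:[:-c, 1:]:]"] by (simp add: \<phi>_def map_poly_pCons)
  moreover have "ev2 y z [:[:-c, 1:]:] \<notin> I" using indep[of "[:[:-c, 1:]:]"] by auto
  ultimately have Iq1: "I \<subset> q1" using q1(2) by blast
  obtain g where g: "g \<noteq> 0" "\<And>\<phi> :: int poly \<Rightarrow> int. comm_ring_hom \<phi> \<Longrightarrow> \<phi> g \<noteq> 0 \<Longrightarrow>
    \<exists>q. prime_set UNIV q \<and> q1 \<subseteq> q \<and> (\<forall>b. ev z b \<in> q \<longleftrightarrow> \<phi> b = 0)"
    by (rule lift_evaluation[OF comm_ring_hom_ev q1(1) ev_q1 Q gen]) (assumption+, rule that)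
  obtain d where d: "poly g d \<noteq> 0" using g(1) by (rule int_poly_nonroot)
  obtain q2 where q2: "prime_set UNIV q2" "q1 \<subseteq> q2" "\<And>b. ev z b \<in> q2 \<longleftrightarrow> poly b d = 0"
    using g(2)[OF cp d] by blast
  have "ev z [:-d, 1:] \<in> q2" using q2(3)[of "[:-d, 1:]"] by simp
  moreover have "ev z [:-d, 1:] \<notin> q1" using ev_q1[of "[:-d, 1:]"] by auto
  ultimately have "q1 \<subset> q2" using q2(2) by blast
  then show thesis using that[OF q1(1) q2(1) Iq1] by blast
qed

section \<open>Number fields\<close>

lemma common_denominator:
  fixes u :: "'a \<Rightarrow> rat"
  assumes "finite A"
  obtains N :: int where "N \<noteq> 0" "\<And>a. a \<in> A \<Longrightarrow> \<exists>m::int. u a * of_int N = of_int m"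
proof -
  have "\<exists>N::int. N \<noteq> 0 \<and> (\<forall>a\<in>A. \<exists>m::int. u a * of_int N = of_int m)"
    using assms
  proof (induction A rule: finite_induct)
    case empty then show ?case by (intro exI[of _ 1]) auto
  next
    case (insert x A)
    then obtain N :: int where N: "N \<noteq> 0" "\<forall>a\<in>A. \<exists>m::int. u a * of_int N = of_int m" by blast
    obtain p q :: int where pq: "q > 0" "u x = of_int p / of_int q" by (metis Rat_cases Fract_of_int_quotient)
    show ?case
    proof (rule exI[of _ "N * q"], intro conjI ballI)
      show "N * q \<noteq> 0" using N pq by simp
      fix a assume "a \<in> insert x A"
      then show "\<exists>m::int. u a * of_int (N * q) = of_int m"
      proof
        assume "a = x"
        then show ?thesis using pq by (intro exI[of _ "p * N"]) simp
      next
        assume "a \<in> A"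
        then obtain m where "u a * of_int N = of_int m" using N(2) by blast
        then show ?thesis by (intro exI[of _ "m * q"]) (simp add: mult.assoc[symmetric])
      qed
    qed
  qed
  then show thesis using that by blast
qed

text \<open>Encodes that the degree over the rationals is at most d, as integral relations among any
  d + 1 elements, repetitions allowed. It applies equally to the powers of one element and to
  representatives of residue classes.\<close>

definition relation_bound :: "'k::field_char_0 itself \<Rightarrow> nat \<Rightarrow> bool" where
  "relation_bound _ d \<longleftrightarrow> (\<forall>f :: nat \<Rightarrow> 'k. \<exists>c :: nat \<Rightarrow> int. (\<exists>i\<le>d. c i \<noteq> 0) \<and> (\<Sum>i\<le>d. of_int (c i) * f i) = 0)"

lemma number_field_relation_bound:
  assumes "number_field TYPE('k::field_char_0)"
  obtains d where "relation_bound TYPE('k) d"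
proof -
  obtain B where "finite_dimensional_vector_space (\<lambda>q (x::'k). of_rat q * x) B"
    using assms unfolding number_field_def by blast
  then interpret V: finite_dimensional_vector_space "\<lambda>q (x::'k). of_rat q * x" B .
  define d where "d = card B"
  have "\<exists>c :: nat \<Rightarrow> int. (\<exists>i\<le>d. c i \<noteq> 0) \<and> (\<Sum>i\<le>d. of_int (c i) * f i) = 0" for f :: "nat \<Rightarrow> 'k"
  proof (cases "inj_on f {..d}")
    case False
    then obtain i j where ij: "i \<le> d" "j \<le> d" "i \<noteq> j" "f i = f j" by (auto simp: inj_on_def)
    define c :: "nat \<Rightarrow> int" where "c k = (if k = i then 1 else if k = j then - 1 else 0)" for k
    have "(\<Sum>k\<le>d. of_int (c k) * f k) = (\<Sum>k\<in>{i, j}. of_int (c k) * f k)"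
      using ij by (intro sum.mono_neutral_right) (auto simp: c_def)
    also have "\<dots> = 0" using ij by (simp add: c_def)
    finally show ?thesis using ij by (intro exI[of _ c]) (auto simp: c_def)
  next
    case True
    define T where "T = f ` {..d}"
    have T: "finite T" "card T = Suc d" using True by (simp_all add: T_def card_image)
    have "V.dependent T"
    proof (rule ccontr)
      assume "\<not> V.dependent T"
      then have "card T \<le> card B"
        using V.independent_span_bound[OF V.finite_Basis, of T] V.span_Basis by simp
      then show False using T by (simp add: d_def)
    qed
    then obtain u where u: "\<exists>v\<in>T. u v \<noteq> 0" "(\<Sum>v\<in>T. of_rat (u v) * v) = 0"
      using V.dependent_finite[OF T(1)] by auto
    obtain N :: int where N: "N \<noteq> 0" "\<And>v. v \<in> T \<Longrightarrow> \<exists>m::int. u v * of_int N = of_int m"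
      by (rule common_denominator[OF T(1)]) (rule that)
    define c where "c i = (SOME m::int. u (f i) * of_int N = of_int m)" for i
    have c: "u (f i) * of_int N = of_int (c i)" if "i \<le> d" for i
      unfolding c_def by (rule someI_ex) (use N(2)[of "f i"] that in \<open>simp add: T_def\<close>)
    have cr: "of_int (c i) = (of_rat (u (f i)) * of_int N :: 'k)" if "i \<le> d" for i
      using arg_cong[OF c[OF that], of "of_rat :: rat \<Rightarrow> 'k"] by (simp add: of_rat_mult)
    have "(\<Sum>i\<le>d. of_int (c i) * f i) = (\<Sum>i\<le>d. of_int N * (of_rat (u (f i)) * f i))"
      using cr by (intro sum.cong) (auto simp: mult_ac)
    also have "\<dots> = of_int N * (\<Sum>i\<le>d. of_rat (u (f i)) * f i)" by (simp add: sum_distrib_left)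
    also have "(\<Sum>i\<le>d. of_rat (u (f i)) * f i) = (\<Sum>v\<in>T. of_rat (u v) * v)"
      unfolding T_def using True by (simp add: sum.reindex)
    finally have "(\<Sum>i\<le>d. of_int (c i) * f i) = 0" using u(2) by simp
    moreover obtain i where "i \<le> d" "u (f i) \<noteq> 0" using u(1) by (auto simp: T_def)
    then have "\<exists>i\<le>d. c i \<noteq> 0" using c[of i] N(1) by (intro exI[of _ i]) auto
    ultimately show ?thesis by blast
  qed
  then have "relation_bound TYPE('k) d" unfolding relation_bound_def by blast
  then show thesis by (rule that)
qed

lemma algebraic_int_multiple:
  fixes k :: "'k::field_char_0"
  assumes "relation_bound TYPE('k) d"
  obtains n :: int where "n \<noteq> 0" "algebraic_int (of_int n * k)"
proof -
  obtain c :: "nat \<Rightarrow> int" where c: "\<exists>i\<le>d. c i \<noteq> 0" "(\<Sum>i\<le>d. of_int (c i) * k ^ i) = 0"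
    using assms unfolding relation_bound_def by blast
  define f where "f = (\<Sum>i\<le>d. monom (c i) i)"
  have cf: "coeff f i = (if i \<le> d then c i else 0)" for i by (simp add: f_def coeff_sum)
  have f0: "f \<noteq> 0" using c(1) cf by (metis coeff_0)
  have fk: "ev k f = 0" using c(2) by (simp add: f_def ev.hom_sum)
  define D a where "D = degree f" and "a = lead_coeff f"
  have a0: "a \<noteq> 0" using f0 by (simp add: a_def)
  have D0: "D > 0"
  proof (rule ccontr)
    assume "\<not> D > 0"
    then obtain e where "f = [:e:]" by (auto simp: D_def elim: degree_eq_zeroE)
    then show False using f0 fk by auto
  qed
  \<comment> \<open>This is a^(D-1) f(T / a), monic with integral coefficients and with root a
    k.\<close>
  define g where "g = monom 1 D + (\<Sum>i<D. monom (coeff f i * a ^ (D - Suc i)) i)"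
  have cg: "coeff g D = 1" "degree g = D"
  proof -
    have "degree (\<Sum>i<D. monom (coeff f i * a ^ (D - Suc i)) i) < D"
    proof -
      have "degree (\<Sum>i<D. monom (coeff f i * a ^ (D - Suc i)) i) \<le> D - 1"
        using D0 by (intro degree_sum_le) (auto intro: order_trans[OF degree_monom_le])
      then show ?thesis using D0 by simp
    qed
    then show "coeff g D = 1" "degree g = D" unfolding g_def
      by (simp_all add: degree_add_eq_left degree_monom_eq coeff_eq_0)
  qed
  have "ev (of_int a * k) g = (of_int a * k) ^ D + (\<Sum>i<D. of_int (coeff f i) * of_int a ^ (D - Suc i) * (of_int a * k) ^ i)"
    by (simp add: g_def ev.hom_add ev.hom_sum)
  also have "(\<Sum>i<D. of_int (coeff f i) * of_int a ^ (D - Suc i) * (of_int a * k) ^ i)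
      = (\<Sum>i<D. of_int a ^ (D - 1) * (of_int (coeff f i) * k ^ i))"
  proof (rule sum.cong[OF refl])
    fix i assume "i \<in> {..<D}"
    then have "D - 1 = (D - Suc i) + i" by auto
    then have "(of_int a :: 'k) ^ (D - 1) = of_int a ^ (D - Suc i) * of_int a ^ i" by (metis power_add)
    then show "of_int (coeff f i) * of_int a ^ (D - Suc i) * (of_int a * k) ^ i = of_int a ^ (D - 1) * (of_int (coeff f i) * k ^ i)"
      by (simp add: power_mult_distrib mult_ac)
  qed
  also have "(of_int a * k) ^ D = of_int a ^ (D - 1) * (of_int (coeff f D) * k ^ D)"
  proof -
    have "(of_int a * k) ^ D = of_int a ^ D * k ^ D" by (rule power_mult_distrib)
    also have "(of_int a :: 'k) ^ D = of_int a ^ (D - 1) * of_int a" using D0 by (metis power_minus_mult)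
    finally show ?thesis by (simp add: a_def D_def mult.assoc)
  qed
  also have "of_int a ^ (D - 1) * (of_int (coeff f D) * k ^ D) + (\<Sum>i<D. of_int a ^ (D - 1) * (of_int (coeff f i) * k ^ i))
     = of_int a ^ (D - 1) * ev k f"
    by (simp add: ev_altdef[of f D] D_def lessThan_Suc_atMost[symmetric] distrib_left sum_distrib_left add.commute)
  finally have "ev (of_int a * k) g = 0" by (simp add: fk)
  then have "algebraic_int (of_int a * k)"
    unfolding algebraic_int_altdef_ipoly using cg by (auto simp: ev_def)
  then show thesis using a0 by (intro that)
qed

text \<open>Once all factors T are removed from an integral equation of k, its constant term is a
  nonzero integer divisible by k.\<close>

lemma algebraic_int_divides_int:
  fixes k :: "'k::field_char_0"
  assumes S: "subring_set {x::'k. algebraic_int x}" and k: "algebraic_int k" "k \<noteq> 0"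
  obtains n :: int and l where "n \<noteq> 0" "algebraic_int l" "of_int n = k * l"
proof -
  obtain f where "ev k f = 0" "lead_coeff f = 1"
    using k(1) unfolding algebraic_int_altdef_ipoly ev_def by blast
  then have f: "ev k f = 0" "f \<noteq> 0" by auto
  have "\<exists>g. coeff g 0 \<noteq> 0 \<and> ev k g = 0"
    using f
  proof (induction "degree f" arbitrary: f rule: less_induct)
    case less
    show ?case
    proof (cases f)
      case (pCons c g)
      show ?thesis
      proof (cases "c = 0")
        case True
        then have "g \<noteq> 0" "ev k g = 0" using less.prems pCons k(2) by (auto simp: ev_pCons)
        moreover from this have "degree g < degree f" using pCons by simp
        ultimately show ?thesis using less.hyps by blast
      next
        case False
        then show ?thesis using less.prems pCons by (intro exI[of _ f]) auto
      qed
    qed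
  qed
  then obtain g where g: "coeff g 0 \<noteq> 0" "ev k g = 0" by blast
  obtain c h where ch: "g = pCons c h" by (cases g)
  have "of_int c = k * (- ev k h)" using g(2) by (simp add: ch ev_pCons eq_neg_iff_add_eq_0)
  moreover have "- ev k h \<in> {x. algebraic_int x}"
    using k(1) by (intro subring_set_uminus[OF S] ev_mem[OF S]) simp
  ultimately show thesis using g(1) by (intro that[of c "- ev k h"]) (auto simp: ch)
qed

text \<open>The residue ring is a vector space over the field with p elements. Its dimension is at
  most d, because d + 1 representatives satisfy an integral relation in which not every coefficient
  is divisible by p.\<close>

lemma ideal_norm_bound:
  fixes P :: "'k::field_char_0 set"
  assumes d: "relation_bound TYPE('k) d" and S: "subring_set {x::'k. algebraic_int x}"
    and P: "ideal_set {x::'k. algebraic_int x} P" "1 \<notin> P" and p: "prime p" "of_nat p \<in> P"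
  shows "ideal_norm P \<le> p ^ d"
proof -
  let ?O = "{x::'k. algebraic_int x}"
  define indep where "indep k b \<longleftrightarrow> (\<forall>i<k. b i \<in> ?O) \<and>
     (\<forall>c :: nat \<Rightarrow> int. (\<Sum>i<k. of_int (c i) * b i) \<in> P \<longrightarrow> (\<forall>i<k. int p dvd c i))" for k :: nat and b :: "nat \<Rightarrow> 'k"
  have p1: "p > 1" using p(1) by (rule prime_gt_1_nat)
  have bound: "k \<le> d" if kb: "indep k b" for k b
  proof (rule ccontr)
    assume "\<not> k \<le> d"
    then have dk: "d < k" by simp
    \<comment> \<open>Infinite descent: in a relation of least total size all coefficients would be
      divisible by p, and dividing by p gives a smaller one.\<close>
    define R where "R c \<longleftrightarrow> (\<exists>i\<le>d. c i \<noteq> 0) \<and> (\<Sum>i\<le>d. of_int (c i) * b i) = 0" for c :: "nat \<Rightarrow> int"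
    have "\<exists>c. R c" using d unfolding relation_bound_def R_def by blast
    then obtain c where c: "R c" "\<And>c'. R c' \<Longrightarrow> (\<Sum>i\<le>d. nat \<bar>c i\<bar>) \<le> (\<Sum>i\<le>d. nat \<bar>c' i\<bar>)"
      using ex_has_least_nat[of R _ "\<lambda>c. \<Sum>i\<le>d. nat \<bar>c i\<bar>"] by blast
    define c0 where "c0 i = (if i \<le> d then c i else 0)" for i
    have "(\<Sum>i<k. of_int (c0 i) * b i) = (\<Sum>i\<le>d. of_int (c i) * b i)"
      using dk by (intro sum.mono_neutral_cong_right) (auto simp: c0_def)
    also have "\<dots> = 0" using c(1) by (simp add: R_def)
    finally have "(\<Sum>i<k. of_int (c0 i) * b i) \<in> P" using ideal_set_0[OF P(1)] by simp
    then have dvd: "int p dvd c i" if "i \<le> d" for i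
      using kb that dk unfolding indep_def by (auto simp: c0_def dest!: spec[of _ c0] spec[of _ i])
    define c' where "c' i = c i div int p" for i
    have c': "c i = int p * c' i" if "i \<le> d" for i using dvd[OF that] by (simp add: c'_def)
    have "of_nat p * (\<Sum>i\<le>d. of_int (c' i) * b i) = (\<Sum>i\<le>d. of_int (c i) * b i)"
      unfolding sum_distrib_left by (intro sum.cong) (auto simp: c' mult.assoc)
    then have "(\<Sum>i\<le>d. of_int (c' i) * b i) = 0" using c(1) p1 by (simp add: R_def)
    moreover obtain j where j: "j \<le> d" "c j \<noteq> 0" using c(1) by (auto simp: R_def)
    ultimately have "R c'" using c'[OF j(1)] by (auto simp: R_def)
    then have "(\<Sum>i\<le>d. nat \<bar>c i\<bar>) \<le> (\<Sum>i\<le>d. nat \<bar>c' i\<bar>)" by (rule c(2))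
    moreover have "(\<Sum>i\<le>d. nat \<bar>c' i\<bar>) < (\<Sum>i\<le>d. nat \<bar>c i\<bar>)"
    proof (rule sum_strict_mono_ex1)
      have e: "nat \<bar>c i\<bar> = p * nat \<bar>c' i\<bar>" if "i \<le> d" for i by (simp add: c'[OF that] abs_mult nat_mult_distrib)
      then show "\<forall>i\<in>{..d}. nat \<bar>c' i\<bar> \<le> nat \<bar>c i\<bar>" using p1 by simp
      show "\<exists>i\<in>{..d}. nat \<bar>c' i\<bar> < nat \<bar>c i\<bar>"
        using j p1 e[OF j(1)] c'[OF j(1)] by (intro bexI[of _ j]) auto
    qed simp
    ultimately show False by simp
  qed
  \<comment> \<open>A system that is independent modulo p and of maximal length spans the residue
    ring, so representatives with coefficients in 0..p-1 suffice.\<close>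
  define K where "K = {k. \<exists>b. indep k b}"
  have "indep 0 (\<lambda>_. 0)" by (simp add: indep_def)
  then have K: "finite K" "K \<noteq> {}" using bound finite_subset[of K "{..d}"] by (auto simp: K_def)
  define k where "k = Max K"
  obtain b where b: "indep k b" using Max_in[OF K] by (auto simp: k_def K_def)
  have kd: "k \<le> d" using bound[OF b] .
  have bO: "b i \<in> ?O" if "i < k" for i using b that by (simp add: indep_def)
  have rep: "\<exists>c\<in>{..<k} \<rightarrow>\<^sub>E {0..<int p}. x - (\<Sum>i<k. of_int (c i) * b i) \<in> P" if x: "x \<in> ?O" for x
  proof -
    have "\<not> indep (Suc k) (b(k := x))" using Max_ge[OF K(1), of "Suc k"] by (auto simp: k_def K_def)
    moreover have "\<forall>i<Suc k. (b(k := x)) i \<in> ?O" using bO x by (auto simp: less_Suc_eq)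
    ultimately obtain c :: "nat \<Rightarrow> int" where c: "(\<Sum>i<Suc k. of_int (c i) * (b(k := x)) i) \<in> P" "\<exists>i<Suc k. \<not> int p dvd c i"
      unfolding indep_def by blast
    have sum: "(\<Sum>i<k. of_int (c i) * b i) + of_int (c k) * x \<in> P" using c(1) by simp
    have pP: "of_int m * y \<in> P" if m: "int p dvd m" and y: "y \<in> ?O" for m y
    proof -
      from m obtain n where "m = int p * n" by (rule dvdE)
      then have "of_int m * y = (of_int n * y) * of_nat p" by simp
      moreover have "(of_int n * y) * of_nat p \<in> P"
        by (rule ideal_set_lmult[OF P(1) subring_set_mult[OF S subring_set_of_int[OF S] y] p(2)])
      ultimately show ?thesis by (simp only:)
    qed
    have ck: "\<not> int p dvd c k"
    proof
      assume dv: "int p dvd c k"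
      have "(\<Sum>i<k. of_int (c i) * b i) \<in> P"
        using ideal_set_diff[OF S P(1) sum pP[OF dv x]] by simp
      then have "\<forall>i<k. int p dvd c i" using b unfolding indep_def by blast
      then show False using c(2) dv by (auto simp: less_Suc_eq)
    qed
    then have "coprime (c k) (int p)" using p(1) prime_imp_coprime[of "int p" "c k"] by (simp add: coprime_commute)
    then obtain e f where ef: "e * c k + f * int p = 1" using bezout_int[of "c k" "int p"] by (auto simp: coprime_iff_gcd_eq_1)
    define a where "a = (\<lambda>i\<in>{..<k}. (- e * c i) mod int p)"
    have a1: "a \<in> {..<k} \<rightarrow>\<^sub>E {0..<int p}" using p1 by (auto simp: a_def)
    have "x = of_int (e * c k) * x + of_int (int p * f) * x"
      using arg_cong[OF ef, of "\<lambda>z. of_int z * x"] by (simp add: algebra_simps)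
    then have "x - (\<Sum>i<k. of_int (a i) * b i) = of_int e * ((\<Sum>i<k. of_int (c i) * b i) + of_int (c k) * x)
        + of_int (int p * f) * x - (\<Sum>i<k. of_int (a i + e * c i) * b i)"
      by (simp add: algebra_simps sum.distrib sum_distrib_left)
    also have "\<dots> \<in> P"
    proof (intro ideal_set_diff[OF S P(1)] ideal_set_add[OF P(1)] ideal_set_sum[OF P(1)])
      show "of_int e * ((\<Sum>i<k. of_int (c i) * b i) + of_int (c k) * x) \<in> P"
        by (rule ideal_set_lmult[OF P(1) subring_set_of_int[OF S] sum])
      show "of_int (int p * f) * x \<in> P" by (rule pP) (use x in auto)
      fix i assume i: "i \<in> {..<k}"
      have "a i + e * c i = (- e * c i) mod int p - (- e * c i)" using i by (simp add: a_def)
      then have "int p dvd a i + e * c i" by (metis dvd_minus_mod dvd_minus_iff minus_diff_eq)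
      then show "of_int (a i + e * c i) * b i \<in> P" by (rule pP) (use bO i in auto)
    qed
    finally show ?thesis using a1 by blast
  qed
  define F where "F c = P +>\<^bsub>\<O>\<^esub> (\<Sum>i<k. of_int (c i) * b i)" for c :: "nat \<Rightarrow> int"
  have cO: "\<O> = ring_on ?O" by (simp add: ring_of_integers_def)
  have coset: "P +>\<^bsub>\<O>\<^esub> x = P +>\<^bsub>\<O>\<^esub> y" if "x - y \<in> P" for x y
  proof -
    have "h + x = (h + (x - y)) + y \<and> h + y = (h - (x - y)) + x" for h by simp
    moreover have "h + (x - y) \<in> P" "h - (x - y) \<in> P" if "h \<in> P" for h
      using that \<open>x - y \<in> P\<close> ideal_set_add[OF P(1)] ideal_set_diff[OF S P(1)] by auto
    ultimately show ?thesis unfolding a_r_coset_def' cO ring_on_simps by blast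
  qed
  have "carrier (\<O> Quot P) \<subseteq> F ` ({..<k} \<rightarrow>\<^sub>E {0..<int p})"
  proof
    fix X assume "X \<in> carrier (\<O> Quot P)"
    then obtain x where x: "x \<in> ?O" "X = P +>\<^bsub>\<O>\<^esub> x"
      by (auto simp: FactRing_def A_RCOSETS_def' cO)
    obtain c where "c \<in> {..<k} \<rightarrow>\<^sub>E {0..<int p}" "x - (\<Sum>i<k. of_int (c i) * b i) \<in> P" using rep[OF x(1)] by blast
    then show "X \<in> F ` ({..<k} \<rightarrow>\<^sub>E {0..<int p})" using coset x(2) by (auto simp: F_def)
  qed
  then have "card (carrier (\<O> Quot P)) \<le> card (F ` ({..<k} \<rightarrow>\<^sub>E {0..<int p}))"
    by (intro card_mono finite_imageI finite_PiE) auto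
  also have "\<dots> \<le> card ({..<k} \<rightarrow>\<^sub>E {0..<int p})" by (intro card_image_le finite_PiE) auto
  also have "\<dots> = p ^ k" by (simp add: card_PiE)
  also have "\<dots> \<le> p ^ d" using kd p1 by (intro power_increasing) auto
  finally show ?thesis by (simp add: ideal_norm_def)
qed

section \<open>Short vectors\<close>

definition l1 :: "int^'n::finite \<Rightarrow> nat" where
  "l1 m = (\<Sum>i\<in>UNIV. nat \<bar>m $ i\<bar>)"

lemma l1_0 [simp]: "l1 0 = 0"
  by (simp add: l1_def)

lemma l1_eq_0_iff [simp]: "l1 m = 0 \<longleftrightarrow> m = 0"
  by (simp add: l1_def Finite_Cartesian_Product.vec_eq_iff)

lemma l1_uminus [simp]: "l1 (- m) = l1 m"
  by (simp add: l1_def)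

lemma l1_add: "l1 (m + l) \<le> l1 m + l1 l"
  unfolding l1_def sum.distrib[symmetric] by (intro sum_mono) (simp add: nat_add_distrib[symmetric] nat_mono abs_triangle_ineq)

lemma l1_diff: "l1 (m - l) \<le> l1 m + l1 l"
  using l1_add[of m "- l"] by simp

lemma l1_axis [simp]: "l1 (axis i c) = nat \<bar>c\<bar>"
proof -
  have "l1 (axis i c) = (\<Sum>j\<in>UNIV. if j = i then nat \<bar>c\<bar> else 0)"
    unfolding l1_def by (intro sum.cong) (auto simp: axis_def)
  then show ?thesis by simp
qed

lemma l1_step:
  fixes m :: "int^'n::finite"
  assumes "l1 m = Suc k"
  obtains i s where "s = 1 \<or> s = - 1" "l1 (m - axis i s) = k"
proof -
  have "m \<noteq> 0" using assms by auto
  then obtain i where i: "m $ i \<noteq> 0" by (auto simp: Finite_Cartesian_Product.vec_eq_iff)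
  define s where "s = sgn (m $ i)"
  have s: "s = 1 \<or> s = - 1" using i by (auto simp: s_def sgn_if)
  have e: "nat \<bar>m $ i\<bar> = Suc (nat \<bar>m $ i - s\<bar>)" using i by (auto simp: s_def sgn_if nat_eq_iff2)
  have "l1 m = nat \<bar>m $ i\<bar> + (\<Sum>j\<in>UNIV - {i}. nat \<bar>m $ j\<bar>)"
    unfolding l1_def by (intro sum.remove) auto
  moreover have "l1 (m - axis i s) = nat \<bar>(m - axis i s) $ i\<bar> + (\<Sum>j\<in>UNIV - {i}. nat \<bar>(m - axis i s) $ j\<bar>)"
    unfolding l1_def by (intro sum.remove) auto
  moreover have "(\<Sum>j\<in>UNIV - {i}. nat \<bar>(m - axis i s) $ j\<bar>) = (\<Sum>j\<in>UNIV - {i}. nat \<bar>m $ j\<bar>)"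
    by (intro sum.cong) (auto simp: axis_def)
  ultimately have "l1 (m - axis i s) = k" using assms e by (simp add: axis_def)
  then show thesis using s by (intro that)
qed

lemma l1_geodesic:
  fixes r :: "int^'n::finite"
  assumes "j \<le> l1 r"
  obtains s where "l1 s = j" "l1 (r - s) = l1 r - j"
proof -
  have "\<exists>s. l1 s = j \<and> l1 (r - s) = l1 r - j"
    using assms
  proof (induction "l1 r - j" arbitrary: r)
    case 0
    then show ?case by (intro exI[of _ r]) auto
  next
    case (Suc k)
    then obtain l where l: "l1 r = Suc l" by (cases "l1 r") auto
    then obtain i e where e: "e = 1 \<or> e = - 1" "l1 (r - axis i e) = l" by (rule l1_step)
    have "k = l1 (r - axis i e) - j" "j \<le> l1 (r - axis i e)" using Suc.hyps(2) Suc.prems l e by auto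
    then obtain s where s: "l1 s = j" "l1 (r - axis i e - s) = l1 (r - axis i e) - j" using Suc.hyps(1) by blast
    have "r - s = (r - axis i e - s) + axis i e" by simp
    then have "l1 (r - s) \<le> (l - j) + 1" using l1_add[of "r - axis i e - s" "axis i e"] s e by auto
    moreover have "l1 r \<le> l1 (r - s) + l1 s" using l1_add[of "r - s" s] by simp
    ultimately show ?case using s Suc.hyps(2) l e by (intro exI[of _ s]) auto
  qed
  then show thesis using that by blast
qed

lemma nat_root_bound:
  assumes "d \<ge> 1"
  shows "N < (nat \<lfloor>real N powr (1 / real d)\<rfloor> + 1) ^ d"
proof (cases "N = 0")
  case False
  define r where "r = real N powr (1 / real d)"
  have "r \<ge> 0" by (simp add: r_def)
  then have "r < real (nat \<lfloor>r\<rfloor> + 1)" by linarith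
  then have "r ^ d < real (nat \<lfloor>r\<rfloor> + 1) ^ d" using assms \<open>r \<ge> 0\<close> by (intro power_strict_mono) auto
  moreover have "r ^ d = real N" using assms False by (simp add: r_def powr_powr flip: powr_realpow)
  ultimately have "real N < real ((nat \<lfloor>r\<rfloor> + 1) ^ d)" by simp
  then show ?thesis unfolding r_def by (simp only: of_nat_less_iff)
qed simp

locale torsion_point =
  fixes E :: "int^'n::finite \<Rightarrow> 'a::comm_ring_1" and S x :: "'a set" and N :: nat
  assumes S: "subring_set S" and x: "prime_set S x" and N: "N \<ge> 1" and n: "CARD('n) \<ge> 2"
    and E_add: "\<And>m l. E (m + l) = E m * E l" and E_0: "E 0 = 1" and ES: "\<And>m. E m \<in> S"
    and torsion: "\<And>m. E m ^ N - 1 \<in> x"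
begin

definition \<Lambda> :: "(int^'n) set" where
  "\<Lambda> = {m. E m - 1 \<in> x}"

lemma xi: "ideal_set S x"
  using prime_set_ideal[OF x] .

lemma diff_mem: "m - l \<in> \<Lambda> \<longleftrightarrow> E m - E l \<in> x"
proof -
  have l: "E l \<notin> x"
  proof
    assume "E l \<in> x"
    then have "E l * E (- l) \<in> x" using ES by (intro ideal_set_rmult[OF xi])
    then show False using prime_set_1[OF x] E_add[of l "- l"] E_0 by simp
  qed
  have "E m = E l * E (m - l)" using E_add[of l "m - l"] by simp
  then have "E m - E l = E l * (E (m - l) - 1)" by (simp add: algebra_simps)
  moreover have "E (m - l) - 1 \<in> S" using ES subring_set_1[OF S] by (intro subring_set_diff[OF S])
  ultimately show ?thesis using mult_mem_prime_set_cancel[OF x ES _ l] by (simp add: \<Lambda>_def)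
qed

lemma zero_mem: "0 \<in> \<Lambda>"
  using ideal_set_0[OF xi] by (simp add: \<Lambda>_def E_0)

lemma add_mem: assumes "m \<in> \<Lambda>" "l \<in> \<Lambda>" shows "m + l \<in> \<Lambda>"
proof -
  have "E (m + l) - 1 = E m * (E l - 1) + (E m - 1)" by (simp add: E_add algebra_simps)
  also have "\<dots> \<in> x" using assms ES by (intro ideal_set_add[OF xi] ideal_set_lmult[OF xi]) (auto simp: \<Lambda>_def)
  finally show ?thesis by (simp add: \<Lambda>_def)
qed

lemma uminus_mem: assumes "m \<in> \<Lambda>" shows "- m \<in> \<Lambda>"
proof -
  have "E 0 - E m = - (E m - 1)" by (simp add: E_0)
  also have "\<dots> \<in> x" using assms by (intro ideal_set_uminus[OF S xi]) (simp add: \<Lambda>_def)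
  finally show ?thesis using diff_mem[of 0 m] by simp
qed

lemma diff_closed: "m \<in> \<Lambda> \<Longrightarrow> l \<in> \<Lambda> \<Longrightarrow> m - l \<in> \<Lambda>"
  using add_mem[of m "- l"] uminus_mem[of l] by simp

lemma E_power: "E (axis i (int k)) = E (axis i 1) ^ k"
proof (induction k)
  case 0
  have "axis i (int 0) = 0" by (simp add: Finite_Cartesian_Product.vec_eq_iff axis_def)
  then show ?case by (simp only: E_0 power_0)
next
  case (Suc k)
  have "axis i (int (Suc k)) = axis i 1 + axis i (int k)" by (simp add: Finite_Cartesian_Product.vec_eq_iff axis_def)
  then show ?case using Suc by (simp add: E_add)
qed

lemma axis_mem: "axis i (int N) \<in> \<Lambda>"
  using torsion[of "axis i 1"] by (simp add: \<Lambda>_def E_power)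

text \<open>At most N classes of exponents exist modulo the lattice: the values of the monomials are
  roots of T^N - 1 modulo x, whose leading coefficient 1 is not in x.\<close>

lemma collision:
  assumes A: "finite A" "card A > N"
  obtains m l where "m \<in> A" "l \<in> A" "m \<noteq> l" "m - l \<in> \<Lambda>"
proof (rule ccontr)
  note gen = that
  assume nt: "\<not> thesis"
  have no: "E m - E l \<notin> x" if ml: "m \<in> A" "l \<in> A" "m \<noteq> l" for m l
  proof
    assume "E m - E l \<in> x"
    then have "m - l \<in> \<Lambda>" by (simp only: diff_mem)
    then have thesis by (rule gen[OF ml])
    with nt show False by contradiction
  qed
  have "inj_on E A"
    using no ideal_set_0[OF xi] by (intro inj_onI) force
  define f where "f = monom 1 N - (1 :: 'a poly)"
  have cf: "coeff f i = (if i = N then 1 else 0) - (if i = 0 then 1 else 0)" for i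
    by (simp add: f_def coeff_1)
  have "f \<in> polys x"
  proof (rule polys_prime_of_many_roots[OF S x, of f "E ` A"])
    show "f \<in> polys S" unfolding f_def
      using polys_monom[OF S subring_set_1[OF S]] subring_set_1[OF polys_subring[OF S]] by (intro subring_set_diff[OF polys_subring[OF S]])
    have "degree f \<le> N" unfolding f_def by (intro degree_diff_le degree_monom_le) auto
    then show "degree f < card (E ` A)" using A \<open>inj_on E A\<close> by (simp add: card_image)
    show "poly f r \<in> x" if "r \<in> E ` A" for r using that torsion by (auto simp: f_def poly_monom)
    show "r - s \<notin> x" if "r \<in> E ` A" "s \<in> E ` A" "r \<noteq> s" for r s using that no by blast
  qed (use A ES in auto)
  then have "coeff f N \<in> x" by (rule polys_coeff)
  then show False using N prime_set_1[OF x] by (simp add: cf)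
qed

lemma box_collision:
  fixes K :: "'n \<Rightarrow> nat"
  assumes "N < (\<Prod>i\<in>UNIV. K i + 1)"
  obtains c where "c \<in> \<Lambda>" "c \<noteq> 0" "\<And>i. \<bar>c $ i\<bar> \<le> int (K i)"
proof -
  define F where "F = Pi\<^sub>E (UNIV :: 'n set) (\<lambda>i. {0..int (K i)})"
  define A where "A = (\<lambda>f. \<chi> i. f i) ` F"
  have "finite F" unfolding F_def by (intro finite_PiE) auto
  have "inj_on (\<lambda>f. \<chi> i. f i) F" by (rule inj_onI) (auto simp: Finite_Cartesian_Product.vec_eq_iff fun_eq_iff)
  then have "card A = card F" by (simp add: A_def card_image)
  also have "\<dots> = (\<Prod>i\<in>UNIV. K i + 1)" by (simp add: F_def card_PiE nat_add_distrib)
  finally have "card A > N" using assms by simp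
  moreover have "finite A" using \<open>finite F\<close> by (simp add: A_def)
  ultimately obtain m l where ml: "m \<in> A" "l \<in> A" "m \<noteq> l" "m - l \<in> \<Lambda>" using collision by metis
  have box: "0 \<le> v $ i \<and> v $ i \<le> int (K i)" if "v \<in> A" for v i
    using that by (auto simp: A_def F_def PiE_def Pi_def)
  have "\<bar>(m - l) $ i\<bar> \<le> int (K i)" for i using box[OF ml(1), of i] box[OF ml(2), of i] by auto
  then show thesis using ml by (intro that[of "m - l"]) auto
qed

section \<open>Short vectors of the lattice\<close>

definition shortest :: "int^'n \<Rightarrow> bool" where
  "shortest a \<longleftrightarrow> a \<in> \<Lambda> \<and> a \<noteq> 0 \<and> (\<forall>c\<in>\<Lambda>. c \<noteq> 0 \<longrightarrow> l1 a \<le> l1 c)"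

lemma shortest_exists: obtains a where "shortest a"
proof -
  have "axis i (int N) \<noteq> 0" for i :: 'n using N by (simp add: axis_eq_0_iff)
  then have "\<exists>a. a \<in> \<Lambda> \<and> a \<noteq> 0" using axis_mem by blast
  then obtain a where "a \<in> \<Lambda> \<and> a \<noteq> 0" "\<And>c. c \<in> \<Lambda> \<and> c \<noteq> 0 \<Longrightarrow> l1 a \<le> l1 c"
    using ex_has_least_nat[of "\<lambda>a. a \<in> \<Lambda> \<and> a \<noteq> 0" _ l1] by blast
  then show thesis by (intro that[of a]) (simp add: shortest_def)
qed

lemma shortest_le_N: "shortest a \<Longrightarrow> l1 a \<le> N"
  using axis_mem[of undefined] N by (auto simp: shortest_def axis_eq_0_iff dest!: bspec[of _ _ "axis undefined (int N)"])

lemma l1_le_box: "(\<And>i. \<bar>c $ i\<bar> \<le> int k) \<Longrightarrow> l1 (c :: int^'n) \<le> CARD('n) * k"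
  unfolding l1_def using sum_bounded_above[of UNIV "\<lambda>i. nat \<bar>c $ i\<bar>" k] by (simp add: nat_le_iff)

lemma shortest_bound:
  assumes a: "shortest a" shows "real (l1 a) \<le> real CARD('n) * real N powr (1 / real CARD('n))"
proof -
  define k where "k = nat \<lfloor>real N powr (1 / real CARD('n))\<rfloor>"
  have "N < (\<Prod>i\<in>(UNIV :: 'n set). k + 1)"
    using nat_root_bound[of "CARD('n)" N] n by (simp add: k_def)
  then obtain c :: "int^'n" where c: "c \<in> \<Lambda>" "c \<noteq> 0" "\<And>i. \<bar>c $ i\<bar> \<le> int k" by (rule box_collision) (rule that)
  have "l1 a \<le> l1 c" using a c by (simp add: shortest_def)
  also have "\<dots> \<le> CARD('n) * k" by (rule l1_le_box[OF c(3)])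
  finally have "real (l1 a) \<le> real CARD('n) * real k" by (simp flip: of_nat_mult)
  also have "real k \<le> real N powr (1 / real CARD('n))" by (simp add: k_def)
  finally show ?thesis by (simp add: mult_left_mono)
qed

text \<open>The box is flat in a direction i in which a is nonzero. So b has coordinate 0 there and
  is independent of a, at the price of having only n - 1 directions to fill.\<close>

lemma independent_short_vector:
  fixes a :: "int^'n"
  assumes a: "a \<noteq> 0"
  obtains b :: "int^'n" and i j where "b \<in> \<Lambda>" "b \<noteq> 0" "a $ i * b $ j \<noteq> a $ j * b $ i"
    "real (l1 b) \<le> real CARD('n) * real N powr (1 / (real CARD('n) - 1))"
proof -
  obtain i where i: "a $ i \<noteq> 0" using a by (auto simp: Finite_Cartesian_Product.vec_eq_iff)
  define d where "d = CARD('n) - 1"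
  have d: "d \<ge> 1" "real d = real CARD('n) - 1" using n by (auto simp: d_def)
  define k where "k = nat \<lfloor>real N powr (1 / real d)\<rfloor>"
  have "(\<Prod>j\<in>(UNIV :: 'n set). (if j = i then 0 else k) + 1) = (\<Prod>j\<in>UNIV - {i}. k + 1)"
    by (intro prod.mono_neutral_cong_right) auto
  also have "\<dots> = (k + 1) ^ d" by (simp add: d_def)
  finally have "N < (\<Prod>j\<in>(UNIV :: 'n set). (if j = i then 0 else k) + 1)"
    using nat_root_bound[OF d(1), of N] by (simp add: k_def)
  then obtain b :: "int^'n" where b: "b \<in> \<Lambda>" "b \<noteq> 0" "\<And>j. \<bar>b $ j\<bar> \<le> int (if j = i then 0 else k)"
    by (rule box_collision) (rule that)
  obtain j where j: "b $ j \<noteq> 0" using b(2) by (auto simp: Finite_Cartesian_Product.vec_eq_iff)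
  have "b $ i = 0" using b(3)[of i] by simp
  then have "a $ i * b $ j \<noteq> a $ j * b $ i" using i j by simp
  moreover have "\<bar>b $ j\<bar> \<le> int k" for j using b(3)[of j] by (auto split: if_splits)
  then have "real (l1 b) \<le> real (CARD('n) * k)" by (simp only: of_nat_le_iff l1_le_box)
  then have "real (l1 b) \<le> real CARD('n) * real k" by simp
  moreover have "real k \<le> real N powr (1 / real d)" by (simp add: k_def)
  then have "real CARD('n) * real k \<le> real CARD('n) * real N powr (1 / real d)" by (simp add: mult_left_mono)
  ultimately have "real (l1 b) \<le> real CARD('n) * real N powr (1 / (real CARD('n) - 1))"
    unfolding d(2)[symmetric] by linarith
  with b(1,2) \<open>a $ i * b $ j \<noteq> a $ j * b $ i\<close> show thesis by (rule that)
qed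

section \<open>Reduced representatives, packing, and generators of the lattice\<close>

definition reduced :: "int^'n \<Rightarrow> bool" where
  "reduced r \<longleftrightarrow> (\<forall>c\<in>\<Lambda>. l1 r \<le> l1 (r + c))"

lemma reduced_representative: obtains r where "reduced r" "r - m \<in> \<Lambda>"
proof -
  have "m - m \<in> \<Lambda>" using zero_mem by simp
  then obtain r where r: "r - m \<in> \<Lambda>" "\<And>s. s - m \<in> \<Lambda> \<Longrightarrow> l1 r \<le> l1 s"
    using ex_has_least_nat[of "\<lambda>r. r - m \<in> \<Lambda>" m l1] by blast
  have "l1 r \<le> l1 (r + c)" if "c \<in> \<Lambda>" for c
    using r(2)[of "r + c"] add_mem[OF r(1) that] by (simp add: algebra_simps)
  then show thesis using r(1) by (intro that[of r]) (auto simp: reduced_def)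
qed

text \<open>Packing: along a shortest path from \<open>0\<close> to \<open>r\<close>, squares of side about half the length of \<open>a\<close> placed at
  distance about that length stay disjoint modulo \<open>\<Lambda>\<close>, which has at most \<open>N\<close> classes.\<close>

lemma reduced_bound:
  assumes a: "shortest a" and r: "reduced r" shows "l1 a * l1 r \<le> 4 * N"
proof -
  have "\<exists>i1 i2 :: 'n. i1 \<noteq> i2"
    using n card_le_Suc0_iff_eq[of "UNIV :: 'n set"] by auto
  then obtain i1 i2 :: 'n where i12: "i1 \<noteq> i2" by blast
  have a0: "l1 a \<ge> 1" using a l1_eq_0_iff[of a] unfolding shortest_def by linarith
  \<comment> \<open>Two points of one square differ by at most 2 * \<rho>, which is less than the
    length of a; consecutive squares are t = 2 * \<rho> + 1 apart along the path.\<close>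
  define \<rho> where "\<rho> = (l1 a - 1) div 2"
  define t where "t = 2 * \<rho> + 1"
  define l where "l = l1 r"
  define q where "q = l div t"
  have t: "t \<le> l1 a" "t \<ge> 1" "l1 a \<le> 2 * (\<rho> + 1)" using a0 by (auto simp: t_def \<rho>_def)
  have "\<forall>j. \<exists>s. j \<le> q \<longrightarrow> l1 s = j * t \<and> l1 (r - s) = l - j * t"
  proof (intro allI)
    fix j
    show "\<exists>s. j \<le> q \<longrightarrow> l1 s = j * t \<and> l1 (r - s) = l - j * t"
    proof (cases "j \<le> q")
      case True
      then have "j * t \<le> l1 r" unfolding l_def[symmetric] q_def by (metis div_times_less_eq_dividend le_trans mult_le_mono1)
      then show ?thesis unfolding l_def using l1_geodesic by metis
    qed auto
  qed
  then obtain s where s: "\<And>j. j \<le> q \<Longrightarrow> l1 (s j) = j * t \<and> l1 (r - s j) = l - j * t" by metis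
  define \<beta> where "\<beta> e f = axis i1 (int e) + axis i2 (int f)" for e f :: nat
  define v where "v = (\<lambda>(j, e, f). s j + \<beta> e f)"
  define J where "J = {..q} \<times> {..\<rho>} \<times> {..\<rho>}"
  have \<beta>: "l1 (\<beta> e f - \<beta> e' f') \<le> 2 * \<rho>" if "e \<le> \<rho>" "f \<le> \<rho>" "e' \<le> \<rho>" "f' \<le> \<rho>" for e f e' f'
  proof -
    have "\<beta> e f - \<beta> e' f' = axis i1 (int e - int e') + axis i2 (int f - int f')"
      by (auto simp: \<beta>_def Finite_Cartesian_Product.vec_eq_iff axis_def)
    then have "l1 (\<beta> e f - \<beta> e' f') \<le> nat \<bar>int e - int e'\<bar> + nat \<bar>int f - int f'\<bar>"
      using l1_add[of "axis i1 (int e - int e')" "axis i2 (int f - int f')"] by simp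
    then show ?thesis using that by linarith
  qed
  \<comment> \<open>If squares at different points of the path met modulo the lattice, jumping from
    one to the other would save at least t and cost at most 2 * \<rho>, giving a representative
    shorter than the reduced r.\<close>
  have lt: False if jj: "j < j'" "j' \<le> q" "e \<le> \<rho>" "f \<le> \<rho>" "e' \<le> \<rho>" "f' \<le> \<rho>"
    and mem: "(s j + \<beta> e f) - (s j' + \<beta> e' f') \<in> \<Lambda>" for j j' e f e' f'
  proof -
    have "r + ((s j + \<beta> e f) - (s j' + \<beta> e' f')) = ((r - s j') + s j) + (\<beta> e f - \<beta> e' f')" by simp
    then have "l \<le> l1 (((r - s j') + s j) + (\<beta> e f - \<beta> e' f'))"
      using r mem unfolding reduced_def l_def by metis
    also have "\<dots> \<le> (l1 (r - s j') + l1 (s j)) + l1 (\<beta> e f - \<beta> e' f')"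
      by (meson add_mono l1_add le_trans order_refl)
    also have "\<dots> \<le> ((l - j' * t) + j * t) + 2 * \<rho>"
      using s[of j] s[of j'] jj \<beta>[OF jj(3-6)] by simp
    finally have "l \<le> ((l - j' * t) + j * t) + 2 * \<rho>" .
    moreover have "j' * t \<le> l" using jj(2) unfolding q_def by (metis div_times_less_eq_dividend le_trans mult_le_mono1)
    ultimately have "j' * t \<le> j * t + 2 * \<rho>" by linarith
    moreover have "(j + 1) * t \<le> j' * t" using jj(1) by (intro mult_right_mono) auto
    ultimately show False by (simp add: t_def)
  qed
  have key: "I = I'" if I: "I \<in> J" "I' \<in> J" and mem: "v I - v I' \<in> \<Lambda>" for I I'
  proof -
    obtain j e f where I1: "I = (j, e, f)" "j \<le> q" "e \<le> \<rho>" "f \<le> \<rho>" using I(1) by (auto simp: J_def)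
    obtain j' e' f' where I2: "I' = (j', e', f')" "j' \<le> q" "e' \<le> \<rho>" "f' \<le> \<rho>" using I(2) by (auto simp: J_def)
    have m1: "(s j + \<beta> e f) - (s j' + \<beta> e' f') \<in> \<Lambda>" using mem by (simp add: v_def I1 I2)
    have m2: "(s j' + \<beta> e' f') - (s j + \<beta> e f) \<in> \<Lambda>" using uminus_mem[OF m1] by simp
    have jj: "j = j'" using lt[of j j' e f e' f'] lt[of j' j e' f' e f] m1 m2 I1 I2 by (meson linorder_neqE_nat)
    then have "\<beta> e f - \<beta> e' f' \<in> \<Lambda>" using m1 by simp
    moreover have "l1 (\<beta> e f - \<beta> e' f') < l1 a" using \<beta>[of e f e' f'] I1 I2 t by (simp add: t_def)
    ultimately have "\<beta> e f - \<beta> e' f' = 0" using a unfolding shortest_def by (meson not_le)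
    then have eq: "\<beta> e f $ i = \<beta> e' f' $ i" for i by simp
    have "e = e'" "f = f'" using eq[of i1] eq[of i2] i12 by (auto simp: \<beta>_def axis_def)
    then show ?thesis using jj I1 I2 by simp
  qed
  have "inj_on v J" using key zero_mem by (intro inj_onI) simp
  then have "card (v ` J) = (q + 1) * (\<rho> + 1) ^ 2" by (simp add: card_image J_def power2_eq_square)
  moreover have "card (v ` J) \<le> N"
  proof (rule ccontr)
    assume "\<not> card (v ` J) \<le> N"
    then have "N < card (v ` J)" "finite (v ` J)" by (simp_all add: J_def)
    then obtain m m' where "m \<in> v ` J" "m' \<in> v ` J" "m \<noteq> m'" "m - m' \<in> \<Lambda>" using collision by metis
    then show False using key by blast
  qed
  ultimately have cN: "(q + 1) * (\<rho> + 1) ^ 2 \<le> N" by simp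
  \<comment> \<open>There are (q + 1) (\<rho> + 1)^2 points in at most N classes. One factor \<rho>
    + 1 cancels against t, the other is at least half the length of a: hence the constant 4.\<close>
  have "l < t * (q + 1)" unfolding q_def using t(2) by (simp add: dividend_less_times_div)
  then have "l * (\<rho> + 1) ^ 2 \<le> t * ((q + 1) * (\<rho> + 1) ^ 2)"
    by (metis less_imp_le_nat mult.assoc mult_le_mono1)
  also have "\<dots> \<le> t * N" using cN by (rule mult_le_mono2)
  also have "\<dots> \<le> (2 * (\<rho> + 1)) * N" by (intro mult_le_mono1) (simp add: t_def)
  finally have "(l * (\<rho> + 1)) * (\<rho> + 1) \<le> (2 * N) * (\<rho> + 1)" by (simp add: power2_eq_square algebra_simps)
  then have "l * (\<rho> + 1) \<le> 2 * N" by (simp only: mult_le_cancel2)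
  moreover have "l1 a * l \<le> (2 * (\<rho> + 1)) * l" using t(3) by (rule mult_le_mono1)
  ultimately show ?thesis unfolding l_def[symmetric] by (simp add: algebra_simps)
qed

text \<open>Walk to m by unit steps and replace every point by a reduced representative. Consecutive
  representatives differ, up to the step, by a lattice vector c with |a| |c| at most 4 N + N + 4 N,
  which is the origin of the 9; the sum of these vectors is m when m is in the lattice.\<close>

lemma lattice_generated:
  assumes a: "shortest a" and M: "0 \<in> M" "\<And>m l. m \<in> M \<Longrightarrow> l \<in> M \<Longrightarrow> m + l \<in> M"
    and short: "\<And>c. c \<in> \<Lambda> \<Longrightarrow> c \<noteq> 0 \<Longrightarrow> l1 a * l1 c \<le> 9 * N \<Longrightarrow> c \<in> M"
  shows "\<Lambda> \<subseteq> M"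
proof -
  have main: "m - r \<in> M" if "reduced r" "r - m \<in> \<Lambda>" for m r
    using that
  proof (induction "l1 m" arbitrary: m r)
    case 0
    then have m: "m = 0" by (metis l1_eq_0_iff)
    then have "- r \<in> \<Lambda>" using uminus_mem[OF 0(3)] by simp
    then have "l1 r \<le> l1 (r + - r)" using 0(2) unfolding reduced_def by blast
    then show ?case using m M(1) by simp
  next
    case (Suc k)
    obtain i e where e: "e = 1 \<or> e = - 1" "l1 (m - axis i e) = k" by (rule l1_step[OF Suc.hyps(2)[symmetric]])
    define m' where "m' = m - axis i e"
    obtain r' where r': "reduced r'" "r' - m' \<in> \<Lambda>" by (rule reduced_representative)
    have IH: "m' - r' \<in> M" using Suc.hyps(1)[of m' r'] e r' by (simp add: m'_def)
    define c where "c = (r' + axis i e) - r"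
    have "c = (r' - m') - (r - m)" by (simp add: c_def m'_def)
    then have c: "c \<in> \<Lambda>" using diff_closed[OF r'(2) Suc.prems(2)] by simp
    have "l1 c \<le> (l1 r' + 1) + l1 r"
      unfolding c_def using l1_diff[of "r' + axis i e" r] l1_add[of r' "axis i e"] e(1) by auto
    then have "l1 a * l1 c \<le> l1 a * ((l1 r' + 1) + l1 r)" by (rule mult_le_mono2)
    also have "\<dots> = l1 a * l1 r' + l1 a + l1 a * l1 r" by (simp add: algebra_simps)
    also have "\<dots> \<le> 4 * N + N + 4 * N"
      using reduced_bound[OF a r'(1)] reduced_bound[OF a Suc.prems(1)] shortest_le_N[OF a] by linarith
    finally have "l1 a * l1 c \<le> 9 * N" by simp
    then have "c \<in> M" using short[OF c] M(1) by (cases "c = 0") auto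
    moreover have "m - r = (m' - r') + c" by (simp add: c_def m'_def)
    ultimately show ?case using M(2)[OF IH] by simp
  qed
  show ?thesis
  proof
    fix m assume "m \<in> \<Lambda>"
    then have "0 - m \<in> \<Lambda>" using uminus_mem by simp
    moreover have "reduced 0" by (simp add: reduced_def)
    ultimately show "m \<in> M" using main[of 0 m] by simp
  qed
qed

end

section \<open>Rational closures of primes\<close>

text \<open>The extension of q to the ring in which nonzero integers are inverted, that is, to the
  generic fibre.\<close>

definition rational_closure :: "'a::comm_ring_1 set \<Rightarrow> 'a set" where
  "rational_closure q = {f. \<exists>n::int. n \<noteq> 0 \<and> of_int n * f \<in> q}"

lemma rational_closure_superset: "q \<subseteq> rational_closure q"
  by (auto simp: rational_closure_def intro!: exI[of _ 1])

lemma rational_closure_mono: "q \<subseteq> r \<Longrightarrow> rational_closure q \<subseteq> rational_closure r"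
  by (auto simp: rational_closure_def)

text \<open>The whole ring is S with the nonzero integers inverted, so primes of it correspond to
  the primes of S that contain no nonzero integer.\<close>

locale integral_form =
  fixes S :: "'a::comm_ring_1 set"
  assumes S: "subring_set S" and S_multiple: "\<And>f. \<exists>n::int. n \<noteq> 0 \<and> of_int n * f \<in> S"
    and inverse_int: "\<And>n::int. n \<noteq> 0 \<Longrightarrow> \<exists>r::'a. of_int n * r = 1"
begin

lemma of_int_notin_prime:
  assumes q: "prime_set UNIV q" and m: "m \<noteq> 0" shows "(of_int m :: 'a) \<notin> q"
proof
  assume mq: "of_int m \<in> q"
  obtain r :: 'a where "of_int m * r = 1" using inverse_int[OF m] by blast
  then show False using ideal_set_rmult[OF prime_set_ideal[OF q] UNIV_I mq, of r] prime_set_1[OF q] by simp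
qed

lemma rational_closure_least:
  fixes J :: "'a set"
  assumes J: "ideal_set UNIV J" and q: "q \<subseteq> J" shows "rational_closure q \<subseteq> J"
proof
  fix f assume "f \<in> rational_closure q"
  then obtain n :: int where n: "n \<noteq> 0" "of_int n * f \<in> q" by (auto simp: rational_closure_def)
  obtain r :: 'a where r: "of_int n * r = 1" using inverse_int[OF n(1)] by blast
  have "of_int n * f \<in> J" using n(2) q by blast
  then have "r * (of_int n * f) \<in> J" by (rule ideal_set_lmult[OF J UNIV_I])
  moreover have "r * (of_int n * f) = f" using r by (metis mult.assoc mult.commute mult_1)
  ultimately show "f \<in> J" by simp
qed

context
  fixes q assumes q: "prime_set S q" and no_int: "\<And>m::int. m \<noteq> 0 \<Longrightarrow> of_int m \<notin> q"
begin

lemma rational_closure_Int: "rational_closure q \<inter> S = q"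
proof (intro equalityI subsetI)
  fix f assume "f \<in> rational_closure q \<inter> S"
  then obtain n :: int where n: "n \<noteq> 0" "of_int n * f \<in> q" "f \<in> S" by (auto simp: rational_closure_def)
  then show "f \<in> q" using mult_mem_prime_set_cancel[OF q subring_set_of_int[OF S]] no_int by blast
next
  fix f assume "f \<in> q"
  then show "f \<in> rational_closure q \<inter> S" using rational_closure_superset prime_set_subset[OF q] by blast
qed

lemma prime_set_rational_closure: "prime_set UNIV (rational_closure q)"
proof -
  note qi = prime_set_ideal[OF q]
  note int = subring_set_of_int[OF S]
  have closed: "f + g \<in> rational_closure q" if f: "f \<in> rational_closure q" and g: "g \<in> rational_closure q" for f g
  proof -
    obtain n :: int where n: "n \<noteq> 0" "of_int n * f \<in> q" using f by (auto simp: rational_closure_def)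
    obtain m :: int where m: "m \<noteq> 0" "of_int m * g \<in> q" using g by (auto simp: rational_closure_def)
    have "of_int (n * m) * (f + g) = of_int m * (of_int n * f) + of_int n * (of_int m * g)"
      by (simp add: algebra_simps)
    also have "\<dots> \<in> q" by (intro ideal_set_add[OF qi] ideal_set_lmult[OF qi] int n m)
    finally show ?thesis using n(1) m(1) unfolding rational_closure_def by (intro CollectI exI[of _ "n * m"]) auto
  qed
  have scaled: "s * f \<in> rational_closure q" if f: "f \<in> rational_closure q" for s f
  proof -
    obtain n :: int where n: "n \<noteq> 0" "of_int n * f \<in> q" using f by (auto simp: rational_closure_def)
    obtain m :: int where m: "m \<noteq> 0" "of_int m * s \<in> S" using S_multiple by blast
    have "of_int (n * m) * (s * f) = (of_int m * s) * (of_int n * f)" by (simp add: algebra_simps)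
    also have "\<dots> \<in> q" by (intro ideal_set_lmult[OF qi] n m)
    finally show ?thesis using n(1) m(1) unfolding rational_closure_def by (intro CollectI exI[of _ "n * m"]) auto
  qed
  have split: "f \<in> rational_closure q \<or> g \<in> rational_closure q" if fg: "f * g \<in> rational_closure q" for f g
  proof -
    obtain n :: int where n: "n \<noteq> 0" "of_int n * (f * g) \<in> q" using fg by (auto simp: rational_closure_def)
    obtain a :: int where a: "a \<noteq> 0" "of_int a * f \<in> S" using S_multiple by blast
    obtain b :: int where b: "b \<noteq> 0" "of_int b * g \<in> S" using S_multiple by blast
    have "of_int n * ((of_int a * f) * (of_int b * g)) = of_int (a * b) * (of_int n * (f * g))"
      by (simp add: algebra_simps)
    also have "\<dots> \<in> q" by (intro ideal_set_lmult[OF qi] int n)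
    finally have "(of_int a * f) * (of_int b * g) \<in> q"
      using mult_mem_prime_set_cancel[OF q int subring_set_mult[OF S a(2) b(2)] no_int[OF n(1)]] by blast
    then have "of_int a * f \<in> q \<or> of_int b * g \<in> q" by (rule prime_setD[OF q a(2) b(2)])
    then show ?thesis using a(1) b(1) by (auto simp: rational_closure_def)
  qed
  have "1 \<notin> rational_closure q" using no_int by (auto simp: rational_closure_def)
  moreover have "0 \<in> rational_closure q" using rational_closure_superset prime_set_0[OF q] by blast
  ultimately show ?thesis unfolding prime_set_def ideal_set_def using closed scaled split by blast
qed

end

end

section \<open>Laurent polynomials with integral coefficients\<close>

definition integral_laurent :: "((int^'n::finite) \<Rightarrow>\<^sub>0 'k::field_char_0) set" where
  "integral_laurent = {f. \<forall>m. algebraic_int (Poly_Mapping.lookup f m)}"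

lemma carrier_integers: "carrier \<O> = {x. algebraic_int x}"
  by (simp add: ring_of_integers_def)

lemma laurent_integers: "laurent (carrier \<O>) = ring_on integral_laurent"
  by (simp add: laurent_def integral_laurent_def carrier_integers)

lemma single_integral [simp]: "Poly_Mapping.single m c \<in> integral_laurent \<longleftrightarrow> algebraic_int c"
  by (auto simp: integral_laurent_def lookup_single when_def)

lemma mon_in_subring:
  fixes T :: "((int^'n::finite) \<Rightarrow>\<^sub>0 'k::comm_ring_1) set"
  assumes T: "subring_set T" and gens: "\<And>i s. s = 1 \<or> s = - 1 \<Longrightarrow> mon (axis i s) \<in> T"
  shows "mon m \<in> T"
proof (induction "l1 m" arbitrary: m)
  case 0
  then have "mon m = (1 :: (int^'n) \<Rightarrow>\<^sub>0 'k)" by (metis l1_eq_0_iff single_one)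
  then show ?case using subring_set_1[OF T] by simp
next
  case (Suc k)
  obtain i s where s: "s = 1 \<or> s = - 1" "l1 (m - axis i s) = k" by (rule l1_step[OF Suc.hyps(2)[symmetric]])
  have "mon m = mon (m - axis i s) * (mon (axis i s) :: (int^'n) \<Rightarrow>\<^sub>0 'k)" by (simp add: mult_single)
  then show ?case using subring_set_mult[OF T Suc.hyps(1)[OF s(2)[symmetric]] gens[OF s(1)]] by simp
qed

lemma in_subring_by_terms:
  fixes T :: "((int^'n::finite) \<Rightarrow>\<^sub>0 'k::comm_ring_1) set"
  assumes T: "subring_set T" and gens: "\<And>i s. s = 1 \<or> s = - 1 \<Longrightarrow> mon (axis i s) \<in> T"
    and coeffs: "\<And>m. Poly_Mapping.single 0 (Poly_Mapping.lookup f m) \<in> T"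
  shows "f \<in> T"
proof -
  have "Poly_Mapping.single m (Poly_Mapping.lookup f m) \<in> T" for m
  proof -
    have "Poly_Mapping.single m (Poly_Mapping.lookup f m) = Poly_Mapping.single 0 (Poly_Mapping.lookup f m) * mon m"
      by (simp add: mult_single)
    then show ?thesis using subring_set_mult[OF T coeffs mon_in_subring[OF T gens]] by metis
  qed
  then have "(\<Sum>m\<in>Poly_Mapping.keys f. Poly_Mapping.single m (Poly_Mapping.lookup f m)) \<in> T"
    by (intro subring_set_sum[OF T])
  then show ?thesis by (simp flip: poly_mapping_expand)
qed

definition unit_mons :: "((int^'n::finite) \<Rightarrow>\<^sub>0 'k::comm_ring_1) set" where
  "unit_mons = (\<lambda>(i, s). mon (axis i s)) ` (UNIV \<times> {1, - 1})"

lemma unit_mons: "s = 1 \<or> s = - 1 \<Longrightarrow> mon (axis i s) \<in> unit_mons"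
  by (auto simp: unit_mons_def)

lemma finite_unit_mons: "finite unit_mons"
  by (simp add: unit_mons_def)

lemma word_mon:
  fixes m :: "int^'n::finite"
  shows "word (unit_mons :: ((int^'n) \<Rightarrow>\<^sub>0 'k::comm_ring_1) set) (l1 m) (mon m)"
proof (induction "l1 m" arbitrary: m)
  case 0
  then have "mon m = (1 :: (int^'n) \<Rightarrow>\<^sub>0 'k)" by (metis l1_eq_0_iff single_one)
  then show ?case using 0 word_0 by metis
next
  case (Suc k)
  obtain i s where s: "s = 1 \<or> s = - 1" "l1 (m - axis i s) = k" by (rule l1_step[OF Suc.hyps(2)[symmetric]])
  have "mon m = (mon (axis i s) :: (int^'n) \<Rightarrow>\<^sub>0 'k) * mon (m - axis i s)" by (simp add: mult_single)
  then show ?case using word_Suc[OF unit_mons[OF s(1)] Suc.hyps(1)[OF s(2)[symmetric]]] Suc.hyps(2) s(2) by metis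
qed

lemma inverse_int_poly_mapping:
  assumes "n \<noteq> 0"
  shows "of_int n * Poly_Mapping.single 0 (inverse (of_int n)) = (1 :: 'm::comm_monoid_add \<Rightarrow>\<^sub>0 'k::field_char_0)"
proof -
  have "of_int n * Poly_Mapping.single 0 (inverse (of_int n)) =
      Poly_Mapping.single 0 (of_int n) * (Poly_Mapping.single 0 (inverse (of_int n)) :: 'm \<Rightarrow>\<^sub>0 'k)"
    by (simp only: single_of_int)
  also have "\<dots> = 1" using assms by (simp add: mult_single del: single_of_int)
  finally show ?thesis .
qed

text \<open>Finite generation over the rationals, phrased through subrings that contain the inverses
  of integers: a basis of K and the monomials of length 1 generate everything.\<close>

lemma laurent_generators:
  assumes "number_field TYPE('k::field_char_0)"
  obtains xs :: "((int^'n::finite) \<Rightarrow>\<^sub>0 'k::field_char_0) list" where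
    "\<forall>T. subring_set T \<longrightarrow> (\<forall>n r. n \<noteq> 0 \<longrightarrow> of_int n * r = 1 \<longrightarrow> r \<in> T) \<longrightarrow> set xs \<subseteq> T \<longrightarrow> T = UNIV"
proof -
  obtain B where B: "finite_dimensional_vector_space (\<lambda>q (x::'k). of_rat q * x) B"
    using assms by (auto simp: number_field_def)
  interpret finite_dimensional_vector_space "\<lambda>q (x::'k). of_rat q * x" B by (rule B)
  have "finite (Poly_Mapping.single 0 ` B \<union> unit_mons :: ((int^'n) \<Rightarrow>\<^sub>0 'k) set)"
    by (intro finite_UnI finite_imageI finite_Basis finite_unit_mons)
  then obtain xs where xs: "set xs = (Poly_Mapping.single 0 ` B \<union> unit_mons :: ((int^'n) \<Rightarrow>\<^sub>0 'k) set)"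
    by (rule finite_list[THEN exE]) (rule that)
  have "T = UNIV" if T: "subring_set T" and inv: "\<And>n r. n \<noteq> 0 \<Longrightarrow> of_int n * r = 1 \<Longrightarrow> r \<in> T" and sub: "set xs \<subseteq> T"
    for T :: "((int^'n) \<Rightarrow>\<^sub>0 'k) set"
  proof -
    have rat: "Poly_Mapping.single 0 (of_rat q) \<in> T" for q
    proof (cases q)
      case (Fract a b)
      then have "(of_rat q :: 'k) = of_int a * inverse (of_int b)" by (simp add: of_rat_rat divide_inverse)
      then have "Poly_Mapping.single 0 (of_rat q) =
          Poly_Mapping.single 0 (of_int a) * (Poly_Mapping.single 0 (inverse (of_int b)) :: (int^'n) \<Rightarrow>\<^sub>0 'k)"
        by (simp add: mult_single del: single_of_int)
      then have e: "Poly_Mapping.single 0 (of_rat q) =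
          of_int a * (Poly_Mapping.single 0 (inverse (of_int b)) :: (int^'n) \<Rightarrow>\<^sub>0 'k)"
        by (simp only: single_of_int)
      have b0: "b \<noteq> 0" using Fract(2) by simp
      have "(Poly_Mapping.single 0 (inverse (of_int b)) :: (int^'n) \<Rightarrow>\<^sub>0 'k) \<in> T"
        by (rule inv[OF b0 inverse_int_poly_mapping[OF b0]])
      then show ?thesis unfolding e by (intro subring_set_mult[OF T] subring_set_of_int[OF T])
    qed
    have "subspace {c. Poly_Mapping.single 0 c \<in> T}"
    proof (rule subspaceI)
      show "0 \<in> {c. Poly_Mapping.single 0 c \<in> T}" using subring_set_0[OF T] by simp
    next
      fix x y assume "x \<in> {c. Poly_Mapping.single 0 c \<in> T}" "y \<in> {c. Poly_Mapping.single 0 c \<in> T}"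
      then show "x + y \<in> {c. Poly_Mapping.single 0 c \<in> T}" by (simp add: single_add subring_set_add[OF T])
    next
      fix q x assume x: "x \<in> {c. Poly_Mapping.single 0 c \<in> T}"
      have "Poly_Mapping.single 0 (of_rat q * x) = Poly_Mapping.single 0 (of_rat q) * (Poly_Mapping.single 0 x :: (int^'n) \<Rightarrow>\<^sub>0 'k)"
        by (simp add: mult_single)
      then show "of_rat q * x \<in> {c. Poly_Mapping.single 0 c \<in> T}" using subring_set_mult[OF T rat] x by simp
    qed
    moreover have "B \<subseteq> {c. Poly_Mapping.single 0 c \<in> T}" using sub unfolding xs by blast
    ultimately have "span B \<subseteq> {c. Poly_Mapping.single 0 c \<in> T}" by (intro span_minimal)
    then have coeffs: "Poly_Mapping.single 0 c \<in> T" for c using span_Basis by blast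
    have um: "mon (axis i s) \<in> T" if "s = 1 \<or> s = - 1" for i s
      using sub unit_mons[OF that] unfolding xs by blast
    show "T = UNIV" using in_subring_by_terms[OF T um coeffs] by blast
  qed
  then have "\<forall>T. subring_set T \<longrightarrow> (\<forall>n r. n \<noteq> 0 \<longrightarrow> of_int n * r = 1 \<longrightarrow> r \<in> T) \<longrightarrow> set xs \<subseteq> T \<longrightarrow> T = UNIV"
    by presburger
  then show thesis by (rule that)
qed

lemma single_notin_prime:
  fixes q :: "((int^'n::finite) \<Rightarrow>\<^sub>0 'k::field) set"
  assumes "prime_set UNIV q" "c \<noteq> 0" shows "Poly_Mapping.single 0 c \<notin> q"
proof
  assume "Poly_Mapping.single 0 c \<in> q"
  then have "Poly_Mapping.single 0 c * Poly_Mapping.single 0 (inverse c) \<in> q"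
    by (rule ideal_set_rmult[OF prime_set_ideal[OF assms(1)] UNIV_I])
  then show False using prime_set_1[OF assms(1)] assms(2) by (simp add: mult_single)
qed

context
  assumes int: "subring_set {x::'k::field_char_0. algebraic_int x}"
begin

lemma subring_constants: "subring_set (Poly_Mapping.single 0 ` {x::'k. algebraic_int x} :: ((int^'n::finite) \<Rightarrow>\<^sub>0 'k) set)"
proof (rule subring_setI)
  show "1 \<in> (Poly_Mapping.single 0 ` {x::'k. algebraic_int x} :: ((int^'n) \<Rightarrow>\<^sub>0 'k) set)"
    using subring_set_1[OF int] by (intro image_eqI[of _ _ 1]) auto
next
  fix x y assume "x \<in> (Poly_Mapping.single 0 ` {x::'k. algebraic_int x} :: ((int^'n) \<Rightarrow>\<^sub>0 'k) set)"
    "y \<in> (Poly_Mapping.single 0 ` {x::'k. algebraic_int x} :: ((int^'n) \<Rightarrow>\<^sub>0 'k) set)"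
  then obtain c d where c: "c \<in> {x::'k. algebraic_int x}" "x = Poly_Mapping.single 0 c"
    and d: "d \<in> {x::'k. algebraic_int x}" "y = Poly_Mapping.single 0 d" by blast
  have "x - y = Poly_Mapping.single 0 (c - d)" by (simp add: c d single_diff)
  then show "x - y \<in> Poly_Mapping.single 0 ` {x::'k. algebraic_int x}" using subring_set_diff[OF int c(1) d(1)] by blast
  have "x * y = Poly_Mapping.single 0 (c * d)" by (simp add: c d mult_single)
  then show "x * y \<in> Poly_Mapping.single 0 ` {x::'k. algebraic_int x}" using subring_set_mult[OF int c(1) d(1)] by blast
qed

text \<open>k divides a nonzero integer n, and a prime number l above |n| generates a proper ideal
  since 1/l is no algebraic integer. A prime above l cannot contain k, because l and n are
  coprime.\<close>

lemma integer_prime_exists: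
  fixes k :: 'k
  assumes k: "algebraic_int k" "k \<noteq> 0"
  obtains \<pp> and l :: nat where "prime_set {x::'k. algebraic_int x} \<pp>" "k \<notin> \<pp>" "l > 0" "of_nat l \<in> \<pp>"
proof -
  obtain n :: int and e where n: "n \<noteq> 0" "algebraic_int e" "of_int n = k * e" by (rule algebraic_int_divides_int[OF int k])
  obtain l :: nat where l: "prime l" "l > nat \<bar>n\<bar>" using bigger_prime by blast
  define J where "J = (\<lambda>r. of_nat l * r) ` {x::'k. algebraic_int x}"
  have J: "ideal_set {x::'k. algebraic_int x} J"
    unfolding ideal_set_def
  proof (intro conjI ballI)
    show "J \<subseteq> {x. algebraic_int x}" unfolding J_def using subring_set_mult[OF int subring_set_of_nat[OF int]] by blast
    show "0 \<in> J" unfolding J_def using subring_set_0[OF int] by (intro image_eqI[of _ _ 0]) auto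
  next
    fix x y assume "x \<in> J" "y \<in> J"
    then obtain r s where "x = of_nat l * r" "y = of_nat l * s" "r \<in> {x::'k. algebraic_int x}" "s \<in> {x::'k. algebraic_int x}"
      unfolding J_def by blast
    then show "x + y \<in> J" unfolding J_def using subring_set_add[OF int, of r s] by (intro image_eqI[of _ _ "r + s"]) (auto simp: algebra_simps)
  next
    fix s x assume "s \<in> {x::'k. algebraic_int x}" "x \<in> J"
    then obtain r where "x = of_nat l * r" "r \<in> {x::'k. algebraic_int x}" unfolding J_def by blast
    then show "s * x \<in> J" unfolding J_def using subring_set_mult[OF int \<open>s \<in> _\<close>, of r] by (intro image_eqI[of _ _ "s * r"]) (auto simp: algebra_simps)
  qed
  have "1 \<notin> J"
  proof
    assume "1 \<in> J"
    then obtain r :: 'k where r: "1 = of_nat l * r" "algebraic_int r" unfolding J_def by blast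
    have l0: "(of_nat l :: 'k) \<noteq> 0" using l(2) by simp
    then have "r = of_rat (1 / of_nat l)" using r(1) by (simp add: of_rat_divide field_simps)
    then have "r \<in> \<rat>" by simp
    then have "r \<in> \<int>" using r(2) by (rule rational_algebraic_int_is_int[rotated])
    then obtain z where "r = of_int z" by (rule Ints_cases)
    then have "of_int (int l * z) = (1 :: 'k)" using r(1) by simp
    then have "int l * z = 1" by (simp only: of_int_eq_1_iff)
    then have "l = 1" using pos_zmult_eq_1_iff_lemma[of "int l" z] by simp
    then show False using l(1) by simp
  qed
  then have "J \<inter> {1} = {}" by blast
  then obtain \<pp> where p: "prime_set {x::'k. algebraic_int x} \<pp>" "J \<subseteq> \<pp>"
    by (rule prime_set_avoiding[OF int J, of "{1}", rotated 3]) (use subring_set_1[OF int] in auto)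
  have lp: "of_nat l \<in> \<pp>" using p(2) subring_set_1[OF int] unfolding J_def by force
  have "k \<notin> \<pp>"
  proof
    assume "k \<in> \<pp>"
    then have "k * e \<in> \<pp>" using n(2) by (intro ideal_set_rmult[OF prime_set_ideal[OF p(1)]]) auto
    then have np: "of_int n \<in> \<pp>" using n(3) by simp
    have "\<not> int l dvd n" using l n(1) zdvd_not_zless[of "\<bar>n\<bar>" "int l"] by auto
    then have "coprime (int l) n" using l(1) by (intro prime_imp_coprime) auto
    then obtain u v where "u * int l + v * n = 1" using bezout_int[of "int l" n] by auto
    then have "of_int u * of_nat l + of_int v * of_int n = (1 :: 'k)" by (metis of_int_1 of_int_add of_int_mult of_int_of_nat_eq)
    moreover have "of_int u * of_nat l + of_int v * of_int n \<in> \<pp>"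
      by (intro ideal_set_add[OF prime_set_ideal[OF p(1)]] ideal_set_lmult[OF prime_set_ideal[OF p(1)]] lp np subring_set_of_int[OF int])
    ultimately show False using prime_set_1[OF p(1)] by simp
  qed
  moreover have "l > 0" using l(2) by simp
  ultimately show thesis using p(1) lp by (intro that)
qed

lemma foldl_adjoin_constants:
  assumes R: "R = Poly_Mapping.single 0 ` {x::'k. algebraic_int x}" and xs: "set xs = unit_mons"
    and S: "subring_set (integral_laurent :: ((int^'n::finite) \<Rightarrow>\<^sub>0 'k) set)"
  shows "foldl adjoin R xs = (integral_laurent :: ((int^'n) \<Rightarrow>\<^sub>0 'k) set)"
proof
  have Rs: "subring_set R" unfolding R by (rule subring_constants)
  show "foldl adjoin R xs \<subseteq> integral_laurent"
    using subring_set_1[OF int] by (intro foldl_adjoin_subset[OF S]) (auto simp: R xs unit_mons_def)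
  show "integral_laurent \<subseteq> foldl adjoin R xs"
  proof
    fix f assume "f \<in> (integral_laurent :: ((int^'n) \<Rightarrow>\<^sub>0 'k) set)"
    then have "Poly_Mapping.single 0 (Poly_Mapping.lookup f m) \<in> R" for m by (auto simp: integral_laurent_def R)
    then have c: "Poly_Mapping.single 0 (Poly_Mapping.lookup f m) \<in> foldl adjoin R xs" for m using foldl_adjoin_base[OF Rs] by blast
    have g: "mon (axis i s) \<in> foldl adjoin R xs" if "s = 1 \<or> s = - 1" for i s
      using foldl_adjoin_gens[OF Rs, of xs] unit_mons[OF that] unfolding xs by blast
    show "f \<in> foldl adjoin R xs" by (rule in_subring_by_terms[OF foldl_adjoin_subring[OF Rs] g c])
  qed
qed

text \<open>A closed point of the generic fibre is not closed in the integral model. Almost every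
  prime of the integers of K lifts to S along the zero locus of q, and one is chosen that avoids the
  exceptional element h.\<close>

lemma prime_over_integer:
  fixes q :: "((int^'n::finite) \<Rightarrow>\<^sub>0 'k) set"
  assumes S: "subring_set (integral_laurent :: ((int^'n) \<Rightarrow>\<^sub>0 'k) set)" and q: "prime_set UNIV q"
  obtains x where "prime_set integral_laurent x" "q \<inter> integral_laurent \<subset> x"
proof -
  define R where "R = (Poly_Mapping.single 0 ` {x::'k. algebraic_int x} :: ((int^'n) \<Rightarrow>\<^sub>0 'k) set)"
  have R: "subring_set R" unfolding R_def by (rule subring_constants)
  obtain xs where xs: "set xs = (unit_mons :: ((int^'n) \<Rightarrow>\<^sub>0 'k) set)" using finite_list[OF finite_unit_mons] by blast
  have fo: "foldl adjoin R xs = integral_laurent" by (rule foldl_adjoin_constants[OF R_def xs S])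
  have "primes_lift q R integral_laurent" unfolding fo[symmetric] by (rule primes_lift_foldl_adjoin[OF R q])
  then obtain h where h: "h \<in> R" "h \<notin> q" "\<And>P. prime_set R P \<Longrightarrow> q \<inter> R \<subseteq> P \<Longrightarrow> h \<notin> P \<Longrightarrow>
        \<exists>Q. prime_set integral_laurent Q \<and> q \<inter> integral_laurent \<subseteq> Q \<and> Q \<inter> R = P \<and> 1 \<notin> Q"
    by (rule primes_liftE[OF _ subring_set_1[OF S] prime_set_1[OF q]]) (rule that)
  obtain k where k: "algebraic_int k" "h = Poly_Mapping.single 0 k" using h(1) unfolding R_def by blast
  have "k \<noteq> 0" using h(2) k(2) prime_set_0[OF q] by auto
  obtain \<pp> l where p: "prime_set {x::'k. algebraic_int x} \<pp>" "k \<notin> \<pp>" "l > 0" "of_nat l \<in> \<pp>"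
    by (rule integer_prime_exists[OF k(1) \<open>k \<noteq> 0\<close>])
  define P where "P = (Poly_Mapping.single 0 ` \<pp> :: ((int^'n) \<Rightarrow>\<^sub>0 'k) set)"
  have P_iff: "Poly_Mapping.single 0 c \<in> P \<longleftrightarrow> c \<in> \<pp>" for c
    unfolding P_def by (rule inj_image_mem_iff[OF inj_single])
  note pi = prime_set_ideal[OF p(1)]
  have "prime_set R P"
    unfolding prime_set_def ideal_set_def
  proof (intro conjI ballI impI)
    show "P \<subseteq> R" unfolding P_def R_def using prime_set_subset[OF p(1)] by blast
    show "0 \<in> P" using P_iff[of 0] prime_set_0[OF p(1)] by simp
    show "1 \<notin> P" using P_iff[of 1] prime_set_1[OF p(1)] by simp
  next
    fix x y assume "x \<in> P" "y \<in> P"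
    then show "x + y \<in> P" unfolding P_def using ideal_set_add[OF pi] by (auto simp: single_add[symmetric])
  next
    fix s x assume "s \<in> R" "x \<in> P"
    then show "s * x \<in> P" unfolding P_def R_def using ideal_set_lmult[OF pi] by (auto simp: mult_single)
  next
    fix x y assume "x \<in> R" "y \<in> R" and xy: "x * y \<in> P"
    then obtain c d where cd: "c \<in> {x. algebraic_int x}" "d \<in> {x. algebraic_int x}" "x = Poly_Mapping.single 0 c" "y = Poly_Mapping.single 0 d"
      unfolding R_def by blast
    then have "c * d \<in> \<pp>" using xy by (simp add: mult_single P_iff)
    then show "x \<in> P \<or> y \<in> P" using prime_setD[OF p(1) cd(1,2)] unfolding cd(3,4) P_iff by blast
  qed
  moreover have "q \<inter> R \<subseteq> P"
  proof
    fix f assume f: "f \<in> q \<inter> R"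
    then obtain c where c: "f = Poly_Mapping.single 0 c" unfolding R_def by blast
    then have "c = 0" using single_notin_prime[OF q, of c] f by blast
    then show "f \<in> P" using P_iff[of 0] prime_set_0[OF p(1)] c by simp
  qed
  moreover have "h \<notin> P" using p(2) by (simp add: k(2) P_iff)
  ultimately obtain Q where Q: "prime_set integral_laurent Q" "q \<inter> integral_laurent \<subseteq> Q" "Q \<inter> R = P" using h(3) by blast
  have "Poly_Mapping.single 0 (of_nat l) \<in> P" using p(4) by (simp only: P_iff)
  then have "Poly_Mapping.single 0 (of_nat l) \<in> Q" using Q(3) by blast
  moreover have "Poly_Mapping.single 0 (of_nat l) \<notin> q" by (rule single_notin_prime[OF q]) (use p(3) in simp)
  ultimately show thesis using Q by (intro that) auto
qed

lemma integral_form_laurent: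
  assumes d: "relation_bound TYPE('k) d" and S: "subring_set (integral_laurent :: ((int^'n::finite) \<Rightarrow>\<^sub>0 'k) set)"
  shows "integral_form (integral_laurent :: ((int^'n) \<Rightarrow>\<^sub>0 'k) set)"
proof
  show "\<exists>n::int. n \<noteq> 0 \<and> of_int n * f \<in> integral_laurent" for f :: "(int^'n) \<Rightarrow>\<^sub>0 'k"
  proof (induction f rule: poly_mapping_single_induct)
    case 1
    then show ?case using subring_set_0[OF S] by (intro exI[of _ 1]) simp
  next
    case (2 m a)
    obtain n :: int where n: "n \<noteq> 0" "algebraic_int (of_int n * a)" by (rule algebraic_int_multiple[OF d])
    have "of_int n * Poly_Mapping.single m a = Poly_Mapping.single 0 (of_int n) * Poly_Mapping.single m a"
      by (simp only: single_of_int)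
    also have "\<dots> \<in> integral_laurent" using n(2) by (simp add: mult_single del: single_of_int)
    finally show ?case using n(1) by (intro exI[of _ n]) simp
  next
    case (3 f g)
    then obtain n m :: int where n: "n \<noteq> 0" "of_int n * f \<in> integral_laurent" and m: "m \<noteq> 0" "of_int m * g \<in> integral_laurent"
      by blast
    have "of_int (n * m) * (f + g) = of_int m * (of_int n * f) + of_int n * (of_int m * g)" by (simp add: algebra_simps)
    also have "\<dots> \<in> integral_laurent"
      by (intro subring_set_add[OF S] subring_set_mult[OF S] subring_set_of_int[OF S] n m)
    finally show ?case using n(1) m(1) by (intro exI[of _ "n * m"]) simp
  qed
  show "\<exists>r :: (int^'n) \<Rightarrow>\<^sub>0 'k. of_int n * r = 1" if n: "n \<noteq> 0" for n :: int
    using inverse_int_poly_mapping[OF n] by blast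
qed (rule S)

end

section \<open>Torsion points on the surface\<close>

lemma ev_single: "ev (Poly_Mapping.single 0 c) f = (Poly_Mapping.single 0 (ev c f) :: 'm::comm_monoid_add \<Rightarrow>\<^sub>0 'k::comm_ring_1)"
proof (induction f)
  case 0
  then show ?case by (simp add: ev_def)
next
  case (pCons a f)
  have "ev (Poly_Mapping.single 0 c) (pCons a f) = Poly_Mapping.single 0 (of_int a) + Poly_Mapping.single 0 c * (Poly_Mapping.single 0 (ev c f) :: 'm \<Rightarrow>\<^sub>0 'k)"
    by (simp add: ev_pCons pCons.IH)
  also have "\<dots> = Poly_Mapping.single 0 (ev c (pCons a f))"
    by (simp add: ev_pCons mult_single single_add[symmetric] del: single_of_int)
  finally show ?case .
qed

lemma integral_laurent_generated:
  fixes T :: "((int^'n::finite) \<Rightarrow>\<^sub>0 'k::field_char_0) set"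
  assumes T: "subring_set T" and G: "unit_mons \<subseteq> T"
    and cl: "\<And>a f. a \<in> integral_laurent \<Longrightarrow> lead_coeff f = 1 \<Longrightarrow> ev a f = 0 \<Longrightarrow> a \<in> T"
  shows "integral_laurent \<subseteq> T"
proof
  fix f :: "(int^'n) \<Rightarrow>\<^sub>0 'k" assume f: "f \<in> integral_laurent"
  have g: "mon (axis i s) \<in> T" if "s = 1 \<or> s = - 1" for i s
    using G unit_mons[OF that] by (rule subsetD)
  have coeffs: "Poly_Mapping.single 0 (Poly_Mapping.lookup f m) \<in> T" for m
  proof -
    have "algebraic_int (Poly_Mapping.lookup f m)" using f by (simp add: integral_laurent_def)
    then obtain h where h: "poly (map_poly of_int h) (Poly_Mapping.lookup f m) = 0" "lead_coeff h = 1"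
      unfolding algebraic_int_altdef_ipoly by blast
    have "ev (Poly_Mapping.single 0 (Poly_Mapping.lookup f m)) h = (0 :: (int^'n) \<Rightarrow>\<^sub>0 'k)"
      using h(1) by (simp add: ev_single ev_def[of "Poly_Mapping.lookup f m"])
    then show ?thesis
      using \<open>algebraic_int (Poly_Mapping.lookup f m)\<close> by (intro cl[OF _ h(2)]) simp_all
  qed
  show "f \<in> T" by (rule in_subring_by_terms[OF T g coeffs])
qed

text \<open>Two natural numbers are congruent modulo P by finiteness, so P contains a positive one;
  some prime factor of the least such number lies in P.\<close>

lemma number_in_prime_of_finite_norm:
  fixes P :: "'k::field_char_0 set"
  assumes S: "subring_set {x::'k. algebraic_int x}" and P: "prime_set {x::'k. algebraic_int x} P" and fin: "ideal_norm P \<noteq> 0"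
  obtains p :: nat where "prime p" "of_nat p \<in> P"
proof -
  let ?O = "{x::'k. algebraic_int x}"
  have cO: "\<O> = ring_on ?O" by (simp add: ring_of_integers_def)
  note Pi = prime_set_ideal[OF P]
  \<comment> \<open>The cardinality of an infinite set is 0, so a nonzero norm expresses
    finiteness.\<close>
  have finite: "finite (carrier (\<O> Quot P))" using fin by (metis card.infinite ideal_norm_def)
  define F where "F k = P +>\<^bsub>\<O>\<^esub> (of_nat k :: 'k)" for k :: nat
  have "F ` UNIV \<subseteq> carrier (\<O> Quot P)"
    using subring_set_of_nat[OF S] by (auto simp: F_def FactRing_def A_RCOSETS_def' cO)
  then have "\<not> inj F" using finite by (metis finite_imageD finite_subset infinite_UNIV_nat)
  then obtain k l where kl: "k < l" "F k = F l" by (metis injI linorder_neqE_nat)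
  have "(of_nat l :: 'k) \<in> F l"
    unfolding F_def a_r_coset_def' cO ring_on_simps using ideal_set_0[OF Pi] by force
  then have "(of_nat l :: 'k) \<in> F k" using kl(2) by simp
  then obtain h where h: "h \<in> P" "(of_nat l :: 'k) = h + of_nat k"
    unfolding F_def a_r_coset_def' cO ring_on_simps by blast
  have "of_nat (l - k) = h" using kl(1) h(2) by (simp add: of_nat_diff)
  then have "\<exists>m. m > 0 \<and> (of_nat m :: 'k) \<in> P" using kl(1) h(1) by (intro exI[of _ "l - k"]) simp
  then obtain m where "m > 0 \<and> (of_nat m :: 'k) \<in> P" "\<forall>m'. m' > 0 \<and> (of_nat m' :: 'k) \<in> P \<longrightarrow> m \<le> m'"
    using ex_has_least_nat[of "\<lambda>m. m > 0 \<and> (of_nat m :: 'k) \<in> P" _ "\<lambda>m. m"] by blast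
  then have m: "m > 0" "(of_nat m :: 'k) \<in> P" and least: "\<And>m'. m' > 0 \<Longrightarrow> (of_nat m' :: 'k) \<in> P \<Longrightarrow> m \<le> m'"
    by blast+
  have "m \<noteq> 1" using m(2) prime_set_1[OF P] by auto
  then obtain p where p: "prime p" "p dvd m" using prime_factor_nat by blast
  then obtain k' where k': "m = p * k'" by (auto elim: dvdE)
  have "(of_nat p :: 'k) * of_nat k' \<in> P" using m(2) k' by simp
  then have "(of_nat p :: 'k) \<in> P \<or> (of_nat k' :: 'k) \<in> P"
    by (rule prime_setD[OF P subring_set_of_nat[OF S] subring_set_of_nat[OF S]])
  moreover have "(of_nat k' :: 'k) \<notin> P"
  proof
    assume "(of_nat k' :: 'k) \<in> P"
    then have "m \<le> k'" using least[of k'] k' m(1) by simp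
    then show False using k' m(1) prime_gt_1_nat[OF p(1)] by simp
  qed
  ultimately have "of_nat p \<in> P" by blast
  with p(1) show thesis by (rule that)
qed

lemma torsion_monomial:
  fixes x :: "((int^'n::finite) \<Rightarrow>\<^sub>0 'k::field_char_0) set" and m :: "int^'n"
  assumes S: "subring_set S" and mon: "\<And>m. mon m \<in> S" and x: "ideal_set S x"
    and var: "\<And>i. var i ^ N - 1 \<in> x"
  shows "mon m ^ N - 1 \<in> x"
proof (induction "l1 m" arbitrary: m)
  case 0
  then have "mon m = (1 :: (int^'n) \<Rightarrow>\<^sub>0 'k)" by (metis l1_eq_0_iff single_one)
  then show ?case using ideal_set_0[OF x] by simp
next
  case (Suc k)
  obtain i s where s: "s = 1 \<or> s = - 1" "l1 (m - axis i s) = k" by (rule l1_step[OF Suc.hyps(2)[symmetric]])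
  have pos: "(mon (axis i 1) :: (int^'n) \<Rightarrow>\<^sub>0 'k) ^ N - 1 \<in> x" using var[of i] by (simp add: var_def)
  have "(mon (axis i s) :: (int^'n) \<Rightarrow>\<^sub>0 'k) ^ N - 1 \<in> x"
  proof (cases "s = 1")
    case False
    define u where "u = (mon (axis i s) :: (int^'n) \<Rightarrow>\<^sub>0 'k)"
    define v where "v = (mon (axis i 1) :: (int^'n) \<Rightarrow>\<^sub>0 'k)"
    have "axis i s + axis i 1 = (0 :: int^'n)" using False s(1)
      by (simp add: Finite_Cartesian_Product.vec_eq_iff axis_def)
    then have "u * v = 1" by (simp add: u_def v_def mult_single)
    then have "u ^ N * v ^ N = 1" by (simp flip: power_mult_distrib)
    then have "u ^ N - 1 = - (u ^ N * (v ^ N - 1))" by (simp add: algebra_simps)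
    also have "\<dots> \<in> x"
      using pos mon unfolding u_def v_def
      by (intro ideal_set_uminus[OF S x] ideal_set_lmult[OF x] subring_set_power[OF S])
    finally show ?thesis by (simp add: u_def)
  qed (use pos in simp)
  moreover have "mon m = mon (m - axis i s) * (mon (axis i s) :: (int^'n) \<Rightarrow>\<^sub>0 'k)" by (simp add: mult_single)
  then have "(mon m :: (int^'n) \<Rightarrow>\<^sub>0 'k) ^ N - 1 =
      mon (m - axis i s) ^ N * (mon (axis i s) ^ N - 1) + (mon (m - axis i s) ^ N - 1)"
    by (simp add: power_mult_distrib algebra_simps)
  ultimately show ?case
    using Suc.hyps(1)[OF s(2)[symmetric]] mon
    by (metis ideal_set_add[OF x] ideal_set_lmult[OF x] subring_set_power[OF S])
qed

locale dominant_surface =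
  fixes I :: "((int^'n::finite) \<Rightarrow>\<^sub>0 'k::field_char_0) set"
  assumes K: "number_field TYPE('k)"
    and n: "CARD('n) \<ge> 2"
    and V_closed: "ideal I (laurent (carrier \<O>))"
    and V_integral: "domain (laurent (carrier \<O>) Quot I)"
    and V_dim: "krull_dim (subtopology (zariski (laurent (carrier \<O>)))
                  (zero_locus (laurent (carrier \<O>)) I)) = 2"
    and V_dominates: "dominates_base I"
    and V_generic: "\<And>J. algebraic_subgroup J \<Longrightarrow> J \<noteq> {0} \<Longrightarrow> \<not> J \<subseteq> generic_fibre I"
begin

abbreviation S :: "((int^'n) \<Rightarrow>\<^sub>0 'k) set" where
  "S \<equiv> integral_laurent"

text \<open>Extracted from \<open>V_closed\<close>: being an ideal presupposes that the ambient
  structure is a ring. The ring axioms for the algebraic integers of K follow from this by looking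
  at constants.\<close>

lemma S: "subring_set S"
proof -
  have "ring (ring_on S)" using V_closed ideal.axioms(2) unfolding laurent_integers by blast
  then show ?thesis by (rule subring_set_ring_on)
qed

lemma integers: "subring_set {x::'k. algebraic_int x}"
proof (rule subring_setI)
  have "Poly_Mapping.single 0 (1::'k) \<in> S" using subring_set_1[OF S] by simp
  then show "1 \<in> {x::'k. algebraic_int x}" by (simp only: single_integral mem_Collect_eq)
next
  fix x y :: 'k assume "x \<in> {x. algebraic_int x}" "y \<in> {x. algebraic_int x}"
  then have xy: "Poly_Mapping.single 0 x \<in> S" "Poly_Mapping.single 0 y \<in> S" by simp_all
  have "Poly_Mapping.single 0 (x - y) \<in> S" using subring_set_diff[OF S xy] by (simp only: single_diff)
  then show "x - y \<in> {x. algebraic_int x}" by simp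
  have "Poly_Mapping.single 0 (x * y) \<in> S" using subring_set_mult[OF S xy] by (simp add: mult_single)
  then show "x * y \<in> {x. algebraic_int x}" by simp
qed

lemma mon_S: "mon m \<in> S"
  using subring_set_1[OF integers] by simp

lemma I_prime: "prime_set S I"
  using cring.quot_domain_imp_primeideal[OF cring_ring_on[OF S]] V_closed V_integral
  unfolding laurent_integers primeideal_ring_on[OF S] by blast

text \<open>The image of V lies in the closed set cut out by the constants in I. By dominance this
  set contains the zero prime, so those constants vanish.\<close>

lemma constant_in_I:
  assumes "Poly_Mapping.single 0 c \<in> I" shows "c = 0"
proof -
  have cO: "\<O> = ring_on {x::'k. algebraic_int x}" by (simp add: ring_of_integers_def)
  define T where "T = {c::'k. algebraic_int c \<and> Poly_Mapping.single 0 c \<in> I}"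
  define A where "A = structure_map ` zero_locus (laurent (carrier \<O>)) I"
  have T: "T \<subseteq> {x. algebraic_int x}" by (auto simp: T_def)
  have closed: "closedin (zariski \<O>) (zero_locus \<O> T)"
    unfolding cO closedin_zariski[OF integers] using T by blast
  have "topspace (zariski \<O>) \<inter> A \<subseteq> zero_locus \<O> T"
  proof
    fix P assume P: "P \<in> topspace (zariski \<O>) \<inter> A"
    then obtain x where x: "x \<in> zero_locus (laurent (carrier \<O>)) I" "P = structure_map x" by (auto simp: A_def)
    have "I \<subseteq> x" using x(1) by (simp add: zero_locus_def)
    then have "T \<subseteq> P" unfolding x(2) by (auto simp: T_def structure_map_def spec_map_def carrier_integers)
    moreover have "P \<in> spec \<O>" using P unfolding cO topspace_zariski[OF integers] by blast
    ultimately show "P \<in> zero_locus \<O> T" by (simp add: zero_locus_def)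
  qed
  then have "zariski \<O> closure_of A \<subseteq> zero_locus \<O> T"
    using closure_of_minimal[OF _ closed] closure_of_restrict by metis
  then have "spec \<O> \<subseteq> zero_locus \<O> T" using V_dominates unfolding dominates_base_def A_def by simp
  moreover have "prime_set {x::'k. algebraic_int x} {0}"
    unfolding prime_set_def ideal_set_def using subring_set_0[OF integers] by auto
  then have "{0::'k} \<in> spec \<O>" unfolding cO spec_ring_on[OF integers] by simp
  ultimately have "T \<subseteq> {0}" by (auto simp: zero_locus_def)
  moreover have "algebraic_int c" using assms prime_set_subset[OF I_prime] by (metis single_integral subsetD)
  ultimately show ?thesis using assms by (auto simp: T_def)
qed

lemma int_notin_I: "m \<noteq> 0 \<Longrightarrow> of_int m \<notin> I"
  using constant_in_I[of "of_int m"] by auto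

lemma laurent_form: "integral_form S"
  using number_field_relation_bound[OF K] integral_form_laurent[OF integers _ S] by metis

interpretation integral_form S by (rule laurent_form)

abbreviation I\<^sub>K :: "((int^'n) \<Rightarrow>\<^sub>0 'k) set" where
  "I\<^sub>K \<equiv> rational_closure I"

lemma IK_prime: "prime_set UNIV I\<^sub>K"
  by (rule prime_set_rational_closure[OF I_prime int_notin_I])

lemma IK_Int: "I\<^sub>K \<inter> S = I"
  by (rule rational_closure_Int[OF I_prime int_notin_I])

lemma generic_fibre_eq: "generic_fibre I = I\<^sub>K"
proof
  show "generic_fibre I \<subseteq> I\<^sub>K" unfolding generic_fibre_def laurent_UNIV
    by (rule genideal_least[OF prime_set_ideal[OF IK_prime] rational_closure_superset])
  show "I\<^sub>K \<subseteq> generic_fibre I" unfolding generic_fibre_def laurent_UNIV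
    by (rule rational_closure_least[OF ideal_set_genideal genideal_superset])
qed

text \<open>Two independent functions on the generic fibre would give a chain of three primes above \<open>I\<close>, the
  last one containing a prime number.\<close>

lemma algebraically_dependent: "\<exists>P. P \<noteq> 0 \<and> ev2 y z P \<in> I\<^sub>K"
proof (rule ccontr)
  assume "\<not> (\<exists>P. P \<noteq> 0 \<and> ev2 y z P \<in> I\<^sub>K)"
  then have indep: "P = 0" if "ev2 y z P \<in> I\<^sub>K" for P using that by blast
  obtain xs :: "((int^'n) \<Rightarrow>\<^sub>0 'k) list" where xs:
    "\<forall>T. subring_set T \<longrightarrow> (\<forall>n r. n \<noteq> 0 \<longrightarrow> of_int n * r = 1 \<longrightarrow> r \<in> T) \<longrightarrow> set xs \<subseteq> T \<longrightarrow> T = UNIV"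
    by (rule laurent_generators[OF K]) (rule that)
  have gen: "T = UNIV" if T: "subring_set T" "\<And>n r. n \<noteq> 0 \<Longrightarrow> of_int n * r = 1 \<Longrightarrow> r \<in> T" "set xs \<subseteq> T"
    for T :: "((int^'n) \<Rightarrow>\<^sub>0 'k) set"
    by (rule xs[rule_format, OF T])
  obtain q1 q2 where q: "prime_set UNIV q1" "prime_set UNIV q2" "I\<^sub>K \<subset> q1" "q1 \<subset> q2"
    by (rule independent_prime_chain[OF IK_prime inverse_int gen indep])
  obtain q3 where q3: "prime_set S q3" "q2 \<inter> S \<subset> q3" by (rule prime_over_integer[OF integers S q(2)])
  \<comment> \<open>Intersecting with S keeps inclusions strict, since an element of the difference
    has an integer multiple in S and nonzero integers are units of the big ring.\<close>
  have strict: "r \<inter> S \<subset> r' \<inter> S" if r: "prime_set UNIV r" "prime_set UNIV r'" "r \<subset> r'" for r r'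
  proof -
    obtain f where f: "f \<in> r'" "f \<notin> r" using r(3) by blast
    obtain m :: int where m: "m \<noteq> 0" "of_int m * f \<in> S" using S_multiple by blast
    have "of_int m * f \<in> r'" by (rule ideal_set_lmult[OF prime_set_ideal[OF r(2)] UNIV_I f(1)])
    moreover have "of_int m * f \<notin> r"
      by (rule prime_set_not_mult[OF r(1) UNIV_I UNIV_I of_int_notin_prime[OF r(1) m(1)] f(2)])
    ultimately show ?thesis using m(2) r(3) by blast
  qed
  define Q where "Q i = (if i = 0 then q3 else if i = 1 then q2 \<inter> S else if i = 2 then q1 \<inter> S else I)" for i :: nat
  have "enat 3 \<le> krull_dim (subtopology (zariski (ring_on S)) (zero_locus (ring_on S) I))"
  proof (rule krull_dim_prime_chain[OF S, of 3 Q])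
    fix i :: nat
    show "prime_set S (Q i)"
      using q3(1) I_prime prime_set_Int[OF q(1) S] prime_set_Int[OF q(2) S] by (simp add: Q_def)
    assume "i < 3"
    then consider "i = 0" | "i = 1" | "i = 2" by linarith
    then show "Q (Suc i) \<subset> Q i"
    proof cases
      case 3
      have "I \<subset> q1 \<inter> S" using strict[OF IK_prime q(1,3)] unfolding IK_Int .
      then show ?thesis using 3 by (simp add: Q_def)
    qed (use strict[OF q(1,2,4)] q3(2) in \<open>auto simp: Q_def\<close>)
  qed (simp add: Q_def)
  then have "enat 3 \<le> 2" using V_dim by (simp add: laurent_integers)
  then show False by (simp add: numeral_eq_enat)
qed

lemma torsion_curve_laurent: "torsion_curve I\<^sub>K S unit_mons"
proof
  show "prime_set UNIV I\<^sub>K" by (rule IK_prime)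
  show "of_int m \<notin> I\<^sub>K" if "m \<noteq> 0" for m by (rule of_int_notin_prime[OF IK_prime that])
  show "subring_set S" by (rule S)
  show "finite (unit_mons :: ((int^'n) \<Rightarrow>\<^sub>0 'k) set)" by (rule finite_unit_mons)
  show "unit_mons \<subseteq> S" using mon_S by (auto simp: unit_mons_def)
  show "\<exists>P. P \<noteq> 0 \<and> ev2 y z P \<in> I\<^sub>K" for y z by (rule algebraically_dependent)
qed (rule integral_laurent_generated)

text \<open>Here the hypothesis on algebraic subgroups enters: otherwise the generic fibre would lie
  in the proper subgroup X^a = 1.\<close>

lemma mon_notin_IK:
  assumes "a \<noteq> 0" shows "mon a - 1 \<notin> I\<^sub>K"
proof
  assume a: "mon a - 1 \<in> I\<^sub>K"
  have "subgroup_ideal {a} \<subseteq> I\<^sub>K"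
    unfolding subgroup_ideal_def laurent_UNIV using a by (intro genideal_least[OF prime_set_ideal[OF IK_prime]]) simp
  moreover have "mon a - 1 \<in> (subgroup_ideal {a} :: ((int^'n) \<Rightarrow>\<^sub>0 'k) set)"
    unfolding subgroup_ideal_def laurent_UNIV using genideal_superset[of "(\<lambda>m. mon m - 1) ` {a}"] by auto
  moreover have "Poly_Mapping.lookup (mon a - 1 :: (int^'n) \<Rightarrow>\<^sub>0 'k) a = 1"
    using assms by (simp add: lookup_minus lookup_one when_def)
  then have "mon a - 1 \<noteq> (0 :: (int^'n) \<Rightarrow>\<^sub>0 'k)" by auto
  ultimately show False
    using V_generic[OF algebraic_subgroup_subgroup_ideal, of "{a}"] unfolding generic_fibre_eq by blast
qed

text \<open>y is the generic point of the horizontal curve, seen in the generic fibre. Its image in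
  V is q itself, and x lies in the closure because q is contained in x; the subgroup is X^a = X^b =
  1.\<close>

lemma unlikely_lift_rational_closure:
  fixes a b :: "int^'n"
  assumes q: "prime_set S q" "I \<subseteq> q" "\<And>m::int. m \<noteq> 0 \<Longrightarrow> of_int m \<notin> q"
    and x: "prime_set S x" "q \<subseteq> x" and ab: "mon a - 1 \<in> q" "mon b - 1 \<in> q" "a $ i * b $ j \<noteq> a $ j * b $ i"
  shows "unlikely_lift I x (rational_closure q)"
proof -
  note y = prime_set_rational_closure[OF q(1,3)]
  have "rational_closure q \<in> zero_locus (laurent UNIV) (generic_fibre I)"
    unfolding laurent_UNIV zero_locus_ring_on[OF subring_set_UNIV] generic_fibre_eq
    using y rational_closure_mono[OF q(2)] by simp
  moreover have "rational_closure q \<in> zero_locus (laurent UNIV) (subgroup_ideal {a, b})"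
  proof -
    have "(\<lambda>m. mon m - 1) ` {a, b} \<subseteq> rational_closure q" using ab(1,2) rational_closure_superset[of q] by auto
    then show ?thesis unfolding laurent_UNIV zero_locus_ring_on[OF subring_set_UNIV] subgroup_ideal_def
      using y genideal_least[OF prime_set_ideal[OF y]] by simp
  qed
  moreover have "spec_map (laurent (carrier \<O>)) (\<lambda>f. f) (rational_closure q) = q"
    using rational_closure_Int[OF q(1,3)] by (auto simp: spec_map_def laurent_integers)
  moreover have "x \<in> subtopology (zariski (ring_on S)) (zero_locus (ring_on S) I) closure_of {q}"
    by (rule closure_of_point[OF S q(1,2) x])
  ultimately show ?thesis
    unfolding unlikely_lift_def laurent_integers
    using algebraic_subgroup_subgroup_ideal codim_subgroup_ideal[OF ab(3)] by (metis laurent_integers)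
qed

lemma fibre_point:
  assumes P: "maximalideal P \<O>" and x: "x \<in> fibre I P \<inter> torsion_kernel (carrier \<O>) N"
    and d: "relation_bound TYPE('k) d" and pos: "ln (real (ideal_norm P)) > 0"
  obtains p :: nat where "prime p" "of_nat p \<in> x" "ln (real (ideal_norm P)) \<le> real d * ln (real p)"
    "prime_set S x" "I \<subseteq> x" "\<And>m. mon m ^ N - 1 \<in> x"
proof -
  have cO: "\<O> = ring_on {x::'k. algebraic_int x}" by (simp add: ring_of_integers_def)
  have "primeideal P \<O>" using cring.maximalideal_prime[OF cring_ring_on[OF integers]] P unfolding cO by blast
  then have Pp: "prime_set {x::'k. algebraic_int x} P" unfolding cO primeideal_ring_on[OF integers] .
  \<comment> \<open>A positive logarithm excludes norm 0, the value of \<open>card\<close> on an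
    infinite residue ring, so finiteness of the residue ring comes for free.\<close>
  have N0: "ideal_norm P \<noteq> 0" using pos by (intro notI) simp
  obtain p where p: "prime p" "of_nat p \<in> P" by (rule number_in_prime_of_finite_norm[OF integers Pp N0])
  have "ideal_norm P \<le> p ^ d"
    by (rule ideal_norm_bound[OF d integers prime_set_ideal[OF Pp] prime_set_1[OF Pp] p])
  then have "real (ideal_norm P) \<le> real p ^ d" by (metis of_nat_le_iff of_nat_power)
  moreover have p0: "real p > 0" using prime_gt_0_nat[OF p(1)] by simp
  ultimately have "ln (real (ideal_norm P)) \<le> ln (real p ^ d)" using N0 by (intro ln_mono) auto
  then have norm: "ln (real (ideal_norm P)) \<le> real d * ln (real p)" using p0 by (simp add: ln_realpow)
  have x1: "x \<in> zero_locus (ring_on S) I" "structure_map x = P"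
    using x by (simp_all add: fibre_def laurent_integers)
  have xp: "prime_set S x" "I \<subseteq> x" using x1(1) unfolding zero_locus_ring_on[OF S] by simp_all
  have "of_nat p \<in> structure_map x" using p(2) x1(2) by simp
  then have px: "of_nat p \<in> x" by (simp add: structure_map_def spec_map_def)
  have var: "var i ^ N - 1 \<in> x" for i
    using x unfolding torsion_kernel_def zero_locus_def by blast
  have "mon m ^ N - 1 \<in> x" for m
    by (rule torsion_monomial[OF S mon_S prime_set_ideal[OF xp(1)] var])
  with p(1) px norm xp show thesis by (rule that)
qed

lemma horizontal_prime_through_point:
  obtains C :: real where "C \<ge> 1" "\<And>x p a. prime_set S x \<Longrightarrow> I \<subseteq> x \<Longrightarrow> prime p \<Longrightarrow> of_nat p \<in> x \<Longrightarrow>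
     a \<noteq> 0 \<Longrightarrow> mon a - 1 \<in> x \<Longrightarrow> exp (C * real (l1 a)) < real p \<Longrightarrow>
     \<exists>q. prime_set S q \<and> I \<subseteq> q \<and> mon a - 1 \<in> q \<and> q \<subseteq> x \<and> (\<forall>m::int. m \<noteq> 0 \<longrightarrow> of_int m \<notin> q) \<and>
       (\<forall>b. b \<noteq> 0 \<and> mon b - 1 \<in> x \<and> exp (C * (real (l1 a) * real (l1 b))) < real p \<longrightarrow> mon b - 1 \<in> q)"
proof -
  interpret T: torsion_curve "I\<^sub>K" S unit_mons by (rule torsion_curve_laurent)
  obtain C :: real where C: "C \<ge> 1"
    "\<And>x p a u. prime_set S x \<Longrightarrow> I\<^sub>K \<inter> S \<subseteq> x \<Longrightarrow> prime p \<Longrightarrow> of_nat p \<in> x \<Longrightarrow>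
       word unit_mons a u \<Longrightarrow> a \<ge> 1 \<Longrightarrow> u - 1 \<in> x \<Longrightarrow> u - 1 \<notin> I\<^sub>K \<Longrightarrow> exp (C * real a) < real p \<Longrightarrow>
       \<exists>q. prime_set S q \<and> I\<^sub>K \<inter> S \<subseteq> q \<and> u - 1 \<in> q \<and> q \<subseteq> x \<and> (\<forall>m. m \<noteq> 0 \<longrightarrow> of_int m \<notin> q) \<and>
         (\<forall>b v. word unit_mons b v \<and> b \<ge> 1 \<and> v - 1 \<in> x \<and> exp (C * (real a * real b)) < real p \<longrightarrow> v - 1 \<in> q)"
    by (rule T.torsion_prime) (rule that)
  have pos: "l1 b \<ge> 1" if "b \<noteq> 0" for b :: "int^'n"
    using l1_eq_0_iff[of b] that by linarith
  have "\<exists>q. prime_set S q \<and> I \<subseteq> q \<and> mon a - 1 \<in> q \<and> q \<subseteq> x \<and> (\<forall>m::int. m \<noteq> 0 \<longrightarrow> of_int m \<notin> q) \<and>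
       (\<forall>b. b \<noteq> 0 \<and> mon b - 1 \<in> x \<and> exp (C * (real (l1 a) * real (l1 b))) < real p \<longrightarrow> mon b - 1 \<in> q)"
    if x: "prime_set S x" "I \<subseteq> x" "prime p" "of_nat p \<in> x" "a \<noteq> 0" "mon a - 1 \<in> x" "exp (C * real (l1 a)) < real p" for x p a
  proof -
    obtain q where q: "prime_set S q" "I\<^sub>K \<inter> S \<subseteq> q" "mon a - 1 \<in> q" "q \<subseteq> x" "\<forall>m. m \<noteq> 0 \<longrightarrow> of_int m \<notin> q"
      and tors: "\<forall>b v. word unit_mons b v \<and> b \<ge> 1 \<and> v - 1 \<in> x \<and> exp (C * (real (l1 a) * real b)) < real p \<longrightarrow> v - 1 \<in> q"
      using C(2)[OF x(1) _ x(3,4) word_mon pos[OF x(5)] x(6) mon_notin_IK[OF x(5)] x(7)] x(2) unfolding IK_Int by blast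
    have "mon b - 1 \<in> q" if "b \<noteq> 0" "mon b - 1 \<in> x" "exp (C * (real (l1 a) * real (l1 b))) < real p" for b
      using tors[rule_format, OF conjI[OF word_mon conjI[OF pos[OF that(1)] conjI[OF that(2,3)]]]] .
    then show ?thesis using q unfolding IK_Int by blast
  qed
  with C(1) show thesis by (rule that)
qed

lemma torsion_point_mon:
  assumes "prime_set S x" "\<And>m. mon m ^ N - 1 \<in> x" "N \<ge> 1"
  shows "torsion_point (mon :: int^'n \<Rightarrow> _) S x N"
  by unfold_locales (use assms S n mon_S in \<open>simp_all add: mult_single\<close>)

lemma exp_less_prime:
  assumes d: "real d * t < l" "l \<le> real d * ln (real p)" and p: "prime p"
  shows "exp t < real p"
proof -
  have "real d * t < real d * ln (real p)" using d by linarith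
  then have "t < ln (real p)" by (rule mult_left_less_imp_less) simp
  then have "exp t < exp (ln (real p))" by simp
  then show ?thesis using prime_gt_0_nat[OF p] by simp
qed

theorem torsion_points_lift:
  obtains C :: real where "C \<ge> 0"
    "\<And>N P x. N \<ge> 1 \<Longrightarrow> maximalideal P \<O> \<Longrightarrow> x \<in> fibre I P \<inter> torsion_kernel (carrier \<O>) N \<Longrightarrow>
       C * real N powr ((2 * real CARD('n) - 1) / (real CARD('n) * (real CARD('n) - 1))) < ln (real (ideal_norm P)) \<Longrightarrow>
       \<exists>y. unlikely_lift I x y"
    "\<And>N P x. N \<ge> 1 \<Longrightarrow> maximalideal P \<O> \<Longrightarrow> x \<in> fibre I P \<inter> torsion_kernel (carrier \<O>) N \<Longrightarrow>
       C * real N < ln (real (ideal_norm P)) \<Longrightarrow> \<exists>y. unlikely_lift I x y \<and> y \<in> torsion_kernel UNIV N"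
proof -
  define c where "c = real CARD('n)"
  have c2: "c \<ge> 2" using n by (simp add: c_def)
  define e where "e = (2 * c - 1) / (c * (c - 1))"
  obtain d where d: "relation_bound TYPE('k) d" by (rule number_field_relation_bound[OF K])
  obtain C :: real where C: "C \<ge> 1" and hor: "\<And>x p a. prime_set S x \<Longrightarrow> I \<subseteq> x \<Longrightarrow> prime p \<Longrightarrow> of_nat p \<in> x \<Longrightarrow>
     a \<noteq> 0 \<Longrightarrow> mon a - 1 \<in> x \<Longrightarrow> exp (C * real (l1 a)) < real p \<Longrightarrow>
     \<exists>q. prime_set S q \<and> I \<subseteq> q \<and> mon a - 1 \<in> q \<and> q \<subseteq> x \<and> (\<forall>m::int. m \<noteq> 0 \<longrightarrow> of_int m \<notin> q) \<and>
       (\<forall>b. b \<noteq> 0 \<and> mon b - 1 \<in> x \<and> exp (C * (real (l1 a) * real (l1 b))) < real p \<longrightarrow> mon b - 1 \<in> q)"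
    by (rule horizontal_prime_through_point) (rule that)
  \<comment> \<open>One constant for both claims: d passes from log p to the logarithm of the norm,
    c^2 comes from the lengths of the two short vectors, and 9 from the generators of the
    lattice.\<close>
  define D where "D = real d * (C * (9 + c^2))"
  have D: "D \<ge> 0" using C by (simp add: D_def)
  have mono: "exp (C * s) < real p" if s: "s \<le> (9 + c^2) * t" and t: "exp (C * ((9 + c^2) * t)) < real p" for s t and p :: nat
  proof -
    have "C * s \<le> C * ((9 + c^2) * t)" using s C by (intro mult_left_mono) auto
    then show ?thesis using t by (meson exp_le_cancel_iff le_less_trans)
  qed
  have "(\<exists>y. unlikely_lift I x y)" if N: "N \<ge> 1" and P: "maximalideal P \<O>"
    and x: "x \<in> fibre I P \<inter> torsion_kernel (carrier \<O>) N" and large: "D * real N powr e < ln (real (ideal_norm P))" for N P x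
  proof -
    have "D * real N powr e \<ge> 0" using D by simp
    then have "ln (real (ideal_norm P)) > 0" using large by linarith
    then obtain p :: nat where p: "prime p" "of_nat p \<in> x" "ln (real (ideal_norm P)) \<le> real d * ln (real p)"
      "prime_set S x" "I \<subseteq> x" and tors: "\<And>m. mon m ^ N - 1 \<in> x"
      by (rule fibre_point[OF P x d]) (rule that)
    have "real d * (C * ((9 + c^2) * real N powr e)) < ln (real (ideal_norm P))"
      using large by (simp add: D_def mult.assoc)
    then have pl: "exp (C * ((9 + c^2) * real N powr e)) < real p" by (rule exp_less_prime[OF _ p(3,1)])
    interpret T: torsion_point "mon :: int^'n \<Rightarrow> (int^'n) \<Rightarrow>\<^sub>0 'k" S x N by (rule torsion_point_mon[OF p(4) tors N])
    obtain a where a: "T.shortest a" by (rule T.shortest_exists)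
    have aL: "a \<in> T.\<Lambda>" "a \<noteq> 0" using a by (simp_all add: T.shortest_def)
    obtain b :: "int^'n" and i j where b: "b \<in> T.\<Lambda>" "b \<noteq> 0" "a $ i * b $ j \<noteq> a $ j * b $ i"
      "real (l1 b) \<le> real CARD('n) * real N powr (1 / (real CARD('n) - 1))"
      by (rule T.independent_short_vector[OF aL(2)])
    have ab: "real (l1 a) * real (l1 b) \<le> (c * real N powr (1 / c)) * (c * real N powr (1 / (c - 1)))"
      using T.shortest_bound[OF a] b(4) unfolding c_def by (intro mult_mono) auto
    also have "\<dots> = c^2 * real N powr (1 / c + 1 / (c - 1))" by (simp add: powr_add power2_eq_square)
    also have "1 / c + 1 / (c - 1) = e" using c2 by (simp add: e_def field_simps)
    also have "c^2 * real N powr e \<le> (9 + c^2) * real N powr e" by (intro mult_right_mono) auto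
    finally have lab: "real (l1 a) * real (l1 b) \<le> (9 + c^2) * real N powr e" .
    have "l1 b \<ge> 1" using l1_eq_0_iff[of b] b(2) by linarith
    then have "real (l1 a) * 1 \<le> real (l1 a) * real (l1 b)" by (intro mult_left_mono) auto
    then have la: "real (l1 a) \<le> (9 + c^2) * real N powr e" using lab by linarith
    obtain q where q: "prime_set S q" "I \<subseteq> q" "mon a - 1 \<in> q" "q \<subseteq> x" "\<forall>m::int. m \<noteq> 0 \<longrightarrow> of_int m \<notin> q"
      and tq: "\<forall>b. b \<noteq> 0 \<and> mon b - 1 \<in> x \<and> exp (C * (real (l1 a) * real (l1 b))) < real p \<longrightarrow> mon b - 1 \<in> q"
      using hor[OF p(4,5,1,2) aL(2) _ mono[OF la pl]] aL(1) unfolding T.\<Lambda>_def by blast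
    have "mon b - 1 \<in> q" using tq b(1,2) mono[OF lab pl] unfolding T.\<Lambda>_def by blast
    then have "unlikely_lift I x (rational_closure q)"
      using q(5) by (intro unlikely_lift_rational_closure[OF q(1,2) _ p(4) q(4,3) _ b(3)]) auto
    then show ?thesis by blast
  qed
  moreover have "\<exists>y. unlikely_lift I x y \<and> y \<in> torsion_kernel UNIV N" if N: "N \<ge> 1" and P: "maximalideal P \<O>"
    and x: "x \<in> fibre I P \<inter> torsion_kernel (carrier \<O>) N" and large: "D * real N < ln (real (ideal_norm P))" for N P x
  proof -
    have "D * real N \<ge> 0" using D by simp
    then have "ln (real (ideal_norm P)) > 0" using large by linarith
    then obtain p :: nat where p: "prime p" "of_nat p \<in> x" "ln (real (ideal_norm P)) \<le> real d * ln (real p)"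
      "prime_set S x" "I \<subseteq> x" and tors: "\<And>m. mon m ^ N - 1 \<in> x"
      by (rule fibre_point[OF P x d]) (rule that)
    have "real d * (C * ((9 + c^2) * real N)) < ln (real (ideal_norm P))"
      using large by (simp add: D_def mult.assoc)
    then have pl: "exp (C * ((9 + c^2) * real N)) < real p" by (rule exp_less_prime[OF _ p(3,1)])
    interpret T: torsion_point "mon :: int^'n \<Rightarrow> (int^'n) \<Rightarrow>\<^sub>0 'k" S x N by (rule torsion_point_mon[OF p(4) tors N])
    obtain a where a: "T.shortest a" by (rule T.shortest_exists)
    have aL: "a \<in> T.\<Lambda>" "a \<noteq> 0" using a by (simp_all add: T.shortest_def)
    have le: "s \<le> (9 + c^2) * real N" if "s \<le> 9 * real N" for s
    proof -
      have "9 * real N \<le> (9 + c^2) * real N" by (intro mult_right_mono) auto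
      then show ?thesis using that by linarith
    qed
    have "real (l1 a) \<le> 9 * real N" using T.shortest_le_N[OF a] by linarith
    then have pa: "exp (C * real (l1 a)) < real p" by (intro mono[OF le pl])
    obtain q where q: "prime_set S q" "I \<subseteq> q" "mon a - 1 \<in> q" "q \<subseteq> x" "\<forall>m::int. m \<noteq> 0 \<longrightarrow> of_int m \<notin> q"
      and tq: "\<forall>b. b \<noteq> 0 \<and> mon b - 1 \<in> x \<and> exp (C * (real (l1 a) * real (l1 b))) < real p \<longrightarrow> mon b - 1 \<in> q"
      using hor[OF p(4,5,1,2) aL(2) _ pa] aL(1) unfolding T.\<Lambda>_def by blast
    have "T.\<Lambda> \<subseteq> {m. mon m - 1 \<in> q}"
    proof (rule T.lattice_generated[OF a])
      show "0 \<in> {m. mon m - 1 \<in> q}" using prime_set_0[OF q(1)] by simp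
      note qi = prime_set_ideal[OF q(1)]
      show "m + l \<in> {m. mon m - 1 \<in> q}" if "m \<in> {m. mon m - 1 \<in> q}" "l \<in> {m. mon m - 1 \<in> q}" for m l
      proof -
        have "mon (m + l) - 1 = mon m * (mon l - 1) + (mon m - 1 :: (int^'n) \<Rightarrow>\<^sub>0 'k)"
          by (simp add: mult_single algebra_simps)
        also have "\<dots> \<in> q" using that by (intro ideal_set_add[OF qi] ideal_set_lmult[OF qi] mon_S) simp_all
        finally show ?thesis by simp
      qed
      show "b \<in> {m. mon m - 1 \<in> q}" if b: "b \<in> T.\<Lambda>" "b \<noteq> 0" "l1 a * l1 b \<le> 9 * N" for b
      proof -
        have "real (l1 a * l1 b) \<le> real (9 * N)" using b(3) by (simp only: of_nat_le_iff)
        then have "real (l1 a) * real (l1 b) \<le> 9 * real N" by simp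
        then have "exp (C * (real (l1 a) * real (l1 b))) < real p" by (intro mono[OF le pl])
        then show ?thesis using tq b(1,2) unfolding T.\<Lambda>_def by blast
      qed
    qed
    then have L: "mon m - 1 \<in> q" if "m \<in> T.\<Lambda>" for m using that by (auto dest: subsetD)
    \<comment> \<open>Its length is irrelevant here: b only witnesses codimension 2, as the whole
      lattice is already known to be trivial on the curve.\<close>
    obtain b :: "int^'n" and i j where b: "b \<in> T.\<Lambda>" "a $ i * b $ j \<noteq> a $ j * b $ i"
      by (rule T.independent_short_vector[OF aL(2)])
    have "unlikely_lift I x (rational_closure q)"
      using q(5) L[OF b(1)] by (intro unlikely_lift_rational_closure[OF q(1,2) _ p(4) q(4,3) _ b(2)]) auto
    moreover have "var i ^ N - 1 \<in> q" for i
      using L[OF T.axis_mem[of i]] by (simp add: T.E_power var_def)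
    then have "range (\<lambda>i. var i ^ N - 1) \<subseteq> rational_closure q" using rational_closure_superset[of q] by blast
    then have "rational_closure q \<in> torsion_kernel UNIV N"
      unfolding torsion_kernel_def laurent_UNIV zero_locus_ring_on[OF subring_set_UNIV]
      using prime_set_rational_closure[OF q(1)] q(5) by simp
    ultimately show ?thesis by blast
  qed
  ultimately show thesis using D unfolding e_def c_def by (intro that[of D]) 
qed

end

theorem theorem1p5:
  fixes I :: "((int^'n::finite) \<Rightarrow>\<^sub>0 'k::field_char_0) set"
  assumes K: "number_field TYPE('k)"
    and n: "CARD('n) \<ge> 2"
    and V_closed: "ideal I (laurent (carrier \<O>))"
    and V_integral: "domain (laurent (carrier \<O>) Quot I)"
    and V_dim: "krull_dim (subtopology (zariski (laurent (carrier \<O>)))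
                  (zero_locus (laurent (carrier \<O>)) I)) = 2"
    and V_dominates: "dominates_base I"
    and V_generic: "\<And>J. algebraic_subgroup J \<Longrightarrow> J \<noteq> {0} \<Longrightarrow> \<not> J \<subseteq> generic_fibre I"
  shows "\<exists>C::real. \<forall>N::nat. \<forall>P x.
           N \<ge> 1 \<and> maximalideal P \<O> \<and> x \<in> fibre I P \<inter> torsion_kernel (carrier \<O>) N \<longrightarrow>
             (ln (real (ideal_norm P)) \<le>
                C * real N powr ((2 * real CARD('n) - 1) / (real CARD('n) * (real CARD('n) - 1)))
              \<or> (\<exists>y. unlikely_lift I x y))
             \<and>
             (ln (real (ideal_norm P)) \<le>
                (if CARD('n) = 2 then C * real N powr (3 / 2) else C * real N)
              \<or> (\<exists>y. unlikely_lift I x y \<and> y \<in> torsion_kernel UNIV N))"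
proof -
  interpret dominant_surface I
    using assms by (rule dominant_surface.intro)
  obtain C :: real where C: "C \<ge> 0" and
    lift: "\<And>N P x. N \<ge> 1 \<Longrightarrow> maximalideal P \<O> \<Longrightarrow> x \<in> fibre I P \<inter> torsion_kernel (carrier \<O>) N \<Longrightarrow>
       C * real N powr ((2 * real CARD('n) - 1) / (real CARD('n) * (real CARD('n) - 1))) < ln (real (ideal_norm P)) \<Longrightarrow>
       \<exists>y. unlikely_lift I x y" and
    lift_kernel: "\<And>N P x. N \<ge> 1 \<Longrightarrow> maximalideal P \<O> \<Longrightarrow> x \<in> fibre I P \<inter> torsion_kernel (carrier \<O>) N \<Longrightarrow>
       C * real N < ln (real (ideal_norm P)) \<Longrightarrow> \<exists>y. unlikely_lift I x y \<and> y \<in> torsion_kernel UNIV N"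
    by (rule torsion_points_lift) (rule that)
  show ?thesis
  proof (intro exI[of _ C] allI impI)
    fix N :: nat and P x
    assume H: "N \<ge> 1 \<and> maximalideal P \<O> \<and> x \<in> fibre I P \<inter> torsion_kernel (carrier \<O>) N"
    \<comment> \<open>\<open>lift_kernel\<close> gives the linear bound for every n; for n = 2 the
      stated exponent 3/2 is weaker.\<close>
    have "real N powr 1 \<le> real N powr (3 / 2)" using H by (intro powr_mono) auto
    then have "C * real N \<le> C * real N powr (3 / 2)" using C by (intro mult_left_mono) auto
    then have "C * real N \<le> (if CARD('n) = 2 then C * real N powr (3 / 2) else C * real N)" by simp
    then show "(ln (real (ideal_norm P)) \<le>
                C * real N powr ((2 * real CARD('n) - 1) / (real CARD('n) * (real CARD('n) - 1)))
              \<or> (\<exists>y. unlikely_lift I x y))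
             \<and>
             (ln (real (ideal_norm P)) \<le>
                (if CARD('n) = 2 then C * real N powr (3 / 2) else C * real N)
              \<or> (\<exists>y. unlikely_lift I x y \<and> y \<in> torsion_kernel UNIV N))"
      using lift[of N P x] lift_kernel[of N P x] H by (meson le_less_trans not_le)
  qed
qed

end
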